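(* Let $0<p,q\le\infty$, $s\in\mathbb{R}$, and let $\bar\alpha=(\alpha_1,\dots,\alpha_d)$ have positive entries with $\sum_{i=1}^d\alpha_i=d$. (i) If $B^{s,\bar\alpha}_{p,q}(\mathbb{R}^d)=\widetilde B^{s,\bar\alpha}_{p,q}(\mathbb{R}^d)$, then $p=q=2$. (ii) In the range $0<p<\infty$: if $F^{s,\bar\alpha}_{p,q}(\mathbb{R}^d)=\widetilde F^{s,\bar\alpha}_{p,q}(\mathbb{R}^d)$, then $q=2$ and $1<p<\infty$.
   Context: $d$ denotes the underlying dimension. Fourier transform: $\mathcal{F}f(\xi)=(2\pi)^{-d/2}\int f(y)e^{-i\xi\cdot y}dy$, extended to $\mathcal{S}'(\mathbb{R}^d)$. $\mathbb{N}_0=\mathbb{N}\cup\{0\}$. For $q=\infty$ the $\ell_q$-sums below are replaced by suprema. Classical anisotropic spaces: let $\varphi_0^{\bar\alpha}\ge0$ be in $\mathcal{S}(\mathbb{R}^d)$ with $\varphi_0^{\bar\alpha}(\xi)=1$ if $\max_i|\xi_i|\le1$ and $\varphi_0^{\bar\alpha}(\xi)=0$ if $\max_i|2^{-\alpha_i}\xi_i|\ge1$. For $j\in\mathbb{N}$ put $\varphi_j^{\bar\alpha}(\xi)=\varphi_0^{\bar\alpha}(2^{-j\alpha_1}\xi_1,\dots,2^{-j\alpha_d}\xi_d)-\varphi_0^{\bar\alpha}(2^{-(j-1)\alpha_1}\xi_1,\dots,2^{-(j-1)\alpha_d}\xi_d)$, and $\Delta_j^{\bar\alpha}f=\mathcal{F}^{-1}(\varphi_j^{\bar\alpha}\mathcal{F}f)$,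 $j\in\mathbb{N}_0$. $B^{s,\bar\alpha}_{p,q}(\mathbb{R}^d)$ (resp. $F^{s,\bar\alpha}_{p,q}(\mathbb{R}^d)$) is the set of $f\in\mathcal{S}'(\mathbb{R}^d)$ with finite (quasi-)norm $\big(\sum_{j\ge0}2^{jsq}\|\Delta^{\bar\alpha}_jf\|_{L_p}^q\big)^{1/q}$ (resp. $\big\|\big(\sum_{j\ge0}2^{jsq}|\Delta^{\bar\alpha}_jf(\cdot)|^q\big)^{1/q}\big\|_{L_p}$). Hyperbolic spaces: fix $\theta_0\in\mathcal{S}(\mathbb{R})$ supported in $[-2,2]$ with $\theta_0=1$ on $[-1,1]$, put $\theta_j=\theta_0(2^{-j}\cdot)-\theta_0(2^{-(j-1)}\cdot)$ for $j\in\mathbb{N}$; for $\bar j\in\mathbb{N}_0^d$ let $\theta_{\bar j}(\xi)=\prod_{i=1}^d\theta_{j_i}(\xi_i)$, $\Delta_{\bar j}f=\mathcal{F}^{-1}(\theta_{\bar j}\mathcal{F}f)$, $\|\bar j/\bar\alpha\|_\infty=\max_ij_i/\alpha_i$. $\widetilde B^{s,\bar\alpha}_{p,q}(\mathbb{R}^d)$ (resp. $\widetilde F^{s,\bar\alpha}_{p,q}(\mathbb{R}^d)$, $p<\infty$) is the set of $f\in\mathcal{S}'(\mathbb{R}^d)$ with finite (quasi-)norm $\big(\sum_{\bar j\in\mathbb{N}_0^d}2^{\|\bar j/\bar\alpha\|_\infty sq}\|\Delta_{\bar j}f\|_{L_p}^q\big)^{1/q}$ (resp. $\big\|\big(\sum_{\bar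 j\in\mathbb{N}_0^d}2^{\|\bar j/\bar\alpha\|_\infty sq}|\Delta_{\bar j}f(\cdot)|^q\big)^{1/q}\big\|_{L_p}$). These definitions do not depend on the chosen resolutions of unity.
   Formalization: The dimension is assumed to satisfy d ≥ 2; for d = 1 the only admissible weight is α = 1, the two scales of spaces coincide for all s, p, q, and the claim as stated is false. *)

theory Defs
  imports "HOL-Probability.Essential_Supremum"
begin

section \<open>Schwartz functions and tempered distributions\<close>

fun iterated_deriv :: "'a::euclidean_space list \<Rightarrow> ('a \<Rightarrow> complex) \<Rightarrow> 'a \<Rightarrow> complex" where
  "iterated_deriv [] f = f"
| "iterated_deriv (b # bs) f = (\<lambda>x. frechet_derivative (iterated_deriv bs f) (at x) b)"

definition smooth :: "('a::euclidean_space \<Rightarrow> complex) \<Rightarrow> bool" where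
  "smooth f \<longleftrightarrow> (\<forall>bs\<in>lists Basis. \<forall>x. iterated_deriv bs f differentiable (at x))"

definition weighted_deriv :: "nat \<Rightarrow> 'a::euclidean_space list \<Rightarrow> ('a \<Rightarrow> complex) \<Rightarrow> 'a \<Rightarrow> real" where
  "weighted_deriv N bs f x = (1 + norm x) ^ N * norm (iterated_deriv bs f x)"

definition schwartz :: "('a::euclidean_space \<Rightarrow> complex) set" where
  "schwartz = {f. smooth f \<and> (\<forall>N. \<forall>bs\<in>lists Basis. bdd_above (range (weighted_deriv N bs f)))}"

definition schwartz_seminorm :: "nat \<Rightarrow> 'a::euclidean_space list \<Rightarrow> ('a \<Rightarrow> complex) \<Rightarrow> real" where
  "schwartz_seminorm N bs f = (SUP x. weighted_deriv N bs f x)"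

definition schwartz_topology :: "('a::euclidean_space \<Rightarrow> complex) topology" where
  "schwartz_topology = topology_generated_by
     {{g \<in> schwartz. schwartz_seminorm N bs (\<lambda>x. g x - f x) < \<epsilon>} | f N bs \<epsilon>.
        f \<in> schwartz \<and> bs \<in> lists Basis \<and> \<epsilon> > 0}"

type_synonym 'a distribution = "('a \<Rightarrow> complex) \<Rightarrow> complex"

text \<open>Functionals on the Schwartz space are represented by HOL functions that take the value
  \<^term>\<open>undefined\<close> off \<^const>\<open>schwartz\<close>, so that equality of functions is equality of
  functionals.\<close>

definition tempered_distributions :: "'a::euclidean_space distribution set" where
  "tempered_distributions = {u \<in> extensional schwartz.
     (\<forall>f\<in>schwartz. \<forall>g\<in>schwartz. u (\<lambda>x. f x + g x) = u f + u g) \<and>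
     (\<forall>c. \<forall>f\<in>schwartz. u (\<lambda>x. c * f x) = c * u f) \<and>
     continuous_map schwartz_topology euclidean u}"

definition fourier :: "('a::euclidean_space \<Rightarrow> complex) \<Rightarrow> 'a \<Rightarrow> complex" where
  "fourier f \<xi> = complex_of_real ((2 * pi) powr (- real DIM('a) / 2)) *
     (LINT y|lborel. f y * exp (- \<i> * complex_of_real (\<xi> \<bullet> y)))"

definition inverse_fourier :: "('a::euclidean_space \<Rightarrow> complex) \<Rightarrow> 'a \<Rightarrow> complex" where
  "inverse_fourier f x = complex_of_real ((2 * pi) powr (- real DIM('a) / 2)) *
     (LINT \<xi>|lborel. f \<xi> * exp (\<i> * complex_of_real (x \<bullet> \<xi>)))"

definition fourier_dist :: "'a::euclidean_space distribution \<Rightarrow> 'a distribution" where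
  "fourier_dist u = (\<lambda>f\<in>schwartz. u (fourier f))"

definition inverse_fourier_dist :: "'a::euclidean_space distribution \<Rightarrow> 'a distribution" where
  "inverse_fourier_dist u = (\<lambda>f\<in>schwartz. u (inverse_fourier f))"

definition mult_dist :: "('a::euclidean_space \<Rightarrow> complex) \<Rightarrow> 'a distribution \<Rightarrow> 'a distribution" where
  "mult_dist m u = (\<lambda>f\<in>schwartz. u (\<lambda>x. m x * f x))"

definition fourier_multiplier ::
    "('a::euclidean_space \<Rightarrow> complex) \<Rightarrow> 'a distribution \<Rightarrow> 'a distribution" where
  "fourier_multiplier m u = inverse_fourier_dist (mult_dist m (fourier_dist u))"

definition represents :: "('a::euclidean_space \<Rightarrow> complex) \<Rightarrow> 'a distribution \<Rightarrow> bool" where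
  "represents g u \<longleftrightarrow> g \<in> borel_measurable lborel \<and>
     (\<forall>f\<in>schwartz. integrable lborel (\<lambda>x. g x * f x)) \<and>
     u = (\<lambda>f\<in>schwartz. LINT x|lborel. g x * f x)"

text \<open>If \<open>m\<close> is a compactly supported Schwartz function and \<open>u\<close> a tempered distribution, then by
  the Paley--Wiener--Schwartz theorem \<open>fourier_multiplier m u\<close> is represented by a smooth
  function of polynomial growth, and a continuous representing function is unique.  The
  pointwise values and \<open>L\<^sub>p\<close>-norms of the Littlewood--Paley blocks are those of this function.\<close>

definition block ::
    "('a::euclidean_space \<Rightarrow> complex) \<Rightarrow> 'a distribution \<Rightarrow> 'a \<Rightarrow> complex" where
  "block m u = (THE g. continuous_on UNIV g \<and> represents g (fourier_multiplier m u))"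


section \<open>Quasi-norms\<close>

text \<open>Only positive exponents are used below.\<close>

definition ennreal_powr :: "ennreal \<Rightarrow> real \<Rightarrow> ennreal" where
  "ennreal_powr x r = (if x = \<infinity> then \<infinity> else ennreal (enn2real x powr r))"

definition Lp_norm :: "ennreal \<Rightarrow> ('a::euclidean_space \<Rightarrow> ennreal) \<Rightarrow> ennreal" where
  "Lp_norm p g = (if p = \<infinity> then esssup lborel g
     else ennreal_powr (\<integral>\<^sup>+ x. ennreal_powr (g x) (enn2real p) \<partial>lborel) (1 / enn2real p))"

definition lq_norm :: "ennreal \<Rightarrow> ('j \<Rightarrow> ennreal) \<Rightarrow> ennreal" where
  "lq_norm q a = (if q = \<infinity> then (SUP j. a j)
     else ennreal_powr (\<Sum>\<^sub>\<infinity>j. ennreal_powr (a j) (enn2real q)) (1 / enn2real q))"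


section \<open>Classical anisotropic spaces\<close>

definition anisotropic_generator :: "real ^ 'n \<Rightarrow> (real ^ 'n \<Rightarrow> complex) \<Rightarrow> bool" where
  "anisotropic_generator \<alpha> \<phi> \<longleftrightarrow> \<phi> \<in> schwartz \<and> (\<forall>\<xi>. \<phi> \<xi> \<in> \<real>\<^sub>\<ge>\<^sub>0) \<and>
     (\<forall>\<xi>. (MAX i. \<bar>\<xi> $ i\<bar>) \<le> 1 \<longrightarrow> \<phi> \<xi> = 1) \<and>
     (\<forall>\<xi>. (MAX i. \<bar>2 powr (- \<alpha> $ i) * \<xi> $ i\<bar>) \<ge> 1 \<longrightarrow> \<phi> \<xi> = 0)"

definition anisotropic_dilation :: "real ^ 'n \<Rightarrow> real \<Rightarrow> real ^ 'n \<Rightarrow> real ^ 'n" where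
  "anisotropic_dilation \<alpha> t \<xi> = (\<chi> i. 2 powr (t * \<alpha> $ i) * \<xi> $ i)"

definition anisotropic_resolution ::
    "real ^ 'n \<Rightarrow> (real ^ 'n \<Rightarrow> complex) \<Rightarrow> nat \<Rightarrow> real ^ 'n \<Rightarrow> complex" where
  "anisotropic_resolution \<alpha> \<phi> j \<xi> = (if j = 0 then \<phi> \<xi>
     else \<phi> (anisotropic_dilation \<alpha> (- real j) \<xi>) - \<phi> (anisotropic_dilation \<alpha> (- (real j - 1)) \<xi>))"

definition besov_norm ::
    "real ^ 'n \<Rightarrow> (real ^ 'n \<Rightarrow> complex) \<Rightarrow> real \<Rightarrow> ennreal \<Rightarrow> ennreal \<Rightarrow> (real ^ 'n) distribution \<Rightarrow> ennreal"
  where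
  "besov_norm \<alpha> \<phi> s p q f = lq_norm q (\<lambda>j. ennreal (2 powr (real j * s)) *
     Lp_norm p (\<lambda>x. ennreal (norm (block (anisotropic_resolution \<alpha> \<phi> j) f x))))"

definition triebel_lizorkin_norm ::
    "real ^ 'n \<Rightarrow> (real ^ 'n \<Rightarrow> complex) \<Rightarrow> real \<Rightarrow> ennreal \<Rightarrow> ennreal \<Rightarrow> (real ^ 'n) distribution \<Rightarrow> ennreal"
  where
  "triebel_lizorkin_norm \<alpha> \<phi> s p q f = Lp_norm p (\<lambda>x. lq_norm q (\<lambda>j. ennreal (2 powr (real j * s)) *
     ennreal (norm (block (anisotropic_resolution \<alpha> \<phi> j) f x))))"

definition besov_space ::
    "real ^ 'n \<Rightarrow> (real ^ 'n \<Rightarrow> complex) \<Rightarrow> real \<Rightarrow> ennreal \<Rightarrow> ennreal \<Rightarrow> (real ^ 'n) distribution set"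
  where
  "besov_space \<alpha> \<phi> s p q = {f \<in> tempered_distributions. besov_norm \<alpha> \<phi> s p q f < \<infinity>}"

definition triebel_lizorkin_space ::
    "real ^ 'n \<Rightarrow> (real ^ 'n \<Rightarrow> complex) \<Rightarrow> real \<Rightarrow> ennreal \<Rightarrow> ennreal \<Rightarrow> (real ^ 'n) distribution set"
  where
  "triebel_lizorkin_space \<alpha> \<phi> s p q =
     {f \<in> tempered_distributions. triebel_lizorkin_norm \<alpha> \<phi> s p q f < \<infinity>}"


section \<open>Hyperbolic spaces\<close>

definition hyperbolic_generator :: "(real \<Rightarrow> complex) \<Rightarrow> bool" where
  "hyperbolic_generator \<theta> \<longleftrightarrow> \<theta> \<in> schwartz \<and> closure (support_on UNIV \<theta>) \<subseteq> {-2..2} \<and>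
     (\<forall>t\<in>{-1..1}. \<theta> t = 1)"

definition dyadic_resolution :: "(real \<Rightarrow> complex) \<Rightarrow> nat \<Rightarrow> real \<Rightarrow> complex" where
  "dyadic_resolution \<theta> j t = (if j = 0 then \<theta> t
     else \<theta> (2 powr (- real j) * t) - \<theta> (2 powr (- (real j - 1)) * t))"

definition hyperbolic_resolution :: "(real \<Rightarrow> complex) \<Rightarrow> nat ^ 'n \<Rightarrow> real ^ 'n \<Rightarrow> complex" where
  "hyperbolic_resolution \<theta> j \<xi> = (\<Prod>i\<in>UNIV. dyadic_resolution \<theta> (j $ i) (\<xi> $ i))"

definition hyperbolic_level :: "real ^ 'n \<Rightarrow> nat ^ 'n \<Rightarrow> real" where
  "hyperbolic_level \<alpha> j = (MAX i. real (j $ i) / \<alpha> $ i)"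

definition hyperbolic_besov_norm ::
    "real ^ 'n \<Rightarrow> (real \<Rightarrow> complex) \<Rightarrow> real \<Rightarrow> ennreal \<Rightarrow> ennreal \<Rightarrow> (real ^ 'n) distribution \<Rightarrow> ennreal"
  where
  "hyperbolic_besov_norm \<alpha> \<theta> s p q f = lq_norm q (\<lambda>j. ennreal (2 powr (hyperbolic_level \<alpha> j * s)) *
     Lp_norm p (\<lambda>x. ennreal (norm (block (hyperbolic_resolution \<theta> j) f x))))"

definition hyperbolic_triebel_lizorkin_norm ::
    "real ^ 'n \<Rightarrow> (real \<Rightarrow> complex) \<Rightarrow> real \<Rightarrow> ennreal \<Rightarrow> ennreal \<Rightarrow> (real ^ 'n) distribution \<Rightarrow> ennreal"
  where
  "hyperbolic_triebel_lizorkin_norm \<alpha> \<theta> s p q f = Lp_norm p (\<lambda>x.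
     lq_norm q (\<lambda>j. ennreal (2 powr (hyperbolic_level \<alpha> j * s)) *
       ennreal (norm (block (hyperbolic_resolution \<theta> j) f x))))"

definition hyperbolic_besov_space ::
    "real ^ 'n \<Rightarrow> (real \<Rightarrow> complex) \<Rightarrow> real \<Rightarrow> ennreal \<Rightarrow> ennreal \<Rightarrow> (real ^ 'n) distribution set"
  where
  "hyperbolic_besov_space \<alpha> \<theta> s p q =
     {f \<in> tempered_distributions. hyperbolic_besov_norm \<alpha> \<theta> s p q f < \<infinity>}"

definition hyperbolic_triebel_lizorkin_space ::
    "real ^ 'n \<Rightarrow> (real \<Rightarrow> complex) \<Rightarrow> real \<Rightarrow> ennreal \<Rightarrow> ennreal \<Rightarrow> (real ^ 'n) distribution set"
  where
  "hyperbolic_triebel_lizorkin_space \<alpha> \<theta> s p q =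
     {f \<in> tempered_distributions. hyperbolic_triebel_lizorkin_norm \<alpha> \<theta> s p q f < \<infinity>}"

end

theory Submission
  imports Defs "HOL-Probability.Probability"
begin

text \<open>A measurable function \<open>H\<close> of polynomial growth defines a tempered distribution with Fourier transform
  \<open>H\<close>, whose Littlewood--Paley blocks are ordinary inverse Fourier integrals. Fix two coordinates
  \<open>i1\<close>, \<open>i2\<close> and consider functions whose spectrum lies near \<open>R\<close> in the coordinate \<open>i1\<close>, well below
  \<open>R\<close> (in the anisotropic sense) in the coordinate \<open>i2\<close>, and near \<open>0\<close> in the others. They meet
  boundedly many anisotropic levels, so the anisotropic quasi-norm is just an \<open>L\<^sub>p\<close>-norm; the hyperbolic
  decomposition gives all its blocks the same weight but resolves the dyadic scales of the frequency \<open>i2\<close>.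
  A sum of \<open>N\<close> wave packets with lacunary frequencies in \<open>i2\<close> thus has hyperbolic quasi-norm of order
  \<open>N\<close> to the power \<open>1/q\<close>, whereas the \<open>L\<^sub>p\<close>-norm is of order \<open>N\<close> to the power \<open>1/2\<close> for concentric packets
  with random signs (Khinchine), \<open>1/p\<close> for packets at distant sites, and \<open>1\<close> for concentric packets of equal
  sign if \<open>p\<close> is infinite. In the Triebel--Lizorkin scale with \<open>p \<le> 1\<close> an approximate delta function in the variable
  \<open>i2\<close> is much larger in the hyperbolic quasi-norm. In each case a sequence of such functions on widely separated
  shells, with suitable coefficients, sums to a distribution that lies in exactly one of the two spaces.\<close>

subsection \<open>Derivative bounds\<close>

text \<open>For \<open>p < 1\<close> the space \<open>L\<^sub>p\<close> has neither a triangle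
  inequality nor a convolution estimate. Upper bounds therefore rest on pointwise decay of inverse
  Fourier integrals, uniform over all multipliers, translations and dilations in play; this is why
  derivative bounds carry explicit constants from the start. The number of dyadic scales available
  to the frequency \<open>i2\<close> below the shell is proportional to \<open>log R\<close>, so
  room for \<open>2 ^ k\<close> packets in generation \<open>k\<close> makes \<open>log R\<close>
  grow like \<open>2 ^ k\<close>. That growth also helps: the coefficients used for gluing are
  bounded by fixed powers of \<open>R\<close>, hence the glued function still has polynomial growth.
  Good signs are found by averaging an integral of \<open>p\<close>-th powers, which makes no sense
  when \<open>p\<close> is infinite. In the Besov case distant sites thus force
  \<open>p = q\<close>, coherent packets then exclude that both are infinite, and only after that
  can random signs force \<open>q = 2\<close>. In the Triebel--Lizorkin case distant sites would not
  help, since the order of the norms is reversed there; the sign argument settles \<open>q\<close>,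
  and a separate construction has to exclude \<open>p \<le> 1\<close>.\<close>

definition partial :: "'a::euclidean_space \<Rightarrow> ('a \<Rightarrow> complex) \<Rightarrow> 'a \<Rightarrow> complex" where
  "partial b f x = frechet_derivative f (at x) b"

text \<open>One number \<open>B\<close> controls all partial derivatives of order at most
  \<open>L\<close> with the weight \<open>(1 + norm x) ^ N\<close>. The recursion strips the
  derivative that is applied first, so that the Leibniz and chain rules become inductions on
  \<open>L\<close> with constants that can be followed.\<close>

primrec deriv_bound :: "nat \<Rightarrow> nat \<Rightarrow> real \<Rightarrow> ('a::euclidean_space \<Rightarrow> complex) \<Rightarrow> bool" where
  "deriv_bound 0 N B f \<longleftrightarrow> (\<forall>x. f differentiable (at x) \<and> (1 + norm x) ^ N * norm (f x) \<le> B)"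
| "deriv_bound (Suc L) N B f \<longleftrightarrow>
     (\<forall>x. f differentiable (at x) \<and> (1 + norm x) ^ N * norm (f x) \<le> B) \<and>
     (\<forall>b\<in>Basis. deriv_bound L N B (partial b f))"

lemma deriv_bound_0: "deriv_bound L N B f \<Longrightarrow> deriv_bound 0 N B f"
  by (cases L) auto

lemma deriv_bound_differentiable: "deriv_bound L N B f \<Longrightarrow> f differentiable (at x)"
  using deriv_bound_0[of L N B f] by simp

lemma deriv_bound_norm: "deriv_bound L N B f \<Longrightarrow> (1 + norm x) ^ N * norm (f x) \<le> B"
  using deriv_bound_0[of L N B f] by simp

lemma deriv_bound_norm0: "deriv_bound L 0 B f \<Longrightarrow> norm (f x) \<le> B"
  using deriv_bound_norm[of L 0 B f x] by simp

lemma deriv_bound_nonneg: "deriv_bound L N B f \<Longrightarrow> 0 \<le> B"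
  using deriv_bound_norm[of L N B f 0] by (simp add: order_trans[OF norm_ge_zero])

lemma deriv_bound_partial: "deriv_bound (Suc L) N B f \<Longrightarrow> b \<in> Basis \<Longrightarrow> deriv_bound L N B (partial b f)"
  by simp

lemma deriv_bound_Suc_D: "deriv_bound (Suc L) N B f \<Longrightarrow> deriv_bound L N B f"
proof (induction L arbitrary: f)
  case (Suc L)
  then show ?case by (metis deriv_bound.simps(2))
qed simp

lemma deriv_bound_mono:
  assumes "deriv_bound L N B f" "L' \<le> L" "N' \<le> N" "B \<le> B'"
  shows "deriv_bound L' N' B' f"
proof -
  have 1: "deriv_bound L' N B f"
    using assms(2) by (induction rule: inc_induct) (use assms(1) deriv_bound_Suc_D in auto)
  show ?thesis using 1
  proof (induction L' arbitrary: f)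
    case 0
    have "(1 + norm x) ^ N' * norm (f x) \<le> B'" for x
    proof -
      have "(1 + norm x) ^ N' * norm (f x) \<le> (1 + norm x) ^ N * norm (f x)"
        using assms(3) by (intro mult_right_mono power_increasing) auto
      then show ?thesis using deriv_bound_norm[OF 0, of x] assms(4) by linarith
    qed
    then show ?case using 0 by simp
  next
    case (Suc L')
    have "(1 + norm x) ^ N' * norm (f x) \<le> B'" for x
    proof -
      have "(1 + norm x) ^ N' * norm (f x) \<le> (1 + norm x) ^ N * norm (f x)"
        using assms(3) by (intro mult_right_mono power_increasing) auto
      then show ?thesis using deriv_bound_norm[OF Suc.prems, of x] assms(4) by linarith
    qed
    then show ?case using Suc by simp
  qed
qed

lemma partial_eqI: "(f has_derivative f') (at x) \<Longrightarrow> partial b f x = f' b"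
  unfolding partial_def by (metis frechet_derivative_at)

lemma has_derivative_frechet: "f differentiable (at x) \<Longrightarrow> (f has_derivative frechet_derivative f (at x)) (at x)"
  by (simp add: frechet_derivative_works)

lemma partial_add:
  "f differentiable (at x) \<Longrightarrow> g differentiable (at x) \<Longrightarrow>
    partial b (\<lambda>x. f x + g x) x = partial b f x + partial b g x"
  by (subst partial_eqI[OF has_derivative_add[OF has_derivative_frechet has_derivative_frechet]])
    (auto simp: partial_def)

lemma partial_mult:
  "f differentiable (at x) \<Longrightarrow> g differentiable (at x) \<Longrightarrow>
    partial b (\<lambda>x. f x * g x) x = partial b f x * g x + f x * partial b g x"
  by (subst partial_eqI[OF has_derivative_mult[OF has_derivative_frechet has_derivative_frechet]])
    (auto simp: partial_def)

lemma partial_const: "partial b (\<lambda>x. c) = (\<lambda>x. 0)"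
  by (rule ext) (subst partial_eqI[OF has_derivative_const], simp)

lemma partial_cmult: "f differentiable (at x) \<Longrightarrow> partial b (\<lambda>x. c * f x) x = c * partial b f x"
  by (subst partial_mult) (auto simp: partial_const)

lemma deriv_bound_add:
  "deriv_bound L N B f \<Longrightarrow> deriv_bound L N C g \<Longrightarrow> deriv_bound L N (B + C) (\<lambda>x. f x + g x)"
proof (induction L arbitrary: f g)
  case 0
  have "(1 + norm x) ^ N * norm (f x + g x) \<le> B + C" for x
  proof -
    have "(1 + norm x) ^ N * norm (f x + g x) \<le> (1 + norm x) ^ N * (norm (f x) + norm (g x))"
      by (intro mult_left_mono norm_triangle_ineq) auto
    then show ?thesis
      using deriv_bound_norm[OF 0(1), of x] deriv_bound_norm[OF 0(2), of x] by (simp add: distrib_left)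
  qed
  then show ?case using 0 by auto
next
  case (Suc L)
  have "(1 + norm x) ^ N * norm (f x + g x) \<le> B + C" for x
  proof -
    have "(1 + norm x) ^ N * norm (f x + g x) \<le> (1 + norm x) ^ N * (norm (f x) + norm (g x))"
      by (intro mult_left_mono norm_triangle_ineq) auto
    then show ?thesis
      using deriv_bound_norm[OF Suc.prems(1), of x] deriv_bound_norm[OF Suc.prems(2), of x]
      by (simp add: distrib_left)
  qed
  moreover have "deriv_bound L N (B + C) (partial b (\<lambda>x. f x + g x))" if "b \<in> Basis" for b
  proof -
    have "partial b (\<lambda>x. f x + g x) = (\<lambda>x. partial b f x + partial b g x)"
      using Suc.prems by (intro ext partial_add) auto
    then show ?thesis using Suc that by auto
  qed
  ultimately show ?case using Suc.prems by auto
qed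

lemma deriv_bound_zero: "0 \<le> B \<Longrightarrow> deriv_bound L N B (\<lambda>x. 0)"
  by (induction L) (auto simp: partial_const)

lemma deriv_bound_const: "norm c \<le> B \<Longrightarrow> deriv_bound L 0 B (\<lambda>x. c)"
  using norm_ge_zero[of c] by (cases L) (auto simp: partial_const simp del: norm_ge_zero intro!: deriv_bound_zero)

text \<open>Each differentiation doubles the number of terms in the Leibniz rule, hence
  \<open>2 ^ L\<close>. The weights add up, so a factor that is merely bounded can be multiplied by
  one that carries all the decay.\<close>

lemma deriv_bound_mult:
  "deriv_bound L N B f \<Longrightarrow> deriv_bound L M C g \<Longrightarrow>
    deriv_bound L (N + M) (2 ^ L * B * C) (\<lambda>x. f x * g x)"
proof (induction L arbitrary: f g)
  case 0
  have "(1 + norm x) ^ (N + M) * norm (f x * g x) \<le> B * C" for x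
    using mult_mono[OF deriv_bound_norm[OF 0(1), of x] deriv_bound_norm[OF 0(2), of x]]
      deriv_bound_nonneg[OF 0(1)]
    by (auto simp: norm_mult power_add mult_ac)
  then show ?case using 0 by (auto intro: differentiable_mult)
next
  case (Suc L)
  note nn = deriv_bound_nonneg[OF Suc.prems(1)] deriv_bound_nonneg[OF Suc.prems(2)]
  have "(1 + norm x) ^ (N + M) * norm (f x * g x) \<le> B * C" for x
    using mult_mono[OF deriv_bound_norm[OF Suc.prems(1), of x] deriv_bound_norm[OF Suc.prems(2), of x]] nn
    by (auto simp: norm_mult power_add mult_ac)
  moreover have "1 * (B * C) \<le> 2 ^ Suc L * (B * C)"
    using nn by (intro mult_right_mono) (auto intro!: one_le_power simp del: power_Suc)
  ultimately have "(1 + norm x) ^ (N + M) * norm (f x * g x) \<le> 2 ^ Suc L * B * C" for x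
    by (smt (verit, best) mult.assoc mult_1)
  moreover have "deriv_bound L (N + M) (2 ^ Suc L * B * C) (partial b (\<lambda>x. f x * g x))"
    if "b \<in> Basis" for b
  proof -
    have "partial b (\<lambda>x. f x * g x) = (\<lambda>x. partial b f x * g x + f x * partial b g x)"
      using Suc.prems by (intro ext partial_mult) auto
    moreover have "deriv_bound L (N + M) (2 ^ L * B * C + 2 ^ L * B * C)
        (\<lambda>x. partial b f x * g x + f x * partial b g x)"
      using Suc.IH[OF deriv_bound_partial[OF Suc.prems(1) that] deriv_bound_Suc_D[OF Suc.prems(2)]]
        Suc.IH[OF deriv_bound_Suc_D[OF Suc.prems(1)] deriv_bound_partial[OF Suc.prems(2) that]]
      by (rule deriv_bound_add)
    ultimately show ?thesis by (simp add: mult_ac)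
  qed
  ultimately show ?case using Suc.prems by (auto intro: differentiable_mult)
qed

lemma deriv_bound_cmult:
  "deriv_bound L N B f \<Longrightarrow> deriv_bound L N (norm c * B) (\<lambda>x. c * f x)"
proof (induction L arbitrary: f)
  case 0
  then show ?case
    using mult_left_mono[OF deriv_bound_norm[OF 0], of "norm c"]
    by (auto simp: norm_mult mult_ac intro: differentiable_mult)
next
  case (Suc L)
  have "partial b (\<lambda>x. c * f x) = (\<lambda>x. c * partial b f x)" for b
    using Suc.prems by (intro ext partial_cmult) auto
  then show ?case
    using mult_left_mono[OF deriv_bound_norm[OF Suc.prems], of "norm c"] Suc
    by (auto simp: norm_mult mult_ac intro: differentiable_mult)
qed

lemma deriv_bound_diff:
  "deriv_bound L N B f \<Longrightarrow> deriv_bound L N C g \<Longrightarrow> deriv_bound L N (B + C) (\<lambda>x. f x - g x)"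
  using deriv_bound_add[of L N B f C "\<lambda>x. (-1) * g x"] deriv_bound_cmult[of L N C g "-1"] by simp

lemma deriv_bound_prod:
  assumes "finite S" "\<And>i. i \<in> S \<Longrightarrow> deriv_bound L 0 B (f i)"
  shows "deriv_bound L 0 ((2 ^ L * B) ^ card S) (\<lambda>x. \<Prod>i\<in>S. f i x)"
  using assms
proof (induction rule: finite_induct)
  case empty
  then show ?case by (simp add: deriv_bound_const)
next
  case (insert i S)
  have "deriv_bound L (0 + 0) (2 ^ L * B * (2 ^ L * B) ^ card S) (\<lambda>x. f i x * (\<Prod>i\<in>S. f i x))"
    using insert by (intro deriv_bound_mult) auto
  then show ?case using insert by simp
qed

subsection \<open>Schwartz functions\<close>

lemma iterated_deriv_snoc: "iterated_deriv (bs @ [b]) f = iterated_deriv bs (partial b f)"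
  by (induction bs) (auto simp: partial_def)

text \<open>In \<open>iterated_deriv\<close> the head of the list is the derivative applied last,
  whereas \<open>deriv_bound\<close> peels off the one applied first. The lists are therefore taken
  apart at their end.\<close>

lemma deriv_bound_iff:
  "deriv_bound L N B f \<longleftrightarrow> (\<forall>bs\<in>lists Basis. length bs \<le> L \<longrightarrow>
     (\<forall>x. iterated_deriv bs f differentiable (at x) \<and> weighted_deriv N bs f x \<le> B))"
proof (induction L arbitrary: f)
  case 0
  then show ?case by (auto simp: weighted_deriv_def)
next
  case (Suc L)
  have *: "(\<forall>bs\<in>lists Basis. length bs \<le> Suc L \<longrightarrow> P bs) \<longleftrightarrow>
    P [] \<and> (\<forall>b\<in>Basis. \<forall>bs\<in>lists Basis. length bs \<le> L \<longrightarrow> P (bs @ [b]))" (is "?l \<longleftrightarrow> ?r")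
    for P :: "'a list \<Rightarrow> bool"
  proof
    assume r: ?r
    show ?l
    proof (intro ballI impI)
      fix bs :: "'a list" assume "bs \<in> lists Basis" "length bs \<le> Suc L"
      then show "P bs" using r by (cases bs rule: rev_cases) auto
    qed
  qed auto
  have w: "weighted_deriv N (bs @ [b]) f x = weighted_deriv N bs (partial b f) x" for bs b x
    by (simp add: weighted_deriv_def iterated_deriv_snoc)
  show ?case
    unfolding * deriv_bound.simps(2) Suc w iterated_deriv_snoc by (simp add: weighted_deriv_def)
qed

text \<open>There are only finitely many lists of basis vectors of length at most \<open>L\<close>,
  so the separate seminorm bounds merge into a single constant, the sum of their absolute
  values.\<close>

lemma schwartz_iff: "f \<in> schwartz \<longleftrightarrow> (\<forall>L N. \<exists>B. deriv_bound L N B f)"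
proof
  assume f: "f \<in> schwartz"
  show "\<forall>L N. \<exists>B. deriv_bound L N B f"
  proof (intro allI)
    fix L N
    define I where "I = {bs::'a list. set bs \<subseteq> Basis \<and> length bs \<le> L}"
    have fin: "finite I" unfolding I_def by (rule finite_lists_length_le) auto
    have "\<forall>bs\<in>I. \<exists>B. \<forall>x. weighted_deriv N bs f x \<le> B"
      using f unfolding schwartz_def I_def bdd_above_def by (auto simp: lists_eq_set)
    then obtain B where B: "\<And>bs x. bs \<in> I \<Longrightarrow> weighted_deriv N bs f x \<le> B bs" by metis
    have "weighted_deriv N bs f x \<le> (\<Sum>bs\<in>I. \<bar>B bs\<bar>)" if "bs \<in> I" for bs x
    proof -
      have "weighted_deriv N bs f x \<le> \<bar>B bs\<bar>" using B[OF that, of x] by linarith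
      also have "\<dots> \<le> (\<Sum>bs\<in>I. \<bar>B bs\<bar>)" by (rule member_le_sum[OF that]) (auto simp: fin)
      finally show ?thesis .
    qed
    then have "deriv_bound L N (\<Sum>bs\<in>I. \<bar>B bs\<bar>) f"
      unfolding deriv_bound_iff using f by (auto simp: schwartz_def smooth_def I_def lists_eq_set)
    then show "\<exists>B. deriv_bound L N B f" ..
  qed
next
  assume *: "\<forall>L N. \<exists>B. deriv_bound L N B f"
  have 1: "\<exists>B. \<forall>x. iterated_deriv bs f differentiable (at x) \<and> weighted_deriv N bs f x \<le> B"
    if "bs \<in> lists Basis" for bs N
    using *[rule_format, of "length bs" N] that unfolding deriv_bound_iff by blast
  have "smooth f" unfolding smooth_def using 1 by blast
  moreover have "bdd_above (range (weighted_deriv N bs f))" if bs: "bs \<in> lists Basis" for N bs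
  proof -
    obtain B where "\<And>x. weighted_deriv N bs f x \<le> B" using 1[OF bs, of N] by blast
    then show ?thesis by (intro bdd_aboveI[of _ B]) auto
  qed
  ultimately show "f \<in> schwartz" unfolding schwartz_def by simp
qed

lemma schwartzI: "(\<And>L N. \<exists>B. deriv_bound L N B f) \<Longrightarrow> f \<in> schwartz"
  by (simp add: schwartz_iff)

lemma deriv_bound_schwartz: "f \<in> schwartz \<Longrightarrow> \<exists>B. deriv_bound L N B f"
  by (simp add: schwartz_iff)

lemma schwartz_differentiable: "f \<in> schwartz \<Longrightarrow> f differentiable (at x)"
  by (meson deriv_bound_schwartz deriv_bound_differentiable)

lemma schwartz_continuous: "f \<in> schwartz \<Longrightarrow> continuous_on UNIV f"
  by (intro continuous_at_imp_continuous_on ballI differentiable_imp_continuous_within schwartz_differentiable)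

lemma schwartz_measurable[measurable]: "f \<in> schwartz \<Longrightarrow> f \<in> borel_measurable borel"
  by (intro borel_measurable_continuous_onI schwartz_continuous)

lemma schwartz_add:
  assumes "f \<in> schwartz" "g \<in> schwartz"
  shows "(\<lambda>x. f x + g x) \<in> schwartz"
proof (rule schwartzI)
  fix L N
  from assms obtain B C where "deriv_bound L N B f" "deriv_bound L N C g"
    by (meson deriv_bound_schwartz)
  then show "\<exists>B. deriv_bound L N B (\<lambda>x. f x + g x)" by (blast intro: deriv_bound_add)
qed

lemma schwartz_cmult: "f \<in> schwartz \<Longrightarrow> (\<lambda>x. c * f x) \<in> schwartz"
  by (rule schwartzI) (metis deriv_bound_schwartz deriv_bound_cmult)

lemma schwartz_diff:
  assumes "f \<in> schwartz" "g \<in> schwartz"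
  shows "(\<lambda>x. f x - g x) \<in> schwartz"
proof (rule schwartzI)
  fix L N
  from assms obtain B C where "deriv_bound L N B f" "deriv_bound L N C g"
    by (meson deriv_bound_schwartz)
  then show "\<exists>B. deriv_bound L N B (\<lambda>x. f x - g x)" by (blast intro: deriv_bound_diff)
qed

lemma schwartz_mult:
  assumes "f \<in> schwartz" "g \<in> schwartz"
  shows "(\<lambda>x. f x * g x) \<in> schwartz"
proof (rule schwartzI)
  fix L N
  from assms obtain B C where "deriv_bound L 0 B f" "deriv_bound L N C g"
    by (meson deriv_bound_schwartz)
  from deriv_bound_mult[OF this] show "\<exists>B. deriv_bound L N B (\<lambda>x. f x * g x)" by auto
qed

lemma partial_coord_mult:
  assumes "f differentiable (at x)"
  shows "partial b (\<lambda>x. complex_of_real (x \<bullet> c) * f x) x =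
    complex_of_real (b \<bullet> c) * f x + complex_of_real (x \<bullet> c) * partial b f x"
proof -
  have "((\<lambda>x. complex_of_real (x \<bullet> c)) has_derivative (\<lambda>h. complex_of_real (h \<bullet> c))) (at x)"
    by (auto intro!: derivative_eq_intros)
  from partial_eqI[OF has_derivative_mult[OF this has_derivative_frechet[OF assms]]] show ?thesis
    by (simp add: partial_def)
qed

lemma differentiable_coord_mult:
  "f differentiable (at x) \<Longrightarrow> (\<lambda>x. complex_of_real (x \<bullet> c) * f x) differentiable (at x)"
  by (intro differentiable_mult) (auto intro!: derivative_eq_intros simp: differentiable_def)

text \<open>One power of the weight absorbs the coordinate. Each order of differentiation may also
  hit the coordinate itself, which contributes one more copy of \<open>B\<close>; this gives the
  factor \<open>L + 1\<close>.\<close>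

lemma deriv_bound_coord_mult:
  assumes "c \<in> Basis"
  shows "deriv_bound L (Suc N) B f \<Longrightarrow> deriv_bound L N (real (Suc L) * B) (\<lambda>x. complex_of_real (x \<bullet> c) * f x)"
proof (induction L arbitrary: f)
  have *: "(1 + norm x) ^ N * norm (complex_of_real (x \<bullet> c) * f x) \<le> B"
    if "deriv_bound L (Suc N) B f" for x f L
  proof -
    have "norm (complex_of_real (x \<bullet> c)) \<le> 1 + norm x"
      using Basis_le_norm[OF assms, of x] by simp
    then have "(1 + norm x) ^ N * norm (complex_of_real (x \<bullet> c) * f x) \<le>
        (1 + norm x) ^ N * ((1 + norm x) * norm (f x))"
      unfolding norm_mult by (intro mult_left_mono mult_right_mono) auto
    then show ?thesis using deriv_bound_norm[OF that, of x] by (simp add: mult_ac)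
  qed
  {
    case 0
    then show ?case using *[OF 0] differentiable_coord_mult[of f] by simp
  next
    case (Suc L)
    have nn: "0 \<le> B" by (rule deriv_bound_nonneg[OF Suc.prems])
    have "deriv_bound L N (real (Suc (Suc L)) * B) (partial b (\<lambda>x. complex_of_real (x \<bullet> c) * f x))"
      if "b \<in> Basis" for b
    proof -
      have "partial b (\<lambda>x. complex_of_real (x \<bullet> c) * f x) =
         (\<lambda>x. complex_of_real (b \<bullet> c) * f x + complex_of_real (x \<bullet> c) * partial b f x)"
        using Suc.prems by (intro ext partial_coord_mult) auto
      moreover have "deriv_bound L N (norm (complex_of_real (b \<bullet> c)) * B) (\<lambda>x. complex_of_real (b \<bullet> c) * f x)"
        using Suc.prems by (intro deriv_bound_cmult) (metis deriv_bound_Suc_D deriv_bound_mono le_SucI order_refl)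
      moreover have "norm (complex_of_real (b \<bullet> c)) \<le> 1"
        using assms that by (auto simp: inner_Basis)
      then have "norm (complex_of_real (b \<bullet> c)) * B \<le> B"
        using nn mult_right_mono by fastforce
      ultimately have "deriv_bound L N (B + real (Suc L) * B) (partial b (\<lambda>x. complex_of_real (x \<bullet> c) * f x))"
        using deriv_bound_add[OF deriv_bound_mono[OF _ order_refl order_refl]
          Suc.IH[OF deriv_bound_partial[OF Suc.prems that]]] by simp
      then show ?thesis by (simp add: algebra_simps)
    qed
    moreover have "B \<le> real (Suc (Suc L)) * B" using nn mult_right_mono[of 1 "real (Suc (Suc L))" B] by simp
    moreover have "(\<lambda>x. complex_of_real (x \<bullet> c) * f x) differentiable (at x)" for x
      using Suc.prems by (intro differentiable_coord_mult) simp
    ultimately show ?case using *[OF Suc.prems] unfolding deriv_bound.simps by (blast intro: order_trans)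
  }
qed

lemma schwartz_coord_mult:
  "c \<in> Basis \<Longrightarrow> f \<in> schwartz \<Longrightarrow> (\<lambda>x. complex_of_real (x \<bullet> c) * f x) \<in> schwartz"
  by (rule schwartzI) (metis deriv_bound_schwartz deriv_bound_coord_mult)

section \<open>Affine changes of variables and compact supports\<close>

definition diag :: "('a::euclidean_space \<Rightarrow> real) \<Rightarrow> 'a \<Rightarrow> 'a" where
  "diag d x = (\<Sum>b\<in>Basis. (d b * (x \<bullet> b)) *\<^sub>R b)"

lemma diag_inner: "b \<in> Basis \<Longrightarrow> diag d x \<bullet> b = d b * (x \<bullet> b)"
  by (simp add: diag_def inner_sum_left inner_Basis if_distrib cong: if_cong)

lemma bounded_linear_diag: "bounded_linear (diag d)"
  unfolding diag_def by (intro bounded_linear_intros)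

lemma diag_Basis: "b \<in> Basis \<Longrightarrow> diag d b = d b *\<^sub>R b"
  by (rule euclidean_eqI) (auto simp: diag_inner inner_Basis)

lemma differentiable_affine:
  fixes f :: "'a::euclidean_space \<Rightarrow> complex"
  assumes "\<And>x. f differentiable (at x)"
  shows "(\<lambda>x. f (t + diag d x)) differentiable (at x)"
    and "b \<in> Basis \<Longrightarrow> partial b (\<lambda>x. f (t + diag d x)) x = of_real (d b) * partial b f (t + diag d x)"
proof -
  have 1: "((\<lambda>x. t + diag d x) has_derivative diag d) (at x)"
    using bounded_linear.has_derivative[OF bounded_linear_diag has_derivative_ident]
    by (auto intro!: derivative_eq_intros)
  have 2: "((\<lambda>x. f (t + diag d x)) has_derivative (\<lambda>h. frechet_derivative f (at (t + diag d x)) (diag d h))) (at x)"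
    using has_derivative_compose[OF 1 has_derivative_frechet[OF assms]] .
  then show "(\<lambda>x. f (t + diag d x)) differentiable (at x)" by (auto simp: differentiable_def)
  show "partial b (\<lambda>x. f (t + diag d x)) x = of_real (d b) * partial b f (t + diag d x)" if "b \<in> Basis"
    using partial_eqI[OF 2, of b] linear_cmul[OF linear_frechet_derivative[OF assms]] that
    by (simp add: partial_def diag_Basis scaleR_conv_of_real)
qed

text \<open>Stated without weight, because translation by an arbitrary \<open>t\<close> does not
  respect decay at the origin; the bound is then uniform in \<open>t\<close>, as needed for packets
  at all frequencies. With \<open>1 \<le> \<Lambda>\<close> the single power
  \<open>\<Lambda> ^ L\<close> dominates the contributions of all lower orders.\<close>

lemma deriv_bound_affine:
  assumes "\<And>b. b \<in> Basis \<Longrightarrow> \<bar>d b\<bar> \<le> \<Lambda>" "1 \<le> \<Lambda>"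
  shows "deriv_bound L 0 B f \<Longrightarrow> deriv_bound L 0 (\<Lambda> ^ L * B) (\<lambda>x. f (t + diag d x))"
proof (induction L arbitrary: f)
  case 0
  then show ?case using differentiable_affine(1)[of f t d] by simp
next
  case (Suc L)
  have diff: "\<And>x. f differentiable (at x)" using Suc.prems by auto
  have nn: "0 \<le> B" by (rule deriv_bound_nonneg[OF Suc.prems])
  have "norm (f x) \<le> \<Lambda> ^ Suc L * B" for x
    using deriv_bound_norm0[OF Suc.prems, of x] mult_right_mono[of 1 "\<Lambda> ^ Suc L" B] nn
      one_le_power[OF assms(2), of "Suc L"] by linarith
  moreover have "deriv_bound L 0 (\<Lambda> ^ Suc L * B) (partial b (\<lambda>x. f (t + diag d x)))" if b: "b \<in> Basis" for b
  proof -
    have "partial b (\<lambda>x. f (t + diag d x)) = (\<lambda>x. of_real (d b) * partial b f (t + diag d x))"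
      using differentiable_affine(2)[OF diff b] by auto
    moreover have "deriv_bound L 0 (norm (complex_of_real (d b)) * (\<Lambda> ^ L * B))
        (\<lambda>x. of_real (d b) * partial b f (t + diag d x))"
      by (rule deriv_bound_cmult[OF Suc.IH[OF deriv_bound_partial[OF Suc.prems b]]])
    moreover have "norm (complex_of_real (d b)) * (\<Lambda> ^ L * B) \<le> \<Lambda> * (\<Lambda> ^ L * B)"
      using assms nn b by (intro mult_right_mono) auto
    ultimately show ?thesis using deriv_bound_mono[OF _ order_refl order_refl] by (simp add: mult.assoc)
  qed
  ultimately show ?case using differentiable_affine(1)[OF diff] by auto
qed

lemma partial_zero_outside:
  fixes f :: "'a::euclidean_space \<Rightarrow> complex"
  assumes "\<And>x. norm x > \<rho> \<Longrightarrow> f x = 0" "norm x > \<rho>"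
  shows "partial b f x = 0"
proof -
  have "(f has_derivative (\<lambda>_. 0)) (at x)"
  proof (rule has_derivative_transform_within_open[of "\<lambda>_. 0" _ x UNIV "{x. norm x > \<rho>}"])
    show "open {x::'a. \<rho> < norm x}" by (intro open_Collect_less continuous_intros)
  qed (use assms in auto)
  then show ?thesis by (rule partial_eqI)
qed

text \<open>This recovers the weights that the affine estimate lacks: on the support the weight is
  at most \<open>(1 + \<rho>) ^ N\<close>, and derivatives vanish wherever the function vanishes on
  an open set.\<close>

lemma deriv_bound_compact_support:
  assumes "0 \<le> \<rho>"
  shows "deriv_bound L 0 B f \<Longrightarrow> (\<And>x. norm x > \<rho> \<Longrightarrow> f x = 0) \<Longrightarrow> deriv_bound L N ((1 + \<rho>) ^ N * B) f"
proof (induction L arbitrary: f)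
  have *: "(1 + norm x) ^ N * norm (f x) \<le> (1 + \<rho>) ^ N * B"
    if "deriv_bound L 0 B f" "\<And>x. norm x > \<rho> \<Longrightarrow> f x = 0" for L f x
  proof (cases "norm x > \<rho>")
    case True
    then show ?thesis using that deriv_bound_nonneg[OF that(1)] assms by simp
  next
    case False
    then show ?thesis using deriv_bound_norm0[OF that(1), of x] assms
      by (intro mult_mono power_mono) auto
  qed
  {
    case 0
    then show ?case using *[OF 0] by auto
  next
    case (Suc L)
    have "deriv_bound L N ((1 + \<rho>) ^ N * B) (partial b f)" if "b \<in> Basis" for b
      using partial_zero_outside[OF Suc.prems(2)] deriv_bound_partial[OF Suc.prems(1) that]
      by (intro Suc.IH) auto
    then show ?case using *[OF Suc.prems] Suc.prems(1) by simp
  }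
qed

lemma schwartzI_compact_support:
  assumes "\<And>L. \<exists>B. deriv_bound L 0 B f" "\<And>x. norm x > \<rho> \<Longrightarrow> f x = 0"
  shows "f \<in> schwartz"
  unfolding schwartz_iff
proof (intro allI)
  fix L N
  from assms(1) obtain B where B: "deriv_bound L 0 B f" by blast
  have "f x = 0" if "norm x > max 0 \<rho>" for x
    by (rule assms(2)) (use that in linarith)
  from deriv_bound_compact_support[OF max.cobounded1 B this]
  have "deriv_bound L N ((1 + max 0 \<rho>) ^ N * B) f" .
  then show "\<exists>B. deriv_bound L N B f" ..
qed

lemma deriv_bound_coord:
  assumes c: "c \<in> Basis"
  shows "deriv_bound L 0 B (g :: real \<Rightarrow> complex) \<Longrightarrow> deriv_bound L 0 B (\<lambda>x. g (x \<bullet> c))"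
proof (induction L arbitrary: g)
  have 1: "((\<lambda>x. g (x \<bullet> c)) has_derivative (\<lambda>h. frechet_derivative g (at (x \<bullet> c)) (h \<bullet> c))) (at x)"
    if "\<And>x. g differentiable (at x)" for g :: "real \<Rightarrow> complex" and x
    by (rule has_derivative_compose[OF _ has_derivative_frechet[OF that]]) (auto intro!: derivative_eq_intros)
  {
    case 0
    then have "\<And>x. g differentiable (at x)" by simp
    from 1[OF this] have "(\<lambda>x. g (x \<bullet> c)) differentiable (at x)" for x
      unfolding differentiable_def by blast
    then show ?case using 0 by simp
  next
    case (Suc L)
    have diff: "\<And>x. g differentiable (at x)" using Suc.prems by auto
    have "(\<lambda>x. g (x \<bullet> c)) differentiable (at x)" for x
      using 1[OF diff] unfolding differentiable_def by blast
    moreover have "partial b (\<lambda>x. g (x \<bullet> c)) = (if b = c then (\<lambda>x. partial 1 g (x \<bullet> c)) else (\<lambda>_. 0))"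
      if "b \<in> Basis" for b
      using partial_eqI[OF 1[OF diff], of b] linear_0[OF linear_frechet_derivative[OF diff]] c that
      by (auto simp: fun_eq_iff partial_def inner_Basis)
    ultimately show ?case
      using Suc deriv_bound_nonneg[OF Suc.prems] by (simp add: deriv_bound_zero)
  }
qed

section \<open>Integrability from decay, and Fubini's theorem for bounded kernels\<close>

lemma integrable_weight: "integrable lborel (\<lambda>x::'a::euclidean_space. inverse ((1 + norm x) ^ (2 * DIM('a))))"
proof (rule integrableI_bounded)
  have i: "integrable lborel (\<lambda>x::real. inverse (1 + x\<^sup>2))"
    using integrable_inverse_1_plus_square by (simp add: einterval_def set_integrable_def)
  have pos: "0 < 1 + x\<^sup>2" for x :: real by (smt (verit) zero_le_power2)
  have fin: "(\<integral>\<^sup>+(x::real). ennreal (inverse (1 + x\<^sup>2)) \<partial>lborel) < \<infinity>"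
    using i pos unfolding integrable_iff_bounded by (auto simp: abs_of_pos)
  have "(\<integral>\<^sup>+(x::'a). ennreal (norm (inverse ((1 + norm x) ^ (2 * DIM('a))))) \<partial>lborel) \<le>
    (\<integral>\<^sup>+(x::'a). (\<Prod>b\<in>Basis. ennreal (inverse (1 + (x \<bullet> b)\<^sup>2))) \<partial>lborel)"
  proof (rule nn_integral_mono)
    fix x :: 'a
    \<comment> \<open>Comparison with a tensor product of functions \<open>1 / (1 + t^2)\<close>
      reduces the integral to a power of a one-dimensional one. Each coordinate costs two powers of
      the weight, hence the exponent twice the dimension.\<close>
    have "(\<Prod>b\<in>Basis. 1 + (x \<bullet> b)\<^sup>2) \<le> (\<Prod>b\<in>(Basis::'a set). (1 + norm x)\<^sup>2)"
    proof (rule prod_mono, safe)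
      fix b :: 'a assume b: "b \<in> Basis"
      show "0 \<le> 1 + (x \<bullet> b)\<^sup>2" using pos less_imp_le by blast
      have "(x \<bullet> b)\<^sup>2 \<le> (norm x)\<^sup>2" using Basis_le_norm[OF b, of x] by (simp add: abs_le_square_iff[symmetric])
      then show "1 + (x \<bullet> b)\<^sup>2 \<le> (1 + norm x)\<^sup>2"
        unfolding power2_sum using norm_ge_zero[of x] by (simp del: norm_ge_zero)
    qed
    also have "\<dots> = (1 + norm x) ^ (2 * DIM('a))" by (simp add: power_mult)
    finally have "inverse ((1 + norm x) ^ (2 * DIM('a))) \<le> inverse (\<Prod>b\<in>Basis. 1 + (x \<bullet> b)\<^sup>2)"
      using pos by (intro le_imp_inverse_le) (auto intro: prod_pos)
    also have "\<dots> = (\<Prod>b\<in>Basis. inverse (1 + (x \<bullet> b)\<^sup>2))" by (simp add: prod_inversef[symmetric] o_def)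
    finally show "ennreal (norm (inverse ((1 + norm x) ^ (2 * DIM('a)))))
      \<le> (\<Prod>b\<in>Basis. ennreal (inverse (1 + (x \<bullet> b)\<^sup>2)))"
      using pos less_imp_le by (subst prod_ennreal) (auto intro!: ennreal_leI)
  qed
  also have "\<dots> = (\<Prod>b\<in>(Basis::'a set). (\<integral>\<^sup>+x. ennreal (inverse (1 + x\<^sup>2)) \<partial>lborel))"
    by (rule nn_integral_lborel_prod) auto
  also have "\<dots> < \<infinity>" using fin by (simp add: less_top[symmetric] power_eq_top_ennreal)
  finally show "(\<integral>\<^sup>+(x::'a). ennreal (norm (inverse ((1 + norm x) ^ (2 * DIM('a))))) \<partial>lborel) < \<infinity>" .
qed simp

lemma norm_le_weight:
  assumes "(1 + norm x) ^ N * norm z \<le> B"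
  shows "norm z \<le> B * inverse ((1 + norm (x::'a::real_normed_vector)) ^ N)"
  using assms by (simp add: field_simps add_pos_nonneg)

lemma
  fixes f :: "'a::euclidean_space \<Rightarrow> complex"
  assumes [measurable]: "f \<in> borel_measurable borel"
    and *: "\<And>x. (1 + norm x) ^ (2 * DIM('a)) * norm (f x) \<le> B"
  shows weight_integrable: "integrable lborel f"
    and weight_integral_le: "(LINT x|lborel. norm (f x)) \<le> B * (LINT x|lborel. inverse ((1 + norm (x::'a)) ^ (2 * DIM('a))))"
proof -
  have i: "integrable lborel (\<lambda>x::'a. B * inverse ((1 + norm x) ^ (2 * DIM('a))))"
    using integrable_weight by (rule integrable_mult_right)
  show 1: "integrable lborel f"
    by (rule Bochner_Integration.integrable_bound[OF i])
      (use norm_le_weight[OF *] in \<open>auto intro!: AE_I2 order_trans[OF _ abs_ge_self]\<close>)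
  have "(LINT x|lborel. norm (f x)) \<le> (LINT x|lborel. B * inverse ((1 + norm (x::'a)) ^ (2 * DIM('a))))"
    using norm_le_weight[OF *] 1 i by (intro integral_mono) auto
  then show "(LINT x|lborel. norm (f x)) \<le> B * (LINT x|lborel. inverse ((1 + norm (x::'a)) ^ (2 * DIM('a))))"
    by simp
qed

lemma deriv_bound_measurable: "deriv_bound L N B f \<Longrightarrow> f \<in> borel_measurable borel"
  by (intro borel_measurable_continuous_onI continuous_at_imp_continuous_on ballI
      differentiable_imp_continuous_within deriv_bound_differentiable)

lemma deriv_bound_integrable:
  "deriv_bound L (2 * DIM('a)) B f \<Longrightarrow> integrable lborel (f :: 'a::euclidean_space \<Rightarrow> complex)"
  by (rule weight_integrable[OF deriv_bound_measurable deriv_bound_norm])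

lemma schwartz_integrable: "f \<in> schwartz \<Longrightarrow> integrable lborel f"
  by (meson deriv_bound_schwartz deriv_bound_integrable)

lemma integrable_mult_bounded:
  fixes f :: "'a::euclidean_space \<Rightarrow> complex"
  assumes "integrable lborel f" "g \<in> borel_measurable borel" "\<And>x. norm (g x) \<le> C"
  shows "integrable lborel (\<lambda>x. f x * g x)"
proof (rule Bochner_Integration.integrable_bound)
  show "integrable lborel (\<lambda>x. C * norm (f x))" using assms(1) by simp
  show "(\<lambda>x. f x * g x) \<in> borel_measurable lborel" using assms(1,2) by simp
  show "AE x in lborel. norm (f x * g x) \<le> norm (C * norm (f x))"
  proof (rule AE_I2)
    fix x
    have "norm (f x * g x) \<le> C * norm (f x)"
      using mult_left_mono[OF assms(3)[of x], of "norm (f x)"] by (simp add: norm_mult mult_ac)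
    then show "norm (f x * g x) \<le> norm (C * norm (f x))" by simp
  qed
qed

lemma norm_exp_i [simp]: "norm (exp (\<i> * complex_of_real t)) = 1"
  by (simp add: norm_exp_i_times)

lemma norm_exp_minus_i [simp]: "norm (exp (- (\<i> * complex_of_real t))) = 1"
  by (simp add: norm_exp_eq_Re)

text \<open>The integrand is dominated by the product of \<open>norm (f x)\<close> and
  \<open>norm (g y)\<close>. In the applications \<open>u\<close> is an exponential of modulus one;
  the lemma yields both the symmetry of the inverse transform and the exchange of integrals in the
  inversion formula.\<close>

lemma fubini_bounded_kernel:
  fixes f g :: "'a::euclidean_space \<Rightarrow> complex"
  assumes f: "integrable lborel f" and g: "integrable lborel g"
    and u: "(\<lambda>(x, y). u x y) \<in> borel_measurable (lborel \<Otimes>\<^sub>M lborel)" and u1: "\<And>x y. norm (u x y) \<le> 1"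
  shows "(LINT x|lborel. f x * (LINT y|lborel. g y * u x y)) = (LINT y|lborel. g y * (LINT x|lborel. f x * u x y))"
proof -
  have fm[measurable]: "f \<in> borel_measurable borel" and gm[measurable]: "g \<in> borel_measurable borel"
    using f g by auto
  note [measurable] = u
  have uy: "(\<lambda>y. u x y) \<in> borel_measurable borel" for x
    using measurable_compose[OF measurable_Pair1', of x lborel "\<lambda>(x, y). u x y" lborel borel] u by simp
  have 1: "integrable lborel (\<lambda>y. g y * u x y)" for x
    by (rule integrable_mult_bounded[OF g uy u1])
  have int: "integrable (lborel \<Otimes>\<^sub>M lborel) (\<lambda>(x, y). f x * (g y * u x y))"
  proof (rule lborel_pair.Fubini_integrable)
    show "(\<lambda>(x, y). f x * (g y * u x y)) \<in> borel_measurable (lborel \<Otimes>\<^sub>M lborel)"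
      using u by (simp add: split_beta')
    show "AE x in lborel. integrable lborel (\<lambda>y. case (x, y) of (x, y) \<Rightarrow> f x * (g y * u x y))"
      using 1 by auto
    show "integrable lborel (\<lambda>x. LINT y|lborel. norm (case (x, y) of (x, y) \<Rightarrow> f x * (g y * u x y)))"
    proof (rule Bochner_Integration.integrable_bound)
      show "integrable lborel (\<lambda>x. norm (f x) * (LINT y|lborel. norm (g y)))" using f by simp
      show "(\<lambda>x. LINT y|lborel. norm (case (x, y) of (x, y) \<Rightarrow> f x * (g y * u x y))) \<in> borel_measurable lborel"
        using u by (intro lborel.borel_measurable_lebesgue_integral) (simp add: split_beta')
      show "AE x in lborel. norm (LINT y|lborel. norm (case (x, y) of (x, y) \<Rightarrow> f x * (g y * u x y)))
          \<le> norm (norm (f x) * (LINT y|lborel. norm (g y)))"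
      proof (rule AE_I2)
        fix x
        have "(LINT y|lborel. norm (g y * u x y)) \<le> (LINT y|lborel. norm (g y))"
        proof (rule integral_mono)
          show "norm (g y * u x y) \<le> norm (g y)" for y
            using mult_left_mono[OF u1[of x y], of "norm (g y)"] by (simp add: norm_mult)
        qed (use 1 g in auto)
        then have "norm (f x) * (LINT y|lborel. norm (g y * u x y)) \<le> norm (f x) * (LINT y|lborel. norm (g y))"
          by (rule mult_left_mono) simp
        then show "norm (LINT y|lborel. norm (case (x, y) of (x, y) \<Rightarrow> f x * (g y * u x y)))
          \<le> norm (norm (f x) * (LINT y|lborel. norm (g y)))"
          by (simp add: norm_mult[of "f x"] integral_nonneg_AE)
      qed
    qed
  qed
  have "(LINT x|lborel. f x * (LINT y|lborel. g y * u x y)) = (LINT x|lborel. LINT y|lborel. f x * (g y * u x y))"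
    using 1 by simp
  also have "\<dots> = (LINT y|lborel. LINT x|lborel. f x * (g y * u x y))"
    using lborel_pair.Fubini_integral[OF int] by simp
  also have "\<dots> = (LINT y|lborel. LINT x|lborel. g y * (f x * u x y))"
    by (simp add: mult_ac)
  also have "\<dots> = (LINT y|lborel. g y * (LINT x|lborel. f x * u x y))"
    by simp
  finally show ?thesis .
qed

lemma lborel_integral_affine:
  fixes f :: "'a::euclidean_space \<Rightarrow> complex"
  assumes [measurable]: "f \<in> borel_measurable borel" and c: "c \<noteq> 0"
  shows "(LINT x|lborel. f x) = \<bar>c\<bar> ^ DIM('a) *\<^sub>R (LINT x|lborel. f (t + c *\<^sub>R x))"
  by (subst lborel_affine[OF c, of t]) (simp add: integral_density integral_distr)

lemma lborel_integral_translate: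
  fixes f :: "'a::euclidean_space \<Rightarrow> complex"
  assumes [measurable]: "f \<in> borel_measurable borel"
  shows "(LINT x|lborel. f (t + x)) = (LINT x|lborel. f x)"
  using lborel_integral_affine[OF assms, of 1 t] by simp

subsection \<open>The Fourier transform on Schwartz functions\<close>

lemma inverse_fourier_bound:
  "\<exists>C\<ge>0. \<forall>(h::'a::euclidean_space \<Rightarrow> complex) B x. deriv_bound 0 (2 * DIM('a)) B h \<longrightarrow>
     norm (inverse_fourier h x) \<le> C * B"
proof (intro exI conjI allI impI)
  let ?W = "LINT x|lborel. inverse ((1 + norm (x::'a)) ^ (2 * DIM('a)))"
  let ?c = "(2 * pi) powr (- real DIM('a) / 2)"
  show "0 \<le> ?c * ?W" by (intro mult_nonneg_nonneg integral_nonneg_AE) auto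
  fix h :: "'a \<Rightarrow> complex" and B x
  assume h: "deriv_bound 0 (2 * DIM('a)) B h"
  have "norm (LINT \<xi>|lborel. h \<xi> * exp (\<i> * complex_of_real (x \<bullet> \<xi>))) \<le> (LINT \<xi>|lborel. norm (h \<xi>))"
    by (rule order_trans[OF integral_norm_bound]) (simp add: norm_mult)
  also have "\<dots> \<le> B * ?W"
    by (rule weight_integral_le[OF deriv_bound_measurable[OF h] deriv_bound_norm[OF h]])
  finally show "norm (inverse_fourier h x) \<le> ?c * ?W * B"
    unfolding inverse_fourier_def norm_mult by (simp add: mult_left_mono mult_ac)
qed

lemma inverse_fourier_cmult: "inverse_fourier (\<lambda>\<xi>. c * h \<xi>) x = c * inverse_fourier h x"
  by (simp add: inverse_fourier_def mult.assoc)

lemma integrable_fourier_kernel: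
  "integrable lborel h \<Longrightarrow> integrable lborel (\<lambda>\<xi>. h \<xi> * exp (\<i> * complex_of_real (x \<bullet> \<xi>)))"
  by (rule integrable_mult_bounded[where C = 1]) auto

lemma inverse_fourier_add:
  "integrable lborel g \<Longrightarrow> integrable lborel h \<Longrightarrow>
    inverse_fourier (\<lambda>\<xi>. g \<xi> + h \<xi>) x = inverse_fourier g x + inverse_fourier h x"
  by (simp add: inverse_fourier_def distrib_right integrable_fourier_kernel distrib_left)

lemma inverse_fourier_sum:
  "(\<And>i. i \<in> I \<Longrightarrow> integrable lborel (h i)) \<Longrightarrow>
    inverse_fourier (\<lambda>\<xi>. \<Sum>i\<in>I. h i \<xi>) x = (\<Sum>i\<in>I. inverse_fourier (h i) x)"
  by (simp add: inverse_fourier_def sum_distrib_right integrable_fourier_kernel sum_distrib_left)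

lemma has_vector_derivative_quotient:
  fixes f :: "real \<Rightarrow> 'a::real_normed_vector"
  assumes "(f has_vector_derivative d) (at 0)"
  shows "((\<lambda>s. (f s - f 0) /\<^sub>R s) \<longlongrightarrow> d) (at 0)"
proof -
  have "((\<lambda>s. norm (f (0 + s) - f 0 - s *\<^sub>R d) / norm s) \<longlongrightarrow> 0) (at 0)"
    using assms unfolding has_vector_derivative_def has_derivative_at by blast
  moreover have "\<forall>\<^sub>F s in at 0. norm (f (0 + s) - f 0 - s *\<^sub>R d) / norm s = norm ((f s - f 0) /\<^sub>R s - d)"
  proof (rule eventually_at_topological[THEN iffD2], intro exI[of _ UNIV] conjI ballI impI)
    fix s :: real assume "s \<noteq> 0"
    then have "(f s - f 0) /\<^sub>R s - d = (f s - f 0 - s *\<^sub>R d) /\<^sub>R s" by (simp add: algebra_simps)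
    then show "norm (f (0 + s) - f 0 - s *\<^sub>R d) / norm s = norm ((f s - f 0) /\<^sub>R s - d)"
      by (simp add: divide_inverse_commute)
  qed auto
  ultimately have "((\<lambda>s. norm ((f s - f 0) /\<^sub>R s - d)) \<longlongrightarrow> 0) (at 0)"
    by (rule Lim_transform_eventually)
  then show ?thesis by (rule LIM_zero_cancel[OF tendsto_norm_zero_cancel])
qed

text \<open>Integration by parts without boundary terms: in a difference quotient of
  \<open>h\<close> along \<open>b\<close> the translation is moved onto the exponential, where it
  becomes an explicit factor, and dominated convergence passes to the limit on the side of
  \<open>h\<close>.\<close>

lemma inverse_fourier_partial:
  fixes h :: "'a::euclidean_space \<Rightarrow> complex"
  assumes h: "deriv_bound 1 (2 * DIM('a)) B h" and b: "b \<in> Basis"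
  shows "inverse_fourier (partial b h) x = - \<i> * complex_of_real (x \<bullet> b) * inverse_fourier h x"
proof -
  let ?n = "2 * DIM('a)"
  define e where "e \<xi> = exp (\<i> * complex_of_real (x \<bullet> \<xi>))" for \<xi> :: 'a
  define t where "t k = inverse (real (Suc k))" for k
  have t0: "t k > 0" "t k \<le> 1" for k by (auto simp: t_def field_simps)
  have tlim: "t \<longlonglongrightarrow> 0" unfolding t_def using LIMSEQ_inverse_real_of_nat by simp
  then have tlim': "filterlim t (at 0) sequentially"
    using t0 by (auto simp: filterlim_at less_imp_neq[symmetric])
  have diff: "h differentiable (at \<xi>)" for \<xi> using deriv_bound_differentiable[OF h] .
  have hp: "deriv_bound 0 ?n B (partial b h)" using h b by simp
  have hm[measurable]: "h \<in> borel_measurable borel" by (rule deriv_bound_measurable[OF h])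
  have hi: "integrable lborel h" by (rule deriv_bound_integrable[OF h])
  have em[measurable]: "e \<in> borel_measurable borel" unfolding e_def by measurable
  have curve: "((\<lambda>s. h (\<xi> + s *\<^sub>R b)) has_vector_derivative partial b h (\<xi> + s *\<^sub>R b)) (at s)" for \<xi> s
  proof -
    have "((\<lambda>s. h (\<xi> + s *\<^sub>R b)) has_derivative (\<lambda>r. frechet_derivative h (at (\<xi> + s *\<^sub>R b)) (r *\<^sub>R b))) (at s)"
      by (rule has_derivative_compose[OF _ has_derivative_frechet[OF diff]]) (auto intro!: derivative_eq_intros)
    then show ?thesis
      by (simp add: has_vector_derivative_def partial_def linear_cmul[OF linear_frechet_derivative[OF diff]])
  qed
  define q where "q k \<xi> = (h (t k *\<^sub>R b + \<xi>) - h \<xi>) /\<^sub>R t k" for k \<xi>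
  have qlim: "(\<lambda>k. q k \<xi>) \<longlonglongrightarrow> partial b h \<xi>" for \<xi>
  proof -
    have "((\<lambda>s. (h (\<xi> + s *\<^sub>R b) - h \<xi>) /\<^sub>R s) \<longlongrightarrow> partial b h \<xi>) (at 0)"
      using has_vector_derivative_quotient[OF curve[of \<xi> 0, simplified]] by simp
    from filterlim_compose[OF this tlim'] show ?thesis by (simp add: q_def add.commute)
  qed
  \<comment> \<open>The majorant must not depend on \<open>k\<close>. The mean value inequality
    leads to the derivative at a point at distance at most one, and over such a distance the weight
    changes by at most a factor 2 per power.\<close>
  have qbound: "norm (q k \<xi>) \<le> 2 ^ ?n * B * inverse ((1 + norm \<xi>) ^ ?n)" for k \<xi>
  proof -
    have "\<exists>s\<in>{0<..<t k}. norm (h (\<xi> + t k *\<^sub>R b) - h (\<xi> + 0 *\<^sub>R b)) \<le> norm ((t k - 0) *\<^sub>R partial b h (\<xi> + s *\<^sub>R b))"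
    proof (rule mvt_general)
      show "continuous_on {0..t k} (\<lambda>s. h (\<xi> + s *\<^sub>R b))"
        using curve by (meson continuous_at_imp_continuous_on has_vector_derivative_continuous)
      show "((\<lambda>s. h (\<xi> + s *\<^sub>R b)) has_derivative (\<lambda>r. r *\<^sub>R partial b h (\<xi> + s *\<^sub>R b))) (at s)" for s
        using curve[of \<xi> s] by (simp add: has_vector_derivative_def)
    qed (use t0 in auto)
    then obtain s where s: "0 < s" "s < t k"
      and le: "norm (h (\<xi> + t k *\<^sub>R b) - h \<xi>) \<le> t k * norm (partial b h (\<xi> + s *\<^sub>R b))"
      using t0(1)[of k] by auto
    have "1 + norm \<xi> \<le> 2 * (1 + norm (\<xi> + s *\<^sub>R b))"
    proof -
      have "norm (s *\<^sub>R b) \<le> 1" using s t0(2)[of k] b by simp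
      then show ?thesis
        using norm_triangle_ineq4[of "\<xi> + s *\<^sub>R b" "s *\<^sub>R b"] norm_ge_zero[of "\<xi> + s *\<^sub>R b"]
        unfolding add_diff_cancel_right' distrib_left by linarith
    qed
    then have "(1 + norm \<xi>) ^ ?n \<le> 2 ^ ?n * (1 + norm (\<xi> + s *\<^sub>R b)) ^ ?n"
      using power_mono[of "1 + norm \<xi>" "2 * (1 + norm (\<xi> + s *\<^sub>R b))" ?n] by (simp only: power_mult_distrib) simp
    then have "(1 + norm \<xi>) ^ ?n * norm (partial b h (\<xi> + s *\<^sub>R b)) \<le>
      (2 ^ ?n * (1 + norm (\<xi> + s *\<^sub>R b)) ^ ?n) * norm (partial b h (\<xi> + s *\<^sub>R b))"
      by (rule mult_right_mono) simp
    also have "\<dots> \<le> 2 ^ ?n * B"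
      using deriv_bound_norm[OF hp, of "\<xi> + s *\<^sub>R b"] by (simp add: mult.assoc)
    finally have 1: "norm (partial b h (\<xi> + s *\<^sub>R b)) \<le> 2 ^ ?n * B * inverse ((1 + norm \<xi>) ^ ?n)"
      by (rule norm_le_weight)
    have "norm (q k \<xi>) = norm (h (\<xi> + t k *\<^sub>R b) - h \<xi>) / t k"
      using t0(1)[of k] by (simp add: q_def add.commute divide_inverse_commute)
    also have "\<dots> \<le> norm (partial b h (\<xi> + s *\<^sub>R b))"
      using le t0(1)[of k] by (simp add: field_simps)
    finally show ?thesis using 1 by linarith
  qed
  have lim1: "(\<lambda>k. LINT \<xi>|lborel. q k \<xi> * e \<xi>) \<longlonglongrightarrow> (LINT \<xi>|lborel. partial b h \<xi> * e \<xi>)"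
  proof (rule integral_dominated_convergence)
    show "integrable lborel (\<lambda>\<xi>::'a. 2 ^ ?n * B * inverse ((1 + norm \<xi>) ^ ?n))"
      using integrable_weight by (rule integrable_mult_right)
    show "(\<lambda>\<xi>. partial b h \<xi> * e \<xi>) \<in> borel_measurable lborel"
      using deriv_bound_measurable[OF hp] by simp
    show "(\<lambda>\<xi>. q k \<xi> * e \<xi>) \<in> borel_measurable lborel" for k
      unfolding q_def by measurable
    show "AE \<xi> in lborel. (\<lambda>k. q k \<xi> * e \<xi>) \<longlonglongrightarrow> partial b h \<xi> * e \<xi>"
      using qlim by (auto intro!: tendsto_intros)
    show "AE \<xi> in lborel. norm (q k \<xi> * e \<xi>) \<le> 2 ^ ?n * B * inverse ((1 + norm \<xi>) ^ ?n)" for k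
      using qbound by (auto simp: norm_mult e_def)
  qed
  define I where "I = (LINT \<xi>|lborel. h \<xi> * e \<xi>)"
  have int_e: "integrable lborel (\<lambda>\<xi>. g \<xi> * e \<xi>)" if "integrable lborel g" for g
    using integrable_fourier_kernel[OF that, of x] by (simp add: e_def)
  have eq: "(LINT \<xi>|lborel. q k \<xi> * e \<xi>) = ((exp (t k *\<^sub>R (- \<i> * complex_of_real (x \<bullet> b))) - 1) /\<^sub>R t k) * I" for k
  proof -
    have shift: "(LINT \<xi>|lborel. h (t k *\<^sub>R b + \<xi>) * e \<xi>) = exp (t k *\<^sub>R (- \<i> * complex_of_real (x \<bullet> b))) * I"
    proof -
      have "(LINT \<xi>|lborel. h (t k *\<^sub>R b + \<xi>) * e \<xi>) =
        (LINT \<xi>|lborel. h (t k *\<^sub>R b + \<xi>) * e ((t k *\<^sub>R b + \<xi>) - t k *\<^sub>R b))" by simp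
      also have "\<dots> = (LINT \<xi>|lborel. h \<xi> * e (\<xi> - t k *\<^sub>R b))"
        by (rule lborel_integral_translate[where f = "\<lambda>\<xi>. h \<xi> * e (\<xi> - t k *\<^sub>R b)"]) measurable
      also have "\<dots> = (LINT \<xi>|lborel. exp (t k *\<^sub>R (- \<i> * complex_of_real (x \<bullet> b))) * (h \<xi> * e \<xi>))"
        by (rule Bochner_Integration.integral_cong)
          (auto simp: e_def inner_diff_right exp_diff exp_minus field_simps scaleR_conv_of_real simp flip: exp_add)
      finally show ?thesis by (simp add: I_def)
    qed
    have hs: "integrable lborel (\<lambda>\<xi>. h (t k *\<^sub>R b + \<xi>))"
      using hi by (intro integrable_distr[of "(+) (t k *\<^sub>R b)" lborel borel h]) (simp_all add: lborel_distr_plus)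
    have "(LINT \<xi>|lborel. q k \<xi> * e \<xi>) = (LINT \<xi>|lborel. (h (t k *\<^sub>R b + \<xi>) * e \<xi> - h \<xi> * e \<xi>) /\<^sub>R t k)"
      by (simp add: q_def algebra_simps)
    also have "\<dots> = ((LINT \<xi>|lborel. h (t k *\<^sub>R b + \<xi>) * e \<xi>) - (LINT \<xi>|lborel. h \<xi> * e \<xi>)) /\<^sub>R t k"
      using int_e[OF hs] int_e[OF hi] by simp
    finally show ?thesis unfolding shift I_def[symmetric] by (simp add: algebra_simps)
  qed
  have "((\<lambda>s::real. (exp (s *\<^sub>R (- \<i> * complex_of_real (x \<bullet> b))) - 1) /\<^sub>R s) \<longlongrightarrow> - \<i> * complex_of_real (x \<bullet> b)) (at 0)"
    using has_vector_derivative_quotient[OF exp_scaleR_has_vector_derivative_right[of "- \<i> * complex_of_real (x \<bullet> b)" 0]]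
    by simp
  from filterlim_compose[OF this tlim']
  have "(\<lambda>k. LINT \<xi>|lborel. q k \<xi> * e \<xi>) \<longlonglongrightarrow> - \<i> * complex_of_real (x \<bullet> b) * I"
    unfolding eq by (intro tendsto_intros)
  from LIMSEQ_unique[OF lim1 this]
  show ?thesis unfolding inverse_fourier_def I_def e_def by (simp add: mult_ac)
qed

text \<open>The exponential differs from its first-order Taylor polynomial by at most half the
  square of its phase. Integrated against \<open>h\<close>, this gives a remainder quadratic in
  \<open>y - x\<close>, provided \<open>h\<close> has two powers of decay beyond integrability;
  hence \<open>2 * DIM('a) + 2\<close>.\<close>

lemma inverse_fourier_has_derivative:
  fixes h :: "'a::euclidean_space \<Rightarrow> complex"
  assumes h: "deriv_bound 0 (2 * DIM('a) + 2) B h"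
  shows "(inverse_fourier h has_derivative
    (\<lambda>v. \<Sum>b\<in>Basis. (v \<bullet> b) *\<^sub>R inverse_fourier (\<lambda>\<xi>. \<i> * (complex_of_real (\<xi> \<bullet> b) * h \<xi>)) x)) (at x)"
    (is "(_ has_derivative ?L) _")
proof -
  define c where "c = (2 * pi) powr (- real DIM('a) / 2)"
  have c0: "c \<ge> 0" by (simp add: c_def)
  define e where "e x \<xi> = exp (\<i> * complex_of_real (x \<bullet> \<xi>))" for x \<xi> :: 'a
  have em[measurable]: "e x \<in> borel_measurable borel" for x unfolding e_def by measurable
  have hm[measurable]: "h \<in> borel_measurable borel" by (rule deriv_bound_measurable[OF h])
  have hi: "integrable lborel h"
    using deriv_bound_integrable[OF deriv_bound_mono[OF h order_refl _ order_refl]] by simp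
  have h2: "(1 + norm \<xi>) ^ (2 * DIM('a)) * ((1 + norm \<xi>)\<^sup>2 * norm (h \<xi>)) \<le> B" for \<xi>
    using deriv_bound_norm[OF h, of \<xi>] by (simp add: power_add power2_eq_square mult_ac)
  have hb: "integrable lborel (\<lambda>\<xi>. \<i> * (complex_of_real (\<xi> \<bullet> b) * h \<xi>))" if "b \<in> Basis" for b
  proof (rule weight_integrable)
    fix \<xi>
    have "\<bar>\<xi> \<bullet> b\<bar> \<le> (1 + norm \<xi>)\<^sup>2"
      using Basis_le_norm[OF that, of \<xi>] self_le_power[of "1 + norm \<xi>" 2] by simp
    then have "\<bar>\<xi> \<bullet> b\<bar> * norm (h \<xi>) \<le> (1 + norm \<xi>)\<^sup>2 * norm (h \<xi>)" by (rule mult_right_mono) simp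
    then have "(1 + norm \<xi>) ^ (2 * DIM('a)) * (\<bar>\<xi> \<bullet> b\<bar> * norm (h \<xi>)) \<le>
        (1 + norm \<xi>) ^ (2 * DIM('a)) * ((1 + norm \<xi>)\<^sup>2 * norm (h \<xi>))"
      by (rule mult_left_mono) simp
    then show "(1 + norm \<xi>) ^ (2 * DIM('a)) * norm (\<i> * (complex_of_real (\<xi> \<bullet> b) * h \<xi>)) \<le> B"
      using h2[of \<xi>] by (simp add: norm_mult)
  qed measurable
  have i2: "integrable lborel (\<lambda>\<xi>. complex_of_real ((norm \<xi>)\<^sup>2) * h \<xi>)"
  proof (rule weight_integrable)
    fix \<xi> :: 'a
    have "(norm \<xi>)\<^sup>2 * norm (h \<xi>) \<le> (1 + norm \<xi>)\<^sup>2 * norm (h \<xi>)" by (intro mult_right_mono power_mono) auto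
    then have "(1 + norm \<xi>) ^ (2 * DIM('a)) * ((norm \<xi>)\<^sup>2 * norm (h \<xi>)) \<le>
        (1 + norm \<xi>) ^ (2 * DIM('a)) * ((1 + norm \<xi>)\<^sup>2 * norm (h \<xi>))"
      by (rule mult_left_mono) simp
    then show "(1 + norm \<xi>) ^ (2 * DIM('a)) * norm (complex_of_real ((norm \<xi>)\<^sup>2) * h \<xi>) \<le> B"
      using h2[of \<xi>] by (simp add: norm_mult norm_power)
  qed measurable
  define K where "K = (LINT \<xi>|lborel. norm (complex_of_real ((norm \<xi>)\<^sup>2) * h \<xi>))"
  have eqv: "\<i> * complex_of_real (v \<bullet> \<xi>) * h \<xi> * e x \<xi> =
      (\<Sum>b\<in>Basis. (v \<bullet> b) *\<^sub>R (\<i> * (complex_of_real (\<xi> \<bullet> b) * h \<xi>) * e x \<xi>))" for v \<xi>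
    by (subst euclidean_inner) (simp add: sum_distrib_left sum_distrib_right scaleR_conv_of_real mult_ac)
  have L: "?L v = c * (LINT \<xi>|lborel. \<i> * complex_of_real (v \<bullet> \<xi>) * h \<xi> * e x \<xi>)" for v
  proof -
    have "(LINT \<xi>|lborel. \<i> * complex_of_real (v \<bullet> \<xi>) * h \<xi> * e x \<xi>) =
      (LINT \<xi>|lborel. (\<Sum>b\<in>Basis. (v \<bullet> b) *\<^sub>R (\<i> * (complex_of_real (\<xi> \<bullet> b) * h \<xi>) * e x \<xi>)))"
      by (simp only: eqv)
    also have "\<dots> = (\<Sum>b\<in>Basis. (v \<bullet> b) *\<^sub>R (LINT \<xi>|lborel. \<i> * (complex_of_real (\<xi> \<bullet> b) * h \<xi>) * e x \<xi>))"
      using integrable_fourier_kernel[OF hb, of _ x]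
      by (subst Bochner_Integration.integral_sum) (auto simp: e_def)
    finally show ?thesis
      unfolding inverse_fourier_def e_def c_def by (simp add: sum_distrib_left)
  qed
  have iL: "integrable lborel (\<lambda>\<xi>. \<i> * complex_of_real (v \<bullet> \<xi>) * h \<xi> * e x \<xi>)" for v
  proof -
    have "integrable lborel (\<lambda>\<xi>. (\<Sum>b\<in>Basis. (v \<bullet> b) *\<^sub>R (\<i> * (complex_of_real (\<xi> \<bullet> b) * h \<xi>) * e x \<xi>)))"
      using integrable_fourier_kernel[OF hb, of _ x] by (auto simp: e_def)
    then show ?thesis by (simp only: eqv)
  qed
  have quad: "norm (inverse_fourier h y - inverse_fourier h x - ?L (y - x)) \<le> c * K * (norm (y - x))\<^sup>2" for y
  proof -
    let ?v = "y - x"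
    have ie: "integrable lborel (\<lambda>\<xi>. h \<xi> * e z \<xi>)" for z
      using integrable_fourier_kernel[OF hi, of z] by (simp add: e_def)
    have "inverse_fourier h y - inverse_fourier h x - ?L ?v =
      c * ((LINT \<xi>|lborel. h \<xi> * e y \<xi>) - (LINT \<xi>|lborel. h \<xi> * e x \<xi>)
        - (LINT \<xi>|lborel. \<i> * complex_of_real (?v \<bullet> \<xi>) * h \<xi> * e x \<xi>))"
      unfolding L by (simp add: inverse_fourier_def e_def c_def algebra_simps)
    also have "\<dots> = c * (LINT \<xi>|lborel. h \<xi> * e y \<xi> - h \<xi> * e x \<xi> - \<i> * complex_of_real (?v \<bullet> \<xi>) * h \<xi> * e x \<xi>)"
      using ie iL by simp
    finally have 1: "norm (inverse_fourier h y - inverse_fourier h x - ?L ?v) =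
      c * norm (LINT \<xi>|lborel. h \<xi> * e y \<xi> - h \<xi> * e x \<xi> - \<i> * complex_of_real (?v \<bullet> \<xi>) * h \<xi> * e x \<xi>)"
      using c0 by (simp add: norm_mult)
    have "norm (LINT \<xi>|lborel. h \<xi> * e y \<xi> - h \<xi> * e x \<xi> - \<i> * complex_of_real (?v \<bullet> \<xi>) * h \<xi> * e x \<xi>)
      \<le> (LINT \<xi>|lborel. norm (h \<xi> * e y \<xi> - h \<xi> * e x \<xi> - \<i> * complex_of_real (?v \<bullet> \<xi>) * h \<xi> * e x \<xi>))"
      by (rule integral_norm_bound)
    also have "\<dots> \<le> (LINT \<xi>|lborel. (norm ?v)\<^sup>2 * norm (complex_of_real ((norm \<xi>)\<^sup>2) * h \<xi>))"
    proof (rule integral_mono)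
      fix \<xi>
      have "e y \<xi> = e x \<xi> * exp (\<i> * complex_of_real (?v \<bullet> \<xi>))"
        by (simp add: e_def inner_diff_left algebra_simps flip: exp_add)
      then have "h \<xi> * e y \<xi> - h \<xi> * e x \<xi> - \<i> * complex_of_real (?v \<bullet> \<xi>) * h \<xi> * e x \<xi> =
        h \<xi> * e x \<xi> * (exp (\<i> * complex_of_real (?v \<bullet> \<xi>)) - (1 + \<i> * complex_of_real (?v \<bullet> \<xi>)))"
        by (simp add: algebra_simps)
      then have "norm (h \<xi> * e y \<xi> - h \<xi> * e x \<xi> - \<i> * complex_of_real (?v \<bullet> \<xi>) * h \<xi> * e x \<xi>) =
        norm (h \<xi>) * norm (exp (\<i> * complex_of_real (?v \<bullet> \<xi>)) - (1 + \<i> * complex_of_real (?v \<bullet> \<xi>)))"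
        by (simp add: norm_mult e_def)
      also have "\<dots> \<le> norm (h \<xi>) * ((norm ?v)\<^sup>2 * (norm \<xi>)\<^sup>2)"
      proof (intro mult_left_mono)
        have "norm (exp (\<i> * complex_of_real (?v \<bullet> \<xi>)) - (1 + \<i> * complex_of_real (?v \<bullet> \<xi>))) \<le> \<bar>?v \<bullet> \<xi>\<bar>\<^sup>2 / 2"
          using iexp_approx1[of "?v \<bullet> \<xi>" 1] by (simp add: numeral_2_eq_2)
        also have "\<dots> \<le> (norm ?v * norm \<xi>)\<^sup>2"
          using power_mono[OF Cauchy_Schwarz_ineq2[of ?v \<xi>], of 2] zero_le_power2[of "norm ?v * norm \<xi>"]
          by linarith
        finally show "norm (exp (\<i> * complex_of_real (?v \<bullet> \<xi>)) - (1 + \<i> * complex_of_real (?v \<bullet> \<xi>))) \<le> (norm ?v)\<^sup>2 * (norm \<xi>)\<^sup>2"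
          by (simp add: power_mult_distrib)
      qed auto
      finally show "norm (h \<xi> * e y \<xi> - h \<xi> * e x \<xi> - \<i> * complex_of_real (?v \<bullet> \<xi>) * h \<xi> * e x \<xi>) \<le>
        (norm ?v)\<^sup>2 * norm (complex_of_real ((norm \<xi>)\<^sup>2) * h \<xi>)"
        by (simp add: norm_mult norm_power mult_ac)
    qed (use ie iL i2 in auto)
    also have "\<dots> = (norm ?v)\<^sup>2 * K" by (simp add: K_def)
    finally show ?thesis unfolding 1 using mult_left_mono[OF _ c0] by (simp only: mult.assoc mult.commute[of K])
  qed
  have bl: "bounded_linear ?L"
    by (intro bounded_linear_intros)
  show ?thesis
    unfolding has_derivative_iff_norm
  proof (intro conjI bl)
    have "((\<lambda>y. c * K * norm (y - x)) \<longlongrightarrow> c * K * norm (x - x)) (at x)" by (intro tendsto_intros)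
    then have z: "((\<lambda>y. c * K * norm (y - x)) \<longlongrightarrow> 0) (at x)" by simp
    show "((\<lambda>y. norm (inverse_fourier h y - inverse_fourier h x - ?L (y - x)) / norm (y - x)) \<longlongrightarrow> 0) (at x)"
    proof (rule Lim_null_comparison[OF _ z], rule always_eventually, rule allI)
      fix y
      show "norm (norm (inverse_fourier h y - inverse_fourier h x - ?L (y - x)) / norm (y - x)) \<le> c * K * norm (y - x)"
        using quad[of y] by (cases "y = x") (simp_all add: field_simps power2_eq_square)
    qed
  qed
qed

lemma partial_inverse_fourier:
  fixes h :: "'a::euclidean_space \<Rightarrow> complex"
  assumes h: "deriv_bound 0 (2 * DIM('a) + 2) B h" and b: "b \<in> Basis"
  shows "partial b (inverse_fourier h) x = inverse_fourier (\<lambda>\<xi>. \<i> * (complex_of_real (\<xi> \<bullet> b) * h \<xi>)) x"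
  unfolding partial_eqI[OF inverse_fourier_has_derivative[OF h]]
  using b by (simp add: inner_Basis if_distrib[of "\<lambda>c. c *\<^sub>R _"] cong: if_cong)

text \<open>Each power of the weight is traded for a derivative of \<open>h\<close>, since a
  coordinate times the transform is the transform of a partial derivative. The constant is
  independent of \<open>h\<close>; all pointwise bounds for packets come from this
  statement.\<close>

lemma inverse_fourier_decay:
  "\<exists>C\<ge>0. \<forall>(h::'a::euclidean_space \<Rightarrow> complex) B x. deriv_bound N (2 * DIM('a)) B h \<longrightarrow>
     (1 + norm x) ^ N * norm (inverse_fourier h x) \<le> C * B"
proof (induction N)
  case 0
  then show ?case using inverse_fourier_bound[where 'a = 'a] by simp
next
  case (Suc N)
  then obtain C where C0: "C \<ge> 0" and C: "\<And>(h::'a \<Rightarrow> complex) B x. deriv_bound N (2 * DIM('a)) B h \<Longrightarrow>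
     (1 + norm x) ^ N * norm (inverse_fourier h x) \<le> C * B" by blast
  show ?case
  proof (intro exI[of _ "(1 + real DIM('a)) * C"] conjI allI impI)
    show "0 \<le> (1 + real DIM('a)) * C" using C0 by simp
    fix h :: "'a \<Rightarrow> complex" and B x
    assume h: "deriv_bound (Suc N) (2 * DIM('a)) B h"
    have h1: "deriv_bound 1 (2 * DIM('a)) B h" by (rule deriv_bound_mono[OF h]) auto
    have "(1 + norm x) * norm (inverse_fourier h x) \<le> (1 + (\<Sum>b\<in>Basis. \<bar>x \<bullet> b\<bar>)) * norm (inverse_fourier h x)"
      by (intro mult_right_mono add_left_mono norm_le_l1) auto
    also have "\<dots> = norm (inverse_fourier h x) + (\<Sum>b\<in>Basis. norm (inverse_fourier (partial b h) x))"
      by (simp add: inverse_fourier_partial[OF h1] norm_mult sum_distrib_right distrib_right)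
    finally have "(1 + norm x) ^ N * ((1 + norm x) * norm (inverse_fourier h x)) \<le>
        (1 + norm x) ^ N * (norm (inverse_fourier h x) + (\<Sum>b\<in>Basis. norm (inverse_fourier (partial b h) x)))"
      by (rule mult_left_mono) simp
    also have "\<dots> = (1 + norm x) ^ N * norm (inverse_fourier h x) +
        (\<Sum>b\<in>Basis. (1 + norm x) ^ N * norm (inverse_fourier (partial b h) x))"
      by (simp add: distrib_left sum_distrib_left)
    also have "\<dots> \<le> C * B + (\<Sum>b\<in>(Basis::'a set). C * B)"
      using C[OF deriv_bound_Suc_D[OF h]] C[OF deriv_bound_partial[OF h]]
      by (intro add_mono sum_mono) auto
    finally show "(1 + norm x) ^ Suc N * norm (inverse_fourier h x) \<le> (1 + real DIM('a)) * C * B"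
      by (simp add: algebra_simps)
  qed
qed

lemma schwartz_inverse_fourier:
  fixes f :: "'a::euclidean_space \<Rightarrow> complex"
  assumes "f \<in> schwartz"
  shows "inverse_fourier f \<in> schwartz"
proof (rule schwartzI)
  fix L N
  show "\<exists>B. deriv_bound L N B (inverse_fourier f)" using assms
  proof (induction L arbitrary: f)
    have base: "\<exists>B. \<forall>x. inverse_fourier f differentiable (at x) \<and> (1 + norm x) ^ N * norm (inverse_fourier f x) \<le> B"
      if f: "f \<in> schwartz" for f :: "'a \<Rightarrow> complex"
    proof -
      obtain B where B: "deriv_bound 0 (2 * DIM('a) + 2) B f" using deriv_bound_schwartz[OF f] by blast
      obtain B' where B': "deriv_bound N (2 * DIM('a)) B' f" using deriv_bound_schwartz[OF f] by blast
      show ?thesis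
        using inverse_fourier_has_derivative[OF B] inverse_fourier_decay[of N, where 'a = 'a] B'
        unfolding differentiable_def by blast
    qed
    {
      case 0
      from base[OF 0] show ?case by simp
    next
      case (Suc L)
      obtain B0 where B0: "\<And>x. inverse_fourier f differentiable (at x) \<and> (1 + norm x) ^ N * norm (inverse_fourier f x) \<le> B0"
        using base[OF Suc.prems] by blast
      obtain B where B: "deriv_bound 0 (2 * DIM('a) + 2) B f" using deriv_bound_schwartz[OF Suc.prems] by blast
      have "\<exists>B. deriv_bound L N B (partial b (inverse_fourier f))" if b: "b \<in> Basis" for b
      proof -
        have "partial b (inverse_fourier f) = inverse_fourier (\<lambda>\<xi>. \<i> * (complex_of_real (\<xi> \<bullet> b) * f \<xi>))"
          using partial_inverse_fourier[OF B b] by auto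
        moreover have "(\<lambda>\<xi>. \<i> * (complex_of_real (\<xi> \<bullet> b) * f \<xi>)) \<in> schwartz"
          by (intro schwartz_cmult schwartz_coord_mult b Suc.prems)
        ultimately show ?thesis using Suc.IH by simp
      qed
      then obtain B1 where B1: "\<And>b. b \<in> Basis \<Longrightarrow> deriv_bound L N (B1 b) (partial b (inverse_fourier f))" by metis
      define M where "M = max B0 (Max (B1 ` Basis))"
      have "deriv_bound L N M (partial b (inverse_fourier f))" if "b \<in> Basis" for b
      proof (rule deriv_bound_mono[OF B1[OF that] order_refl order_refl])
        have "B1 b \<le> Max (B1 ` Basis)" using that by (intro Max_ge) auto
        then show "B1 b \<le> M" by (simp add: M_def)
      qed
      moreover have "(1 + norm x) ^ N * norm (inverse_fourier f x) \<le> M" for x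
        using B0[of x] unfolding M_def by linarith
      ultimately have "deriv_bound (Suc L) N M (inverse_fourier f)" using B0 by simp
      then show ?case ..
    }
  qed
qed

lemma deriv_bound_uminus: "deriv_bound L N B f \<Longrightarrow> deriv_bound L N B (\<lambda>x. f (- x))"
proof (induction L arbitrary: f)
  have d: "((\<lambda>x. f (- x)) has_derivative (\<lambda>v. frechet_derivative f (at (- x)) (- v))) (at x)"
    if "\<And>x. f differentiable (at x)" for f :: "'a \<Rightarrow> complex" and x
    by (rule has_derivative_compose[OF _ has_derivative_frechet[OF that]]) (auto intro!: derivative_eq_intros)
  have norm: "(1 + norm x) ^ N * norm (f (- x)) \<le> B" if "deriv_bound L N B f" for f :: "'a \<Rightarrow> complex" and x L
    using deriv_bound_norm[OF that, of "- x"] by simp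
  {
    case 0
    have "(\<lambda>x. f (- x)) differentiable (at x)" for x
      using d[of f] 0 unfolding differentiable_def[of "\<lambda>x. f (- x)"] by auto
    then show ?case using norm[OF 0] by simp
  next
    case (Suc L)
    have diff: "\<And>x. f differentiable (at x)" using Suc.prems by auto
    have "(\<lambda>x. f (- x)) differentiable (at x)" for x
      using d[OF diff] unfolding differentiable_def by blast
    moreover have "partial b (\<lambda>x. f (- x)) = (\<lambda>x. - 1 * partial b f (- x))" for b
      using partial_eqI[OF d[OF diff], of b] linear_neg[OF linear_frechet_derivative[OF diff]]
      by (auto simp: partial_def)
    moreover have "deriv_bound L N B (\<lambda>x. - 1 * partial b f (- x))" if "b \<in> Basis" for b
      using deriv_bound_cmult[OF Suc.IH[OF deriv_bound_partial[OF Suc.prems that]], of "- 1"] by simp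
    ultimately show ?case using norm[OF Suc.prems] by simp
  }
qed

lemma schwartz_uminus:
  assumes "f \<in> schwartz"
  shows "(\<lambda>x. f (- x)) \<in> schwartz"
proof (rule schwartzI)
  fix L N
  obtain B where "deriv_bound L N B f" using deriv_bound_schwartz[OF assms] by blast
  from deriv_bound_uminus[OF this] show "\<exists>B. deriv_bound L N B (\<lambda>x. f (- x))" ..
qed

lemma fourier_eq: "fourier f = (\<lambda>\<xi>. inverse_fourier f (- \<xi>))"
  by (auto simp: fourier_def inverse_fourier_def)

lemma schwartz_fourier: "f \<in> schwartz \<Longrightarrow> fourier f \<in> schwartz"
  unfolding fourier_eq by (intro schwartz_uminus schwartz_inverse_fourier)

subsection \<open>Fourier inversion\<close>

text \<open>This is the characteristic function of the standard normal law, freed from its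
  normalising factor.\<close>

lemma gaussian_1d:
  "integrable lborel (\<lambda>x. complex_of_real (exp (- x\<^sup>2 / 2)) * exp (\<i> * complex_of_real (t * x)))" (is ?i)
  "(LINT x|lborel. complex_of_real (exp (- x\<^sup>2 / 2)) * exp (\<i> * complex_of_real (t * x))) =
    complex_of_real (sqrt (2 * pi) * exp (- t\<^sup>2 / 2))" (is ?e)
proof -
  have i: "integrable lborel (\<lambda>x. std_normal_density x)"
    by simp
  have eq: "std_normal_density x = exp (- x\<^sup>2 / 2) / sqrt (2 * pi)" for x
    by (simp add: std_normal_density_def)
  have "integrable lborel (\<lambda>x. sqrt (2 * pi) * std_normal_density x)" using i by simp
  then have "integrable lborel (\<lambda>x::real. exp (- x\<^sup>2 / 2))" by (simp add: eq)
  then have i2: "integrable lborel (\<lambda>x::real. complex_of_real (exp (- x\<^sup>2 / 2)))" by simp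
  show ?i by (rule integrable_mult_bounded[OF i2, where C = 1]) auto
  have "complex_of_real (exp (- (t\<^sup>2) / 2)) = char std_normal_distribution t"
    by (simp add: char_std_normal_distribution)
  also have "\<dots> = (LINT x|lborel. std_normal_density x *\<^sub>R exp (\<i> * complex_of_real (t * x)))"
    unfolding char_def by (subst integral_density) (auto simp: normal_density_nonneg)
  also have "\<dots> = (LINT x|lborel. complex_of_real (1 / sqrt (2 * pi)) * (complex_of_real (exp (- x\<^sup>2 / 2)) * exp (\<i> * complex_of_real (t * x))))"
    by (rule Bochner_Integration.integral_cong) (auto simp: eq scaleR_conv_of_real)
  also have "\<dots> = complex_of_real (1 / sqrt (2 * pi)) * (LINT x|lborel. complex_of_real (exp (- x\<^sup>2 / 2)) * exp (\<i> * complex_of_real (t * x)))"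
    by simp
  finally show ?e by (simp add: field_simps)
qed

lemma lborel_integral_prod:
  fixes f :: "'a::euclidean_space \<Rightarrow> real \<Rightarrow> complex"
  assumes "\<And>b. b \<in> Basis \<Longrightarrow> integrable lborel (f b)"
  shows "integrable lborel (\<lambda>x::'a. \<Prod>b\<in>Basis. f b (x \<bullet> b))" (is ?i)
    and "(LINT x::'a|lborel. (\<Prod>b\<in>Basis. f b (x \<bullet> b))) = (\<Prod>b\<in>Basis. (LINT x|lborel. f b x))" (is ?e)
proof -
  interpret product_sigma_finite "\<lambda>_::'a. lborel :: real measure" ..
  have [measurable]: "f b \<in> borel_measurable borel" if "b \<in> Basis" for b
    using assms[OF that] by auto
  have m: "(\<lambda>x::'a. \<Prod>b\<in>Basis. f b (x \<bullet> b)) \<in> borel_measurable borel"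
    by measurable
  have T: "(\<lambda>z. \<Sum>b\<in>Basis. z b *\<^sub>R b) \<in> (\<Pi>\<^sub>M b\<in>(Basis::'a set). lborel) \<rightarrow>\<^sub>M borel"
    by measurable
  have eq: "(\<Prod>b\<in>Basis. f b ((\<Sum>b\<in>Basis. z b *\<^sub>R b) \<bullet> b)) = (\<Prod>b\<in>Basis. f b (z b))" for z :: "'a \<Rightarrow> real"
    by (intro prod.cong) (auto simp: inner_sum_left inner_Basis if_distrib cong: if_cong)
  show ?i
    unfolding lborel_eq[where 'a = 'a] integrable_distr_eq[OF T m] eq
    by (rule product_integrable_prod) (use assms in auto)
  show ?e
    unfolding lborel_eq[where 'a = 'a] integral_distr[OF T m] eq
    by (rule product_integral_prod) (use assms in auto)
qed

lemma norm_sq_eq_sum: "(norm (z::'a::euclidean_space))\<^sup>2 = (\<Sum>b\<in>Basis. (z \<bullet> b)\<^sup>2)"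
  unfolding power2_norm_eq_inner by (subst euclidean_inner) (simp add: power2_eq_square)

lemma gaussian_eq_prod:
  "complex_of_real (exp (- (norm (z::'a::euclidean_space))\<^sup>2 / 2)) * exp (\<i> * complex_of_real (v \<bullet> z)) =
    (\<Prod>b\<in>Basis. complex_of_real (exp (- (z \<bullet> b)\<^sup>2 / 2)) * exp (\<i> * complex_of_real ((v \<bullet> b) * (z \<bullet> b))))"
proof -
  have "- (norm z)\<^sup>2 / 2 = (\<Sum>b\<in>Basis. - (z \<bullet> b)\<^sup>2 / 2)"
    by (simp add: norm_sq_eq_sum sum_negf sum_divide_distrib)
  then have 1: "complex_of_real (exp (- (norm z)\<^sup>2 / 2)) = (\<Prod>b\<in>Basis. complex_of_real (exp (- (z \<bullet> b)\<^sup>2 / 2)))"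
    by (simp only: exp_sum[OF finite_Basis] of_real_prod)
  have "exp (\<i> * complex_of_real (v \<bullet> z)) = exp (\<Sum>b\<in>Basis. \<i> * complex_of_real ((v \<bullet> b) * (z \<bullet> b)))"
    by (subst euclidean_inner) (simp add: sum_distrib_left)
  then have 2: "exp (\<i> * complex_of_real (v \<bullet> z)) = (\<Prod>b\<in>Basis. exp (\<i> * complex_of_real ((v \<bullet> b) * (z \<bullet> b))))"
    by (simp only: exp_sum[OF finite_Basis])
  show ?thesis unfolding 1 2 prod.distrib ..
qed

lemma gaussian_fourier:
  fixes v :: "'a::euclidean_space"
  shows "(LINT z|lborel. complex_of_real (exp (- (norm z)\<^sup>2 / 2)) * exp (\<i> * complex_of_real (v \<bullet> z))) =
    complex_of_real ((2 * pi) powr (real DIM('a) / 2) * exp (- (norm v)\<^sup>2 / 2))"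
proof -
  have "(LINT z|lborel. complex_of_real (exp (- (norm z)\<^sup>2 / 2)) * exp (\<i> * complex_of_real (v \<bullet> z))) =
    (\<Prod>b\<in>Basis. complex_of_real (sqrt (2 * pi) * exp (- (v \<bullet> b)\<^sup>2 / 2)))"
    unfolding gaussian_eq_prod by (subst lborel_integral_prod(2)) (simp_all only: gaussian_1d)
  also have "\<dots> = complex_of_real ((\<Prod>b\<in>(Basis::'a set). sqrt (2 * pi)) * (\<Prod>b\<in>Basis. exp (- (v \<bullet> b)\<^sup>2 / 2)))"
    by (simp add: prod.distrib)
  also have "(\<Prod>b\<in>(Basis::'a set). sqrt (2 * pi)) = (2 * pi) powr (real DIM('a) / 2)"
    by (simp add: powr_half_sqrt[symmetric] powr_powr flip: powr_realpow)
  also have "(\<Prod>b\<in>Basis. exp (- (v \<bullet> b)\<^sup>2 / 2)) = exp (- (norm v)\<^sup>2 / 2)"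
    by (simp add: norm_sq_eq_sum sum_negf sum_divide_distrib flip: exp_sum)
  finally show ?thesis .
qed

lemma gaussian_integrable: "integrable lborel (\<lambda>z::'a::euclidean_space. complex_of_real (exp (- (norm z)\<^sup>2 / 2)))"
proof -
  have "integrable lborel (\<lambda>z::'a. complex_of_real (exp (- (norm z)\<^sup>2 / 2)) * exp (\<i> * complex_of_real (0 \<bullet> z)))"
    unfolding gaussian_eq_prod by (intro lborel_integral_prod gaussian_1d)
  then show ?thesis by simp
qed

lemma gaussian_fourier_scaled:
  fixes v :: "'a::euclidean_space"
  assumes t: "t > 0"
  shows "t ^ DIM('a) *\<^sub>R (LINT z|lborel. complex_of_real (exp (- (norm (t *\<^sub>R z))\<^sup>2 / 2)) * exp (\<i> * complex_of_real (v \<bullet> z))) =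
    complex_of_real ((2 * pi) powr (real DIM('a) / 2) * exp (- (norm (v /\<^sub>R t))\<^sup>2 / 2))"
proof -
  have k: "(v /\<^sub>R t) \<bullet> (0 + t *\<^sub>R z) = v \<bullet> z" for z using t by simp
  have "(LINT z|lborel. complex_of_real (exp (- (norm z)\<^sup>2 / 2)) * exp (\<i> * complex_of_real ((v /\<^sub>R t) \<bullet> z))) =
    \<bar>t\<bar> ^ DIM('a) *\<^sub>R (LINT z|lborel. complex_of_real (exp (- (norm (0 + t *\<^sub>R z))\<^sup>2 / 2)) *
       exp (\<i> * complex_of_real ((v /\<^sub>R t) \<bullet> (0 + t *\<^sub>R z))))"
    using t by (intro lborel_integral_affine) auto
  from this[unfolded k] show ?thesis
    using t gaussian_fourier[of "v /\<^sub>R t"] by simp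
qed

text \<open>Gaussian regularisation: the factor \<open>g (t k *\<^sub>R \<xi>)\<close> is inserted
  into the inverse transform and removed in the limit. For each \<open>k\<close> the regularised
  integral is, up to a constant, the average of \<open>h\<close> against a Gaussian of width
  \<open>t k\<close> around \<open>x\<close>, which tends to \<open>h x\<close> by
  continuity.\<close>

theorem inverse_fourier_fourier:
  fixes h :: "'a::euclidean_space \<Rightarrow> complex"
  assumes h: "h \<in> schwartz"
  shows "inverse_fourier (fourier h) = h"
proof
  fix x
  define c where "c = (2 * pi) powr (- real DIM('a) / 2)"
  define g where "g z = complex_of_real (exp (- (norm (z::'a))\<^sup>2 / 2))" for z
  define t where "t k = inverse (real (Suc k))" for k
  have t0: "t k > 0" for k by (simp add: t_def)
  have tlim: "t \<longlonglongrightarrow> 0" unfolding t_def by (rule LIMSEQ_inverse_real_of_nat)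
  have gm[measurable]: "g \<in> borel_measurable borel" unfolding g_def by measurable
  have g1: "norm (g z) \<le> 1" for z by (simp add: g_def)
  have hm[measurable]: "h \<in> borel_measurable borel" using h by measurable
  have hi: "integrable lborel h" by (rule schwartz_integrable[OF h])
  have hc: "isCont h y" for y by (rule differentiable_imp_continuous_within[OF schwartz_differentiable[OF h]])
  obtain B where "deriv_bound 0 0 B h" using deriv_bound_schwartz[OF h] by blast
  then have B: "norm (h y) \<le> B" for y by (rule deriv_bound_norm0)
  have fi: "integrable lborel (fourier h)" by (rule schwartz_integrable[OF schwartz_fourier[OF h]])
  define e where "e y \<xi> = exp (\<i> * complex_of_real (y \<bullet> \<xi>))" for y \<xi> :: 'a
  have e1: "norm (e y \<xi>) = 1" for y \<xi> by (simp add: e_def)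
  have em[measurable]: "e y \<in> borel_measurable borel" for y unfolding e_def by measurable
  have gi: "integrable lborel (\<lambda>\<xi>. g (t k *\<^sub>R \<xi>))" for k
  proof -
    have "integrable (distr lborel borel (\<lambda>\<xi>. t k *\<^sub>R \<xi>)) g"
    proof -
      have "integrable (density (distr lborel borel (\<lambda>\<xi>::'a. 0 + t k *\<^sub>R \<xi>)) (\<lambda>_. ennreal (\<bar>t k\<bar> ^ DIM('a)))) g"
        using lborel_affine[of "t k" "0::'a"] t0[of k] gaussian_integrable[where 'a = 'a] by (simp add: g_def[abs_def])
      then have "integrable (distr lborel borel (\<lambda>\<xi>. 0 + t k *\<^sub>R \<xi>)) (\<lambda>z. \<bar>t k\<bar> ^ DIM('a) *\<^sub>R g z)"
        by (subst (asm) integrable_density) auto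
      then have "integrable (distr lborel borel ((*\<^sub>R) (t k))) (\<lambda>z. inverse (\<bar>t k\<bar> ^ DIM('a)) *\<^sub>R (\<bar>t k\<bar> ^ DIM('a) *\<^sub>R g z))"
        unfolding add_0 by (rule integrable_scaleR_right)
      then show ?thesis using t0[of k] less_imp_neq[OF t0[of k]] by simp
    qed
    then show ?thesis by (subst (asm) integrable_distr_eq) auto
  qed
  have 1: "(\<lambda>k. LINT \<xi>|lborel. fourier h \<xi> * g (t k *\<^sub>R \<xi>) * e x \<xi>) \<longlonglongrightarrow> (LINT \<xi>|lborel. fourier h \<xi> * g 0 * e x \<xi>)"
  proof (rule integral_dominated_convergence)
    show "integrable lborel (\<lambda>\<xi>. norm (fourier h \<xi>))" using fi by simp
    have [measurable]: "fourier h \<in> borel_measurable borel" using fi by auto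
    show "(\<lambda>\<xi>. fourier h \<xi> * g 0 * e x \<xi>) \<in> borel_measurable lborel" by measurable
    show "(\<lambda>\<xi>. fourier h \<xi> * g (t k *\<^sub>R \<xi>) * e x \<xi>) \<in> borel_measurable lborel" for k by measurable
    have "(\<lambda>k. g (t k *\<^sub>R \<xi>)) \<longlonglongrightarrow> g (0 *\<^sub>R \<xi>)" for \<xi>
      unfolding g_def by (intro tendsto_intros tlim) auto
    then show "AE \<xi> in lborel. (\<lambda>k. fourier h \<xi> * g (t k *\<^sub>R \<xi>) * e x \<xi>) \<longlonglongrightarrow> fourier h \<xi> * g 0 * e x \<xi>"
      by (auto intro!: tendsto_intros)
    show "AE \<xi> in lborel. norm (fourier h \<xi> * g (t k *\<^sub>R \<xi>) * e x \<xi>) \<le> norm (fourier h \<xi>)" for k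
      using mult_left_mono[OF g1] by (auto simp: norm_mult e1)
  qed
  \<comment> \<open>The exchange of integrals leaves the transform of a dilated Gaussian as kernel;
    the substitution \<open>y = x + t k *\<^sub>R z\<close> then cancels the dilation, so that
    \<open>k\<close> survives only in the argument of \<open>h\<close>.\<close>
  have eq: "(LINT \<xi>|lborel. fourier h \<xi> * g (t k *\<^sub>R \<xi>) * e x \<xi>) = (LINT z|lborel. h (x + t k *\<^sub>R z) * g z)" for k
  proof -
    have gei: "integrable lborel (\<lambda>\<xi>. g (t k *\<^sub>R \<xi>) * e x \<xi>)"
      by (rule integrable_mult_bounded[OF gi, where C = 1]) (auto simp: e1)
    have "(LINT \<xi>|lborel. fourier h \<xi> * g (t k *\<^sub>R \<xi>) * e x \<xi>) =
      c * (LINT \<xi>|lborel. (g (t k *\<^sub>R \<xi>) * e x \<xi>) * (LINT y|lborel. h y * e (- \<xi>) y))"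
    proof -
      have F: "fourier h \<xi> = complex_of_real c * (LINT y|lborel. h y * e (- \<xi>) y)" for \<xi>
        by (simp add: fourier_def c_def e_def)
      show ?thesis
        unfolding F by (subst integral_mult_right_zero[symmetric]) (simp only: mult_ac)
    qed
    also have "(LINT \<xi>|lborel. (g (t k *\<^sub>R \<xi>) * e x \<xi>) * (LINT y|lborel. h y * e (- \<xi>) y)) =
       (LINT y|lborel. h y * (LINT \<xi>|lborel. (g (t k *\<^sub>R \<xi>) * e x \<xi>) * e (- \<xi>) y))"
      by (rule fubini_bounded_kernel[OF gei hi]) (auto simp: e_def)
    also have "\<dots> = (LINT y|lborel. h y * (LINT \<xi>|lborel. g (t k *\<^sub>R \<xi>) * e (x - y) \<xi>))"
    proof -
      have "e x \<xi> * e (- \<xi>) y = e (x - y) \<xi>" for \<xi> y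
        by (simp add: e_def inner_diff_left inner_commute algebra_simps flip: exp_add)
      then show ?thesis by (simp add: mult.assoc)
    qed
    also have "\<dots> = \<bar>t k\<bar> ^ DIM('a) *\<^sub>R (LINT z|lborel. h (x + t k *\<^sub>R z) * (LINT \<xi>|lborel. g (t k *\<^sub>R \<xi>) * e (x - (x + t k *\<^sub>R z)) \<xi>))"
    proof (rule lborel_integral_affine)
      have "(\<lambda>y. LINT \<xi>|lborel. g (t k *\<^sub>R \<xi>) * e (x - y) \<xi>) \<in> borel_measurable borel"
        unfolding e_def by measurable
      then show "(\<lambda>y. h y * (LINT \<xi>|lborel. g (t k *\<^sub>R \<xi>) * e (x - y) \<xi>)) \<in> borel_measurable borel" by measurable
    qed (use t0[of k] in auto)
    also have "\<dots> = (LINT z|lborel. h (x + t k *\<^sub>R z) * (t k ^ DIM('a) *\<^sub>R (LINT \<xi>|lborel. g (t k *\<^sub>R \<xi>) * e (- (t k *\<^sub>R z)) \<xi>)))"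
      using t0[of k] by (subst integral_scaleR_right[symmetric]) simp
    also have "\<dots> = (LINT z|lborel. h (x + t k *\<^sub>R z) * complex_of_real ((2 * pi) powr (real DIM('a) / 2) * exp (- (norm z)\<^sup>2 / 2)))"
    proof -
      have "t k ^ DIM('a) *\<^sub>R (LINT \<xi>|lborel. g (t k *\<^sub>R \<xi>) * e (- (t k *\<^sub>R z)) \<xi>) =
          complex_of_real ((2 * pi) powr (real DIM('a) / 2) * exp (- (norm (- (t k *\<^sub>R z) /\<^sub>R t k))\<^sup>2 / 2))" for z :: 'a
        using gaussian_fourier_scaled[OF t0[of k], of "- (t k *\<^sub>R z)"] unfolding g_def e_def .
      moreover have "norm (- (t k *\<^sub>R z) /\<^sub>R t k) = norm z" for z :: 'a using t0[of k] by simp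
      ultimately show ?thesis by (simp only:)
    qed
    also have "\<dots> = (LINT z|lborel. (h (x + t k *\<^sub>R z) * g z) * complex_of_real ((2 * pi) powr (real DIM('a) / 2)))"
      by (simp add: g_def mult_ac)
    also have "\<dots> = (LINT z|lborel. h (x + t k *\<^sub>R z) * g z) * complex_of_real ((2 * pi) powr (real DIM('a) / 2))"
      by simp
    finally show ?thesis by (simp add: c_def powr_minus field_simps flip: of_real_mult)
  qed
  have 2: "(\<lambda>k. LINT z|lborel. h (x + t k *\<^sub>R z) * g z) \<longlonglongrightarrow> (LINT z|lborel. h x * g z)"
  proof (rule integral_dominated_convergence)
    show "integrable lborel (\<lambda>z. B * norm (g z))"
      unfolding g_def by (intro integrable_mult_right integrable_norm gaussian_integrable)
    show "(\<lambda>z. h x * g z) \<in> borel_measurable lborel" by measurable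
    show "(\<lambda>z. h (x + t k *\<^sub>R z) * g z) \<in> borel_measurable lborel" for k by measurable
    have "(\<lambda>k. h (x + t k *\<^sub>R z)) \<longlonglongrightarrow> h x" for z
    proof (rule isCont_tendsto_compose[OF hc])
      have "(\<lambda>k. x + t k *\<^sub>R z) \<longlonglongrightarrow> x + 0 *\<^sub>R z" by (intro tendsto_intros tlim)
      then show "(\<lambda>k. x + t k *\<^sub>R z) \<longlonglongrightarrow> x" by simp
    qed
    then show "AE z in lborel. (\<lambda>k. h (x + t k *\<^sub>R z) * g z) \<longlonglongrightarrow> h x * g z" by (auto intro!: tendsto_intros)
    show "AE z in lborel. norm (h (x + t k *\<^sub>R z) * g z) \<le> B * norm (g z)" for k
      using mult_right_mono[OF B] by (auto simp: norm_mult)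
  qed
  have "(LINT \<xi>|lborel. fourier h \<xi> * e x \<xi>) = (LINT z|lborel. h x * g z)"
    using LIMSEQ_unique[OF 1[unfolded eq] 2] by (simp add: g_def)
  also have "\<dots> = h x * complex_of_real ((2 * pi) powr (real DIM('a) / 2))"
    using gaussian_fourier[of "0::'a"] by (simp add: g_def)
  finally show "inverse_fourier (fourier h) x = h x"
    unfolding inverse_fourier_def e_def by (simp add: powr_minus field_simps)
qed

subsection \<open>Distributions with a prescribed Fourier transform\<close>

definition poly_growth :: "('a::euclidean_space \<Rightarrow> complex) \<Rightarrow> bool" where
  "poly_growth G \<longleftrightarrow> G \<in> borel_measurable borel \<and> (\<exists>C M. \<forall>\<xi>. norm (G \<xi>) \<le> C * (1 + norm \<xi>) ^ M)"

text \<open>The inverse Fourier transform of \<open>G\<close> in the sense of distributions: the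
  transform is moved onto the test function, where it is an ordinary integral.\<close>

definition spectral_dist :: "('a::euclidean_space \<Rightarrow> complex) \<Rightarrow> 'a distribution" where
  "spectral_dist G = (\<lambda>h\<in>schwartz. LINT \<xi>|lborel. G \<xi> * inverse_fourier h \<xi>)"

text \<open>Continuity in quantitative form: the decay order \<open>M\<close> in the proof covers
  the growth of \<open>G\<close> plus integrability, and decay of the transform costs just as many
  derivatives of \<open>h\<close>. Only finitely many seminorms enter.\<close>

lemma poly_growth_pairing:
  fixes G :: "'a::euclidean_space \<Rightarrow> complex"
  assumes "poly_growth G"
  obtains K M where "K \<ge> 0"
    and "\<And>h B. deriv_bound M (2 * DIM('a)) B h \<Longrightarrow> h \<in> schwartz \<Longrightarrow>
      norm (LINT \<xi>|lborel. G \<xi> * inverse_fourier h \<xi>) \<le> K * B"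
    and "\<And>h. h \<in> schwartz \<Longrightarrow> integrable lborel (\<lambda>\<xi>. G \<xi> * inverse_fourier h \<xi>)"
proof -
  obtain C M where [measurable]: "G \<in> borel_measurable borel" and G: "\<And>\<xi>. norm (G \<xi>) \<le> C * (1 + norm \<xi>) ^ M"
    using assms unfolding poly_growth_def by blast
  have C0: "C \<ge> 0" using order_trans[OF norm_ge_zero G[of 0]] by simp
  let ?n = "2 * DIM('a)"
  obtain D where D0: "D \<ge> 0" and D: "\<And>(h::'a \<Rightarrow> complex) B x. deriv_bound (M + ?n) ?n B h \<Longrightarrow>
     (1 + norm x) ^ (M + ?n) * norm (inverse_fourier h x) \<le> D * B"
    using inverse_fourier_decay[of "M + ?n", where 'a = 'a] by blast
  have w: "(1 + norm \<xi>) ^ ?n * norm (G \<xi> * inverse_fourier h \<xi>) \<le> C * (D * B)"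
    if "deriv_bound (M + ?n) ?n B h" for h B \<xi>
  proof -
    have "(1 + norm \<xi>) ^ ?n * norm (G \<xi> * inverse_fourier h \<xi>) \<le>
      (1 + norm \<xi>) ^ ?n * ((C * (1 + norm \<xi>) ^ M) * norm (inverse_fourier h \<xi>))"
      unfolding norm_mult by (intro mult_left_mono mult_right_mono G) auto
    also have "\<dots> = C * ((1 + norm \<xi>) ^ (M + ?n) * norm (inverse_fourier h \<xi>))"
      by (simp add: power_add mult_ac)
    also have "\<dots> \<le> C * (D * B)" by (intro mult_left_mono D that C0)
    finally show ?thesis .
  qed
  have m: "(\<lambda>\<xi>. G \<xi> * inverse_fourier h \<xi>) \<in> borel_measurable borel" if "h \<in> schwartz" for h :: "'a \<Rightarrow> complex"
    using schwartz_measurable[OF schwartz_inverse_fourier[OF that]] by measurable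
  let ?W = "LINT x|lborel. inverse ((1 + norm (x::'a)) ^ ?n)"
  have W0: "?W \<ge> 0" by (rule integral_nonneg_AE) auto
  show ?thesis
  proof (rule that[of "C * D * ?W" "M + ?n"])
    show "0 \<le> C * D * ?W" using C0 D0 W0 by simp
    show "integrable lborel (\<lambda>\<xi>. G \<xi> * inverse_fourier h \<xi>)" if h: "h \<in> schwartz" for h
    proof -
      obtain B where B: "deriv_bound (M + ?n) ?n B h" using deriv_bound_schwartz[OF h] by blast
      show ?thesis by (rule weight_integrable[OF m[OF h] w[OF B]])
    qed
    show "norm (LINT \<xi>|lborel. G \<xi> * inverse_fourier h \<xi>) \<le> C * D * ?W * B"
      if B: "deriv_bound (M + ?n) ?n B h" and h: "h \<in> schwartz" for h B
    proof -
      have "norm (LINT \<xi>|lborel. G \<xi> * inverse_fourier h \<xi>) \<le> (LINT \<xi>|lborel. norm (G \<xi> * inverse_fourier h \<xi>))"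
        by (rule integral_norm_bound)
      also have "\<dots> \<le> C * (D * B) * ?W" by (rule weight_integral_le[OF m[OF h] w[OF B]])
      finally show ?thesis by (simp only: mult_ac)
    qed
  qed
qed

lemma topspace_schwartz_topology: "topspace schwartz_topology = schwartz"
proof -
  have "f \<in> topspace schwartz_topology" if f: "f \<in> schwartz" for f :: "'a \<Rightarrow> complex"
  proof -
    let ?S = "{g \<in> schwartz. schwartz_seminorm 0 [] (\<lambda>x. g x - f x) < 1}"
    have "openin schwartz_topology ?S"
      unfolding schwartz_topology_def
    proof (rule topology_generated_by_Basis, rule CollectI, intro exI conjI)
      show "?S = {g \<in> schwartz. schwartz_seminorm 0 [] (\<lambda>x. g x - f x) < 1}" ..
    qed (use f in auto)
    moreover have "f \<in> ?S" using f by (simp add: schwartz_seminorm_def weighted_deriv_def)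
    ultimately show ?thesis using openin_subset by blast
  qed
  moreover have "topspace schwartz_topology \<subseteq> (schwartz :: ('a \<Rightarrow> complex) set)"
    unfolding schwartz_topology_def topology_generated_by_topspace by (rule Union_least) auto
  ultimately show ?thesis by blast
qed

lemma tempered_spectral_dist:
  fixes G :: "'a::euclidean_space \<Rightarrow> complex"
  assumes G: "poly_growth G"
  shows "spectral_dist G \<in> tempered_distributions"
proof -
  let ?u = "spectral_dist G" and ?n = "2 * DIM('a)"
  obtain K M where K0: "K \<ge> 0"
    and K: "\<And>h B. deriv_bound M ?n B h \<Longrightarrow> h \<in> schwartz \<Longrightarrow>
      norm (LINT \<xi>|lborel. G \<xi> * inverse_fourier h \<xi>) \<le> K * B"
    and int: "\<And>h. h \<in> schwartz \<Longrightarrow> integrable lborel (\<lambda>\<xi>. G \<xi> * inverse_fourier h \<xi>)"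
    using poly_growth_pairing[OF G] by blast
  have add: "?u (\<lambda>x. f x + g x) = ?u f + ?u g" if "f \<in> schwartz" "g \<in> schwartz" for f g
    using that int by (simp add: spectral_dist_def schwartz_add inverse_fourier_add schwartz_integrable distrib_left)
  have cmult: "?u (\<lambda>x. c * f x) = c * ?u f" if "f \<in> schwartz" for c f
    using that by (simp add: spectral_dist_def schwartz_cmult inverse_fourier_cmult mult.left_commute)
  have diff: "?u f - ?u g = ?u (\<lambda>x. f x - g x)" if "f \<in> schwartz" "g \<in> schwartz" for f g
    using add[OF that(1) schwartz_cmult[OF that(2), of "-1"]] cmult[OF that(2), of "-1"] by simp
  have "continuous_map schwartz_topology euclidean ?u"
    unfolding continuous_map_def topspace_schwartz_topology
  proof (intro conjI allI impI)
    fix U :: "complex set" assume "openin euclidean U"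
    then have U: "open U" by simp
    show "openin schwartz_topology {f \<in> schwartz. ?u f \<in> U}"
    proof (subst openin_subopen, intro ballI)
      fix f assume f: "f \<in> {f \<in> schwartz. ?u f \<in> U}"
      then obtain \<delta> where \<delta>: "\<delta> > 0" "\<And>z. dist z (?u f) < \<delta> \<Longrightarrow> z \<in> U"
        using U unfolding open_dist by auto
      define \<epsilon> where "\<epsilon> = \<delta> / (K + 1)"
      have \<epsilon>: "\<epsilon> > 0" using \<delta>(1) K0 by (simp add: \<epsilon>_def)
      define I where "I = {bs::'a list. set bs \<subseteq> Basis \<and> length bs \<le> M}"
      have fin: "finite I" unfolding I_def by (rule finite_lists_length_le) auto
      have ne: "I \<noteq> {}" unfolding I_def by (auto intro!: exI[of _ "[]"])
      \<comment> \<open>The topology is generated by sublevel sets of single seminorms, so a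
        neighbourhood controlling all derivatives up to order \<open>M\<close> is a finite
        intersection of such sets.\<close>
      define T where "T = (\<Inter>bs\<in>I. {g \<in> schwartz. schwartz_seminorm ?n bs (\<lambda>x. g x - f x) < \<epsilon>})"
      have "openin schwartz_topology T" unfolding T_def
      proof (rule openin_INT2[OF fin ne])
        fix bs assume "bs \<in> I"
        then have "bs \<in> lists Basis" by (auto simp: I_def)
        then show "openin schwartz_topology {g \<in> schwartz. schwartz_seminorm ?n bs (\<lambda>x. g x - f x) < \<epsilon>}"
          unfolding schwartz_topology_def using f \<epsilon> by (intro topology_generated_by_Basis) blast
      qed
      moreover have "f \<in> T"
      proof -
        have "schwartz_seminorm ?n bs (\<lambda>x. f x - f x) = 0" for bs
        proof -
          have "iterated_deriv bs (\<lambda>x::'a. 0) = (\<lambda>x. 0)"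
            by (induction bs) (auto simp: partial_const[unfolded partial_def fun_eq_iff, simplified])
          then show ?thesis by (simp add: schwartz_seminorm_def weighted_deriv_def)
        qed
        then show ?thesis using f \<epsilon> by (simp add: T_def)
      qed
      moreover have "T \<subseteq> {f \<in> schwartz. ?u f \<in> U}"
      proof
        fix g assume g: "g \<in> T"
        then have gs: "g \<in> schwartz" using ne by (auto simp: T_def)
        have d: "(\<lambda>x. g x - f x) \<in> schwartz" using gs f by (auto intro: schwartz_diff)
        have "deriv_bound M ?n \<epsilon> (\<lambda>x. g x - f x)"
          unfolding deriv_bound_iff
        proof (intro ballI impI allI conjI)
          fix bs :: "'a list" and x assume bs: "bs \<in> lists Basis" "length bs \<le> M"
          show "iterated_deriv bs (\<lambda>x. g x - f x) differentiable at x"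
            using d bs by (simp add: schwartz_def smooth_def)
          have "weighted_deriv ?n bs (\<lambda>x. g x - f x) x \<le> schwartz_seminorm ?n bs (\<lambda>x. g x - f x)"
            unfolding schwartz_seminorm_def using d bs by (intro cSUP_upper) (auto simp: schwartz_def)
          also have "\<dots> \<le> \<epsilon>" using g bs by (auto simp: T_def I_def lists_eq_set)
          finally show "weighted_deriv ?n bs (\<lambda>x. g x - f x) x \<le> \<epsilon>" .
        qed
        from K[OF this d] have "norm (?u g - ?u f) \<le> K * \<epsilon>"
          using d f gs by (simp add: diff) (simp add: spectral_dist_def)
        also have "\<dots> < \<delta>" using \<delta>(1) K0 by (simp add: \<epsilon>_def field_simps)
        finally show "g \<in> {f \<in> schwartz. ?u f \<in> U}" using \<delta>(2) gs by (simp add: dist_norm)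
      qed
      ultimately show "\<exists>T. openin schwartz_topology T \<and> f \<in> T \<and> T \<subseteq> {f \<in> schwartz. ?u f \<in> U}" by blast
    qed
  qed simp
  then show ?thesis
    unfolding tempered_distributions_def using add cmult by (simp add: spectral_dist_def)
qed

section \<open>Uniqueness of representing functions and computation of the blocks\<close>

definition bump :: "('a::euclidean_space \<Rightarrow> complex) \<Rightarrow> bool" where
  "bump \<eta> \<longleftrightarrow> \<eta> \<in> schwartz \<and> (\<forall>x. \<eta> x \<in> \<real>\<^sub>\<ge>\<^sub>0) \<and> \<eta> 0 = 1 \<and> (\<exists>\<rho>. \<forall>x. norm x > \<rho> \<longrightarrow> \<eta> x = 0)"

lemma deriv_bound_scale:
  assumes "deriv_bound L 0 B f" "1 \<le> \<Lambda>"
  shows "deriv_bound L 0 (\<Lambda> ^ L * B) (\<lambda>x. f (t + \<Lambda> *\<^sub>R x))"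
proof -
  have "diag (\<lambda>_. \<Lambda>) x = \<Lambda> *\<^sub>R x" for x :: 'a
    by (simp add: diag_def euclidean_representation flip: scaleR_scaleR scaleR_sum_right)
  then show ?thesis using deriv_bound_affine[OF _ assms(2,1), of "\<lambda>_. \<Lambda>" t] assms(2) by simp
qed

lemma AE_zero_continuous:
  fixes F :: "'a::euclidean_space \<Rightarrow> 'b::real_normed_vector"
  assumes "continuous_on UNIV F" "AE x in lborel. F x = 0"
  shows "F x = 0"
proof (rule ccontr)
  assume "F x \<noteq> 0"
  have "open (F -` (- {0}))" using assms(1) by (intro open_vimage) auto
  moreover have "F -` (- {0}) \<noteq> {}" using \<open>F x \<noteq> 0\<close> by auto
  ultimately have "\<not> negligible (F -` (- {0}))" by (rule open_not_negligible)
  moreover have "AE x in lebesgue. F x = 0" using assms(2) by (rule AE_completion)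
  then have "negligible (F -` (- {0}))"
    unfolding negligible_iff_null_sets using \<open>open (F -` (- {0}))\<close>
    by (subst AE_iff_null_sets) (auto simp: borel_open)
  ultimately show False by simp
qed

text \<open>\<open>block\<close> is a definite description, so two continuous representing functions
  must be shown to agree. If they differ at \<open>x0\<close>, testing with a small nonnegative
  function around \<open>x0\<close> gives a contradiction; such a function is obtained by dilating
  \<open>\<eta>\<close>, for which the anisotropic generator serves later on.\<close>

lemma represents_unique:
  fixes \<eta> g1 g2 :: "'a::euclidean_space \<Rightarrow> complex"
  assumes \<eta>: "bump \<eta>" and g: "continuous_on UNIV g1" "continuous_on UNIV g2" "represents g1 u" "represents g2 u"
  shows "g1 = g2"
proof (rule ccontr)
  assume "g1 \<noteq> g2"
  then obtain x0 where x0: "g1 x0 \<noteq> g2 x0" by auto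
  \<comment> \<open>Multiplication by the conjugate of the difference at \<open>x0\<close> makes the
    real part positive there, which reduces the complex case to a sign argument.\<close>
  define c where "c = cnj (g1 x0 - g2 x0)"
  define r where "r x = Re (c * (g1 x - g2 x))" for x
  have rc: "continuous_on UNIV r" unfolding r_def by (intro continuous_intros g)
  have "r x0 = (Re (g1 x0 - g2 x0))\<^sup>2 + (Im (g1 x0 - g2 x0))\<^sup>2"
    by (simp add: r_def c_def power2_eq_square algebra_simps)
  then have r0: "r x0 > 0" using x0 by (simp add: sum_power2_gt_zero_iff complex_eq_iff)
  have "open (r -` {0<..})" using rc by (intro open_vimage) auto
  then obtain \<delta> where \<delta>: "\<delta> > 0" "ball x0 \<delta> \<subseteq> r -` {0<..}"
    using r0 openE[of "r -` {0<..}" x0] by auto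
  obtain \<rho> where \<eta>s: "\<eta> \<in> schwartz" "\<And>x. \<eta> x \<in> \<real>\<^sub>\<ge>\<^sub>0" "\<eta> 0 = 1" and \<rho>: "\<And>x. norm x > \<rho> \<Longrightarrow> \<eta> x = 0"
    using \<eta> unfolding bump_def by blast
  \<comment> \<open>So large that the dilated bump vanishes outside the ball of radius
    \<open>\<delta>\<close> around \<open>x0\<close>; the maximum with 1 meets the hypothesis of the
    dilation estimate.\<close>
  define \<Lambda> where "\<Lambda> = max 1 ((\<bar>\<rho>\<bar> + 1) / \<delta>)"
  have \<Lambda>1: "\<Lambda> \<ge> 1" by (simp add: \<Lambda>_def)
  have "(\<bar>\<rho>\<bar> + 1) / \<delta> * \<delta> \<le> \<Lambda> * \<delta>" using \<delta>(1) by (intro mult_right_mono) (auto simp: \<Lambda>_def)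
  then have \<Lambda>2: "\<Lambda> * \<delta> > \<rho>" using \<delta>(1) by simp
  define f where "f x = \<eta> (- \<Lambda> *\<^sub>R x0 + \<Lambda> *\<^sub>R x)" for x
  have fz: "f x = 0" if "x \<notin> ball x0 \<delta>" for x
  proof -
    have "\<Lambda> * \<delta> \<le> \<Lambda> * norm (x - x0)" using that \<Lambda>1 by (intro mult_left_mono) (auto simp: dist_norm norm_minus_commute)
    also have "\<dots> = norm (- \<Lambda> *\<^sub>R x0 + \<Lambda> *\<^sub>R x)" using \<Lambda>1 by (simp flip: scaleR_diff_right)
    finally show ?thesis unfolding f_def using \<Lambda>2 by (intro \<rho>) linarith
  qed
  have fs: "f \<in> schwartz"
  proof (rule schwartzI_compact_support[where \<rho> = "norm x0 + \<delta>"])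
    show "\<exists>B. deriv_bound L 0 B f" for L
    proof -
      obtain B where "deriv_bound L 0 B \<eta>" using deriv_bound_schwartz[OF \<eta>s(1)] by blast
      from deriv_bound_scale[OF this \<Lambda>1] show ?thesis unfolding f_def by blast
    qed
    show "f x = 0" if "norm x > norm x0 + \<delta>" for x
    proof (rule fz)
      have "norm x \<le> norm x0 + norm (x - x0)" using norm_triangle_sub by blast
      then show "x \<notin> ball x0 \<delta>" using that by (auto simp: dist_norm norm_minus_commute)
    qed
  qed
  have i: "integrable lborel (\<lambda>x. g1 x * f x)" "integrable lborel (\<lambda>x. g2 x * f x)"
    using g(3,4) fs by (auto simp: represents_def)
  have "(LINT x|lborel. g1 x * f x) = u f" "(LINT x|lborel. g2 x * f x) = u f"
    using g(3,4) fs unfolding represents_def by (metis restrict_apply')+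
  then have "(LINT x|lborel. g1 x * f x - g2 x * f x) = 0" using i by simp
  then have "(LINT x|lborel. c * (g1 x * f x - g2 x * f x)) = 0" by (simp only: integral_mult_right_zero mult_zero_right)
  moreover have "integrable lborel (\<lambda>x. c * (g1 x * f x - g2 x * f x))" using i by simp
  ultimately have z: "(LINT x|lborel. Re (c * (g1 x * f x - g2 x * f x))) = 0" by (simp only: integral_Re zero_complex.sel)
  have eq: "Re (c * (g1 x * f x - g2 x * f x)) = r x * Re (f x)" for x
  proof -
    have "f x = complex_of_real (Re (f x))"
      using \<eta>s(2) unfolding f_def by (simp add: complex_nonneg_Reals_iff complex_eq_iff)
    then have "c * (g1 x * f x - g2 x * f x) = (c * (g1 x - g2 x)) * complex_of_real (Re (f x))"
      by (simp add: algebra_simps)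
    moreover have "Re (z * complex_of_real s) = Re z * s" for z s by simp
    ultimately show ?thesis by (simp only: r_def)
  qed
  have nn: "0 \<le> r x * Re (f x)" for x
  proof (cases "x \<in> ball x0 \<delta>")
    case True
    have "Re (f x) \<ge> 0" using \<eta>s(2) unfolding f_def by (simp add: complex_nonneg_Reals_iff)
    moreover have "r x > 0" using True \<delta>(2) by auto
    ultimately show ?thesis by simp
  next
    case False
    then show ?thesis by (simp add: fz)
  qed
  have "integrable lborel (\<lambda>x. Re (c * (g1 x * f x - g2 x * f x)))"
    by (intro integrable_Re integrable_mult_right Bochner_Integration.integrable_diff i)
  then have "AE x in lborel. r x * Re (f x) = 0"
    using z nn unfolding eq by (subst (asm) integral_nonneg_eq_0_iff_AE) auto
  then have "r x0 * Re (f x0) = 0"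
    by (intro AE_zero_continuous[where F = "\<lambda>x. r x * Re (f x)"]) (intro continuous_intros rc schwartz_continuous fs)
  moreover have "f x0 = 1" by (simp add: f_def \<eta>s)
  ultimately show False using r0 by simp
qed

lemma continuous_inverse_fourier:
  fixes h :: "'a::euclidean_space \<Rightarrow> complex"
  assumes h: "integrable lborel h"
  shows "continuous_on UNIV (inverse_fourier h)"
proof (intro continuous_at_imp_continuous_on ballI)
  fix x
  have [measurable]: "h \<in> borel_measurable borel" using h by auto
  show "isCont (inverse_fourier h) x"
  proof (rule continuous_at_sequentiallyI)
    fix y assume y: "y \<longlonglongrightarrow> x"
    have "(\<lambda>k. LINT \<xi>|lborel. h \<xi> * exp (\<i> * complex_of_real (y k \<bullet> \<xi>))) \<longlonglongrightarrow>
        (LINT \<xi>|lborel. h \<xi> * exp (\<i> * complex_of_real (x \<bullet> \<xi>)))"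
    proof (rule integral_dominated_convergence)
      show "integrable lborel (\<lambda>\<xi>. norm (h \<xi>))" using h by simp
      show "AE \<xi> in lborel. (\<lambda>k. h \<xi> * exp (\<i> * complex_of_real (y k \<bullet> \<xi>))) \<longlonglongrightarrow> h \<xi> * exp (\<i> * complex_of_real (x \<bullet> \<xi>))"
        using y by (auto intro!: tendsto_intros)
    qed (auto simp: norm_mult)
    then show "(\<lambda>k. inverse_fourier h (y k)) \<longlonglongrightarrow> inverse_fourier h x"
      unfolding inverse_fourier_def by (intro tendsto_intros)
  qed
qed

lemma inverse_fourier_norm_le:
  fixes h :: "'a::euclidean_space \<Rightarrow> complex"
  shows "norm (inverse_fourier h x) \<le> (2 * pi) powr (- real DIM('a) / 2) * (LINT \<xi>|lborel. norm (h \<xi>))"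
  unfolding inverse_fourier_def norm_mult
  by (intro mult_mono order_trans[OF integral_norm_bound]) (auto simp: norm_mult)

lemma inverse_fourier_adjoint:
  fixes h f :: "'a::euclidean_space \<Rightarrow> complex"
  assumes h: "integrable lborel h" and f: "integrable lborel f"
  shows "(LINT \<xi>|lborel. h \<xi> * inverse_fourier f \<xi>) = (LINT x|lborel. inverse_fourier h x * f x)"
proof -
  define c where "c = complex_of_real ((2 * pi) powr (- real DIM('a) / 2))"
  have "(LINT \<xi>|lborel. h \<xi> * inverse_fourier f \<xi>) =
    (LINT \<xi>|lborel. c * (h \<xi> * (LINT x|lborel. f x * exp (\<i> * complex_of_real (\<xi> \<bullet> x)))))"
    by (simp only: inverse_fourier_def c_def mult.left_commute)
  also have "\<dots> = c * (LINT \<xi>|lborel. h \<xi> * (LINT x|lborel. f x * exp (\<i> * complex_of_real (\<xi> \<bullet> x))))"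
    by (rule integral_mult_right_zero)
  also have "(LINT \<xi>|lborel. h \<xi> * (LINT x|lborel. f x * exp (\<i> * complex_of_real (\<xi> \<bullet> x)))) =
     (LINT x|lborel. f x * (LINT \<xi>|lborel. h \<xi> * exp (\<i> * complex_of_real (\<xi> \<bullet> x))))"
    by (rule fubini_bounded_kernel[OF h f]) auto
  also have "c * \<dots> = (LINT x|lborel. c * (f x * (LINT \<xi>|lborel. h \<xi> * exp (\<i> * complex_of_real (\<xi> \<bullet> x)))))"
    by (rule integral_mult_right_zero[symmetric])
  also have "\<dots> = (LINT x|lborel. inverse_fourier h x * f x)"
    by (simp only: inverse_fourier_def c_def mult_ac inner_commute)
  finally show ?thesis .
qed

text \<open>By Fourier inversion, multiplying the transform of \<open>spectral_dist G\<close> by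
  \<open>m\<close> amounts to multiplying \<open>G\<close> by \<open>m\<close>. The symmetry of the
  inverse transform exhibits a continuous representing function, and uniqueness turns the
  description operator into this function.\<close>

lemma block_spectral_dist:
  fixes G :: "'a::euclidean_space \<Rightarrow> complex"
  assumes \<eta>: "bump (\<eta> :: 'a \<Rightarrow> complex)" and G: "poly_growth G" and m: "m \<in> schwartz"
    and int: "integrable lborel (\<lambda>\<xi>. m \<xi> * G \<xi>)"
  shows "block m (spectral_dist G) = inverse_fourier (\<lambda>\<xi>. m \<xi> * G \<xi>)"
proof -
  let ?g = "inverse_fourier (\<lambda>\<xi>. m \<xi> * G \<xi>)"
  have [measurable]: "G \<in> borel_measurable borel" using G by (simp add: poly_growth_def)
  have c: "continuous_on UNIV ?g" by (rule continuous_inverse_fourier[OF int])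
  have "fourier_multiplier m (spectral_dist G) = (\<lambda>f\<in>schwartz. LINT x|lborel. ?g x * f x)"
  proof (rule ext)
    fix f :: "'a \<Rightarrow> complex"
    show "fourier_multiplier m (spectral_dist G) f = (\<lambda>f\<in>schwartz. LINT x|lborel. ?g x * f x) f"
    proof (cases "f \<in> schwartz")
      case True
      then have 1: "inverse_fourier f \<in> schwartz" by (rule schwartz_inverse_fourier)
      have 2: "(\<lambda>x. m x * inverse_fourier f x) \<in> schwartz" by (rule schwartz_mult[OF m 1])
      have "fourier_multiplier m (spectral_dist G) f = (LINT \<xi>|lborel. G \<xi> * (m \<xi> * inverse_fourier f \<xi>))"
        using True 1 2 schwartz_fourier[OF 2]
        by (simp add: fourier_multiplier_def inverse_fourier_dist_def mult_dist_def fourier_dist_def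
            spectral_dist_def inverse_fourier_fourier)
      also have "\<dots> = (LINT \<xi>|lborel. (m \<xi> * G \<xi>) * inverse_fourier f \<xi>)" by (simp only: mult_ac)
      also have "\<dots> = (LINT x|lborel. ?g x * f x)"
        by (rule inverse_fourier_adjoint[OF int schwartz_integrable[OF True]])
      finally show ?thesis using True by simp
    next
      case False
      then show ?thesis by (simp add: fourier_multiplier_def inverse_fourier_dist_def)
    qed
  qed
  moreover have "integrable lborel (\<lambda>x. ?g x * f x)" if "f \<in> schwartz" for f
    using integrable_mult_bounded[OF schwartz_integrable[OF that] borel_measurable_continuous_onI[OF c] inverse_fourier_norm_le]
    by (simp add: mult.commute)
  ultimately have r: "represents ?g (fourier_multiplier m (spectral_dist G))"
    unfolding represents_def using borel_measurable_continuous_onI[OF c] by simp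
  show ?thesis
    unfolding block_def using c r represents_unique[OF \<eta>] by (intro the_equality) auto
qed

lemma integrable_mult_poly_growth:
  fixes G :: "'a::euclidean_space \<Rightarrow> complex"
  assumes G: "poly_growth G" and m: "m \<in> schwartz"
  shows "integrable lborel (\<lambda>\<xi>. m \<xi> * G \<xi>)"
proof -
  obtain C M where [measurable]: "G \<in> borel_measurable borel" and GC: "\<And>\<xi>. norm (G \<xi>) \<le> C * (1 + norm \<xi>) ^ M"
    using G unfolding poly_growth_def by blast
  have C0: "C \<ge> 0" using order_trans[OF norm_ge_zero GC[of 0]] by simp
  obtain B where B: "deriv_bound 0 (2 * DIM('a) + M) B m" using deriv_bound_schwartz[OF m] by blast
  have [measurable]: "m \<in> borel_measurable borel" by (rule schwartz_measurable[OF m])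
  show ?thesis
  proof (rule weight_integrable)
    fix x
    have "(1 + norm x) ^ (2 * DIM('a)) * norm (m x * G x) \<le> (1 + norm x) ^ (2 * DIM('a)) * (norm (m x) * (C * (1 + norm x) ^ M))"
      unfolding norm_mult by (intro mult_left_mono GC) auto
    also have "\<dots> = C * ((1 + norm x) ^ (2 * DIM('a) + M) * norm (m x))" by (simp add: power_add mult_ac)
    also have "\<dots> \<le> C * B" by (intro mult_left_mono deriv_bound_norm[OF B] C0)
    finally show "(1 + norm x) ^ (2 * DIM('a)) * norm (m x * G x) \<le> C * B" .
  qed measurable
qed

subsection \<open>Quasi-norms\<close>

lemma ennreal_powr_ennreal: "0 \<le> a \<Longrightarrow> ennreal_powr (ennreal a) r = ennreal (a powr r)"
  by (simp add: ennreal_powr_def)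

lemma ennreal_powr_top [simp]: "ennreal_powr \<top> r = \<top>"
  by (simp add: ennreal_powr_def)

lemma ennreal_powr_0 [simp]: "ennreal_powr 0 r = 0"
  by (simp add: ennreal_powr_def)

lemma ennreal_powr_mono:
  assumes "x \<le> y" "0 \<le> r"
  shows "ennreal_powr x r \<le> ennreal_powr y r"
proof (cases y)
  case (real b)
  then obtain a where "x = ennreal a" "0 \<le> a" "a \<le> b"
    using assms(1) by (cases x) (auto simp: top_unique)
  then show ?thesis using real assms(2) by (simp add: ennreal_powr_ennreal ennreal_leI powr_mono2)
qed simp

lemma ennreal_powr_powr: "0 < r \<Longrightarrow> ennreal_powr (ennreal_powr x r) s = ennreal_powr x (r * s)"
  by (cases x) (auto simp: ennreal_powr_ennreal powr_powr)

lemma ennreal_powr_one [simp]: "ennreal_powr x 1 = x"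
  by (cases x) (auto simp: ennreal_powr_ennreal)

lemma ennreal_powr_mult: "0 < r \<Longrightarrow> ennreal_powr (x * y) r = ennreal_powr x r * ennreal_powr y r"
proof (cases x; cases y)
  fix a b assume r: "0 < r" and "x = ennreal a" "y = ennreal b" "0 \<le> a" "0 \<le> b"
  then show ?thesis by (simp add: ennreal_powr_ennreal powr_mult flip: ennreal_mult)
next
  fix a assume r: "0 < r" and *: "x = ennreal a" "0 \<le> a" "y = \<top>"
  then show ?thesis by (cases "a = 0") (auto simp: ennreal_powr_ennreal ennreal_mult_top ennreal_mult_eq_top_iff)
next
  fix a assume r: "0 < r" and *: "y = ennreal a" "0 \<le> a" "x = \<top>"
  then show ?thesis by (cases "a = 0") (auto simp: ennreal_powr_ennreal ennreal_top_mult)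
qed auto

lemma ennreal_powr_le_iff:
  assumes "0 < r"
  shows "ennreal_powr x r \<le> y \<longleftrightarrow> x \<le> ennreal_powr y (1 / r)"
proof
  assume "ennreal_powr x r \<le> y"
  from ennreal_powr_mono[OF this, of "1 / r"] show "x \<le> ennreal_powr y (1 / r)"
    using assms by (simp add: ennreal_powr_powr)
next
  assume "x \<le> ennreal_powr y (1 / r)"
  from ennreal_powr_mono[OF this, of r] show "ennreal_powr x r \<le> y"
    using assms by (simp add: ennreal_powr_powr)
qed

lemma ennreal_powr_measurable [measurable]:
  assumes [measurable]: "f \<in> borel_measurable M"
  shows "(\<lambda>x. ennreal_powr (f x) r) \<in> borel_measurable M"
  unfolding ennreal_powr_def by measurable

lemma enn2real_pos: "0 < p \<Longrightarrow> p \<noteq> \<top> \<Longrightarrow> 0 < enn2real p"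
  by (cases p) (auto simp: ennreal_zero_less_mult_iff)

text \<open>Both \<open>L\<^sub>p\<close> and \<open>\<ell>\<^sub>q\<close> are instances of the following, for Lebesgue and counting measure.\<close>

definition measure_norm :: "'a measure \<Rightarrow> ennreal \<Rightarrow> ('a \<Rightarrow> ennreal) \<Rightarrow> ennreal" where
  "measure_norm M p g = (if p = \<infinity> then esssup M g
     else ennreal_powr (\<integral>\<^sup>+ x. ennreal_powr (g x) (enn2real p) \<partial>M) (1 / enn2real p))"

lemma Lp_norm_eq: "Lp_norm = measure_norm lborel"
  by (auto simp: fun_eq_iff Lp_norm_def measure_norm_def)

text \<open>For the harder inequality a simple function below \<open>f\<close> either has finite
  support, and its integral is a finite sum, or takes some nonzero value infinitely often; then the
  unordered sum of \<open>f\<close> is already infinite.\<close>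

lemma infsum_ennreal_eq: "(\<Sum>\<^sub>\<infinity>j. f j) = (\<integral>\<^sup>+ j. f j \<partial>count_space UNIV)" for f :: "'j \<Rightarrow> ennreal"
proof -
  have "(\<integral>\<^sup>+ j. f j \<partial>count_space UNIV) = (SUP F\<in>{F. finite F}. sum f F)"
  proof (rule antisym)
    show "(SUP F\<in>{F. finite F}. sum f F) \<le> (\<integral>\<^sup>+ j. f j \<partial>count_space UNIV)"
    proof (rule SUP_least)
      fix F :: "'j set" assume "F \<in> {F. finite F}"
      then have "sum f F = (\<integral>\<^sup>+ j. f j * indicator F j \<partial>count_space UNIV)"
        by (subst nn_integral_count_space'[of F]) (auto simp: indicator_def)
      also have "\<dots> \<le> (\<integral>\<^sup>+ j. f j \<partial>count_space UNIV)"
        by (intro nn_integral_mono) (auto simp: indicator_def)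
      finally show "sum f F \<le> (\<integral>\<^sup>+ j. f j \<partial>count_space UNIV)" .
    qed
    show "(\<integral>\<^sup>+ j. f j \<partial>count_space UNIV) \<le> (SUP F\<in>{F. finite F}. sum f F)"
      unfolding nn_integral_def
    proof (rule SUP_least)
      fix g assume g: "g \<in> {g. simple_function (count_space UNIV) g \<and> g \<le> f}"
      have fin: "finite (range g)" using g by (simp add: simple_function_def)
      show "integral\<^sup>S (count_space UNIV) g \<le> (SUP F\<in>{F. finite F}. sum f F)"
      proof (cases "finite {j. g j \<noteq> 0}")
        case True
        have "integral\<^sup>S (count_space UNIV) g = (\<integral>\<^sup>+ j. g j \<partial>count_space UNIV)"
          using g by (simp add: nn_integral_eq_simple_integral)
        also have "\<dots> = sum g {j. g j \<noteq> 0}"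
          using True by (subst nn_integral_count_space'[of "{j. g j \<noteq> 0}"]) auto
        also have "\<dots> \<le> sum f {j. g j \<noteq> 0}" using g by (intro sum_mono) (auto simp: le_fun_def)
        also have "\<dots> \<le> (SUP F\<in>{F. finite F}. sum f F)" using True by (intro SUP_upper) auto
        finally show ?thesis .
      next
        case False
        have "{j. g j \<noteq> 0} = (\<Union>c\<in>range g - {0}. g -` {c})" by auto
        then obtain c where c: "c \<noteq> 0" "infinite (g -` {c})"
          using False fin by (metis (no_types, lifting) DiffE finite_Diff finite_UN insertI1)
        have "\<top> = (\<Sum>\<^sub>\<infinity>j\<in>g -` {c}. f j)"
          using c g by (subst infsum_superconst_infinite_ennreal[of _ c]) (auto simp: le_fun_def zero_less_iff_neq_zero)
        also have "\<dots> = (SUP F\<in>{F. finite F \<and> F \<subseteq> g -` {c}}. sum f F)"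
          by (simp add: nonneg_infsum_complete)
        also have "\<dots> \<le> (SUP F\<in>{F. finite F}. sum f F)" by (rule SUP_subset_mono) auto
        finally have "(SUP F\<in>{F. finite F}. sum f F) = \<top>" by (simp only: top_unique)
        then show ?thesis by (simp only: top_greatest)
      qed
    qed
  qed
  then show ?thesis by (simp add: nonneg_infsum_complete)
qed

lemma esssup_count_space: "esssup (count_space UNIV) (a :: 'j \<Rightarrow> ennreal) = (SUP j. a j)"
proof (rule antisym)
  show "esssup (count_space UNIV) a \<le> (SUP j. a j)"
    by (rule esssup_I) (auto intro: SUP_upper simp: AE_count_space)
  show "(SUP j. a j) \<le> esssup (count_space UNIV) a"
    using esssup_AE[of a "count_space UNIV"] by (auto intro: SUP_least simp: AE_count_space)
qed

lemma lq_norm_eq: "lq_norm = measure_norm (count_space UNIV)"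
  by (auto simp: fun_eq_iff lq_norm_def measure_norm_def infsum_ennreal_eq esssup_count_space)

lemma measure_norm_mono:
  assumes "AE x in M. f x \<le> g x" "f \<in> borel_measurable M" "0 < p"
  shows "measure_norm M p f \<le> measure_norm M p g"
  using assms unfolding measure_norm_def
  by (auto intro!: esssup_AE_mono ennreal_powr_mono nn_integral_mono_AE)

lemma measure_norm_cmult:
  assumes [measurable]: "f \<in> borel_measurable M" and p: "0 < p" and c: "c < \<top>"
  shows "measure_norm M p (\<lambda>x. c * f x) = c * measure_norm M p f"
proof (cases "p = \<infinity>")
  case True
  show ?thesis
  proof (cases "c = 0")
    case True
    have "esssup M (\<lambda>x. 0::ennreal) \<le> 0" by (rule esssup_I) auto
    then show ?thesis using True \<open>p = \<infinity>\<close> by (simp add: measure_norm_def)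
  next
    case False
    then obtain r where r: "c = ennreal r" "r > 0" using c by (cases c) (auto simp: less_le)
    have le: "esssup M (\<lambda>x. ennreal r * f x) \<le> ennreal r * esssup M f"
      if "r > 0" "f \<in> borel_measurable M" for r f
      using esssup_AE[of f M] that by (intro esssup_I) (auto intro: mult_left_mono elim!: eventually_mono)
    \<comment> \<open>The reverse inequality is the first one applied to the factor
      \<open>inverse r\<close>.\<close>
    have "ennreal r * esssup M f = ennreal r * esssup M (\<lambda>x. ennreal (inverse r) * (ennreal r * f x))"
      using r by (simp add: mult.assoc[symmetric] flip: ennreal_mult)
    also have "\<dots> \<le> ennreal r * (ennreal (inverse r) * esssup M (\<lambda>x. ennreal r * f x))"
      using r by (intro mult_left_mono le) auto
    also have "\<dots> = esssup M (\<lambda>x. ennreal r * f x)"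
      using r by (simp add: mult.assoc[symmetric] flip: ennreal_mult)
    finally show ?thesis using le[of r f] r \<open>p = \<infinity>\<close> by (auto simp: measure_norm_def intro: antisym)
  qed
next
  case False
  then have r: "0 < enn2real p" using p enn2real_pos by simp
  show ?thesis
    using False r by (simp add: measure_norm_def ennreal_powr_mult nn_integral_cmult ennreal_powr_powr)
qed

lemma measure_norm_powr:
  assumes "0 < p" "p \<noteq> \<top>"
  shows "ennreal_powr (measure_norm M p f) (enn2real p) = (\<integral>\<^sup>+ x. ennreal_powr (f x) (enn2real p) \<partial>M)"
  using assms enn2real_pos[OF assms] by (simp add: measure_norm_def ennreal_powr_powr)

lemma measure_norm_leI:
  assumes "0 < p" "p \<noteq> \<top>" "(\<integral>\<^sup>+ x. ennreal_powr (f x) (enn2real p) \<partial>M) \<le> ennreal_powr c (enn2real p)"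
  shows "measure_norm M p f \<le> c"
proof -
  have r: "0 < enn2real p" using assms enn2real_pos by simp
  have "ennreal_powr (measure_norm M p f) (enn2real p) \<le> ennreal_powr c (enn2real p)"
    using assms by (simp add: measure_norm_powr)
  then show ?thesis unfolding ennreal_powr_le_iff[OF r] using r by (simp add: ennreal_powr_powr)
qed

lemma measure_norm_geI:
  assumes "0 < p" "p \<noteq> \<top>" "ennreal_powr c (enn2real p) \<le> (\<integral>\<^sup>+ x. ennreal_powr (f x) (enn2real p) \<partial>M)"
  shows "c \<le> measure_norm M p f"
proof -
  have r: "0 < enn2real p" using assms enn2real_pos by simp
  have "ennreal_powr c (enn2real p) \<le> ennreal_powr (measure_norm M p f) (enn2real p)"
    using assms by (simp add: measure_norm_powr)
  then show ?thesis unfolding ennreal_powr_le_iff[OF r] using r by (simp add: ennreal_powr_powr)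
qed

text \<open>A countable supremum is controlled by the pieces up to an arbitrarily small geometric loss; this replaces
  the quasi-triangle inequality.\<close>

lemma measure_norm_SUP:
  assumes p: "0 < p" and \<eta>: "0 < (\<eta>::real)"
  obtains C :: real where "0 \<le> C"
    "\<And>(M::'a measure) F. (\<And>k. F k \<in> borel_measurable M) \<Longrightarrow>
      measure_norm M p (\<lambda>x. SUP k. F k x) \<le> ennreal C * (SUP k. ennreal (2 powr (real k * \<eta>)) * measure_norm M p (F k))"
proof (cases "p = \<infinity>")
  case True
  show ?thesis
  proof (rule that[of 1])
    fix M :: "'a measure" and F :: "nat \<Rightarrow> 'a \<Rightarrow> ennreal" assume [measurable]: "\<And>k. F k \<in> borel_measurable M"
    have "AE x in M. \<forall>k. F k x \<le> esssup M (F k)"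
      unfolding AE_all_countable using esssup_AE by blast
    then have "esssup M (\<lambda>x. SUP k. F k x) \<le> (SUP k. esssup M (F k))"
      by (intro esssup_I) (auto intro: SUP_mono elim!: eventually_mono)
    also have "\<dots> \<le> (SUP k. ennreal (2 powr (real k * \<eta>)) * esssup M (F k))"
    proof (rule SUP_mono, rule bexI)
      fix k
      have "(1::real) \<le> 2 powr (real k * \<eta>)" using \<eta> by (intro ge_one_powr_ge_zero) auto
      then show "esssup M (F k) \<le> ennreal (2 powr (real k * \<eta>)) * esssup M (F k)"
        using mult_right_mono[of 1 "ennreal (2 powr (real k * \<eta>))"] by (simp add: ennreal_leI[of 1, simplified])
    qed simp
    finally show "measure_norm M p (\<lambda>x. SUP k. F k x) \<le> ennreal 1 * (SUP k. ennreal (2 powr (real k * \<eta>)) * measure_norm M p (F k))"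
      using True by (simp add: measure_norm_def)
  qed simp
next
  case False
  define r where "r = enn2real p"
  have r: "0 < r" using p False enn2real_pos by (simp add: r_def)
  \<comment> \<open>The \<open>r\<close>-th power of a supremum is at most the sum of the
    \<open>r\<close>-th powers. The weight \<open>2 powr (real k * \<eta>)\<close> turns this sum
    into a geometric series of ratio \<open>z\<close>, and \<open>C\<close> is the
    \<open>r\<close>-th root of its value.\<close>
  define z where "z = (2::real) powr (- \<eta> * r)"
  have z: "0 < z" "z < 1" using \<eta> r by (auto simp: z_def powr_less_one)
  define C where "C = (1 / (1 - z)) powr (1 / r)"
  show ?thesis
  proof (rule that[of C])
    show "0 \<le> C" by (simp add: C_def)
    fix M :: "'a measure" and F :: "nat \<Rightarrow> 'a \<Rightarrow> ennreal" assume [measurable]: "\<And>k. F k \<in> borel_measurable M"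
    define S where "S = (SUP k. ennreal (2 powr (real k * \<eta>)) * measure_norm M p (F k))"
    show "measure_norm M p (\<lambda>x. SUP k. F k x) \<le> ennreal C * S"
    proof (rule measure_norm_leI[OF p], unfold r_def[symmetric])
      show "p \<noteq> \<top>" using False by simp
      have "ennreal_powr (SUP k. F k x) r \<le> (\<Sum>k. ennreal_powr (F k x) r)" for x
        unfolding ennreal_powr_le_iff[OF r]
      proof (rule SUP_least)
        fix k
        have "ennreal_powr (F k x) r \<le> (\<Sum>k. ennreal_powr (F k x) r)"
          using sum_le_suminf[of "\<lambda>k. ennreal_powr (F k x) r" "{k}"] by simp
        then show "F k x \<le> ennreal_powr (\<Sum>k. ennreal_powr (F k x) r) (1 / r)"
          unfolding ennreal_powr_le_iff[OF r] .
      qed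
      then have "(\<integral>\<^sup>+ x. ennreal_powr (SUP k. F k x) r \<partial>M) \<le> (\<integral>\<^sup>+ x. (\<Sum>k. ennreal_powr (F k x) r) \<partial>M)"
        by (intro nn_integral_mono)
      also have "\<dots> = (\<Sum>k. \<integral>\<^sup>+ x. ennreal_powr (F k x) r \<partial>M)"
        by (rule nn_integral_suminf) measurable
      also have "\<dots> \<le> (\<Sum>k. ennreal (z ^ k) * ennreal_powr S r)"
      proof (rule suminf_le)
        fix k
        have "(\<integral>\<^sup>+ x. ennreal_powr (F k x) r \<partial>M) = ennreal_powr (measure_norm M p (F k)) r"
          using p False by (simp add: measure_norm_powr r_def)
        also have "measure_norm M p (F k) = ennreal (2 powr (- (real k * \<eta>))) * (ennreal (2 powr (real k * \<eta>)) * measure_norm M p (F k))"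
          by (simp add: mult.assoc[symmetric] powr_minus flip: ennreal_mult)
        also have "ennreal_powr (ennreal (2 powr (- (real k * \<eta>))) * (ennreal (2 powr (real k * \<eta>)) * measure_norm M p (F k))) r
            \<le> ennreal_powr (ennreal (2 powr (- (real k * \<eta>))) * S) r"
          using r by (intro ennreal_powr_mono mult_left_mono) (auto simp: S_def intro: SUP_upper)
        also have "\<dots> = ennreal ((2 powr (- (real k * \<eta>))) powr r) * ennreal_powr S r"
          using r by (simp only: ennreal_powr_mult) (subst ennreal_powr_ennreal, simp_all)
        also have "(2 powr (- (real k * \<eta>))) powr r = z ^ k"
          by (simp add: z_def powr_powr mult_ac flip: powr_realpow)
        finally show "(\<integral>\<^sup>+ x. ennreal_powr (F k x) r \<partial>M) \<le> ennreal (z ^ k) * ennreal_powr S r" .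
      qed auto
      also have "\<dots> = (\<Sum>k. ennreal (z ^ k)) * ennreal_powr S r"
        by (rule ennreal_suminf_multc)
      also have "(\<Sum>k. ennreal (z ^ k)) = ennreal (1 / (1 - z))"
        using z by (subst suminf_ennreal2) (auto simp: suminf_geometric summable_geometric)
      also have "ennreal (1 / (1 - z)) * ennreal_powr S r = ennreal_powr (ennreal C * S) r"
        using r z by (simp add: ennreal_powr_mult ennreal_powr_ennreal C_def powr_powr)
      finally show "(\<integral>\<^sup>+ x. ennreal_powr (SUP k. F k x) r \<partial>M) \<le> ennreal_powr (ennreal C * S) r" .
    qed
  qed
qed

text \<open>A triangle inequality valid for every positive exponent, with a constant depending only
  on the number \<open>w\<close> of terms: a sum is at most \<open>w\<close> times its largest term,
  whose \<open>r\<close>-th power is at most the sum of all \<open>r\<close>-th powers.\<close>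

lemma measure_norm_sum:
  assumes p: "0 < p"
  obtains C :: real where "0 < C"
    "\<And>(M::'a measure) (F::'j \<Rightarrow> 'a \<Rightarrow> ennreal) W g S. finite W \<Longrightarrow> card W \<le> w \<Longrightarrow> (\<And>j. j \<in> W \<Longrightarrow> F j \<in> borel_measurable M) \<Longrightarrow>
      g \<in> borel_measurable M \<Longrightarrow> (\<And>x. g x \<le> (\<Sum>j\<in>W. F j x)) \<Longrightarrow> (\<And>j. j \<in> W \<Longrightarrow> measure_norm M p (F j) \<le> S) \<Longrightarrow>
      measure_norm M p g \<le> ennreal C * S"
proof (cases "p = \<infinity>")
  case True
  show ?thesis
  proof (rule that[of "real w + 1"])
    fix M :: "'a measure" and F :: "'j \<Rightarrow> 'a \<Rightarrow> ennreal" and W g S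
    assume W: "finite W" "card W \<le> w" and [measurable]: "\<And>j. j \<in> W \<Longrightarrow> F j \<in> borel_measurable M" "g \<in> borel_measurable M"
      and g: "\<And>x. g x \<le> (\<Sum>j\<in>W. F j x)" and S: "\<And>j. j \<in> W \<Longrightarrow> measure_norm M p (F j) \<le> S"
    have "AE x in M. \<forall>j\<in>W. F j x \<le> esssup M (F j)"
      using W(1) esssup_AE by (subst AE_ball_countable) (auto intro: countable_finite)
    then have "AE x in M. g x \<le> of_nat (card W) * S"
    proof (rule eventually_mono)
      fix x assume *: "\<forall>j\<in>W. F j x \<le> esssup M (F j)"
      have "(\<Sum>j\<in>W. F j x) \<le> of_nat (card W) * S"
        using * S True by (intro sum_bounded_above) (auto simp: measure_norm_def intro: order_trans)
      then show "g x \<le> of_nat (card W) * S" using g order_trans by blast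
    qed
    then have "esssup M g \<le> of_nat (card W) * S" by (rule esssup_I[rotated]) simp
    also have "\<dots> \<le> ennreal (real w + 1) * S"
      using W(2) unfolding ennreal_of_nat_eq_real_of_nat by (intro mult_right_mono ennreal_leI) auto
    finally show "measure_norm M p g \<le> ennreal (real w + 1) * S" using True by (simp add: measure_norm_def)
  qed simp
next
  case False
  define r where "r = enn2real p"
  have r: "0 < r" using p False enn2real_pos by (simp add: r_def)
  define C where "C = (real w + 1) * (real w + 1) powr (1 / r)"
  show ?thesis
  proof (rule that[of C])
    show "0 < C" by (simp add: C_def)
    fix M :: "'a measure" and F :: "'j \<Rightarrow> 'a \<Rightarrow> ennreal" and W g S
    assume W: "finite W" "card W \<le> w" and [measurable]: "\<And>j. j \<in> W \<Longrightarrow> F j \<in> borel_measurable M" "g \<in> borel_measurable M"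
      and g: "\<And>x. g x \<le> (\<Sum>j\<in>W. F j x)" and S: "\<And>j. j \<in> W \<Longrightarrow> measure_norm M p (F j) \<le> S"
    show "measure_norm M p g \<le> ennreal C * S"
    proof (rule measure_norm_leI[OF p], unfold r_def[symmetric])
      show "p \<noteq> \<top>" using False by simp
      have "ennreal_powr (g x) r \<le> ennreal ((real w + 1) powr r) * (\<Sum>j\<in>W. ennreal_powr (F j x) r)" for x
      proof (cases "W = {}")
        case True
        then show ?thesis using g[of x] by simp
      next
        case False
        define m where "m = Max ((\<lambda>j. F j x) ` W)"
        have "m \<in> (\<lambda>j. F j x) ` W" unfolding m_def using W False by (intro Max_in) auto
        then obtain j where j: "j \<in> W" "m = F j x" by auto
        have "g x \<le> of_nat (card W) * m"
          using W by (intro order_trans[OF g] sum_bounded_above) (auto simp: m_def)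
        also have "\<dots> \<le> ennreal (real w + 1) * F j x"
          using W(2) unfolding j(2) ennreal_of_nat_eq_real_of_nat by (intro mult_right_mono ennreal_leI) auto
        finally have "ennreal_powr (g x) r \<le> ennreal_powr (ennreal (real w + 1) * F j x) r"
          using r by (intro ennreal_powr_mono) auto
        also have "\<dots> = ennreal ((real w + 1) powr r) * ennreal_powr (F j x) r"
          using r by (simp only: ennreal_powr_mult) (subst ennreal_powr_ennreal, simp_all)
        also have "\<dots> \<le> ennreal ((real w + 1) powr r) * (\<Sum>j\<in>W. ennreal_powr (F j x) r)"
          using W j by (intro mult_left_mono member_le_sum) auto
        finally show ?thesis .
      qed
      then have "(\<integral>\<^sup>+ x. ennreal_powr (g x) r \<partial>M) \<le> (\<integral>\<^sup>+ x. ennreal ((real w + 1) powr r) * (\<Sum>j\<in>W. ennreal_powr (F j x) r) \<partial>M)"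
        by (intro nn_integral_mono)
      also have "\<dots> = ennreal ((real w + 1) powr r) * (\<Sum>j\<in>W. \<integral>\<^sup>+ x. ennreal_powr (F j x) r \<partial>M)"
        by (subst nn_integral_cmult) (auto simp: nn_integral_sum)
      also have "\<dots> \<le> ennreal ((real w + 1) powr r) * (of_nat (card W) * ennreal_powr S r)"
      proof (intro mult_left_mono sum_bounded_above)
        fix j assume j: "j \<in> W"
        have "(\<integral>\<^sup>+ x. ennreal_powr (F j x) r \<partial>M) = ennreal_powr (measure_norm M p (F j)) r"
          using p False by (simp add: measure_norm_powr r_def)
        then show "(\<integral>\<^sup>+ x. ennreal_powr (F j x) r \<partial>M) \<le> ennreal_powr S r"
          using S[OF j] r by (simp add: ennreal_powr_mono)
      qed simp
      also have "\<dots> \<le> ennreal ((real w + 1) powr r) * (ennreal (real w + 1) * ennreal_powr S r)"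
        using W(2) unfolding ennreal_of_nat_eq_real_of_nat by (intro mult_left_mono mult_right_mono ennreal_leI) auto
      also have "\<dots> = ennreal_powr (ennreal C * S) r"
      proof -
        have "C powr r = (real w + 1) powr r * (real w + 1)" using r by (simp add: C_def powr_mult powr_powr)
        moreover have "ennreal_powr (ennreal C * S) r = ennreal (C powr r) * ennreal_powr S r"
          using r by (simp only: ennreal_powr_mult) (subst ennreal_powr_ennreal, simp_all add: C_def)
        ultimately show ?thesis by (simp only: ennreal_mult powr_ge_zero mult.assoc)
      qed
      finally show "(\<integral>\<^sup>+ x. ennreal_powr (g x) r \<partial>M) \<le> ennreal_powr (ennreal C * S) r" .
    qed
  qed
qed

text \<open>The \<open>\<ell>\<^sub>q\<close> quasi-norm of \<open>N\<close> ones, for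
  \<open>N \<ge> 1\<close>.\<close>

definition qpow :: "ennreal \<Rightarrow> real \<Rightarrow> real" where
  "qpow q N = (if q = \<infinity> then 1 else N powr (1 / enn2real q))"

lemma qpow_nonneg [simp]: "0 \<le> qpow q N"
  by (simp add: qpow_def)

lemma lq_norm_ge: "0 < q \<Longrightarrow> a j \<le> lq_norm q a"
proof (cases "q = \<infinity>")
  case True
  then show ?thesis by (auto simp: lq_norm_def intro: SUP_upper)
next
  case False
  assume q: "0 < q"
  have r: "0 < enn2real q" using q False enn2real_pos by simp
  have "ennreal_powr (a j) (enn2real q) = (\<integral>\<^sup>+ i. ennreal_powr (a i) (enn2real q) * indicator {j} i \<partial>count_space UNIV)"
    by (subst nn_integral_count_space'[of "{j}"]) (auto simp: indicator_def)
  also have "\<dots> \<le> (\<integral>\<^sup>+ i. ennreal_powr (a i) (enn2real q) \<partial>count_space UNIV)"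
    by (intro nn_integral_mono) (auto simp: indicator_def)
  finally show ?thesis using q False unfolding lq_norm_eq by (intro measure_norm_geI) auto
qed

lemma lq_norm_le_card:
  assumes q: "0 < q" and W: "finite W" "real (card W) \<le> N" and a: "\<And>j. j \<in> W \<Longrightarrow> a j \<le> c" "\<And>j. j \<notin> W \<Longrightarrow> a j = 0"
  shows "lq_norm q a \<le> ennreal (qpow q N) * c"
proof (cases "q = \<infinity>")
  case True
  have "a j \<le> c" for j using a by (cases "j \<in> W") auto
  then show ?thesis using True by (auto simp: lq_norm_def qpow_def intro: SUP_least)
next
  case False
  define r where "r = enn2real q"
  have r: "0 < r" using q False enn2real_pos by (simp add: r_def)
  have N: "0 \<le> N" using W(2) by (meson of_nat_0_le_iff order_trans)
  show ?thesis unfolding lq_norm_eq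
  proof (rule measure_norm_leI[OF q], unfold r_def[symmetric])
    have "(\<integral>\<^sup>+ j. ennreal_powr (a j) r \<partial>count_space UNIV) = (\<Sum>j\<in>W. ennreal_powr (a j) r)"
      using W a by (subst nn_integral_count_space'[of W]) auto
    also have "\<dots> \<le> of_nat (card W) * ennreal_powr c r"
      using r a by (intro sum_bounded_above ennreal_powr_mono) auto
    also have "\<dots> \<le> ennreal N * ennreal_powr c r"
      using W unfolding ennreal_of_nat_eq_real_of_nat by (intro mult_right_mono ennreal_leI) auto
    also have "\<dots> = ennreal_powr (ennreal (qpow q N) * c) r"
      using False r N by (simp add: qpow_def ennreal_powr_mult ennreal_powr_ennreal powr_powr flip: r_def)
    finally show "(\<integral>\<^sup>+ j. ennreal_powr (a j) r \<partial>count_space UNIV) \<le> ennreal_powr (ennreal (qpow q N) * c) r" .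
  qed (use False in simp)
qed

lemma lq_norm_ge_card:
  assumes q: "0 < q" and W: "finite W" "N \<le> real (card W)" "1 \<le> N" and a: "\<And>j. j \<in> W \<Longrightarrow> c \<le> a j"
  shows "ennreal (qpow q N) * c \<le> lq_norm q a"
proof (cases "q = \<infinity>")
  case True
  have "W \<noteq> {}" using W by auto
  then obtain j where "j \<in> W" by blast
  then show ?thesis using True a[of j] lq_norm_ge[OF q, of a j] by (simp add: qpow_def)
next
  case False
  define r where "r = enn2real q"
  have r: "0 < r" using q False enn2real_pos by (simp add: r_def)
  show ?thesis unfolding lq_norm_eq
  proof (rule measure_norm_geI[OF q], unfold r_def[symmetric])
    have "ennreal_powr (ennreal (qpow q N) * c) r = ennreal N * ennreal_powr c r"
      using False r W by (simp add: qpow_def ennreal_powr_mult ennreal_powr_ennreal powr_powr flip: r_def)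
    also have "\<dots> \<le> of_nat (card W) * ennreal_powr c r"
      using W unfolding ennreal_of_nat_eq_real_of_nat by (intro mult_right_mono ennreal_leI) auto
    also have "\<dots> \<le> (\<Sum>j\<in>W. ennreal_powr (a j) r)"
      using r a by (intro sum_bounded_below ennreal_powr_mono) auto
    also have "\<dots> = (\<integral>\<^sup>+ j. ennreal_powr (a j) r * indicator W j \<partial>count_space UNIV)"
      using W(1) by (subst nn_integral_count_space'[of W]) (auto simp: indicator_def)
    also have "\<dots> \<le> (\<integral>\<^sup>+ j. ennreal_powr (a j) r \<partial>count_space UNIV)"
      by (intro nn_integral_mono) (auto simp: indicator_def)
    finally show "ennreal_powr (ennreal (qpow q N) * c) r \<le> (\<integral>\<^sup>+ j. ennreal_powr (a j) r \<partial>count_space UNIV)" .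
  qed (use False in simp)
qed

lemma lq_norm_measurable:
  fixes F :: "'j::countable \<Rightarrow> 'a \<Rightarrow> ennreal"
  assumes [measurable]: "\<And>j. F j \<in> borel_measurable M"
  shows "(\<lambda>x. lq_norm q (\<lambda>j. F j x)) \<in> borel_measurable M"
proof (cases "q = \<infinity>")
  case True
  then show ?thesis unfolding lq_norm_def by simp
next
  case False
  interpret sigma_finite_measure "count_space (UNIV :: 'j set)"
    by (rule sigma_finite_measure_count_space_countable) simp
  have "(\<lambda>(x, j). ennreal_powr (F j x) (enn2real q)) \<in> borel_measurable (M \<Otimes>\<^sub>M count_space UNIV)"
    unfolding split_beta' by (rule measurable_compose_countable) measurable
  from borel_measurable_nn_integral[OF this] show ?thesis
    using False unfolding lq_norm_eq measure_norm_def by simp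
qed

subsection \<open>Random signs\<close>

text \<open>The set \<open>T\<close> of indices with sign plus encodes a choice of signs; averages
  over \<open>Pow S\<close> stand for expectations over independent random signs.\<close>

definition signed_sum :: "'l set \<Rightarrow> 'l set \<Rightarrow> ('l \<Rightarrow> 'b) \<Rightarrow> 'b::real_vector" where
  "signed_sum S T a = (\<Sum>l\<in>S. (if l \<in> T then 1 else - 1) *\<^sub>R a l)"

lemma signed_sum_scaleR: "signed_sum S T (\<lambda>l. c *\<^sub>R a l) = c *\<^sub>R signed_sum S T a"
  by (simp add: signed_sum_def scaleR_sum_right mult.commute)

lemma signed_sum_Re: "Re (signed_sum S T a) = signed_sum S T (\<lambda>l. Re (a l))"
  by (simp add: signed_sum_def)

lemma signed_sum_Im: "Im (signed_sum S T a) = signed_sum S T (\<lambda>l. Im (a l))"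
  by (simp add: signed_sum_def)

text \<open>Conditioning on the sign of the new index \<open>x\<close>. All moment estimates below
  are inductions along this identity.\<close>

lemma sum_Pow_insert:
  fixes \<Phi> :: "'b::real_vector \<Rightarrow> 'c::comm_monoid_add"
  assumes "finite S" "x \<notin> S"
  shows "(\<Sum>T\<in>Pow (insert x S). \<Phi> (signed_sum (insert x S) T a)) =
    (\<Sum>T\<in>Pow S. \<Phi> (signed_sum S T a + a x) + \<Phi> (signed_sum S T a - a x))"
proof -
  have 1: "signed_sum (insert x S) (insert x T) a = signed_sum S T a + a x" if "T \<subseteq> S" for T
  proof -
    have "(\<Sum>l\<in>S. (if l \<in> insert x T then 1 else - 1) *\<^sub>R a l) = signed_sum S T a"
      unfolding signed_sum_def using assms by (intro sum.cong) auto
    then show ?thesis using assms by (simp add: signed_sum_def add.commute)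
  qed
  have 2: "signed_sum (insert x S) T a = signed_sum S T a - a x" if "T \<subseteq> S" for T
    using that assms by (auto simp: signed_sum_def)
  have "(\<Sum>T\<in>Pow (insert x S). \<Phi> (signed_sum (insert x S) T a)) =
    (\<Sum>T\<in>Pow S. \<Phi> (signed_sum (insert x S) T a)) + (\<Sum>T\<in>insert x ` Pow S. \<Phi> (signed_sum (insert x S) T a))"
    unfolding Pow_insert using assms by (intro sum.union_disjoint) auto
  also have "(\<Sum>T\<in>insert x ` Pow S. \<Phi> (signed_sum (insert x S) T a)) = (\<Sum>T\<in>Pow S. \<Phi> (signed_sum (insert x S) (insert x T) a))"
    using assms by (subst sum.reindex) (auto simp: inj_on_def)
  finally show ?thesis using 1 2 by (simp add: sum.distrib add.commute)
qed

lemma signed_sum_second_moment: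
  fixes a :: "'l \<Rightarrow> complex"
  assumes "finite S"
  shows "(\<Sum>T\<in>Pow S. (norm (signed_sum S T a))\<^sup>2) = 2 ^ card S * (\<Sum>l\<in>S. (norm (a l))\<^sup>2)"
  using assms
proof (induction rule: finite_induct)
  case empty
  then show ?case by (simp add: signed_sum_def)
next
  case (insert x S)
  have par: "(norm (u + v))\<^sup>2 + (norm (u - v))\<^sup>2 = 2 * (norm u)\<^sup>2 + 2 * (norm v)\<^sup>2" for u v :: complex
    unfolding cmod_power2 by (simp add: power2_eq_square algebra_simps)
  have "(\<Sum>T\<in>Pow (insert x S). (norm (signed_sum (insert x S) T a))\<^sup>2) =
    (\<Sum>T\<in>Pow S. 2 * (norm (signed_sum S T a))\<^sup>2 + 2 * (norm (a x))\<^sup>2)"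
    using sum_Pow_insert[OF insert(1,2), of "\<lambda>u. (norm u)\<^sup>2" a] by (simp add: par)
  also have "\<dots> = 2 * (\<Sum>T\<in>Pow S. (norm (signed_sum S T a))\<^sup>2) + 2 ^ card S * (2 * (norm (a x))\<^sup>2)"
    using insert(1) by (simp add: sum.distrib sum_distrib_left card_Pow)
  also have "\<dots> = 2 ^ card (insert x S) * (\<Sum>l\<in>insert x S. (norm (a l))\<^sup>2)"
    using insert by (simp add: algebra_simps)
  finally show ?case .
qed

text \<open>The derivative of \<open>x\<^sup>2 / 2 - ln (cosh x)\<close> is
  \<open>x - tanh x\<close>, which is nonnegative for \<open>0 \<le> x\<close> because its own
  derivative is a square; evenness does the rest.\<close>

lemma cosh_le_exp_half_square: "cosh x \<le> exp (x\<^sup>2 / 2)" for x :: real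
proof -
  have nonneg: "cosh x \<le> exp (x\<^sup>2 / 2)" if "0 \<le> x" for x :: real
  proof -
    have t: "tanh y \<le> y" if "0 \<le> y" for y :: real
    proof -
      have "0 - tanh 0 \<le> y - tanh y"
      proof (rule DERIV_nonneg_imp_nondecreasing[OF that])
        fix z :: real
        show "\<exists>d. ((\<lambda>z. z - tanh z) has_real_derivative d) (at z) \<and> 0 \<le> d"
          by (intro exI[of _ "1 - (1 - (tanh z)\<^sup>2)"] conjI derivative_eq_intros) auto
      qed
      then show ?thesis by simp
    qed
    have "0\<^sup>2 / 2 - ln (cosh 0) \<le> x\<^sup>2 / 2 - ln (cosh x)"
    proof (rule DERIV_nonneg_imp_nondecreasing[OF that])
      fix z :: real assume "0 \<le> z"
      then show "\<exists>d. ((\<lambda>z. z\<^sup>2 / 2 - ln (cosh z)) has_real_derivative d) (at z) \<and> 0 \<le> d"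
        using t[of z] by (intro exI[of _ "z - tanh z"] conjI)
          (auto intro!: derivative_eq_intros simp: tanh_def cosh_real_pos divide_simps)
    qed
    then have "ln (cosh x) \<le> x\<^sup>2 / 2" by simp
    then show ?thesis using cosh_real_pos[of x] by (metis exp_le_cancel_iff exp_ln)
  qed
  show ?thesis using nonneg[of x] nonneg[of "- x"] by (cases "0 \<le> x") auto
qed

text \<open>Sub-Gaussian bound for the exponential moment: each sign contributes a factor
  \<open>cosh (a x)\<close>.\<close>

lemma signed_sum_exp:
  fixes a :: "'l \<Rightarrow> real"
  assumes "finite S"
  shows "(\<Sum>T\<in>Pow S. exp (signed_sum S T a)) \<le> 2 ^ card S * exp ((\<Sum>l\<in>S. (a l)\<^sup>2) / 2)"
  using assms
proof (induction rule: finite_induct)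
  case empty
  then show ?case by (simp add: signed_sum_def)
next
  case (insert x S)
  have "(\<Sum>T\<in>Pow (insert x S). exp (signed_sum (insert x S) T a)) =
    (\<Sum>T\<in>Pow S. exp (signed_sum S T a) * (2 * cosh (a x)))"
  proof -
    have "exp (u + v) + exp (u - v) = exp u * (2 * cosh v)" for u v :: real
      unfolding diff_conv_add_uminus exp_add cosh_def by (simp add: distrib_left)
    then show ?thesis using sum_Pow_insert[OF insert(1,2), of exp a] by simp
  qed
  also have "\<dots> = (\<Sum>T\<in>Pow S. exp (signed_sum S T a)) * (2 * cosh (a x))"
    by (simp add: sum_distrib_right)
  also have "\<dots> \<le> (2 ^ card S * exp ((\<Sum>l\<in>S. (a l)\<^sup>2) / 2)) * (2 * exp ((a x)\<^sup>2 / 2))"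
    using insert cosh_le_exp_half_square[of "a x"] by (intro mult_mono) (auto intro: less_imp_le[OF cosh_real_pos])
  also have "\<dots> = 2 ^ card (insert x S) * exp ((\<Sum>l\<in>insert x S. (a l)\<^sup>2) / 2)"
    using insert by (simp add: add_divide_distrib exp_add)
  finally show ?case .
qed

lemma powr_le_exp_abs:
  assumes "0 < (p::real)"
  obtains K where "0 < K" "\<And>y::real. \<bar>y\<bar> powr p \<le> K * (exp y + exp (- y))"
proof -
  define n where "n = nat \<lceil>p\<rceil>"
  have n: "p \<le> real n" unfolding n_def by linarith
  show ?thesis
  proof (rule that[of "1 + fact n"])
    show "0 < 1 + (fact n :: real)" by (simp add: add_pos_pos)
    fix y :: real
    have e: "exp \<bar>y\<bar> \<le> exp y + exp (- y)" by (cases "0 \<le> y") auto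
    have "\<bar>y\<bar> powr p \<le> 1 + \<bar>y\<bar> ^ n"
    proof (cases "\<bar>y\<bar> \<le> 1")
      case True
      then have "\<bar>y\<bar> powr p \<le> 1 powr p" using assms by (intro powr_mono2) auto
      then show ?thesis by (simp add: add_increasing2)
    next
      case False
      then have "\<bar>y\<bar> powr p \<le> \<bar>y\<bar> powr real n" using n by (intro powr_mono) auto
      then show ?thesis using False by (simp add: powr_realpow)
    qed
    also have "\<bar>y\<bar> ^ n \<le> fact n * exp \<bar>y\<bar>"
    proof -
      have "(\<Sum>k\<in>{n}. \<bar>y\<bar> ^ k /\<^sub>R fact k) \<le> exp \<bar>y\<bar>"
        unfolding exp_def by (intro sum_le_suminf summable_exp_generic) auto
      then show ?thesis by (simp add: field_simps)
    qed
    also have "1 + fact n * exp \<bar>y\<bar> \<le> (1 + fact n) * exp \<bar>y\<bar>" by (simp add: algebra_simps)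
    also have "\<dots> \<le> (1 + fact n) * (exp y + exp (- y))" using e by (intro mult_left_mono) (auto simp: add_nonneg_nonneg)
    finally show "\<bar>y\<bar> powr p \<le> (1 + fact n) * (exp y + exp (- y))" by simp
  qed
qed

text \<open>After division by \<open>D\<close> the exponential moments of the sum and of its
  negative are at most \<open>exp (1 / 2)\<close>, and they dominate every power. The hypothesis is
  an inequality in \<open>D\<close>, so that a pointwise majorant may replace the exact square
  function.\<close>

lemma khinchine_upper_real:
  assumes "0 < (p::real)"
  obtains K where "0 < K" "\<And>S (a :: 'l \<Rightarrow> real) D. finite S \<Longrightarrow> 0 < D \<Longrightarrow> (\<Sum>l\<in>S. (a l)\<^sup>2) \<le> D\<^sup>2 \<Longrightarrow>
    (\<Sum>T\<in>Pow S. \<bar>signed_sum S T a\<bar> powr p) \<le> K * 2 ^ card S * D powr p"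
proof -
  obtain K where K: "0 < K" "\<And>y::real. \<bar>y\<bar> powr p \<le> K * (exp y + exp (- y))" using powr_le_exp_abs[OF assms] by blast
  show ?thesis
  proof (rule that[of "K * (2 * exp (1 / 2))"])
    show "0 < K * (2 * exp (1 / 2))" using K(1) by simp
    fix S :: "'l set" and a :: "'l \<Rightarrow> real" and D assume S: "finite S" and D: "0 < D" and le: "(\<Sum>l\<in>S. (a l)\<^sup>2) \<le> D\<^sup>2"
    define b where "b l = a l / D" for l
    have bs: "(\<Sum>l\<in>S. (b l)\<^sup>2) \<le> 1"
      using le D by (simp add: b_def power_divide flip: sum_divide_distrib)
    have ab: "signed_sum S T a = D * signed_sum S T b" for T
      using signed_sum_scaleR[of S T D b] D by (simp add: b_def)
    have e: "(\<Sum>T\<in>Pow S. exp (signed_sum S T c)) \<le> 2 ^ card S * exp (1 / 2)" if "(\<Sum>l\<in>S. (c l)\<^sup>2) \<le> 1" for c :: "'l \<Rightarrow> real"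
      using that by (intro order_trans[OF signed_sum_exp[OF S]] mult_left_mono) auto
    have "(\<Sum>T\<in>Pow S. \<bar>signed_sum S T b\<bar> powr p) \<le>
      (\<Sum>T\<in>Pow S. K * (exp (signed_sum S T b) + exp (signed_sum S T (\<lambda>l. - b l))))"
      using K(2) signed_sum_scaleR[of S _ "-1" b] by (intro sum_mono) simp
    also have "\<dots> = K * ((\<Sum>T\<in>Pow S. exp (signed_sum S T b)) + (\<Sum>T\<in>Pow S. exp (signed_sum S T (\<lambda>l. - b l))))"
      by (simp add: sum.distrib flip: sum_distrib_left)
    also have "\<dots> \<le> K * (2 ^ card S * exp (1 / 2) + 2 ^ card S * exp (1 / 2))"
      using bs K(1) by (intro mult_left_mono add_mono e) auto
    finally have "(\<Sum>T\<in>Pow S. \<bar>signed_sum S T b\<bar> powr p) \<le> K * (2 * exp (1 / 2)) * 2 ^ card S" by (simp add: mult_ac)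
    then have "(\<Sum>T\<in>Pow S. \<bar>signed_sum S T b\<bar> powr p) * D powr p \<le> K * (2 * exp (1 / 2)) * 2 ^ card S * D powr p"
      by (intro mult_right_mono) auto
    then show "(\<Sum>T\<in>Pow S. \<bar>signed_sum S T a\<bar> powr p) \<le> K * (2 * exp (1 / 2)) * 2 ^ card S * D powr p"
      using D by (simp add: ab abs_mult powr_mult sum_distrib_left mult_ac)
  qed
qed

lemma khinchine_upper:
  assumes "0 < (p::real)"
  obtains K where "0 < K" "\<And>S (a :: 'l \<Rightarrow> complex) D. finite S \<Longrightarrow> 0 \<le> D \<Longrightarrow> (\<Sum>l\<in>S. (norm (a l))\<^sup>2) \<le> D\<^sup>2 \<Longrightarrow>
    (\<Sum>T\<in>Pow S. norm (signed_sum S T a) powr p) \<le> K * 2 ^ card S * D powr p"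
proof -
  obtain K where K: "0 < K" "\<And>S (a :: 'l \<Rightarrow> real) D. finite S \<Longrightarrow> 0 < D \<Longrightarrow> (\<Sum>l\<in>S. (a l)\<^sup>2) \<le> D\<^sup>2 \<Longrightarrow>
    (\<Sum>T\<in>Pow S. \<bar>signed_sum S T a\<bar> powr p) \<le> K * 2 ^ card S * D powr p"
    using khinchine_upper_real[OF assms] by metis
  show ?thesis
  proof (rule that[of "2 powr p * (2 * K)"])
    show "0 < 2 powr p * (2 * K)" using K(1) by simp
    fix S :: "'l set" and a :: "'l \<Rightarrow> complex" and D assume S: "finite S" and D: "0 \<le> D" and le: "(\<Sum>l\<in>S. (norm (a l))\<^sup>2) \<le> D\<^sup>2"
    show "(\<Sum>T\<in>Pow S. norm (signed_sum S T a) powr p) \<le> 2 powr p * (2 * K) * 2 ^ card S * D powr p"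
    proof (cases "D = 0")
      case True
      then have "(\<Sum>l\<in>S. (norm (a l))\<^sup>2) = 0" using le sum_nonneg[of S "\<lambda>l. (norm (a l))\<^sup>2"] by simp
      then have "a l = 0" if "l \<in> S" for l using that S by (simp add: sum_nonneg_eq_0_iff)
      then have "signed_sum S T a = 0" for T by (simp add: signed_sum_def)
      then show ?thesis using True by simp
    next
      case False
      then have D: "0 < D" using D by simp
      have part: "(\<Sum>l\<in>S. (f (a l))\<^sup>2) \<le> D\<^sup>2" if "\<And>z. \<bar>f z\<bar> \<le> norm z" for f :: "complex \<Rightarrow> real"
      proof -
        have "(\<Sum>l\<in>S. (f (a l))\<^sup>2) \<le> (\<Sum>l\<in>S. (norm (a l))\<^sup>2)"
          using that by (intro sum_mono) (auto simp: abs_le_square_iff[symmetric])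
        then show ?thesis using le by linarith
      qed
      have c: "norm z powr p \<le> 2 powr p * (\<bar>Re z\<bar> powr p + \<bar>Im z\<bar> powr p)" for z
      proof -
        have "norm z \<le> 2 * max \<bar>Re z\<bar> \<bar>Im z\<bar>" using cmod_le[of z] by linarith
        then have "norm z powr p \<le> (2 * max \<bar>Re z\<bar> \<bar>Im z\<bar>) powr p" using assms by (intro powr_mono2) auto
        also have "\<dots> = 2 powr p * (max \<bar>Re z\<bar> \<bar>Im z\<bar>) powr p" by (simp add: powr_mult)
        also have "\<dots> \<le> 2 powr p * (\<bar>Re z\<bar> powr p + \<bar>Im z\<bar> powr p)" by (intro mult_left_mono) (auto simp: max_def)
        finally show ?thesis .
      qed
      have "(\<Sum>T\<in>Pow S. norm (signed_sum S T a) powr p) \<le>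
        (\<Sum>T\<in>Pow S. 2 powr p * (\<bar>signed_sum S T (\<lambda>l. Re (a l))\<bar> powr p + \<bar>signed_sum S T (\<lambda>l. Im (a l))\<bar> powr p))"
        using c by (intro sum_mono) (simp add: signed_sum_Re[symmetric] signed_sum_Im[symmetric])
      also have "\<dots> = 2 powr p * ((\<Sum>T\<in>Pow S. \<bar>signed_sum S T (\<lambda>l. Re (a l))\<bar> powr p) + (\<Sum>T\<in>Pow S. \<bar>signed_sum S T (\<lambda>l. Im (a l))\<bar> powr p))"
        by (simp add: sum.distrib flip: sum_distrib_left)
      also have "\<dots> \<le> 2 powr p * (K * 2 ^ card S * D powr p + K * 2 ^ card S * D powr p)"
        by (intro mult_left_mono add_mono K(2)[OF S D] part abs_Re_le_cmod abs_Im_le_cmod) auto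
      finally show ?thesis by (simp add: mult_ac)
    qed
  qed
qed

text \<open>The lower bound interpolates the second moment between the \<open>p\<close>-th and the fourth:
  \<open>y\<^sup>2 \<le> 1/4 + K y\<^sup>p + y\<^sup>4 / T\<^sup>2\<close>, according to whether \<open>y < 1/2\<close>, \<open>1/2 \<le> y \<le> T\<close> or \<open>y > T\<close>.\<close>

lemma khinchine_lower:
  assumes "0 < (p::real)"
  obtains c where "0 < c" "\<And>S (a :: 'l \<Rightarrow> complex). finite S \<Longrightarrow>
    c * 2 ^ card S * sqrt (\<Sum>l\<in>S. (norm (a l))\<^sup>2) powr p \<le> (\<Sum>T\<in>Pow S. norm (signed_sum S T a) powr p)"
proof -
  obtain C where C: "0 < C" "\<And>S (a :: 'l \<Rightarrow> complex) D. finite S \<Longrightarrow> 0 \<le> D \<Longrightarrow> (\<Sum>l\<in>S. (norm (a l))\<^sup>2) \<le> D\<^sup>2 \<Longrightarrow>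
    (\<Sum>T\<in>Pow S. norm (signed_sum S T a) powr 4) \<le> C * 2 ^ card S * D powr 4"
    using khinchine_upper[of 4] by (metis zero_less_numeral)
  \<comment> \<open>The threshold is \<open>T\<^sup>2 = 4 * C\<close>: the normalised fourth moment
    is at most \<open>C\<close>, so the last term costs a quarter of the second moment; the constant
    \<open>1/4\<close> costs another, and half is left for the \<open>p\<close>-th moment. On the
    middle range \<open>2 * y \<ge> 1\<close> gives \<open>1 \<le> 2 powr p * y powr p\<close>,
    which determines \<open>K\<close>.\<close>
  define K where "K = 4 * C * 2 powr p"
  have K0: "0 < K" using C by (simp add: K_def)
  have pt: "y\<^sup>2 \<le> 1 / 4 + K * y powr p + y powr 4 / (4 * C)" if y: "0 \<le> y" for y :: real
  proof -
    have nn: "0 \<le> K * y powr p" "0 \<le> y powr 4 / (4 * C)" using K0 C(1) by auto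
    consider "y\<^sup>2 < 1 / 4" | "1 / 4 \<le> y\<^sup>2" "y\<^sup>2 \<le> 4 * C" | "4 * C < y\<^sup>2" by linarith
    then show ?thesis
    proof cases
      case 1
      then show ?thesis using nn by linarith
    next
      case 2
      have "(1 / 2)\<^sup>2 \<le> y\<^sup>2" using 2 by (simp add: power_divide)
      then have "1 / 2 \<le> y" using y by (rule power2_le_imp_le)
      then have "(1 / 2) powr p \<le> y powr p" using assms by (intro powr_mono2) auto
      then have "1 \<le> 2 powr p * y powr p" by (simp add: powr_divide field_simps)
      then have "4 * C * 1 \<le> 4 * C * (2 powr p * y powr p)" using C(1) by (intro mult_left_mono) auto
      then have "4 * C \<le> K * y powr p" by (simp add: K_def mult.assoc)
      then show ?thesis using 2 nn by linarith
    next
      case 3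
      have "y powr 4 = y\<^sup>2 * y\<^sup>2" using y by (simp add: powr_numeral power_numeral_reduce[of y] power2_eq_square)
      moreover have "4 * C * y\<^sup>2 \<le> y\<^sup>2 * y\<^sup>2" using 3 by (intro mult_right_mono) auto
      ultimately have "y\<^sup>2 \<le> y powr 4 / (4 * C)" using C(1) by (simp add: field_simps)
      then show ?thesis using nn by linarith
    qed
  qed
  show ?thesis
  proof (rule that[of "1 / (2 * K)"])
    show "0 < 1 / (2 * K)" using K0 by simp
    fix S :: "'l set" and a :: "'l \<Rightarrow> complex" assume S: "finite S"
    define \<sigma> where "\<sigma> = sqrt (\<Sum>l\<in>S. (norm (a l))\<^sup>2)"
    show "1 / (2 * K) * 2 ^ card S * \<sigma> powr p \<le> (\<Sum>T\<in>Pow S. norm (signed_sum S T a) powr p)"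
    proof (cases "\<sigma> = 0")
      case True
      then show ?thesis by (simp add: sum_nonneg)
    next
      case False
      have "0 \<le> \<sigma>" by (simp add: \<sigma>_def sum_nonneg)
      with False have \<sigma>: "0 < \<sigma>" by simp
      have \<sigma>2: "(\<Sum>l\<in>S. (norm (a l))\<^sup>2) = \<sigma>\<^sup>2" by (simp add: \<sigma>_def sum_nonneg)
      define b where "b l = a l /\<^sub>R \<sigma>" for l
      have b1: "(\<Sum>l\<in>S. (norm (b l))\<^sup>2) = 1"
        using \<sigma> \<sigma>2 by (simp add: b_def power_mult_distrib power_inverse flip: sum_distrib_left)
      have ab: "signed_sum S T a = \<sigma> *\<^sub>R signed_sum S T b" for T
        using signed_sum_scaleR[of S T \<sigma> b] \<sigma> by (simp add: b_def)
      define P where "P = (\<Sum>T\<in>Pow S. norm (signed_sum S T b) powr p)"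
      have "2 ^ card S = (\<Sum>T\<in>Pow S. (norm (signed_sum S T b))\<^sup>2)"
        using signed_sum_second_moment[OF S, of b] b1 by simp
      also have "\<dots> \<le> (\<Sum>T\<in>Pow S. 1 / 4 + K * norm (signed_sum S T b) powr p + norm (signed_sum S T b) powr 4 / (4 * C))"
        by (intro sum_mono pt) simp
      also have "\<dots> = 2 ^ card S / 4 + K * P + (\<Sum>T\<in>Pow S. norm (signed_sum S T b) powr 4) / (4 * C)"
        using S by (simp add: P_def sum.distrib card_Pow sum_distrib_left sum_divide_distrib)
      also have "(\<Sum>T\<in>Pow S. norm (signed_sum S T b) powr 4) \<le> C * 2 ^ card S * 1 powr 4"
        using b1 by (intro C(2)[OF S]) auto
      also have "(C * 2 ^ card S * 1 powr 4) / (4 * C) = 2 ^ card S / 4" using C(1) by simp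
      finally have "2 ^ card S \<le> 2 * K * P" using C(1) by (simp add: divide_right_mono)
      then have "1 / (2 * K) * 2 ^ card S \<le> P" using K0 by (simp add: field_simps)
      then have "1 / (2 * K) * 2 ^ card S * \<sigma> powr p \<le> P * \<sigma> powr p" by (rule mult_right_mono) simp
      also have "\<dots> = (\<Sum>T\<in>Pow S. norm (signed_sum S T a) powr p)"
        using \<sigma> by (simp add: P_def ab powr_mult sum_distrib_left mult.commute)
      finally show ?thesis .
    qed
  qed
qed

lemma ennreal_exists_le_average:
  fixes f :: "'i \<Rightarrow> ennreal"
  assumes "finite A" "A \<noteq> {}" "(\<Sum>i\<in>A. f i) \<le> of_nat (card A) * X"
  shows "\<exists>i\<in>A. f i \<le> X"
proof (rule ccontr)
  assume "\<not> (\<exists>i\<in>A. f i \<le> X)"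
  then have gt: "\<And>i. i \<in> A \<Longrightarrow> X < f i" by auto
  define m where "m = Min (f ` A)"
  have "m \<in> f ` A" unfolding m_def using assms by (intro Min_in) auto
  then have "X < m" using gt by auto
  have "of_nat (card A) * m \<le> (\<Sum>i\<in>A. f i)"
    using assms by (intro sum_bounded_below) (auto simp: m_def)
  then have "of_nat (card A) * m \<le> of_nat (card A) * X" using assms(3) by (rule order_trans)
  then have "m \<le> X"
    using assms(1,2) by (subst (asm) ennreal_mult_le_mult_iff) auto
  then show False using \<open>X < m\<close> by simp
qed

lemma ennreal_exists_ge_average:
  fixes f :: "'i \<Rightarrow> ennreal"
  assumes "finite A" "A \<noteq> {}" "of_nat (card A) * X \<le> (\<Sum>i\<in>A. f i)"
  shows "\<exists>i\<in>A. X \<le> f i"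
proof (rule ccontr)
  assume "\<not> (\<exists>i\<in>A. X \<le> f i)"
  then have gt: "\<And>i. i \<in> A \<Longrightarrow> f i < X" by auto
  define m where "m = Max (f ` A)"
  have "m \<in> f ` A" unfolding m_def using assms by (intro Max_in) auto
  then have "m < X" using gt by auto
  have "(\<Sum>i\<in>A. f i) \<le> of_nat (card A) * m"
    using assms by (intro sum_bounded_above) (auto simp: m_def)
  with assms(3) have "of_nat (card A) * X \<le> of_nat (card A) * m" by (rule order_trans)
  then have "X \<le> m"
    using assms(1,2) by (subst (asm) ennreal_mult_le_mult_iff) auto
  then show False using \<open>m < X\<close> by simp
qed

lemma signed_sum_measurable [measurable]:
  fixes h :: "'l \<Rightarrow> 'a \<Rightarrow> complex"
  assumes "\<And>l. h l \<in> borel_measurable M"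
  shows "(\<lambda>x. signed_sum S T (\<lambda>l. h l x)) \<in> borel_measurable M"
  unfolding signed_sum_def using assms by measurable

text \<open>One choice of signs has to serve all \<open>j\<close> in \<open>W\<close>, since a
  packet has several anisotropic levels. The integrals are therefore summed over \<open>W\<close>
  before averaging; bounding this sum and then each summand by it costs only a constant depending on
  \<open>w\<close>.\<close>

lemma signs_upper:
  assumes p: "0 < p" "p \<noteq> \<top>"
  obtains C :: real where "0 < C"
    "\<And>(S::'l set) (W::'j set) (h::'j \<Rightarrow> 'l \<Rightarrow> 'a::euclidean_space \<Rightarrow> complex) \<omega>. finite S \<Longrightarrow> finite W \<Longrightarrow> card W \<le> w \<Longrightarrow>
      (\<And>j l. h j l \<in> borel_measurable borel) \<Longrightarrow> \<omega> \<in> borel_measurable borel \<Longrightarrow>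
      (\<And>j l x. j \<in> W \<Longrightarrow> l \<in> S \<Longrightarrow> norm (h j l x) \<le> \<omega> x) \<Longrightarrow> (\<And>x. 0 \<le> \<omega> x) \<Longrightarrow>
      \<exists>T\<subseteq>S. \<forall>j\<in>W. Lp_norm p (\<lambda>x. ennreal (norm (signed_sum S T (\<lambda>l. h j l x)))) \<le>
        ennreal (C * sqrt (real (card S))) * Lp_norm p (\<lambda>x. ennreal (\<omega> x))"
proof -
  define r where "r = enn2real p"
  have r: "0 < r" using p enn2real_pos by (simp add: r_def)
  obtain K where K: "0 < K" "\<And>S (a :: 'l \<Rightarrow> complex) D. finite S \<Longrightarrow> 0 \<le> D \<Longrightarrow> (\<Sum>l\<in>S. (norm (a l))\<^sup>2) \<le> D\<^sup>2 \<Longrightarrow>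
    (\<Sum>T\<in>Pow S. norm (signed_sum S T a) powr r) \<le> K * 2 ^ card S * D powr r"
    using khinchine_upper[OF r] by metis
  define C where "C = ((real w + 1) * K) powr (1 / r)"
  have C0: "0 < C" using K(1) by (simp add: C_def)
  have Cr: "C powr r = (real w + 1) * K" using r K(1) by (simp add: C_def powr_powr)
  show ?thesis
  proof (rule that[OF C0])
    fix S :: "'l set" and W :: "'j set" and h :: "'j \<Rightarrow> 'l \<Rightarrow> 'a \<Rightarrow> complex" and \<omega> :: "'a \<Rightarrow> real"
    assume S: "finite S" and W: "finite W" "card W \<le> w" and [measurable]: "\<And>j l. h j l \<in> borel_measurable borel" "\<omega> \<in> borel_measurable borel"
      and h: "\<And>j l x. j \<in> W \<Longrightarrow> l \<in> S \<Longrightarrow> norm (h j l x) \<le> \<omega> x" and \<omega>: "\<And>x. 0 \<le> \<omega> x"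
    define N where "N = real (card S)"
    define I where "I = (\<integral>\<^sup>+ x. ennreal (\<omega> x powr r) \<partial>lborel)"
    define J where "J j T = (\<integral>\<^sup>+ x. ennreal (norm (signed_sum S T (\<lambda>l. h j l x)) powr r) \<partial>lborel)" for j T
    have pt: "(\<Sum>T\<in>Pow S. norm (signed_sum S T (\<lambda>l. h j l x)) powr r) \<le> K * 2 ^ card S * (sqrt N * \<omega> x) powr r"
      if "j \<in> W" for j x
    proof (rule K(2)[OF S])
      have "(\<Sum>l\<in>S. (norm (h j l x))\<^sup>2) \<le> (\<Sum>l\<in>S. (\<omega> x)\<^sup>2)"
        using h[OF that] by (intro sum_mono power_mono) auto
      then show "(\<Sum>l\<in>S. (norm (h j l x))\<^sup>2) \<le> (sqrt N * \<omega> x)\<^sup>2" by (simp add: N_def power_mult_distrib)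
    qed (use \<omega> in \<open>simp add: N_def\<close>)
    have "(\<Sum>T\<in>Pow S. J j T) \<le> ennreal (K * 2 ^ card S * sqrt N powr r) * I" if j: "j \<in> W" for j
    proof -
      have "(\<Sum>T\<in>Pow S. J j T) = (\<integral>\<^sup>+ x. (\<Sum>T\<in>Pow S. ennreal (norm (signed_sum S T (\<lambda>l. h j l x)) powr r)) \<partial>lborel)"
        unfolding J_def by (rule nn_integral_sum[symmetric]) measurable
      also have "\<dots> \<le> (\<integral>\<^sup>+ x. ennreal (K * 2 ^ card S * sqrt N powr r) * ennreal (\<omega> x powr r) \<partial>lborel)"
      proof (rule nn_integral_mono)
        fix x
        have "(\<Sum>T\<in>Pow S. ennreal (norm (signed_sum S T (\<lambda>l. h j l x)) powr r)) \<le> ennreal (K * 2 ^ card S * (sqrt N * \<omega> x) powr r)"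
          using pt[OF j, of x] by (subst sum_ennreal) (auto intro: ennreal_leI)
        also have "\<dots> = ennreal (K * 2 ^ card S * sqrt N powr r) * ennreal (\<omega> x powr r)"
          using K(1) \<omega>[of x] by (subst ennreal_mult[symmetric]) (auto simp: powr_mult N_def mult.assoc)
        finally show "(\<Sum>T\<in>Pow S. ennreal (norm (signed_sum S T (\<lambda>l. h j l x)) powr r)) \<le>
            ennreal (K * 2 ^ card S * sqrt N powr r) * ennreal (\<omega> x powr r)" .
      qed
      also have "\<dots> = ennreal (K * 2 ^ card S * sqrt N powr r) * I"
        unfolding I_def by (rule nn_integral_cmult) measurable
      finally show ?thesis .
    qed
    then have "(\<Sum>j\<in>W. \<Sum>T\<in>Pow S. J j T) \<le> of_nat (card W) * (ennreal (K * 2 ^ card S * sqrt N powr r) * I)"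
      by (rule sum_bounded_above)
    also have "\<dots> \<le> ennreal (real w + 1) * (ennreal (K * 2 ^ card S * sqrt N powr r) * I)"
      using W(2) unfolding ennreal_of_nat_eq_real_of_nat by (intro mult_right_mono ennreal_leI) auto
    also have "\<dots> = of_nat (card (Pow S)) * (ennreal ((C * sqrt N) powr r) * I)"
    proof -
      have "ennreal (real w + 1) * ennreal (K * 2 ^ card S * sqrt N powr r) = ennreal (2 ^ card S) * ennreal ((C * sqrt N) powr r)"
        using K(1) C0 by (subst (1 2) ennreal_mult[symmetric]) (auto simp: powr_mult Cr N_def mult_ac)
      moreover have "of_nat (card (Pow S)) = ennreal (2 ^ card S)"
        using S by (simp add: card_Pow ennreal_of_nat_eq_real_of_nat)
      ultimately show ?thesis by (simp only: mult.assoc[symmetric])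
    qed
    finally have "(\<Sum>T\<in>Pow S. \<Sum>j\<in>W. J j T) \<le> of_nat (card (Pow S)) * (ennreal ((C * sqrt N) powr r) * I)"
      by (subst sum.swap)
    then obtain T where T: "T \<subseteq> S" "(\<Sum>j\<in>W. J j T) \<le> ennreal ((C * sqrt N) powr r) * I"
      using ennreal_exists_le_average[of "Pow S" "\<lambda>T. \<Sum>j\<in>W. J j T"] S by auto
    show "\<exists>T\<subseteq>S. \<forall>j\<in>W. Lp_norm p (\<lambda>x. ennreal (norm (signed_sum S T (\<lambda>l. h j l x)))) \<le>
        ennreal (C * sqrt (real (card S))) * Lp_norm p (\<lambda>x. ennreal (\<omega> x))"
    proof (intro exI conjI ballI)
      show "T \<subseteq> S" by fact
      fix j assume j: "j \<in> W"
      have "J j T \<le> (\<Sum>j\<in>W. J j T)" using j W(1) by (intro member_le_sum) auto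
      with T(2) have le: "J j T \<le> ennreal ((C * sqrt N) powr r) * I" by (rule order_trans[rotated])
      have I: "I = ennreal_powr (Lp_norm p (\<lambda>x. ennreal (\<omega> x))) r"
        unfolding Lp_norm_eq r_def using p by (subst measure_norm_powr) (auto simp: I_def r_def ennreal_powr_ennreal \<omega>)
      have "ennreal ((C * sqrt N) powr r) = ennreal_powr (ennreal (C * sqrt N)) r"
        using C0 by (simp add: ennreal_powr_ennreal N_def)
      then have "ennreal ((C * sqrt N) powr r) * I = ennreal_powr (ennreal (C * sqrt N) * Lp_norm p (\<lambda>x. ennreal (\<omega> x))) r"
        using r by (simp only: ennreal_powr_mult I)
      with le show "Lp_norm p (\<lambda>x. ennreal (norm (signed_sum S T (\<lambda>l. h j l x)))) \<le>
        ennreal (C * sqrt (real (card S))) * Lp_norm p (\<lambda>x. ennreal (\<omega> x))"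
        unfolding Lp_norm_eq N_def by (intro measure_norm_leI p) (auto simp: J_def r_def ennreal_powr_ennreal)
    qed
  qed
qed

text \<open>The Khinchine lower bound is integrated over space and the signs are exchanged with the
  integral; some choice of signs is at least as good as the average. The square function remains in
  the statement because it is evaluated differently for concentric and for distant packets.\<close>

lemma signs_lower:
  assumes p: "0 < p" "p \<noteq> \<top>"
  obtains c :: real where "0 < c"
    "\<And>(S::'l set) (h::'l \<Rightarrow> 'a::euclidean_space \<Rightarrow> complex). finite S \<Longrightarrow> (\<And>l. h l \<in> borel_measurable borel) \<Longrightarrow>
      \<exists>T\<subseteq>S. ennreal c * Lp_norm p (\<lambda>x. ennreal (sqrt (\<Sum>l\<in>S. (norm (h l x))\<^sup>2))) \<le>
        Lp_norm p (\<lambda>x. ennreal (norm (signed_sum S T (\<lambda>l. h l x))))"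
proof -
  define r where "r = enn2real p"
  have r: "0 < r" using p enn2real_pos by (simp add: r_def)
  obtain k where k: "0 < k" "\<And>S (a :: 'l \<Rightarrow> complex). finite S \<Longrightarrow>
    k * 2 ^ card S * sqrt (\<Sum>l\<in>S. (norm (a l))\<^sup>2) powr r \<le> (\<Sum>T\<in>Pow S. norm (signed_sum S T a) powr r)"
    using khinchine_lower[OF r] by metis
  define c where "c = k powr (1 / r)"
  have c0: "0 < c" using k(1) by (simp add: c_def)
  have cr: "c powr r = k" using r k(1) by (simp add: c_def powr_powr)
  show ?thesis
  proof (rule that[OF c0])
    fix S :: "'l set" and h :: "'l \<Rightarrow> 'a \<Rightarrow> complex"
    assume S: "finite S" and [measurable]: "\<And>l. h l \<in> borel_measurable borel"
    define g where "g x = sqrt (\<Sum>l\<in>S. (norm (h l x))\<^sup>2)" for x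
    have [measurable]: "g \<in> borel_measurable borel" unfolding g_def by measurable
    have g0: "0 \<le> g x" for x by (simp add: g_def sum_nonneg)
    define J where "J T = (\<integral>\<^sup>+ x. ennreal (norm (signed_sum S T (\<lambda>l. h l x)) powr r) \<partial>lborel)" for T
    have "of_nat (card (Pow S)) * (ennreal k * (\<integral>\<^sup>+ x. ennreal (g x powr r) \<partial>lborel)) =
      (\<integral>\<^sup>+ x. of_nat (card (Pow S)) * (ennreal k * ennreal (g x powr r)) \<partial>lborel)"
      by (simp add: nn_integral_cmult)
    also have "\<dots> \<le> (\<integral>\<^sup>+ x. (\<Sum>T\<in>Pow S. ennreal (norm (signed_sum S T (\<lambda>l. h l x)) powr r)) \<partial>lborel)"
    proof (rule nn_integral_mono)
      fix x
      have "of_nat (card (Pow S)) = ennreal (2 ^ card S)"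
        using S by (simp add: card_Pow ennreal_of_nat_eq_real_of_nat)
      then have "of_nat (card (Pow S)) * (ennreal k * ennreal (g x powr r)) = ennreal (k * 2 ^ card S * g x powr r)"
        using k(1) by (simp only:) (simp add: ennreal_mult mult_ac)
      also have "\<dots> \<le> ennreal (\<Sum>T\<in>Pow S. norm (signed_sum S T (\<lambda>l. h l x)) powr r)"
        unfolding g_def by (intro ennreal_leI k(2) S)
      finally show "of_nat (card (Pow S)) * (ennreal k * ennreal (g x powr r)) \<le>
          (\<Sum>T\<in>Pow S. ennreal (norm (signed_sum S T (\<lambda>l. h l x)) powr r))" by (subst sum_ennreal) auto
    qed
    also have "\<dots> = (\<Sum>T\<in>Pow S. J T)" unfolding J_def by (rule nn_integral_sum) measurable
    finally obtain T where T: "T \<subseteq> S" "ennreal k * (\<integral>\<^sup>+ x. ennreal (g x powr r) \<partial>lborel) \<le> J T"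
      using ennreal_exists_ge_average[of "Pow S" _ J] S by auto
    have I: "(\<integral>\<^sup>+ x. ennreal (g x powr r) \<partial>lborel) = ennreal_powr (Lp_norm p (\<lambda>x. ennreal (g x))) r"
      unfolding Lp_norm_eq r_def using p by (subst measure_norm_powr) (auto simp: r_def ennreal_powr_ennreal g0)
    have "ennreal k = ennreal_powr (ennreal c) r" using c0 cr by (simp add: ennreal_powr_ennreal)
    then have "ennreal_powr (ennreal c * Lp_norm p (\<lambda>x. ennreal (g x))) r \<le> J T"
      using T(2) r by (simp only: ennreal_powr_mult I)
    then have "ennreal c * Lp_norm p (\<lambda>x. ennreal (g x)) \<le> Lp_norm p (\<lambda>x. ennreal (norm (signed_sum S T (\<lambda>l. h l x))))"
      unfolding Lp_norm_eq by (intro measure_norm_geI p) (auto simp: J_def r_def ennreal_powr_ennreal)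
    then show "\<exists>T\<subseteq>S. ennreal c * Lp_norm p (\<lambda>x. ennreal (sqrt (\<Sum>l\<in>S. (norm (h l x))\<^sup>2))) \<le>
        Lp_norm p (\<lambda>x. ennreal (norm (signed_sum S T (\<lambda>l. h l x))))"
      using T(1) unfolding g_def by blast
  qed
qed

subsection \<open>Mixed quasi-norms\<close>

text \<open>The Besov type \<open>\<ell>\<^sub>q(L\<^sub>p)\<close> for \<^term>\<open>True\<close>, the Triebel--Lizorkin type \<open>L\<^sub>p(\<ell>\<^sub>q)\<close> for \<^term>\<open>False\<close>.\<close>

definition mixed_norm :: "bool \<Rightarrow> ennreal \<Rightarrow> ennreal \<Rightarrow> ('j \<Rightarrow> 'a::euclidean_space \<Rightarrow> ennreal) \<Rightarrow> ennreal" where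
  "mixed_norm b p q F = (if b then lq_norm q (\<lambda>j. Lp_norm p (F j)) else Lp_norm p (\<lambda>x. lq_norm q (\<lambda>j. F j x)))"

lemma Lp_norm_mono:
  assumes "\<And>x. f x \<le> g x" "f \<in> borel_measurable borel" "0 < p"
  shows "Lp_norm p f \<le> Lp_norm p g"
  unfolding Lp_norm_eq using assms by (intro measure_norm_mono) auto

lemma lq_norm_mono:
  assumes "\<And>j. a j \<le> b j" "0 < q"
  shows "lq_norm q a \<le> lq_norm q b"
  unfolding lq_norm_eq using assms by (intro measure_norm_mono) auto

lemma Lp_norm_cmult:
  assumes "f \<in> borel_measurable borel" "0 < p" "c < \<top>"
  shows "Lp_norm p (\<lambda>x. c * f x) = c * Lp_norm p f"
  unfolding Lp_norm_eq using assms by (intro measure_norm_cmult) auto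

lemma lq_norm_cmult: "0 < q \<Longrightarrow> c < \<top> \<Longrightarrow> lq_norm q (\<lambda>j. c * a j) = c * lq_norm q a"
  unfolding lq_norm_eq by (intro measure_norm_cmult) auto

lemma mixed_norm_mono:
  fixes F :: "'j::countable \<Rightarrow> 'a::euclidean_space \<Rightarrow> ennreal"
  assumes "\<And>j x. F j x \<le> F' j x" "\<And>j. F j \<in> borel_measurable borel" "0 < p" "0 < q"
  shows "mixed_norm b p q F \<le> mixed_norm b p q F'"
  unfolding mixed_norm_def using assms
  by (auto intro!: lq_norm_mono Lp_norm_mono lq_norm_measurable)

lemma mixed_norm_cmult:
  fixes F :: "'j::countable \<Rightarrow> 'a::euclidean_space \<Rightarrow> ennreal"
  assumes "\<And>j. F j \<in> borel_measurable borel" "0 < p" "0 < q" "c < \<top>"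
  shows "mixed_norm b p q (\<lambda>j x. c * F j x) = c * mixed_norm b p q F"
  unfolding mixed_norm_def using assms
  by (simp add: Lp_norm_cmult lq_norm_cmult lq_norm_measurable)

lemma mixed_norm_component:
  fixes F :: "'j::countable \<Rightarrow> 'a::euclidean_space \<Rightarrow> ennreal"
  assumes "\<And>j. F j \<in> borel_measurable borel" "0 < p" "0 < q"
  shows "Lp_norm p (F j) \<le> mixed_norm b p q F"
proof (cases b)
  case True
  then show ?thesis using lq_norm_ge[OF assms(3), of "\<lambda>j. Lp_norm p (F j)" j] by (simp add: mixed_norm_def)
next
  case False
  then show ?thesis using assms lq_norm_ge[OF assms(3)] by (auto simp: mixed_norm_def intro!: Lp_norm_mono)
qed

text \<open>The bound for a single quasi-norm is used once for \<open>\<ell>\<^sub>q\<close> and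
  once for \<open>L\<^sub>p\<close>, in the order dictated by \<open>b\<close>; each application
  spends half of \<open>\<eta>\<close>.\<close>

lemma mixed_norm_SUP:
  assumes p: "0 < p" and q: "0 < q" and \<eta>: "0 < (\<eta>::real)"
  obtains C :: real where "0 \<le> C"
    "\<And>F::nat \<Rightarrow> 'j::countable \<Rightarrow> 'a::euclidean_space \<Rightarrow> ennreal. (\<And>k j. F k j \<in> borel_measurable borel) \<Longrightarrow>
      mixed_norm b p q (\<lambda>j x. SUP k. F k j x) \<le> ennreal C * (SUP k. ennreal (2 powr (real k * \<eta>)) * mixed_norm b p q (F k))"
proof -
  obtain C1 where C1: "0 \<le> C1" "\<And>(M::'a measure) F. (\<And>k. F k \<in> borel_measurable M) \<Longrightarrow>
      measure_norm M p (\<lambda>x. SUP k. F k x) \<le> ennreal C1 * (SUP k. ennreal (2 powr (real k * (\<eta> / 2))) * measure_norm M p (F k))"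
    by (rule measure_norm_SUP[OF p half_gt_zero[OF \<eta>]]) blast
  obtain C2 where C2: "0 \<le> C2" "\<And>(M::'j measure) F. (\<And>k. F k \<in> borel_measurable M) \<Longrightarrow>
      measure_norm M q (\<lambda>x. SUP k. F k x) \<le> ennreal C2 * (SUP k. ennreal (2 powr (real k * (\<eta> / 2))) * measure_norm M q (F k))"
    by (rule measure_norm_SUP[OF q half_gt_zero[OF \<eta>]]) blast
  define e where "e k = ennreal (2 powr (real k * (\<eta> / 2)))" for k :: nat
  have e: "e k < \<top>" for k by (simp add: e_def)
  have ee: "e k * (e k * y) = ennreal (2 powr (real k * \<eta>)) * y" for k y
    by (simp add: e_def mult.assoc[symmetric] mult.commute[of \<eta>] flip: ennreal_mult powr_add)
  show ?thesis
  proof (rule that[of "C1 * C2"])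
    show "0 \<le> C1 * C2" using C1 C2 by simp
    fix F :: "nat \<Rightarrow> 'j \<Rightarrow> 'a \<Rightarrow> ennreal" assume [measurable]: "\<And>k j. F k j \<in> borel_measurable borel"
    show "mixed_norm b p q (\<lambda>j x. SUP k. F k j x) \<le> ennreal (C1 * C2) * (SUP k. ennreal (2 powr (real k * \<eta>)) * mixed_norm b p q (F k))"
    proof (cases b)
      case True
      have "lq_norm q (\<lambda>j. Lp_norm p (\<lambda>x. SUP k. F k j x)) \<le> lq_norm q (\<lambda>j. ennreal C1 * (SUP k. e k * Lp_norm p (F k j)))"
        unfolding Lp_norm_eq e_def by (intro lq_norm_mono C1(2) q) simp
      also have "\<dots> = ennreal C1 * lq_norm q (\<lambda>j. SUP k. e k * Lp_norm p (F k j))"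
        by (rule lq_norm_cmult[OF q]) simp
      also have "\<dots> \<le> ennreal C1 * (ennreal C2 * (SUP k. e k * lq_norm q (\<lambda>j. e k * Lp_norm p (F k j))))"
        unfolding lq_norm_eq e_def by (intro mult_left_mono C2(2)) auto
      also have "\<dots> = ennreal (C1 * C2) * (SUP k. ennreal (2 powr (real k * \<eta>)) * lq_norm q (\<lambda>j. Lp_norm p (F k j)))"
        using C1(1) C2(1) by (simp only: lq_norm_cmult[OF q e] ee ennreal_mult mult.assoc)
      finally show ?thesis using True by (simp add: mixed_norm_def)
    next
      case False
      have [measurable]: "(\<lambda>x. lq_norm q (\<lambda>j. F k j x)) \<in> borel_measurable borel" for k
        by (rule lq_norm_measurable) simp
      have "Lp_norm p (\<lambda>x. lq_norm q (\<lambda>j. SUP k. F k j x)) \<le> Lp_norm p (\<lambda>x. ennreal C2 * (SUP k. e k * lq_norm q (\<lambda>j. F k j x)))"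
      proof (intro Lp_norm_mono p)
        show "lq_norm q (\<lambda>j. SUP k. F k j x) \<le> ennreal C2 * (SUP k. e k * lq_norm q (\<lambda>j. F k j x))" for x
          unfolding lq_norm_eq e_def by (intro C2(2)) simp
      qed (intro lq_norm_measurable, measurable)
      also have "\<dots> = ennreal C2 * Lp_norm p (\<lambda>x. SUP k. e k * lq_norm q (\<lambda>j. F k j x))"
        by (rule Lp_norm_cmult[OF _ p]) auto
      also have "\<dots> \<le> ennreal C2 * (ennreal C1 * (SUP k. e k * Lp_norm p (\<lambda>x. e k * lq_norm q (\<lambda>j. F k j x))))"
        unfolding Lp_norm_eq e_def by (intro mult_left_mono C1(2)) auto
      also have "\<dots> = ennreal (C1 * C2) * (SUP k. ennreal (2 powr (real k * \<eta>)) * Lp_norm p (\<lambda>x. lq_norm q (\<lambda>j. F k j x)))"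
        using C1(1) C2(1) by (simp add: Lp_norm_cmult p e ee ennreal_mult mult_ac)
      finally show ?thesis using False by (simp add: mixed_norm_def)
    qed
  qed
qed

text \<open>With at most \<open>w\<close> active indices the order of the two norms and the value of
  \<open>q\<close> affect only constants. This and the companion upper bound reduce the anisotropic
  quasi-norm to \<open>L\<^sub>p\<close>.\<close>

lemma mixed_norm_window_lower:
  assumes p: "0 < p" and q: "0 < q"
  obtains K :: real where "0 < K"
    "\<And>(F::'j::countable \<Rightarrow> 'a::euclidean_space \<Rightarrow> ennreal) W g. finite W \<Longrightarrow> card W \<le> w \<Longrightarrow> (\<And>j. F j \<in> borel_measurable borel) \<Longrightarrow>
      g \<in> borel_measurable borel \<Longrightarrow> (\<And>x. g x \<le> (\<Sum>j\<in>W. F j x)) \<Longrightarrow> Lp_norm p g \<le> ennreal K * mixed_norm b p q F"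
proof -
  obtain K where K: "0 < K" "\<And>(M::'a measure) (F::'j \<Rightarrow> 'a \<Rightarrow> ennreal) W g S. finite W \<Longrightarrow> card W \<le> w \<Longrightarrow> (\<And>j. j \<in> W \<Longrightarrow> F j \<in> borel_measurable M) \<Longrightarrow>
      g \<in> borel_measurable M \<Longrightarrow> (\<And>x. g x \<le> (\<Sum>j\<in>W. F j x)) \<Longrightarrow> (\<And>j. j \<in> W \<Longrightarrow> measure_norm M p (F j) \<le> S) \<Longrightarrow>
      measure_norm M p g \<le> ennreal K * S" by (rule measure_norm_sum[OF p]) blast
  show ?thesis
  proof (rule that[OF K(1)])
    fix F :: "'j \<Rightarrow> 'a \<Rightarrow> ennreal" and W g
    assume *: "finite W" "card W \<le> w" "\<And>j. F j \<in> borel_measurable borel" "g \<in> borel_measurable borel" "\<And>x. g x \<le> (\<Sum>j\<in>W. F j x)"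
    show "Lp_norm p g \<le> ennreal K * mixed_norm b p q F"
      unfolding Lp_norm_eq using * mixed_norm_component[of F p q, OF *(3) p q]
      by (intro K(2)[of W F]) (auto simp: Lp_norm_eq)
  qed
qed

lemma mixed_norm_window_upper:
  assumes p: "0 < p" and q: "0 < q"
  obtains K :: real where "0 < K"
    "\<And>(F::'j::countable \<Rightarrow> 'a::euclidean_space \<Rightarrow> ennreal) W S. finite W \<Longrightarrow> card W \<le> w \<Longrightarrow> (\<And>j. F j \<in> borel_measurable borel) \<Longrightarrow>
      (\<And>j x. j \<notin> W \<Longrightarrow> F j x = 0) \<Longrightarrow> (\<And>j. j \<in> W \<Longrightarrow> Lp_norm p (F j) \<le> S) \<Longrightarrow> mixed_norm b p q F \<le> ennreal K * S"
proof -
  obtain K where K: "0 < K" "\<And>(M::'a measure) (F::'j \<Rightarrow> 'a \<Rightarrow> ennreal) W g S. finite W \<Longrightarrow> card W \<le> w \<Longrightarrow> (\<And>j. j \<in> W \<Longrightarrow> F j \<in> borel_measurable M) \<Longrightarrow>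
      g \<in> borel_measurable M \<Longrightarrow> (\<And>x. g x \<le> (\<Sum>j\<in>W. F j x)) \<Longrightarrow> (\<And>j. j \<in> W \<Longrightarrow> measure_norm M p (F j) \<le> S) \<Longrightarrow>
      measure_norm M p g \<le> ennreal K * S" by (rule measure_norm_sum[OF p]) blast
  have zero: "Lp_norm p (\<lambda>x::'a. 0) = 0"
    using Lp_norm_cmult[of "\<lambda>x::'a. 0" p 0] p by simp
  define Q where "Q = qpow q (real w)"
  have Q0: "0 \<le> Q" by (simp add: Q_def)
  show ?thesis
  proof (rule that[of "(Q + 1) * (K + 1)"])
    show "0 < (Q + 1) * (K + 1)" using K(1) Q0 by simp
    fix F :: "'j \<Rightarrow> 'a \<Rightarrow> ennreal" and W S
    assume W: "finite W" "card W \<le> w" and [measurable]: "\<And>j. F j \<in> borel_measurable borel"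
      and z: "\<And>j x. j \<notin> W \<Longrightarrow> F j x = 0" and S: "\<And>j. j \<in> W \<Longrightarrow> Lp_norm p (F j) \<le> S"
    have Wr: "real (card W) \<le> real w" using W by simp
    show "mixed_norm b p q F \<le> ennreal ((Q + 1) * (K + 1)) * S"
    proof (cases b)
      case True
      have "F j = (\<lambda>x. 0)" if "j \<notin> W" for j using z[OF that] by auto
      then have "lq_norm q (\<lambda>j. Lp_norm p (F j)) \<le> ennreal Q * S"
        unfolding Q_def using S zero by (intro lq_norm_le_card[OF q W(1) Wr]) auto
      also have "\<dots> \<le> ennreal ((Q + 1) * (K + 1)) * S"
        using K(1) Q0 by (intro mult_right_mono ennreal_leI) (auto simp: algebra_simps)
      finally show ?thesis using True by (simp add: mixed_norm_def)
    next
      case False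
      have "lq_norm q (\<lambda>j. F j x) \<le> ennreal Q * (\<Sum>j\<in>W. F j x)" for x
        unfolding Q_def using W z by (intro lq_norm_le_card[OF q W(1) Wr]) (auto intro!: member_le_sum)
      then have "Lp_norm p (\<lambda>x. lq_norm q (\<lambda>j. F j x)) \<le> Lp_norm p (\<lambda>x. ennreal Q * (\<Sum>j\<in>W. F j x))"
        by (intro Lp_norm_mono p lq_norm_measurable) auto
      also have "\<dots> = ennreal Q * Lp_norm p (\<lambda>x. \<Sum>j\<in>W. F j x)"
        by (rule Lp_norm_cmult[OF _ p]) auto
      also have "\<dots> \<le> ennreal Q * (ennreal K * S)"
        unfolding Lp_norm_eq using S by (intro mult_left_mono K(2)[OF W, of F]) (auto simp: Lp_norm_eq)
      also have "\<dots> = ennreal (Q * K) * S" using Q0 K(1) by (simp add: ennreal_mult mult.assoc)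
      also have "\<dots> \<le> ennreal ((Q + 1) * (K + 1)) * S"
        using K(1) Q0 by (intro mult_right_mono ennreal_leI) (auto simp: algebra_simps)
      finally show ?thesis using False by (simp add: mixed_norm_def)
    qed
  qed
qed

text \<open>For \<open>\<ell>\<^sub>q(L\<^sub>p)\<close> only the \<open>L\<^sub>p\<close> norms of
  the majorants count, so they may sit at different places. For
  \<open>L\<^sub>p(\<ell>\<^sub>q)\<close> the inner norm is taken at each point, and the count
  \<open>N\<close> comes out only if all indices share one majorant; this is the hypothesis
  \<open>common\<close>.\<close>

lemma mixed_norm_le_card:
  fixes F :: "'j::countable \<Rightarrow> 'a::euclidean_space \<Rightarrow> ennreal"
  assumes p: "0 < p" and q: "0 < q" and W: "finite W" "real (card W) \<le> N"
    and m: "\<And>j. F j \<in> borel_measurable borel" "\<And>j. \<omega> j \<in> borel_measurable borel"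
    and z: "\<And>j x. j \<notin> W \<Longrightarrow> F j x = 0" and le: "\<And>j x. j \<in> W \<Longrightarrow> F j x \<le> \<omega> j x"
    and S: "\<And>j. j \<in> W \<Longrightarrow> Lp_norm p (\<omega> j) \<le> S" and common: "\<not> b \<Longrightarrow> (\<And>j j'. \<omega> j = \<omega> j')"
  shows "mixed_norm b p q F \<le> ennreal (qpow q N) * S"
proof -
  have zero: "Lp_norm p (\<lambda>x::'a. 0) = 0"
    using Lp_norm_cmult[of "\<lambda>x::'a. 0" p 0] p by simp
  have F0: "F j = (\<lambda>x. 0)" if "j \<notin> W" for j using z[OF that] by auto
  have "Lp_norm p (F j) \<le> S" if "j \<in> W" for j
    using order_trans[OF Lp_norm_mono S[OF that]] le[OF that] m p by blast
  then have True: "lq_norm q (\<lambda>j. Lp_norm p (F j)) \<le> ennreal (qpow q N) * S"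
    using zero F0 by (intro lq_norm_le_card[OF q W]) auto
  show ?thesis
  proof (cases "b \<or> W = {}")
    case True
    show ?thesis
    proof (cases b)
      case False
      then have "F j = (\<lambda>x. 0)" for j using True F0 by auto
      moreover have "lq_norm q (\<lambda>j::'j. 0) = 0" using lq_norm_cmult[OF q, of 0 "\<lambda>j::'j. 0"] by simp
      ultimately show ?thesis using False zero by (simp add: mixed_norm_def)
    qed (use \<open>lq_norm q (\<lambda>j. Lp_norm p (F j)) \<le> ennreal (qpow q N) * S\<close> in \<open>simp add: mixed_norm_def\<close>)
  next
    case False
    then obtain j0 where j0: "j0 \<in> W" by blast
    have c: "\<omega> j = \<omega> j0" for j using common False by blast
    have "Lp_norm p (\<lambda>x. lq_norm q (\<lambda>j. F j x)) \<le> Lp_norm p (\<lambda>x. ennreal (qpow q N) * \<omega> j0 x)"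
    proof (intro Lp_norm_mono p lq_norm_measurable m)
      fix x
      have "F j x \<le> \<omega> j0 x" if "j \<in> W" for j using le[OF that, of x] unfolding c[of j] .
      then show "lq_norm q (\<lambda>j. F j x) \<le> ennreal (qpow q N) * \<omega> j0 x"
        using z by (intro lq_norm_le_card[OF q W]) simp_all
    qed
    also have "\<dots> = ennreal (qpow q N) * Lp_norm p (\<omega> j0)"
      using m by (intro Lp_norm_cmult p) auto
    also have "\<dots> \<le> ennreal (qpow q N) * S" by (intro mult_left_mono S j0) simp
    finally show ?thesis using False by (simp add: mixed_norm_def)
  qed
qed

lemma exists_ge_average:
  fixes f :: "'i \<Rightarrow> ennreal"
  assumes "finite W" "W \<noteq> {}" "card W \<le> w" "y \<le> (\<Sum>i\<in>W. f i)"
  shows "\<exists>i\<in>W. ennreal (1 / real w) * y \<le> f i"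
proof (rule ennreal_exists_ge_average[OF assms(1,2)])
  have w: "0 < real w" using assms by (metis card_gt_0_iff le_zero_eq not_gr0 of_nat_0_less_iff)
  have "of_nat (card W) * (ennreal (1 / real w) * y) \<le> ennreal (real w) * (ennreal (1 / real w) * y)"
    using assms(3) unfolding ennreal_of_nat_eq_real_of_nat by (intro mult_right_mono ennreal_leI) auto
  also have "\<dots> = y" using w by (simp add: mult.assoc[symmetric] flip: ennreal_mult)
  finally show "of_nat (card W) * (ennreal (1 / real w) * y) \<le> (\<Sum>i\<in>W. f i)" using assms(4) by simp
qed

text \<open>From each window one large entry is chosen; disjointness makes the choice injective, so
  at least \<open>N\<close> entries of the sequence are large.\<close>

lemma lq_norm_ge_disjoint:
  assumes q: "0 < q" and L: "finite L" "N \<le> real (card L)" "1 \<le> N"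
    and W: "\<And>l. l \<in> L \<Longrightarrow> \<exists>j\<in>W l. y \<le> a j"
    and disj: "\<And>l l'. l \<in> L \<Longrightarrow> l' \<in> L \<Longrightarrow> l \<noteq> l' \<Longrightarrow> W l \<inter> W l' = {}"
  shows "ennreal (qpow q N) * y \<le> lq_norm q a"
proof -
  obtain J where J: "\<And>l. l \<in> L \<Longrightarrow> J l \<in> W l \<and> y \<le> a (J l)" using W by metis
  have "inj_on J L"
  proof (rule inj_onI, rule ccontr)
    fix l l' assume l: "l \<in> L" "l' \<in> L" "J l = J l'" "l \<noteq> l'"
    then have "J l \<in> W l \<inter> W l'" using J by force
    then show False using disj l by auto
  qed
  then have "card (J ` L) = card L" by (rule card_image)
  then show ?thesis using L J by (intro lq_norm_ge_card[OF q, of "J ` L"]) auto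
qed

lemma mixed_norm_ge_card:
  assumes p: "0 < p" and q: "0 < q"
  obtains c :: real where "0 < c"
    "\<And>(F::'j::countable \<Rightarrow> 'a::euclidean_space \<Rightarrow> ennreal) (L::'l set) W N g S. finite L \<Longrightarrow> N \<le> real (card L) \<Longrightarrow> 1 \<le> N \<Longrightarrow>
      (\<And>j. F j \<in> borel_measurable borel) \<Longrightarrow> (\<And>l. g l \<in> borel_measurable borel) \<Longrightarrow>
      (\<And>l. l \<in> L \<Longrightarrow> finite (W l) \<and> card (W l) \<le> w \<and> W l \<noteq> {}) \<Longrightarrow>
      (\<And>l l'. l \<in> L \<Longrightarrow> l' \<in> L \<Longrightarrow> l \<noteq> l' \<Longrightarrow> W l \<inter> W l' = {}) \<Longrightarrow>
      (\<And>l x. l \<in> L \<Longrightarrow> g l x \<le> (\<Sum>j\<in>W l. F j x)) \<Longrightarrow>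
      (\<And>l. l \<in> L \<Longrightarrow> S \<le> Lp_norm p (g l)) \<Longrightarrow> (\<not> b \<Longrightarrow> (\<And>l l'. g l = g l')) \<Longrightarrow>
      ennreal (c * qpow q N) * S \<le> mixed_norm b p q F"
proof -
  obtain K where K: "0 < K" "\<And>(M::'a measure) (F::'j \<Rightarrow> 'a \<Rightarrow> ennreal) W g S. finite W \<Longrightarrow> card W \<le> w \<Longrightarrow> (\<And>j. j \<in> W \<Longrightarrow> F j \<in> borel_measurable M) \<Longrightarrow>
      g \<in> borel_measurable M \<Longrightarrow> (\<And>x. g x \<le> (\<Sum>j\<in>W. F j x)) \<Longrightarrow> (\<And>j. j \<in> W \<Longrightarrow> measure_norm M p (F j) \<le> S) \<Longrightarrow>
      measure_norm M p g \<le> ennreal K * S" by (rule measure_norm_sum[OF p]) blast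
  \<comment> \<open>The first entry serves the Besov type, where the largest
    \<open>L\<^sub>p\<close> norm in a window is compared with \<open>g\<close>; the second serves
    the Triebel--Lizorkin type, where at each point some summand of the window reaches the
    average.\<close>
  define c where "c = min (1 / K) (1 / (real w + 1))"
  have c: "0 < c" "c \<le> 1 / K" "c \<le> 1 / (real w + 1)" using K(1) by (auto simp: c_def)
  show ?thesis
  proof (rule that[OF c(1)])
    fix F :: "'j \<Rightarrow> 'a \<Rightarrow> ennreal" and L :: "'l set" and W N g S
    assume L: "finite L" "N \<le> real (card L)" "1 \<le> N" and m: "\<And>j. F j \<in> borel_measurable borel" "\<And>l. g l \<in> borel_measurable borel"
      and W: "\<And>l. l \<in> L \<Longrightarrow> finite (W l) \<and> card (W l) \<le> w \<and> W l \<noteq> {}"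
      and disj: "\<And>l l'. l \<in> L \<Longrightarrow> l' \<in> L \<Longrightarrow> l \<noteq> l' \<Longrightarrow> W l \<inter> W l' = {}"
      and g: "\<And>l x. l \<in> L \<Longrightarrow> g l x \<le> (\<Sum>j\<in>W l. F j x)"
      and S: "\<And>l. l \<in> L \<Longrightarrow> S \<le> Lp_norm p (g l)" and common: "\<not> b \<Longrightarrow> (\<And>l l'. g l = g l')"
    have eq: "ennreal (c * qpow q N) * y = ennreal (qpow q N) * (ennreal c * y)" for y
      using c(1) by (simp add: ennreal_mult mult_ac)
    show "ennreal (c * qpow q N) * S \<le> mixed_norm b p q F"
    proof (cases b)
      case True
      have "ennreal (qpow q N) * (ennreal c * S) \<le> lq_norm q (\<lambda>j. Lp_norm p (F j))"
      proof (rule lq_norm_ge_disjoint[OF q L _ disj])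
        fix l assume l: "l \<in> L"
        define M where "M = Max ((\<lambda>j. Lp_norm p (F j)) ` W l)"
        have "M \<in> (\<lambda>j. Lp_norm p (F j)) ` W l" unfolding M_def using W[OF l] by (intro Max_in) auto
        then obtain j where j: "j \<in> W l" "M = Lp_norm p (F j)" by auto
        have "Lp_norm p (g l) \<le> ennreal K * M"
          unfolding Lp_norm_eq using W[OF l] m g[OF l]
          by (intro K(2)[of "W l" F]) (auto simp: M_def Lp_norm_eq)
        with S[OF l] have "S \<le> ennreal K * M" by (rule order_trans)
        then have "ennreal (1 / K) * S \<le> ennreal (1 / K) * (ennreal K * M)" by (rule mult_left_mono) simp
        also have "\<dots> = M" using K(1) by (simp add: mult.assoc[symmetric] flip: ennreal_mult)
        finally have "ennreal (1 / K) * S \<le> M" .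
        moreover have "ennreal c * S \<le> ennreal (1 / K) * S"
          using c by (intro mult_right_mono ennreal_leI) auto
        ultimately show "\<exists>j\<in>W l. ennreal c * S \<le> Lp_norm p (F j)" using j by (metis order_trans)
      qed
      then show ?thesis using True by (simp add: mixed_norm_def eq)
    next
      case False
      obtain l0 where l0: "l0 \<in> L" using L by fastforce
      have eqg: "g l = g l0" for l using common False by blast
      have "ennreal (qpow q N) * (ennreal c * g l0 x) \<le> lq_norm q (\<lambda>j. F j x)" for x
      proof (rule lq_norm_ge_disjoint[OF q L _ disj])
        fix l assume l: "l \<in> L"
        obtain j where j: "j \<in> W l" "ennreal (1 / real (w + 1)) * g l0 x \<le> F j x"
          using exists_ge_average[of "W l" "w + 1" "g l0 x" "\<lambda>j. F j x"] W[OF l] g[OF l, of x] eqg[of l] by auto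
        have "ennreal c * g l0 x \<le> ennreal (1 / real (w + 1)) * g l0 x"
          using c by (intro mult_right_mono ennreal_leI) (auto simp: add.commute)
        then show "\<exists>j\<in>W l. ennreal c * g l0 x \<le> F j x" using j order_trans by blast
      qed
      then have "Lp_norm p (\<lambda>x. ennreal (c * qpow q N) * g l0 x) \<le> Lp_norm p (\<lambda>x. lq_norm q (\<lambda>j. F j x))"
        unfolding eq using m by (intro Lp_norm_mono p) auto
      then have "ennreal (c * qpow q N) * Lp_norm p (g l0) \<le> mixed_norm b p q F"
        using False m p by (simp add: mixed_norm_def Lp_norm_cmult)
      moreover have "ennreal (c * qpow q N) * S \<le> ennreal (c * qpow q N) * Lp_norm p (g l0)"
        by (intro mult_left_mono S l0) simp
      ultimately show ?thesis by (rule order_trans[rotated])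
    qed
  qed
qed

subsection \<open>Resolutions of unity\<close>

text \<open>Derivatives are only required to be bounded uniformly in \<open>j\<close>, without the
  gain at high levels that dilation would give. This is enough for multipliers acting on spectra of
  unit size. The sum is one over any finite set of indices containing the active ones, so it can be
  taken over a convenient window.\<close>

definition resolution :: "('j \<Rightarrow> 'a::euclidean_space \<Rightarrow> complex) \<Rightarrow> bool" where
  "resolution \<mu> \<longleftrightarrow> (\<forall>j. \<mu> j \<in> schwartz) \<and> (\<forall>L. \<exists>B. \<forall>j. deriv_bound L 0 B (\<mu> j)) \<and>
     (\<forall>\<xi>. finite {j. \<mu> j \<xi> \<noteq> 0} \<and> (\<forall>W. finite W \<longrightarrow> {j. \<mu> j \<xi> \<noteq> 0} \<subseteq> W \<longrightarrow> (\<Sum>j\<in>W. \<mu> j \<xi>) = 1))"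

lemma resolution_schwartz: "resolution \<mu> \<Longrightarrow> \<mu> j \<in> schwartz"
  by (simp add: resolution_def)

lemma resolution_deriv_bound: "resolution \<mu> \<Longrightarrow> \<exists>B. \<forall>j. deriv_bound L 0 B (\<mu> j)"
  by (simp add: resolution_def)

lemma resolution_sum: "resolution \<mu> \<Longrightarrow> finite W \<Longrightarrow> (\<And>j. \<mu> j \<xi> \<noteq> 0 \<Longrightarrow> j \<in> W) \<Longrightarrow> (\<Sum>j\<in>W. \<mu> j \<xi>) = 1"
  unfolding resolution_def by (metis (mono_tags, lifting) mem_Collect_eq subsetI)

lemma resolution_nonzero: "resolution \<mu> \<Longrightarrow> \<exists>j. \<mu> j \<xi> \<noteq> 0"
  using resolution_sum[of \<mu> "{}" \<xi>] by auto

lemma resolutionI: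
  assumes "\<And>j. \<mu> j \<in> schwartz" "\<And>L. \<exists>B. \<forall>j. deriv_bound L 0 B (\<mu> j)"
    and "\<And>\<xi>. \<exists>W. finite W \<and> {j. \<mu> j \<xi> \<noteq> 0} \<subseteq> W \<and> (\<Sum>j\<in>W. \<mu> j \<xi>) = 1"
  shows "resolution \<mu>"
  unfolding resolution_def
proof (intro conjI allI impI)
  fix \<xi>
  obtain W where W: "finite W" "{j. \<mu> j \<xi> \<noteq> 0} \<subseteq> W" "(\<Sum>j\<in>W. \<mu> j \<xi>) = 1" using assms(3) by blast
  show fin: "finite {j. \<mu> j \<xi> \<noteq> 0}" using W finite_subset by blast
  fix W' assume W': "finite W'" "{j. \<mu> j \<xi> \<noteq> 0} \<subseteq> W'"
  have "(\<Sum>j\<in>W'. \<mu> j \<xi>) = (\<Sum>j\<in>{j. \<mu> j \<xi> \<noteq> 0}. \<mu> j \<xi>)" using W' by (intro sum.mono_neutral_right) auto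
  also have "\<dots> = (\<Sum>j\<in>W. \<mu> j \<xi>)" using W by (intro sum.mono_neutral_left) auto
  finally show "(\<Sum>j\<in>W'. \<mu> j \<xi>) = 1" using W(3) by simp
qed (use assms in auto)

lemma Max_range_le_iff: "(MAX i. f i) \<le> c \<longleftrightarrow> (\<forall>i. f i \<le> c)" for f :: "'n::finite \<Rightarrow> 'b::linorder"
  by (subst Max_le_iff) auto

lemma Max_range_ge_iff: "c \<le> (MAX i. f i) \<longleftrightarrow> (\<exists>i. c \<le> f i)" for f :: "'n::finite \<Rightarrow> 'b::linorder"
  by (subst Max_ge_iff) auto

lemma anisotropic_dilation_nth [simp]: "anisotropic_dilation \<alpha> t \<xi> $ i = 2 powr (t * \<alpha> $ i) * \<xi> $ i"
  by (simp add: anisotropic_dilation_def)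

lemma anisotropic_dilation_diag:
  fixes \<alpha> \<xi> :: "real ^ 'n"
  shows "anisotropic_dilation \<alpha> t \<xi> = 0 + diag (\<lambda>b. 2 powr (t * (\<alpha> \<bullet> b))) \<xi>"
proof (rule euclidean_eqI)
  fix b :: "real ^ 'n" assume b: "b \<in> Basis"
  then obtain i where i: "b = axis i 1" by (auto simp: Basis_vec_def)
  show "anisotropic_dilation \<alpha> t \<xi> \<bullet> b = (0 + diag (\<lambda>b. 2 powr (t * (\<alpha> \<bullet> b))) \<xi>) \<bullet> b"
    by (simp only: add_0 diag_inner[OF b]) (simp add: i inner_axis)
qed

lemma aniso_generator_zero: "anisotropic_generator \<alpha> \<phi> \<Longrightarrow> \<phi> \<xi> \<noteq> 0 \<Longrightarrow> \<bar>\<xi> $ i\<bar> < 2 powr (\<alpha> $ i)"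
proof -
  assume *: "anisotropic_generator \<alpha> \<phi>" "\<phi> \<xi> \<noteq> 0"
  then have "\<not> (MAX i. \<bar>2 powr (- \<alpha> $ i) * \<xi> $ i\<bar>) \<ge> 1"
    unfolding anisotropic_generator_def by blast
  then have "\<not> 1 \<le> \<bar>2 powr (- \<alpha> $ i) * \<xi> $ i\<bar>" unfolding Max_range_ge_iff by blast
  then show ?thesis by (simp add: abs_mult powr_minus field_simps)
qed

lemma aniso_generator_one: "anisotropic_generator \<alpha> \<phi> \<Longrightarrow> (\<And>i. \<bar>\<xi> $ i\<bar> \<le> 1) \<Longrightarrow> \<phi> \<xi> = 1"
  unfolding anisotropic_generator_def Max_range_le_iff by blast

lemma aniso_generator_dilation_zero:
  assumes "anisotropic_generator \<alpha> \<phi>" "\<phi> (anisotropic_dilation \<alpha> (- t) \<xi>) \<noteq> 0"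
  shows "\<bar>\<xi> $ i\<bar> < 2 powr ((t + 1) * \<alpha> $ i)"
  using aniso_generator_zero[OF assms, of i] by (simp add: abs_mult powr_minus powr_add field_simps)

lemma aniso_generator_dilation_one:
  assumes "anisotropic_generator \<alpha> \<phi>" "\<And>i. \<bar>\<xi> $ i\<bar> \<le> 2 powr (t * \<alpha> $ i)"
  shows "\<phi> (anisotropic_dilation \<alpha> (- t) \<xi>) = 1"
  using assms(2) by (intro aniso_generator_one[OF assms(1)]) (simp add: abs_mult powr_minus field_simps)

text \<open>For positive \<open>m\<close> both dilates of the generator equal one on the box of
  level \<open>m - 1\<close>, so their difference vanishes there; this locates the support in the
  second claim.\<close>

lemma aniso_resolution_nonzero:
  assumes \<phi>: "anisotropic_generator \<alpha> \<phi>" and pos: "\<And>i. 0 < \<alpha> $ i" and nz: "anisotropic_resolution \<alpha> \<phi> m \<xi> \<noteq> 0"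
  shows "\<bar>\<xi> $ i\<bar> < 2 powr ((real m + 1) * \<alpha> $ i)"
    and "0 < m \<Longrightarrow> \<exists>i. 2 powr ((real m - 1) * \<alpha> $ i) < \<bar>\<xi> $ i\<bar>"
proof -
  show "\<bar>\<xi> $ i\<bar> < 2 powr ((real m + 1) * \<alpha> $ i)"
  proof (cases "m = 0")
    case True
    then show ?thesis using nz aniso_generator_zero[OF \<phi>] by (simp add: anisotropic_resolution_def)
  next
    case False
    then consider "\<phi> (anisotropic_dilation \<alpha> (- real m) \<xi>) \<noteq> 0" | "\<phi> (anisotropic_dilation \<alpha> (- (real m - 1)) \<xi>) \<noteq> 0"
      using nz unfolding anisotropic_resolution_def by (metis diff_zero)
    then show ?thesis
    proof cases
      case 1
      then show ?thesis using aniso_generator_dilation_zero[OF \<phi>] by blast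
    next
      case 2
      have "\<bar>\<xi> $ i\<bar> < 2 powr (real m * \<alpha> $ i)" using aniso_generator_dilation_zero[OF \<phi> 2, of i] by simp
      also have "\<dots> \<le> 2 powr ((real m + 1) * \<alpha> $ i)"
        using pos[of i] by (intro powr_mono mult_right_mono) auto
      finally show ?thesis .
    qed
  qed
  show "\<exists>i. 2 powr ((real m - 1) * \<alpha> $ i) < \<bar>\<xi> $ i\<bar>" if "0 < m"
  proof (rule ccontr)
    assume "\<not> ?thesis"
    then have le: "\<bar>\<xi> $ i\<bar> \<le> 2 powr ((real m - 1) * \<alpha> $ i)" for i by (simp add: not_less)
    have "\<bar>\<xi> $ i\<bar> \<le> 2 powr (real m * \<alpha> $ i)" for i
      using pos[of i] by (intro order_trans[OF le] powr_mono mult_right_mono) auto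
    then have "anisotropic_resolution \<alpha> \<phi> m \<xi> = 0"
      using that aniso_generator_dilation_one[OF \<phi> le] aniso_generator_dilation_one[OF \<phi>, of \<xi> "real m"]
      by (simp add: anisotropic_resolution_def)
    then show False using nz by simp
  qed
qed

lemma schwartz_cart_support:
  fixes f :: "real ^ 'n \<Rightarrow> complex"
  assumes "\<And>L. \<exists>B. deriv_bound L 0 B f" "\<And>\<xi> i. f \<xi> \<noteq> 0 \<Longrightarrow> \<bar>\<xi> $ i\<bar> \<le> \<rho> i"
  shows "f \<in> schwartz"
proof (rule schwartzI_compact_support[OF assms(1), where \<rho> = "\<Sum>i\<in>UNIV. \<rho> i"])
  fix \<xi> :: "real ^ 'n" assume n: "norm \<xi> > (\<Sum>i\<in>UNIV. \<rho> i)"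
  show "f \<xi> = 0"
  proof (rule ccontr)
    assume "f \<xi> \<noteq> 0"
    then have "(\<Sum>i\<in>UNIV. \<bar>\<xi> $ i\<bar>) \<le> (\<Sum>i\<in>UNIV. \<rho> i)" by (intro sum_mono assms(2))
    then show False using n norm_le_l1_cart[of \<xi>] by linarith
  qed
qed

lemma ex_nat_powr_ge:
  assumes "0 < (a::real)"
  shows "\<exists>K::nat. t \<le> 2 powr (real K * a)"
proof -
  define K where "K = nat \<lceil>log 2 (\<bar>t\<bar> + 1) / a\<rceil>"
  have "log 2 (\<bar>t\<bar> + 1) / a \<le> real K" unfolding K_def by linarith
  then have "log 2 (\<bar>t\<bar> + 1) \<le> real K * a" using assms by (simp add: field_simps)
  then have "2 powr (log 2 (\<bar>t\<bar> + 1)) \<le> 2 powr (real K * a)" by (intro powr_mono) auto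
  then show ?thesis by (intro exI[of _ K]) simp
qed

lemma ex_nat_powr_ge_all:
  fixes a t :: "'n::finite \<Rightarrow> real"
  assumes "\<And>i. 0 < a i"
  shows "\<exists>K::nat. \<forall>i. t i \<le> 2 powr (real K * a i)"
proof -
  have "\<forall>i. \<exists>k::nat. t i \<le> 2 powr (real k * a i)" using ex_nat_powr_ge[OF assms] by blast
  then obtain k :: "'n \<Rightarrow> nat" where k: "\<And>i. t i \<le> 2 powr (real (k i) * a i)" by metis
  have "t i \<le> 2 powr (real (\<Sum>i\<in>UNIV. k i) * a i)" for i
  proof -
    have "k i \<le> (\<Sum>i\<in>UNIV. k i)" by (rule member_le_sum) auto
    then have "2 powr (real (k i) * a i) \<le> 2 powr (real (\<Sum>i\<in>UNIV. k i) * a i)"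
      using assms[of i] by (intro powr_mono mult_right_mono) (auto simp only: of_nat_le_iff)
    then show ?thesis using k[of i] by linarith
  qed
  then show ?thesis by blast
qed

lemma resolution_anisotropic:
  fixes \<alpha> :: "real ^ 'n"
  assumes \<phi>: "anisotropic_generator \<alpha> \<phi>" and pos: "\<And>i. 0 < \<alpha> $ i"
  shows "resolution (anisotropic_resolution \<alpha> \<phi>)"
proof (rule resolutionI)
  have \<phi>s: "\<phi> \<in> schwartz" using \<phi> by (simp add: anisotropic_generator_def)
  have dil: "deriv_bound L 0 B (\<lambda>\<xi>. \<phi> (anisotropic_dilation \<alpha> (- t) \<xi>))" if "deriv_bound L 0 B \<phi>" "0 \<le> t" for L B t
  proof -
    have "2 powr (- t * (\<alpha> \<bullet> b)) \<le> 1" if b: "b \<in> Basis" for b :: "real ^ 'n"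
    proof -
      from b obtain i where "b = axis i 1" by (auto simp: Basis_vec_def)
      then have "0 \<le> \<alpha> \<bullet> b" using pos[of i] by (simp add: inner_axis)
      then show ?thesis using \<open>0 \<le> t\<close> powr_mono[of "- t * (\<alpha> \<bullet> b)" 0 2] by simp
    qed
    then show ?thesis
      using deriv_bound_affine[of "\<lambda>b. 2 powr (- t * (\<alpha> \<bullet> b))" 1 L B \<phi> 0] that
      unfolding anisotropic_dilation_diag by simp
  qed
  show bd: "\<exists>B. \<forall>j. deriv_bound L 0 B (anisotropic_resolution \<alpha> \<phi> j)" for L
  proof -
    obtain B where B: "deriv_bound L 0 B \<phi>" using deriv_bound_schwartz[OF \<phi>s] by blast
    have "deriv_bound L 0 (B + B) (anisotropic_resolution \<alpha> \<phi> j)" for j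
    proof (cases "j = 0")
      case True
      then have "anisotropic_resolution \<alpha> \<phi> j = \<phi>" by (auto simp: anisotropic_resolution_def)
      then show ?thesis using deriv_bound_mono[OF B order_refl order_refl, of "B + B"] deriv_bound_nonneg[OF B] by simp
    next
      case False
      then have "anisotropic_resolution \<alpha> \<phi> j =
        (\<lambda>\<xi>. \<phi> (anisotropic_dilation \<alpha> (- real j) \<xi>) - \<phi> (anisotropic_dilation \<alpha> (- (real j - 1)) \<xi>))"
        by (auto simp: anisotropic_resolution_def)
      then show ?thesis using False by (simp only:) (intro deriv_bound_diff dil B, auto)
    qed
    then show ?thesis by blast
  qed
  show "anisotropic_resolution \<alpha> \<phi> j \<in> schwartz" for j
  proof (rule schwartz_cart_support)
    show "\<exists>B. deriv_bound L 0 B (anisotropic_resolution \<alpha> \<phi> j)" for L using bd by blast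
    show "\<bar>\<xi> $ i\<bar> \<le> 2 powr ((real j + 1) * \<alpha> $ i)" if "anisotropic_resolution \<alpha> \<phi> j \<xi> \<noteq> 0" for \<xi> i
      using aniso_resolution_nonzero(1)[OF \<phi> pos that] less_imp_le by blast
  qed
  fix \<xi>
  obtain K :: nat where K: "\<And>i. \<bar>\<xi> $ i\<bar> \<le> 2 powr (real K * \<alpha> $ i)" using ex_nat_powr_ge_all[of "\<lambda>i. \<alpha> $ i" "\<lambda>i. \<bar>\<xi> $ i\<bar>"] pos by blast
  have "m \<le> K" if nz: "anisotropic_resolution \<alpha> \<phi> m \<xi> \<noteq> 0" for m
  proof (rule ccontr)
    assume m: "\<not> m \<le> K"
    then obtain i where i: "2 powr ((real m - 1) * \<alpha> $ i) < \<bar>\<xi> $ i\<bar>" using aniso_resolution_nonzero(2)[OF \<phi> pos nz] by auto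
    have "2 powr (real K * \<alpha> $ i) \<le> 2 powr ((real m - 1) * \<alpha> $ i)"
      using m pos[of i] by (intro powr_mono mult_right_mono) auto
    then show False using i K[of i] by linarith
  qed
  \<comment> \<open>Telescoping: the partial sum is a single dilate of the generator, which equals
    one at \<open>\<xi>\<close> once \<open>K\<close> is large.\<close>
  moreover have "(\<Sum>m\<le>K'. anisotropic_resolution \<alpha> \<phi> m \<xi>) = \<phi> (anisotropic_dilation \<alpha> (- real K') \<xi>)" for K' :: nat
  proof (induction K')
    case 0
    have "anisotropic_dilation \<alpha> 0 \<xi> = \<xi>" by (simp add: anisotropic_dilation_def vec_eq_iff)
    then show ?case by (simp add: anisotropic_resolution_def)
  next
    case (Suc K')
    then show ?case by (simp add: anisotropic_resolution_def)
  qed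
  then have "(\<Sum>m\<le>K. anisotropic_resolution \<alpha> \<phi> m \<xi>) = 1" using aniso_generator_dilation_one[OF \<phi> K] by simp
  ultimately show "\<exists>W. finite W \<and> {j. anisotropic_resolution \<alpha> \<phi> j \<xi> \<noteq> 0} \<subseteq> W \<and> (\<Sum>j\<in>W. anisotropic_resolution \<alpha> \<phi> j \<xi>) = 1"
    by (intro exI[of _ "{..K}"]) auto
qed

lemma hyperbolic_generator_zero: "hyperbolic_generator \<theta> \<Longrightarrow> \<theta> t \<noteq> 0 \<Longrightarrow> \<bar>t\<bar> \<le> 2"
proof -
  assume \<theta>: "hyperbolic_generator \<theta>" "\<theta> t \<noteq> 0"
  then have "t \<in> support_on UNIV \<theta>" by (simp add: support_on_def)
  then have "t \<in> closure (support_on UNIV \<theta>)" using closure_subset by (rule set_mp[rotated])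
  then have "t \<in> {-2..2}" using \<theta>(1) by (auto simp: hyperbolic_generator_def)
  then show ?thesis by auto
qed

lemma hyperbolic_generator_one: "hyperbolic_generator \<theta> \<Longrightarrow> \<bar>t\<bar> \<le> 1 \<Longrightarrow> \<theta> t = 1"
  unfolding hyperbolic_generator_def by (simp add: abs_le_iff)

lemma hyperbolic_generator_dilation_one:
  assumes "hyperbolic_generator \<theta>" "\<bar>t\<bar> \<le> 2 powr x"
  shows "\<theta> (2 powr (- x) * t) = 1"
  using assms(2) by (intro hyperbolic_generator_one[OF assms(1)]) (simp add: abs_mult powr_minus field_simps)

lemma dyadic_resolution_nonzero:
  assumes \<theta>: "hyperbolic_generator \<theta>" and nz: "dyadic_resolution \<theta> m t \<noteq> 0"
  shows "\<bar>t\<bar> \<le> 2 powr (real m + 1)" and "0 < m \<Longrightarrow> 2 powr (real m - 1) < \<bar>t\<bar>"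
proof -
  have z: "\<bar>t\<bar> \<le> 2 powr (x + 1)" if "\<theta> (2 powr (- x) * t) \<noteq> 0" for x
    using hyperbolic_generator_zero[OF \<theta> that] by (simp add: abs_mult powr_minus powr_add field_simps)
  show "\<bar>t\<bar> \<le> 2 powr (real m + 1)"
  proof (cases "m = 0")
    case True
    then show ?thesis using nz hyperbolic_generator_zero[OF \<theta>] by (simp add: dyadic_resolution_def)
  next
    case False
    then consider "\<theta> (2 powr (- real m) * t) \<noteq> 0" | "\<theta> (2 powr (- (real m - 1)) * t) \<noteq> 0"
      using nz unfolding dyadic_resolution_def by (metis diff_zero)
    then show ?thesis
    proof cases
      case 1
      then show ?thesis by (rule z)
    next
      case 2
      have "\<bar>t\<bar> \<le> 2 powr (real m - 1 + 1)" by (rule z[OF 2])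
      also have "\<dots> \<le> 2 powr (real m + 1)" by (intro powr_mono) auto
      finally show ?thesis .
    qed
  qed
  show "2 powr (real m - 1) < \<bar>t\<bar>" if "0 < m"
  proof (rule ccontr)
    assume "\<not> ?thesis"
    then have le: "\<bar>t\<bar> \<le> 2 powr (real m - 1)" by simp
    also have "\<dots> \<le> 2 powr (real m)" by (intro powr_mono) auto
    finally have "dyadic_resolution \<theta> m t = 0"
      using that hyperbolic_generator_dilation_one[OF \<theta> le] hyperbolic_generator_dilation_one[OF \<theta>, of t "real m"]
      by (simp add: dyadic_resolution_def)
    then show False using nz by simp
  qed
qed

lemma dyadic_resolution_sum: "(\<Sum>m\<le>K. dyadic_resolution \<theta> m t) = \<theta> (2 powr (- real K) * t)"
  by (induction K) (auto simp: dyadic_resolution_def)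

lemma dyadic_deriv_bound:
  assumes "deriv_bound L 0 B \<theta>"
  shows "deriv_bound L 0 (B + B) (dyadic_resolution \<theta> j)"
proof -
  have dil: "deriv_bound L 0 B (\<lambda>t. \<theta> (2 powr (- x) * t))" if "0 \<le> x" for x
  proof -
    have "2 powr (- x) \<le> 1" using that powr_mono[of "- x" 0 2] by simp
    then show ?thesis
      using deriv_bound_affine[of "\<lambda>_. 2 powr (- x)" 1 L B \<theta> 0] assms by (simp add: diag_def)
  qed
  show ?thesis
  proof (cases "j = 0")
    case True
    then have "dyadic_resolution \<theta> j = \<theta>" by (auto simp: dyadic_resolution_def)
    then show ?thesis using deriv_bound_mono[OF assms order_refl order_refl, of "B + B"] deriv_bound_nonneg[OF assms] by simp
  next
    case False
    then have "dyadic_resolution \<theta> j = (\<lambda>t. \<theta> (2 powr (- real j) * t) - \<theta> (2 powr (- (real j - 1)) * t))"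
      by (auto simp: dyadic_resolution_def)
    then show ?thesis using False by (simp only:) (intro deriv_bound_diff dil, auto)
  qed
qed

lemma hyperbolic_resolution_nonzero:
  "hyperbolic_resolution \<theta> j \<xi> \<noteq> 0 \<longleftrightarrow> (\<forall>i. dyadic_resolution \<theta> (j $ i) (\<xi> $ i) \<noteq> 0)"
  by (simp add: hyperbolic_resolution_def)

lemma finite_vec_le: "finite {j :: nat ^ 'n. \<forall>i. j $ i \<le> K}"
proof -
  have "{j :: nat ^ 'n. \<forall>i. j $ i \<le> K} \<subseteq> vec_lambda ` (Pi\<^sub>E UNIV (\<lambda>_. {..K}))"
  proof
    fix j :: "nat ^ 'n" assume "j \<in> {j. \<forall>i. j $ i \<le> K}"
    then have "(\<lambda>i. j $ i) \<in> Pi\<^sub>E UNIV (\<lambda>_. {..K})" by (auto simp: PiE_UNIV_domain)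
    moreover have "j = vec_lambda (\<lambda>i. j $ i)" by (simp add: vec_eq_iff)
    ultimately show "j \<in> vec_lambda ` (Pi\<^sub>E UNIV (\<lambda>_. {..K}))" by blast
  qed
  then show ?thesis by (rule finite_subset) (auto intro!: finite_imageI finite_PiE)
qed

lemma sum_vec_prod:
  fixes f :: "'n::finite \<Rightarrow> nat \<Rightarrow> complex"
  shows "(\<Sum>j\<in>{j :: nat ^ 'n. \<forall>i. j $ i \<le> K}. \<Prod>i\<in>UNIV. f i (j $ i)) = (\<Prod>i\<in>UNIV. \<Sum>m\<le>K. f i m)"
proof -
  have "(\<Prod>i\<in>UNIV. \<Sum>m\<le>K. f i m) = (\<Sum>g\<in>Pi\<^sub>E UNIV (\<lambda>_. {..K}). \<Prod>i\<in>UNIV. f i (g i))"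
    by (rule prod_sum_PiE) auto
  also have "\<dots> = (\<Sum>j\<in>{j :: nat ^ 'n. \<forall>i. j $ i \<le> K}. \<Prod>i\<in>UNIV. f i (j $ i))"
    by (rule sum.reindex_bij_witness[of _ "\<lambda>j i. j $ i" vec_lambda]) (auto simp: PiE_UNIV_domain vec_eq_iff)
  finally show ?thesis by simp
qed

lemma prod_coord_schwartz:
  fixes g :: "'n::finite \<Rightarrow> real \<Rightarrow> complex"
  assumes "\<And>i. deriv_bound L 0 B (g i)"
  shows "deriv_bound L 0 ((2 ^ L * B) ^ CARD('n)) (\<lambda>\<xi>::real ^ 'n. \<Prod>i\<in>UNIV. g i (\<xi> $ i))"
proof (rule deriv_bound_prod)
  show "deriv_bound L 0 B (\<lambda>\<xi>::real ^ 'n. g i (\<xi> $ i))" for i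
    using deriv_bound_coord[OF _ assms, of "axis i 1 :: real ^ 'n"] by (simp add: inner_axis axis_in_Basis_iff)
qed simp

text \<open>A sum over a cube of multi-indices factors into one-dimensional telescoping sums, each
  equal to one when the cube is large enough. The derivative bound is uniform because the number of
  factors is fixed and each factor has a uniform bound.\<close>

lemma resolution_hyperbolic:
  assumes \<theta>: "hyperbolic_generator \<theta>"
  shows "resolution (hyperbolic_resolution \<theta> :: nat ^ 'n \<Rightarrow> real ^ 'n \<Rightarrow> complex)"
proof (rule resolutionI)
  have \<theta>s: "\<theta> \<in> schwartz" using \<theta> by (simp add: hyperbolic_generator_def)
  show bd: "\<exists>B. \<forall>j. deriv_bound L 0 B (hyperbolic_resolution \<theta> j :: real ^ 'n \<Rightarrow> complex)" for L
  proof -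
    obtain B where B: "deriv_bound L 0 B \<theta>" using deriv_bound_schwartz[OF \<theta>s] by blast
    have "deriv_bound L 0 ((2 ^ L * (B + B)) ^ CARD('n)) (hyperbolic_resolution \<theta> j :: real ^ 'n \<Rightarrow> complex)" for j
      unfolding hyperbolic_resolution_def[abs_def]
      by (rule prod_coord_schwartz) (rule dyadic_deriv_bound[OF B])
    then show ?thesis by blast
  qed
  show "hyperbolic_resolution \<theta> j \<in> schwartz" for j :: "nat ^ 'n"
  proof (rule schwartz_cart_support)
    show "\<exists>B. deriv_bound L 0 B (hyperbolic_resolution \<theta> j)" for L using bd by blast
    show "\<bar>\<xi> $ i\<bar> \<le> 2 powr (real (j $ i) + 1)" if "hyperbolic_resolution \<theta> j \<xi> \<noteq> 0" for \<xi> i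
      using that dyadic_resolution_nonzero(1)[OF \<theta>] unfolding hyperbolic_resolution_nonzero by blast
  qed
  fix \<xi> :: "real ^ 'n"
  obtain K :: nat where K: "\<And>i. \<bar>\<xi> $ i\<bar> \<le> 2 powr (real K * 1)" using ex_nat_powr_ge_all[of "\<lambda>i. 1" "\<lambda>i. \<bar>\<xi> $ i\<bar>"] by auto
  have le: "m \<le> K" if nz: "dyadic_resolution \<theta> m (\<xi> $ i) \<noteq> 0" for m i
  proof (rule ccontr)
    assume m: "\<not> m \<le> K"
    then have i: "2 powr (real m - 1) < \<bar>\<xi> $ i\<bar>" using dyadic_resolution_nonzero(2)[OF \<theta> nz] by auto
    have "2 powr (real K * 1) \<le> 2 powr (real m - 1)"
      using m by (intro powr_mono) auto
    then show False using i K[of i] by linarith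
  qed
  have "(\<Sum>j\<in>{j. \<forall>i. j $ i \<le> K}. hyperbolic_resolution \<theta> j \<xi>) = (\<Prod>i\<in>UNIV. \<Sum>m\<le>K. dyadic_resolution \<theta> m (\<xi> $ i))"
    unfolding hyperbolic_resolution_def by (rule sum_vec_prod)
  also have "\<dots> = 1"
    using hyperbolic_generator_dilation_one[OF \<theta>, of _ "real K"] K by (simp add: dyadic_resolution_sum)
  finally show "\<exists>W. finite W \<and> {j. hyperbolic_resolution \<theta> j \<xi> \<noteq> 0} \<subseteq> W \<and> (\<Sum>j\<in>W. hyperbolic_resolution \<theta> j \<xi>) = 1"
    using le by (intro exI[of _ "{j. \<forall>i. j $ i \<le> K}"]) (auto simp: finite_vec_le hyperbolic_resolution_nonzero)
qed

lemma bump_aniso_generator: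
  fixes \<phi> :: "real ^ 'n \<Rightarrow> complex"
  assumes \<phi>: "anisotropic_generator \<alpha> \<phi>"
  shows "bump \<phi>"
  unfolding bump_def
proof (intro conjI)
  show "\<phi> \<in> schwartz" "\<forall>x. \<phi> x \<in> \<real>\<^sub>\<ge>\<^sub>0" using \<phi> by (auto simp: anisotropic_generator_def)
  show "\<phi> 0 = 1" by (rule aniso_generator_one[OF \<phi>]) simp
  show "\<exists>\<rho>. \<forall>x. \<rho> < norm x \<longrightarrow> \<phi> x = 0"
  proof (intro exI[of _ "\<Sum>i\<in>UNIV. 2 powr (\<alpha> $ i)"] allI impI)
    fix x :: "real ^ 'n" assume n: "(\<Sum>i\<in>UNIV. 2 powr (\<alpha> $ i)) < norm x"
    show "\<phi> x = 0"
    proof (rule ccontr)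
      assume "\<phi> x \<noteq> 0"
      then have "(\<Sum>i\<in>UNIV. \<bar>x $ i\<bar>) \<le> (\<Sum>i\<in>UNIV. 2 powr (\<alpha> $ i))"
        using aniso_generator_zero[OF \<phi>] by (intro sum_mono less_imp_le) auto
      then show False using n norm_le_l1_cart[of x] by linarith
    qed
  qed
qed

text \<open>The common form of the four quasi-norms, expressed through the Fourier transform
  \<open>G\<close>: \<open>b\<close> selects the order of the norms, \<open>lev\<close> the weight,
  \<open>\<mu>\<close> the resolution. The blocks are now explicit integrals.\<close>

definition spectral_norm ::
    "bool \<Rightarrow> ennreal \<Rightarrow> ennreal \<Rightarrow> real \<Rightarrow> ('j \<Rightarrow> real) \<Rightarrow> ('j \<Rightarrow> 'a::euclidean_space \<Rightarrow> complex) \<Rightarrow> ('a \<Rightarrow> complex) \<Rightarrow> ennreal"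
  where
  "spectral_norm b p q s lev \<mu> G = mixed_norm b p q (\<lambda>j x. ennreal (2 powr (lev j * s)) *
     ennreal (norm (inverse_fourier (\<lambda>\<xi>. \<mu> j \<xi> * G \<xi>) x)))"

lemma inverse_fourier_measurable [measurable]:
  "integrable lborel h \<Longrightarrow> inverse_fourier h \<in> borel_measurable borel"
  by (intro borel_measurable_continuous_onI continuous_inverse_fourier)

lemma spectral_norm_besov:
  fixes \<mu> :: "'j::countable \<Rightarrow> 'a::euclidean_space \<Rightarrow> complex"
  assumes \<eta>: "bump (\<eta> :: 'a \<Rightarrow> complex)" and G: "poly_growth G" and \<mu>: "resolution \<mu>" and p: "0 < p"
  shows "lq_norm q (\<lambda>j. ennreal (2 powr (lev j * s)) * Lp_norm p (\<lambda>x. ennreal (norm (block (\<mu> j) (spectral_dist G) x)))) =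
      spectral_norm True p q s lev \<mu> G"
    and "Lp_norm p (\<lambda>x. lq_norm q (\<lambda>j. ennreal (2 powr (lev j * s)) * ennreal (norm (block (\<mu> j) (spectral_dist G) x)))) =
      spectral_norm False p q s lev \<mu> G"
proof -
  have i: "integrable lborel (\<lambda>\<xi>. \<mu> j \<xi> * G \<xi>)" for j
    by (rule integrable_mult_poly_growth[OF G resolution_schwartz[OF \<mu>]])
  have b: "block (\<mu> j) (spectral_dist G) = inverse_fourier (\<lambda>\<xi>. \<mu> j \<xi> * G \<xi>)" for j
    by (rule block_spectral_dist[OF \<eta> G resolution_schwartz[OF \<mu>] i])
  show "lq_norm q (\<lambda>j. ennreal (2 powr (lev j * s)) * Lp_norm p (\<lambda>x. ennreal (norm (block (\<mu> j) (spectral_dist G) x)))) =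
      spectral_norm True p q s lev \<mu> G"
    unfolding spectral_norm_def mixed_norm_def b using inverse_fourier_measurable[OF i] p by (simp add: Lp_norm_cmult)
  show "Lp_norm p (\<lambda>x. lq_norm q (\<lambda>j. ennreal (2 powr (lev j * s)) * ennreal (norm (block (\<mu> j) (spectral_dist G) x)))) =
      spectral_norm False p q s lev \<mu> G"
    unfolding spectral_norm_def mixed_norm_def b by simp
qed

subsection \<open>Condensation of singularities\<close>

lemma ennreal_top_unique_nat:
  assumes "\<And>n. of_nat n \<le> (x::ennreal)"
  shows "x = \<top>"
proof -
  have "(SUP n. of_nat n :: ennreal) \<le> x" using assms by (rule SUP_least)
  then show ?thesis by (simp add: ennreal_SUP_of_nat_eq_top top_unique)
qed

lemma inverse_fourier_zero: "inverse_fourier (\<lambda>_. 0) x = 0"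
  by (simp add: inverse_fourier_def)

text \<open>The smoothness weights are left out: on a single shell they are all comparable to
  \<open>2 powr (octave k * s)\<close>, so the two quasi-norms of one generation can be compared
  independently of \<open>s\<close>.\<close>

definition flat_norm ::
    "bool \<Rightarrow> ennreal \<Rightarrow> ennreal \<Rightarrow> ('j \<Rightarrow> 'a::euclidean_space \<Rightarrow> complex) \<Rightarrow> ('a \<Rightarrow> complex) \<Rightarrow> ennreal"
  where
  "flat_norm b p q \<mu> G = mixed_norm b p q (\<lambda>j x. ennreal (norm (inverse_fourier (\<lambda>\<xi>. \<mu> j \<xi> * G \<xi>) x)))"

text \<open>All test functions of the \<open>k\<close>-th generation have their spectrum in \<open>shell k\<close>, where both
  resolutions only have levels close to \<open>octave k\<close>; \<open>c\<close> is so large that different generations do not interact.\<close>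

locale two_scales =
  fixes \<alpha> :: "real ^ 'n" and \<phi> :: "real ^ 'n \<Rightarrow> complex" and \<theta> :: "real \<Rightarrow> complex"
    and i1 i2 :: 'n and c :: nat and \<kappa> :: real
  assumes ne: "i1 \<noteq> i2" and pos: "\<And>i. 0 < \<alpha> $ i"
    and gen\<phi>: "anisotropic_generator \<alpha> \<phi>" and gen\<theta>: "hyperbolic_generator \<theta>"
    and \<kappa>: "\<kappa> = 2 + 2 / \<alpha> $ i1 + 1 / \<alpha> $ i2"
    and c: "10 \<le> real c * \<alpha> $ i1" "10 \<le> real c * \<alpha> $ i2" "2 * \<kappa> < real c"
begin

abbreviation \<Phi> :: "nat \<Rightarrow> real ^ 'n \<Rightarrow> complex" where
  "\<Phi> \<equiv> anisotropic_resolution \<alpha> \<phi>"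

abbreviation \<Theta> :: "nat ^ 'n \<Rightarrow> real ^ 'n \<Rightarrow> complex" where
  "\<Theta> \<equiv> hyperbolic_resolution \<theta>"

text \<open>Exponential in \<open>k\<close>, because generation \<open>k\<close> must accommodate
  \<open>2 ^ k\<close> well separated dyadic scales in the coordinate \<open>i2\<close>. The factor
  \<open>c\<close> makes consecutive octaves differ by more than
  \<open>2 * \<kappa>\<close>.\<close>

definition octave :: "nat \<Rightarrow> real" where "octave k = real c * 2 ^ k"

definition radius :: "nat \<Rightarrow> real" where "radius k = 2 powr (\<alpha> $ i1 * octave k)"

text \<open>The coordinate \<open>i1\<close> alone fixes the level; \<open>i2\<close> may range up
  to the size that an element of this level can have. The remaining coordinates stay below one and
  so never activate a positive level of either resolution.\<close>

definition shell :: "nat \<Rightarrow> (real ^ 'n) set" where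
  "shell k = {\<xi>. \<bar>\<xi> $ i1 - radius k\<bar> \<le> 1 / 4 \<and> \<bar>\<xi> $ i2\<bar> \<le> 2 powr (\<alpha> $ i2 * octave k) \<and>
     (\<forall>i. i \<noteq> i1 \<longrightarrow> i \<noteq> i2 \<longrightarrow> \<bar>\<xi> $ i\<bar> \<le> 1 / 4)}"

definition localized :: "('j \<Rightarrow> real) \<Rightarrow> ('j \<Rightarrow> real ^ 'n \<Rightarrow> complex) \<Rightarrow> bool" where
  "localized lev \<mu> \<longleftrightarrow> resolution \<mu> \<and> (\<forall>k \<xi> j. \<xi> \<in> shell k \<longrightarrow> \<mu> j \<xi> \<noteq> 0 \<longrightarrow> \<bar>lev j - octave k\<bar> \<le> \<kappa>)"

lemma \<kappa>_pos: "0 < \<kappa>"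
  using pos[of i1] pos[of i2] by (simp add: \<kappa> add_pos_pos)

lemma c_pos: "1 \<le> real c"
  using c(3) \<kappa>_pos by (cases c) auto

lemma octave_ge: "2 ^ k \<le> octave k" "real k \<le> octave k" "1 \<le> octave k"
proof -
  show 1: "2 ^ k \<le> octave k" unfolding octave_def using mult_right_mono[OF c_pos, of "2 ^ k"] by simp
  have "real k \<le> 2 ^ k" using of_nat_less_two_power[of k, where 'a = real] by linarith
  then show "real k \<le> octave k" using 1 by linarith
  have "(1::real) \<le> 2 ^ k" by simp
  then show "1 \<le> octave k" using 1 by linarith
qed

lemma octave_i1: "10 \<le> \<alpha> $ i1 * octave k" and octave_i2: "10 * 2 ^ k \<le> \<alpha> $ i2 * octave k"
proof -
  have *: "10 * 2 ^ k \<le> \<alpha> $ i * octave k" if "10 \<le> real c * \<alpha> $ i" for i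
    using mult_right_mono[OF that, of "2 ^ k"] by (simp add: octave_def mult_ac)
  have "(10::real) \<le> 10 * 2 ^ k" by simp
  then show "10 \<le> \<alpha> $ i1 * octave k" using *[OF c(1)] by linarith
  show "10 * 2 ^ k \<le> \<alpha> $ i2 * octave k" using *[OF c(2)] .
qed

lemma radius_ge: "2 \<le> radius k"
proof -
  have "(2::real) powr 1 \<le> radius k" unfolding radius_def using octave_i1[of k] by (intro powr_mono) auto
  then show ?thesis by simp
qed

lemma shell_i1:
  assumes "\<xi> \<in> shell k"
  shows "2 powr (\<alpha> $ i1 * octave k - 1) \<le> \<bar>\<xi> $ i1\<bar>" "\<bar>\<xi> $ i1\<bar> \<le> 2 powr (\<alpha> $ i1 * octave k + 1)"
proof -
  have 1: "\<bar>\<xi> $ i1 - radius k\<bar> \<le> 1 / 4" using assms by (simp add: shell_def)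
  have "radius k / 2 \<le> \<bar>\<xi> $ i1\<bar>" "\<bar>\<xi> $ i1\<bar> \<le> 2 * radius k" using 1 radius_ge[of k] by linarith+
  then show "2 powr (\<alpha> $ i1 * octave k - 1) \<le> \<bar>\<xi> $ i1\<bar>" "\<bar>\<xi> $ i1\<bar> \<le> 2 powr (\<alpha> $ i1 * octave k + 1)"
    by (auto simp: radius_def powr_add powr_diff)
qed

lemma powr_less_powr_2: "2 powr x < 2 powr y \<Longrightarrow> x < y" for x y :: real
  using powr_less_cancel_iff[of 2 x y] by simp

lemma powr_le_powr_2: "2 powr x \<le> 2 powr y \<Longrightarrow> x \<le> y" for x y :: real
  using powr_le_cancel_iff[of 2 x y] by simp

text \<open>The large coordinate \<open>i1\<close> forces the level up to about
  \<open>octave k\<close>, and no coordinate is large enough to push it further. The deviation is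
  less than \<open>1 + 1 / \<alpha> $ i1\<close>, which \<open>\<kappa>\<close> covers.\<close>

lemma localized_anisotropic: "localized real \<Phi>"
  unfolding localized_def
proof (intro conjI allI impI)
  show "resolution \<Phi>" by (rule resolution_anisotropic[OF gen\<phi> pos])
  fix k \<xi> m assume \<xi>: "\<xi> \<in> shell k" and nz: "\<Phi> m \<xi> \<noteq> 0"
  have p1: "0 < \<alpha> $ i1" and p2: "0 < \<alpha> $ i2" by (auto simp: pos)
  have pd: "0 < 1 / \<alpha> $ i1" "0 < 1 / \<alpha> $ i2" using p1 p2 by auto
  have "2 powr (\<alpha> $ i1 * octave k - 1) < 2 powr ((real m + 1) * \<alpha> $ i1)"
    using shell_i1(1)[OF \<xi>] aniso_resolution_nonzero(1)[OF gen\<phi> pos nz, of i1] by linarith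
  then have "\<alpha> $ i1 * octave k - 1 < (real m + 1) * \<alpha> $ i1" by (rule powr_less_powr_2)
  then have "\<alpha> $ i1 * (octave k - 1 / \<alpha> $ i1) < \<alpha> $ i1 * (real m + 1)" using p1 by (simp add: algebra_simps)
  then have lower: "octave k - 1 / \<alpha> $ i1 < real m + 1" using p1 by simp
  have upper: "real m < octave k + 1 + 1 / \<alpha> $ i1"
  proof (cases "m = 0")
    case True
    show ?thesis unfolding True of_nat_0 using octave_ge(3)[of k] pd(1) by linarith
  next
    case False
    then obtain i where i: "2 powr ((real m - 1) * \<alpha> $ i) < \<bar>\<xi> $ i\<bar>" using aniso_resolution_nonzero(2)[OF gen\<phi> pos nz] by auto
    consider "i = i1" | "i = i2" | "i \<noteq> i1" "i \<noteq> i2" by blast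
    then show ?thesis
    proof cases
      case 1
      have "2 powr ((real m - 1) * \<alpha> $ i1) < 2 powr (\<alpha> $ i1 * octave k + 1)" using i shell_i1(2)[OF \<xi>] unfolding 1 by linarith
      then have "(real m - 1) * \<alpha> $ i1 < \<alpha> $ i1 * octave k + 1" by (rule powr_less_powr_2)
      then have "\<alpha> $ i1 * (real m - 1) < \<alpha> $ i1 * (octave k + 1 / \<alpha> $ i1)" using p1 by (simp add: algebra_simps)
      then have "real m - 1 < octave k + 1 / \<alpha> $ i1" using p1 by simp
      then show ?thesis by simp
    next
      case 2
      have "\<bar>\<xi> $ i2\<bar> \<le> 2 powr (\<alpha> $ i2 * octave k)" using \<xi> by (simp add: shell_def)
      then have "2 powr ((real m - 1) * \<alpha> $ i2) < 2 powr (\<alpha> $ i2 * octave k)" using i unfolding 2 by linarith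
      then have "(real m - 1) * \<alpha> $ i2 < \<alpha> $ i2 * octave k" by (rule powr_less_powr_2)
      then have "real m - 1 < octave k" using p2 by (simp add: mult.commute)
      then show ?thesis using pd by linarith
    next
      case 3
      have "(2::real) powr 0 \<le> 2 powr ((real m - 1) * \<alpha> $ i)"
        using False pos[of i] by (intro powr_mono) (auto intro!: mult_nonneg_nonneg)
      moreover have "\<bar>\<xi> $ i\<bar> \<le> 1 / 4" using \<xi> 3 by (simp add: shell_def)
      ultimately show ?thesis using i by simp
    qed
  qed
  have e: "2 / \<alpha> $ i1 = 2 * (1 / \<alpha> $ i1)" by simp
  show "\<bar>real m - octave k\<bar> \<le> \<kappa>" using lower upper pd unfolding \<kappa> e abs_le_iff by linarith
qed

lemma hyperbolic_shell:
  assumes \<xi>: "\<xi> \<in> shell k" and nz: "\<Theta> j \<xi> \<noteq> 0"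
  shows "\<bar>real (j $ i1) - \<alpha> $ i1 * octave k\<bar> \<le> 2"
    and "real (j $ i2) \<le> \<alpha> $ i2 * octave k + 1"
    and "i \<noteq> i1 \<Longrightarrow> i \<noteq> i2 \<Longrightarrow> j $ i = 0"
proof -
  have nzi: "dyadic_resolution \<theta> (j $ i) (\<xi> $ i) \<noteq> 0" for i using nz by (simp add: hyperbolic_resolution_nonzero)
  have "2 powr (\<alpha> $ i1 * octave k - 1) \<le> 2 powr (real (j $ i1) + 1)"
    using shell_i1(1)[OF \<xi>] dyadic_resolution_nonzero(1)[OF gen\<theta> nzi, of i1] by linarith
  then have 1: "\<alpha> $ i1 * octave k - 1 \<le> real (j $ i1) + 1" by (rule powr_le_powr_2)
  have 2: "real (j $ i1) \<le> \<alpha> $ i1 * octave k + 2"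
  proof (cases "j $ i1 = 0")
    case True
    then show ?thesis using octave_i1[of k] by simp
  next
    case False
    then have "2 powr (real (j $ i1) - 1) < \<bar>\<xi> $ i1\<bar>"
      using dyadic_resolution_nonzero(2)[OF gen\<theta> nzi, of i1] by simp
    then have "2 powr (real (j $ i1) - 1) < 2 powr (\<alpha> $ i1 * octave k + 1)"
      using shell_i1(2)[OF \<xi>] by (rule less_le_trans)
    from powr_less_powr_2[OF this] show ?thesis by simp
  qed
  show "\<bar>real (j $ i1) - \<alpha> $ i1 * octave k\<bar> \<le> 2" using 1 2 by linarith
  show "real (j $ i2) \<le> \<alpha> $ i2 * octave k + 1"
  proof (cases "j $ i2 = 0")
    case True
    have "0 \<le> \<alpha> $ i2 * octave k" using octave_ge(3)[of k] pos[of i2] by simp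
    then show ?thesis using True by simp
  next
    case False
    then have "2 powr (real (j $ i2) - 1) < \<bar>\<xi> $ i2\<bar>"
      using dyadic_resolution_nonzero(2)[OF gen\<theta> nzi, of i2] by simp
    moreover have "\<bar>\<xi> $ i2\<bar> \<le> 2 powr (\<alpha> $ i2 * octave k)" using \<xi> by (simp add: shell_def)
    ultimately have "2 powr (real (j $ i2) - 1) < 2 powr (\<alpha> $ i2 * octave k)" by (rule less_le_trans)
    from powr_less_powr_2[OF this] show ?thesis by simp
  qed
  show "j $ i = 0" if i: "i \<noteq> i1" "i \<noteq> i2"
  proof (rule ccontr)
    assume z: "j $ i \<noteq> 0"
    then have "(2::real) powr 0 \<le> 2 powr (real (j $ i) - 1)" by (intro powr_mono) auto
    moreover have "\<bar>\<xi> $ i\<bar> \<le> 1 / 4" using \<xi> i by (simp add: shell_def)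
    ultimately show False using dyadic_resolution_nonzero(2)[OF gen\<theta> nzi, of i] z by simp
  qed
qed

text \<open>The index in the direction \<open>i1\<close> is within 2 of its expected value and the
  one in the direction \<open>i2\<close> exceeds its bound by at most 1. Division by the anisotropy
  produces the terms \<open>2 / \<alpha> $ i1\<close> and \<open>1 / \<alpha> $ i2\<close> of
  \<open>\<kappa>\<close>. The maximum is attained near \<open>i1\<close>, hence the weight does not
  depend on the scale in \<open>i2\<close>.\<close>

lemma localized_hyperbolic: "localized (hyperbolic_level \<alpha>) \<Theta>"
  unfolding localized_def
proof (intro conjI allI impI)
  show "resolution (\<Theta> :: nat ^ 'n \<Rightarrow> _)" by (rule resolution_hyperbolic[OF gen\<theta>])
  fix k \<xi> and j :: "nat ^ 'n" assume \<xi>: "\<xi> \<in> shell k" and nz: "\<Theta> j \<xi> \<noteq> 0"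
  note h = hyperbolic_shell[OF \<xi> nz]
  have p1: "0 < \<alpha> $ i1" and p2: "0 < \<alpha> $ i2" by (auto simp: pos)
  have pd: "0 < 1 / \<alpha> $ i1" "0 < 1 / \<alpha> $ i2" using p1 p2 by auto
  have e: "2 / \<alpha> $ i1 = 2 * (1 / \<alpha> $ i1)" by simp
  have l1: "octave k - 2 / \<alpha> $ i1 \<le> real (j $ i1) / \<alpha> $ i1" "real (j $ i1) / \<alpha> $ i1 \<le> octave k + 2 / \<alpha> $ i1"
  proof -
    have "(\<alpha> $ i1 * octave k - 2) / \<alpha> $ i1 \<le> real (j $ i1) / \<alpha> $ i1"
      "real (j $ i1) / \<alpha> $ i1 \<le> (\<alpha> $ i1 * octave k + 2) / \<alpha> $ i1"
      using h(1) p1 by (intro divide_right_mono; simp add: abs_le_iff)+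
    then show "octave k - 2 / \<alpha> $ i1 \<le> real (j $ i1) / \<alpha> $ i1" "real (j $ i1) / \<alpha> $ i1 \<le> octave k + 2 / \<alpha> $ i1"
      using p1 by (simp_all add: diff_divide_distrib add_divide_distrib)
  qed
  have l2: "real (j $ i2) / \<alpha> $ i2 \<le> octave k + 1 / \<alpha> $ i2"
  proof -
    have "real (j $ i2) / \<alpha> $ i2 \<le> (\<alpha> $ i2 * octave k + 1) / \<alpha> $ i2"
      using h(2) p2 by (intro divide_right_mono) auto
    then show ?thesis using p2 by (simp add: add_divide_distrib)
  qed
  have "real (j $ i) / \<alpha> $ i \<le> octave k + \<kappa>" for i
  proof -
    consider "i = i1" | "i = i2" | "i \<noteq> i1" "i \<noteq> i2" by blast
    then show ?thesis
    proof cases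
      case 1
      show ?thesis using l1 pd unfolding 1 \<kappa> e by linarith
    next
      case 2
      show ?thesis using l2 pd unfolding 2 \<kappa> e by linarith
    next
      case 3
      then show ?thesis using h(3)[OF 3] octave_ge(3)[of k] \<kappa>_pos by simp
    qed
  qed
  then have "hyperbolic_level \<alpha> j \<le> octave k + \<kappa>" unfolding hyperbolic_level_def Max_range_le_iff by blast
  moreover have "octave k - \<kappa> \<le> real (j $ i1) / \<alpha> $ i1" using l1 pd unfolding \<kappa> e by linarith
  then have "octave k - \<kappa> \<le> hyperbolic_level \<alpha> j" unfolding hyperbolic_level_def Max_range_ge_iff by blast
  ultimately show "\<bar>hyperbolic_level \<alpha> j - octave k\<bar> \<le> \<kappa>" by linarith
qed

lemma octave_separated:
  assumes "\<bar>x - octave k\<bar> \<le> \<kappa>" "\<bar>x - octave l\<bar> \<le> \<kappa>"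
  shows "k = l"
proof (rule ccontr)
  assume "k \<noteq> l"
  have *: "octave k + real c \<le> octave l" if "k < l" for k l
  proof -
    have "(2::real) ^ Suc k \<le> 2 ^ l" using that by (intro power_increasing) auto
    moreover have "(1::real) \<le> 2 ^ k" by simp
    ultimately have "2 ^ k + 1 \<le> (2::real) ^ l" unfolding power_Suc by linarith
    then have "real c * (2 ^ k + 1) \<le> real c * 2 ^ l" by (intro mult_left_mono) auto
    then show ?thesis by (simp add: octave_def algebra_simps)
  qed
  show False using *[of k l] *[of l k] assms c(3) \<open>k \<noteq> l\<close> by (cases "k < l") (auto simp: abs_le_iff)
qed

text \<open>A level cannot lie within \<open>\<kappa>\<close> of two octaves, because their distance
  is at least \<open>c\<close>. Each block therefore sees at most one generation.\<close>

lemma generation_unique: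
  assumes loc: "localized lev \<mu>" and supp: "\<And>k \<xi>. G k \<xi> \<noteq> 0 \<Longrightarrow> \<xi> \<in> shell k"
  shows "\<exists>K. \<forall>k. k \<noteq> K \<longrightarrow> (\<forall>\<xi>. \<mu> j \<xi> * G k \<xi> = 0)"
proof (cases "\<exists>K \<xi>. \<mu> j \<xi> * G K \<xi> \<noteq> 0")
  case True
  then obtain K \<xi> where K: "\<mu> j \<xi> * G K \<xi> \<noteq> 0" by blast
  have lev: "\<bar>lev j - octave k\<bar> \<le> \<kappa>" if "\<mu> j \<xi> * G k \<xi> \<noteq> 0" for k \<xi>
    using that loc supp[of k \<xi>] unfolding localized_def by auto
  show ?thesis using octave_separated[OF lev lev[OF K]] by blast
qed auto

lemma weight_bounds:
  assumes "\<bar>l - octave k\<bar> \<le> \<kappa>"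
  shows "2 powr (l * s) \<le> 2 powr (octave k * s + \<kappa> * \<bar>s\<bar>)" "2 powr (octave k * s - \<kappa> * \<bar>s\<bar>) \<le> 2 powr (l * s)"
proof -
  have "\<bar>(l - octave k) * s\<bar> \<le> \<kappa> * \<bar>s\<bar>" unfolding abs_mult using assms by (rule mult_right_mono) simp
  then have "l * s \<le> octave k * s + \<kappa> * \<bar>s\<bar>" "octave k * s - \<kappa> * \<bar>s\<bar> \<le> l * s"
    by (auto simp: abs_le_iff algebra_simps)
  then show "2 powr (l * s) \<le> 2 powr (octave k * s + \<kappa> * \<bar>s\<bar>)" "2 powr (octave k * s - \<kappa> * \<bar>s\<bar>) \<le> 2 powr (l * s)"
    by (auto intro: powr_mono)
qed

text \<open>On the shell \<open>norm \<xi>\<close> is at least of the size of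
  \<open>radius k\<close>, so an exponential in \<open>octave k\<close> is a polynomial in
  \<open>norm \<xi>\<close>. This is what makes glued functions tempered.\<close>

lemma shell_growth:
  assumes "\<xi> \<in> shell k" "0 \<le> F"
  shows "2 powr (F * octave k) \<le> (1 + norm \<xi>) ^ nat \<lceil>F / \<alpha> $ i1\<rceil>"
proof -
  have p1: "0 < \<alpha> $ i1" by (rule pos)
  have "\<bar>\<xi> $ i1 - radius k\<bar> \<le> 1 / 4" using assms(1) by (simp add: shell_def)
  then have r: "radius k \<le> 1 + norm \<xi>" using component_le_norm_cart[of \<xi> i1] by linarith
  have "2 powr (F * octave k) = radius k powr (F / \<alpha> $ i1)"
    using p1 by (simp add: radius_def powr_powr mult.commute)
  also have "\<dots> \<le> (1 + norm \<xi>) powr (F / \<alpha> $ i1)"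
    using r radius_ge[of k] p1 assms(2) by (intro powr_mono2) auto
  also have "\<dots> \<le> (1 + norm \<xi>) powr (real (nat \<lceil>F / \<alpha> $ i1\<rceil>))"
    by (intro powr_mono) (linarith, simp)
  also have "\<dots> = (1 + norm \<xi>) ^ nat \<lceil>F / \<alpha> $ i1\<rceil>"
    by (intro powr_realpow) (simp add: add_pos_nonneg)
  finally show ?thesis .
qed

definition good_family :: "(nat \<Rightarrow> real ^ 'n \<Rightarrow> complex) \<Rightarrow> bool" where
  "good_family G \<longleftrightarrow> (\<forall>k. G k \<in> borel_measurable borel) \<and> (\<forall>k \<xi>. G k \<xi> \<noteq> 0 \<longrightarrow> \<xi> \<in> shell k) \<and>
     (\<exists>D. \<forall>k \<xi>. norm (G k \<xi>) \<le> D * 2 powr octave k)"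

lemma good_family_integrable:
  assumes "good_family G" "resolution \<mu>"
  shows "integrable lborel (\<lambda>\<xi>. \<mu> j \<xi> * G k \<xi>)"
proof (rule integrable_mult_poly_growth[OF _ resolution_schwartz[OF assms(2)]])
  obtain D where "\<And>\<xi>. norm (G k \<xi>) \<le> D * 2 powr octave k" using assms(1) unfolding good_family_def by blast
  then show "poly_growth (G k)"
    unfolding poly_growth_def using assms(1) by (intro conjI exI[of _ "D * 2 powr octave k"] exI[of _ 0]) (auto simp: good_family_def)
qed

text \<open>Under a localised resolution the series has at most one nonzero term at each frequency:
  some \<open>\<mu> j\<close> does not vanish there, and it meets at most one generation.\<close>

definition glue :: "(nat \<Rightarrow> real) \<Rightarrow> (nat \<Rightarrow> real ^ 'n \<Rightarrow> complex) \<Rightarrow> real ^ 'n \<Rightarrow> complex" where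
  "glue a G \<xi> = (\<Sum>k. complex_of_real (a k) * G k \<xi>)"

lemma glue_single: "(\<And>k. k \<noteq> K \<Longrightarrow> G k \<xi> = 0) \<Longrightarrow> glue a G \<xi> = complex_of_real (a K) * G K \<xi>"
  unfolding glue_def by (subst suminf_finite[of "{K}"]) auto

text \<open>Each block of the glued function is a block of one generation, so its modulus is a
  supremum over the generations and no sum has to be estimated. The supremum costs the factor
  \<open>2 powr (real k * \<eta>)\<close> in the upper bound; in the lower bound only the comparison
  of weights is lost.\<close>

lemma
  fixes \<mu> :: "'l::countable \<Rightarrow> real ^ 'n \<Rightarrow> complex"
  assumes loc: "localized lev \<mu>" and G: "good_family G" and a: "\<And>k. 0 < a k" and p: "0 < p" and q: "0 < q"
  shows glue_norm_upper: "0 < \<eta> \<Longrightarrow>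
      (\<And>k. flat_norm b p q \<mu> (G k) \<le> ennreal (C / (a k * 2 powr (octave k * s)) * 2 powr (- (real k * \<eta>)))) \<Longrightarrow>
      spectral_norm b p q s lev \<mu> (glue a G) < \<infinity>"
    and glue_norm_lower: "ennreal (a k * 2 powr (octave k * s - \<kappa> * \<bar>s\<bar>)) * flat_norm b p q \<mu> (G k) \<le>
      spectral_norm b p q s lev \<mu> (glue a G)"
proof -
  have res: "resolution \<mu>" using loc by (simp add: localized_def)
  have supp: "\<And>k \<xi>. G k \<xi> \<noteq> 0 \<Longrightarrow> \<xi> \<in> shell k" using G by (auto simp: good_family_def)
  define U where "U k j x = norm (inverse_fourier (\<lambda>\<xi>. \<mu> j \<xi> * G k \<xi>) x)" for k j x
  define P where "P k j x = ennreal (2 powr (lev j * s) * (a k * U k j x))" for k j x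
  have [measurable]: "inverse_fourier (\<lambda>\<xi>. \<mu> j \<xi> * G k \<xi>) \<in> borel_measurable borel" for j k
    by (rule inverse_fourier_measurable[OF good_family_integrable[OF G res]])
  have [measurable]: "U k j \<in> borel_measurable borel" "P k j \<in> borel_measurable borel" for k j
    unfolding U_def P_def by measurable
  have U0: "U k j x = 0" if "\<not> \<bar>lev j - octave k\<bar> \<le> \<kappa>" for k j x
  proof -
    have "\<mu> j \<xi> * G k \<xi> = 0" for \<xi> using that loc supp[of k \<xi>] unfolding localized_def by auto
    then show ?thesis by (simp only: U_def inverse_fourier_zero norm_zero)
  qed
  have SUP: "ennreal (2 powr (lev j * s)) * ennreal (norm (inverse_fourier (\<lambda>\<xi>. \<mu> j \<xi> * glue a G \<xi>) x)) = (SUP k. P k j x)" for j x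
  proof -
    obtain K where K: "\<And>k \<xi>. k \<noteq> K \<Longrightarrow> \<mu> j \<xi> * G k \<xi> = 0" using generation_unique[OF loc supp, of G j] by blast
    have eqG: "\<mu> j \<xi> * glue a G \<xi> = complex_of_real (a K) * (\<mu> j \<xi> * G K \<xi>)" for \<xi>
    proof (cases "\<mu> j \<xi> = 0")
      case False
      then have "glue a G \<xi> = complex_of_real (a K) * G K \<xi>" using K[of _ \<xi>] by (intro glue_single) auto
      then show ?thesis by simp
    qed simp
    have 1: "norm (inverse_fourier (\<lambda>\<xi>. \<mu> j \<xi> * glue a G \<xi>) x) = a K * U K j x"
      unfolding eqG inverse_fourier_cmult norm_mult using less_imp_le[OF a[of K]] by (simp add: U_def)
    have "U k j x = 0" if "k \<noteq> K" for k using K[OF that] by (simp only: U_def inverse_fourier_zero norm_zero)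
    then have "P k j x \<le> P K j x" for k by (cases "k = K") (auto simp: P_def)
    then have "(SUP k. P k j x) = P K j x" by (intro antisym SUP_least SUP_upper) auto
    moreover have "0 \<le> a K * U K j x" using less_imp_le[OF a[of K]] by (simp add: U_def)
    ultimately show ?thesis unfolding 1 by (simp add: P_def ennreal_mult)
  qed
  have flat: "flat_norm b p q \<mu> (G k) = mixed_norm b p q (\<lambda>j x. ennreal (U k j x))" for k
    by (simp add: flat_norm_def U_def)
  have spec: "spectral_norm b p q s lev \<mu> (glue a G) = mixed_norm b p q (\<lambda>j x. SUP k. P k j x)"
    unfolding spectral_norm_def SUP ..
  have Pu: "mixed_norm b p q (P k) \<le> ennreal (a k * 2 powr (octave k * s + \<kappa> * \<bar>s\<bar>)) * flat_norm b p q \<mu> (G k)" for k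
  proof -
    have "P k j x \<le> ennreal (a k * 2 powr (octave k * s + \<kappa> * \<bar>s\<bar>)) * ennreal (U k j x)" for j x
    proof (cases "\<bar>lev j - octave k\<bar> \<le> \<kappa>")
      case True
      have "2 powr (lev j * s) * (a k * U k j x) \<le> 2 powr (octave k * s + \<kappa> * \<bar>s\<bar>) * (a k * U k j x)"
        using weight_bounds(1)[OF True] less_imp_le[OF a[of k]] by (intro mult_right_mono) (auto simp: U_def)
      then show ?thesis unfolding P_def using less_imp_le[OF a[of k]]
        by (subst ennreal_mult[symmetric]) (auto simp: U_def mult_ac intro!: ennreal_leI)
    qed (simp add: P_def U0)
    then have "mixed_norm b p q (P k) \<le> mixed_norm b p q (\<lambda>j x. ennreal (a k * 2 powr (octave k * s + \<kappa> * \<bar>s\<bar>)) * ennreal (U k j x))"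
      by (intro mixed_norm_mono p q) auto
    also have "\<dots> = ennreal (a k * 2 powr (octave k * s + \<kappa> * \<bar>s\<bar>)) * flat_norm b p q \<mu> (G k)"
      unfolding flat by (intro mixed_norm_cmult p q) auto
    finally show ?thesis .
  qed
  have Pl: "ennreal (a k * 2 powr (octave k * s - \<kappa> * \<bar>s\<bar>)) * flat_norm b p q \<mu> (G k) \<le> mixed_norm b p q (P k)" for k
  proof -
    have "ennreal (a k * 2 powr (octave k * s - \<kappa> * \<bar>s\<bar>)) * ennreal (U k j x) \<le> P k j x" for j x
    proof (cases "\<bar>lev j - octave k\<bar> \<le> \<kappa>")
      case True
      have "2 powr (octave k * s - \<kappa> * \<bar>s\<bar>) * (a k * U k j x) \<le> 2 powr (lev j * s) * (a k * U k j x)"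
        using weight_bounds(2)[OF True] less_imp_le[OF a[of k]] by (intro mult_right_mono) (auto simp: U_def)
      then show ?thesis unfolding P_def using less_imp_le[OF a[of k]]
        by (subst ennreal_mult[symmetric]) (auto simp: U_def mult_ac intro!: ennreal_leI)
    qed (simp add: P_def U0)
    then have "mixed_norm b p q (\<lambda>j x. ennreal (a k * 2 powr (octave k * s - \<kappa> * \<bar>s\<bar>)) * ennreal (U k j x)) \<le> mixed_norm b p q (P k)"
      by (intro mixed_norm_mono p q) auto
    also have "mixed_norm b p q (\<lambda>j x. ennreal (a k * 2 powr (octave k * s - \<kappa> * \<bar>s\<bar>)) * ennreal (U k j x)) =
        ennreal (a k * 2 powr (octave k * s - \<kappa> * \<bar>s\<bar>)) * flat_norm b p q \<mu> (G k)"
      unfolding flat by (intro mixed_norm_cmult p q) auto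
    finally show ?thesis .
  qed
  show "ennreal (a k * 2 powr (octave k * s - \<kappa> * \<bar>s\<bar>)) * flat_norm b p q \<mu> (G k) \<le> spectral_norm b p q s lev \<mu> (glue a G)"
  proof (rule order_trans[OF Pl])
    show "mixed_norm b p q (P k) \<le> spectral_norm b p q s lev \<mu> (glue a G)"
      unfolding spec by (intro mixed_norm_mono p q) (auto intro: SUP_upper)
  qed
  assume \<eta>: "0 < \<eta>" and C: "\<And>k. flat_norm b p q \<mu> (G k) \<le> ennreal (C / (a k * 2 powr (octave k * s)) * 2 powr (- (real k * \<eta>)))"
  obtain K :: real where K: "0 \<le> K" "\<And>F::nat \<Rightarrow> 'l \<Rightarrow> real ^ 'n \<Rightarrow> ennreal. (\<And>k j. F k j \<in> borel_measurable borel) \<Longrightarrow>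
      mixed_norm b p q (\<lambda>j x. SUP k. F k j x) \<le> ennreal K * (SUP k. ennreal (2 powr (real k * \<eta>)) * mixed_norm b p q (F k))"
    by (rule mixed_norm_SUP[OF p q \<eta>]) blast
  have "spectral_norm b p q s lev \<mu> (glue a G) \<le> ennreal K * (SUP k. ennreal (2 powr (real k * \<eta>)) * mixed_norm b p q (P k))"
    unfolding spec by (rule K(2)) measurable
  also have "\<dots> \<le> ennreal K * ennreal (2 powr (\<kappa> * \<bar>s\<bar>) * C)"
  proof (intro mult_left_mono SUP_least)
    fix k
    have "ennreal (2 powr (real k * \<eta>)) * mixed_norm b p q (P k) \<le>
      ennreal (2 powr (real k * \<eta>)) * (ennreal (a k * 2 powr (octave k * s + \<kappa> * \<bar>s\<bar>)) *
        ennreal (C / (a k * 2 powr (octave k * s)) * 2 powr (- (real k * \<eta>))))"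
      by (intro mult_left_mono order_trans[OF Pu] C) auto
    also have "\<dots> = ennreal (2 powr (real k * \<eta>) * (a k * 2 powr (octave k * s + \<kappa> * \<bar>s\<bar>)) *
        (C / (a k * 2 powr (octave k * s)) * 2 powr (- (real k * \<eta>))))"
    proof -
      have "ennreal u * (ennreal v * ennreal w) = ennreal (u * v * w)" if "0 \<le> u" "0 \<le> v" for u v w
        using that by (simp add: ennreal_mult' mult.assoc)
      then show ?thesis using less_imp_le[OF a[of k]] by (metis mult_nonneg_nonneg powr_ge_zero)
    qed
    also have "2 powr (real k * \<eta>) * (a k * 2 powr (octave k * s + \<kappa> * \<bar>s\<bar>)) *
        (C / (a k * 2 powr (octave k * s)) * 2 powr (- (real k * \<eta>))) = 2 powr (\<kappa> * \<bar>s\<bar>) * C"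
      using a[of k] by (simp add: powr_add powr_minus field_simps)
    finally show "ennreal (2 powr (real k * \<eta>)) * mixed_norm b p q (P k) \<le> ennreal (2 powr (\<kappa> * \<bar>s\<bar>) * C)" .
  qed simp
  also have "\<dots> < \<infinity>" by (simp add: ennreal_mult_less_top)
  finally show "spectral_norm b p q s lev \<mu> (glue a G) < \<infinity>" .
qed

text \<open>Gluing the generations with suitable coefficients turns a discrepancy between the two quasi-norms that
  grows with \<open>k\<close> into a single distribution for which exactly one of them is finite.\<close>

lemma condensation:
  fixes \<mu>1 :: "'i::countable \<Rightarrow> real ^ 'n \<Rightarrow> complex" and \<mu>2 :: "'j::countable \<Rightarrow> real ^ 'n \<Rightarrow> complex"
  assumes loc1: "localized lev1 \<mu>1" and loc2: "localized lev2 \<mu>2" and p: "0 < p" and q: "0 < q"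
    and G: "good_family G" and \<tau>: "\<And>k. 0 < \<tau> k" "0 \<le> E" "\<And>k. 1 / \<tau> k \<le> 2 powr (E * octave k)"
    and AB: "A < B" and e: "0 < e"
    and upper: "\<And>k. flat_norm b p q \<mu>1 (G k) \<le> ennreal (C * \<tau> k * 2 powr (real k * A))"
    and lower: "\<And>k. ennreal (e * \<tau> k * 2 powr (real k * B)) \<le> flat_norm b p q \<mu>2 (G k)"
  shows "\<exists>H. poly_growth H \<and> spectral_norm b p q s lev1 \<mu>1 H < \<infinity> \<and> spectral_norm b p q s lev2 \<mu>2 H = \<infinity>"
proof -
  have Gm[measurable]: "\<And>k. G k \<in> borel_measurable borel" and supp: "\<And>k \<xi>. G k \<xi> \<noteq> 0 \<Longrightarrow> \<xi> \<in> shell k"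
    using G by (auto simp: good_family_def)
  obtain D where D: "\<And>k \<xi>. norm (G k \<xi>) \<le> D * 2 powr octave k" using G by (auto simp: good_family_def)
  have D0: "0 \<le> D" using order_trans[OF norm_ge_zero D[of 0 0]] by (simp add: zero_le_mult_iff)
  have res1: "resolution \<mu>1" and res2: "resolution \<mu>2" using loc1 loc2 by (auto simp: localized_def)
  \<comment> \<open>The first two factors normalise the smoothness weight and the size
    \<open>\<tau> k\<close>. The last one splits the gap between \<open>A\<close> and
    \<open>B\<close> in the middle, so that the contribution of generation \<open>k\<close> decays
    like \<open>2 powr (- (real k * ((B - A) / 2)))\<close> in one quasi-norm and grows at the
    opposite rate in the other.\<close>
  define a where "a k = 2 powr (- (octave k * s)) / \<tau> k * 2 powr (- (real k * ((A + B) / 2)))" for k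
  have a0: "0 < a k" for k using \<tau>(1) by (simp add: a_def)
  define H where "H = glue a G"
  have Hm: "H \<in> borel_measurable borel" unfolding H_def glue_def[abs_def] by measurable
  \<comment> \<open>The four terms account for the smoothness weight, for
    \<open>1 / \<tau> k\<close>, for the geometric factor (with \<open>k\<close> bounded by
    \<open>octave k\<close>) and for the growth allowed by \<open>good_family\<close>.\<close>
  define F where "F = \<bar>s\<bar> + E + \<bar>(A + B) / 2\<bar> + 1"
  have F0: "0 \<le> F" using \<tau>(2) by (simp add: F_def)
  have aF: "a k * 2 powr octave k \<le> 2 powr (F * octave k)" for k
  proof -
    have "2 powr (- (octave k * s)) \<le> 2 powr (\<bar>s\<bar> * octave k)"
      using octave_ge(3)[of k] mult_right_mono[OF abs_ge_minus_self[of s], of "octave k"] by (intro powr_mono) (auto simp: mult.commute)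
    moreover have "2 powr (- (real k * ((A + B) / 2))) \<le> 2 powr (\<bar>(A + B) / 2\<bar> * octave k)"
    proof (rule powr_mono)
      have "- (real k * ((A + B) / 2)) \<le> real k * \<bar>(A + B) / 2\<bar>"
        using mult_left_mono[OF abs_ge_minus_self[of "(A + B) / 2"], of "real k"] by simp
      also have "\<dots> \<le> octave k * \<bar>(A + B) / 2\<bar>" using octave_ge(2)[of k] by (rule mult_right_mono) simp
      finally show "- (real k * ((A + B) / 2)) \<le> \<bar>(A + B) / 2\<bar> * octave k" by (simp add: mult.commute)
    qed simp
    ultimately have "2 powr (- (octave k * s)) * (1 / \<tau> k) * 2 powr (- (real k * ((A + B) / 2))) \<le>
        2 powr (\<bar>s\<bar> * octave k) * 2 powr (E * octave k) * 2 powr (\<bar>(A + B) / 2\<bar> * octave k)"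
      using \<tau>(3)[of k] less_imp_le[OF \<tau>(1)[of k]] by (intro mult_mono) auto
    then have "a k * 2 powr octave k \<le> 2 powr (\<bar>s\<bar> * octave k) * 2 powr (E * octave k) * 2 powr (\<bar>(A + B) / 2\<bar> * octave k) * 2 powr octave k"
      by (intro mult_right_mono) (simp_all add: a_def)
    also have "\<dots> = 2 powr (F * octave k)"
      unfolding F_def by (simp only: powr_add[symmetric] distrib_right mult_1)
    finally show ?thesis .
  qed
  have growth: "poly_growth H"
    unfolding poly_growth_def
  proof (intro conjI exI allI)
    fix \<xi>
    obtain j where j: "\<mu>1 j \<xi> \<noteq> 0" using resolution_nonzero[OF res1] by blast
    obtain K where "\<And>k. k \<noteq> K \<Longrightarrow> \<mu>1 j \<xi> * G k \<xi> = 0" using generation_unique[OF loc1 supp, of G j] by blast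
    then have "H \<xi> = complex_of_real (a K) * G K \<xi>" using j unfolding H_def by (intro glue_single) auto
    then have n: "norm (H \<xi>) = a K * norm (G K \<xi>)" using a0[of K] by (simp add: norm_mult)
    show "norm (H \<xi>) \<le> D * (1 + norm \<xi>) ^ nat \<lceil>F / \<alpha> $ i1\<rceil>"
    proof (cases "G K \<xi> = 0")
      case True
      then show ?thesis using n D0 by simp
    next
      case False
      have "a K * norm (G K \<xi>) \<le> a K * (D * 2 powr octave K)" using a0[of K] D by (intro mult_left_mono) auto
      also have "\<dots> = D * (a K * 2 powr octave K)" by simp
      also have "\<dots> \<le> D * (1 + norm \<xi>) ^ nat \<lceil>F / \<alpha> $ i1\<rceil>"
        using order_trans[OF aF shell_growth[OF supp[OF False] F0]] D0 by (rule mult_left_mono)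
      finally show ?thesis using n by simp
    qed
  qed (rule Hm)
  have a_eq: "a k * 2 powr (octave k * s) * \<tau> k = 2 powr (- (real k * ((A + B) / 2)))" for k
    using \<tau>(1)[of k] by (simp add: a_def powr_minus field_simps)
  have fin: "spectral_norm b p q s lev1 \<mu>1 H < \<infinity>"
    unfolding H_def
  proof (rule glue_norm_upper[OF loc1 G a0 p q, where \<eta> = "(B - A) / 2" and C = C])
    show "0 < (B - A) / 2" using AB by simp
    fix k
    have "C * \<tau> k * 2 powr (real k * A) = C / (a k * 2 powr (octave k * s)) * (a k * 2 powr (octave k * s) * \<tau> k) * 2 powr (real k * A)"
      using a0[of k] by simp
    also have "\<dots> = C / (a k * 2 powr (octave k * s)) * (2 powr (- (real k * ((A + B) / 2))) * 2 powr (real k * A))"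
      unfolding a_eq by simp
    also have "2 powr (- (real k * ((A + B) / 2))) * 2 powr (real k * A) = 2 powr (- (real k * ((B - A) / 2)))"
    proof -
      have "- (real k * ((A + B) / 2)) + real k * A = - (real k * ((B - A) / 2))" by (simp add: field_simps)
      then show ?thesis by (simp only: powr_add[symmetric])
    qed
    finally show "flat_norm b p q \<mu>1 (G k) \<le> ennreal (C / (a k * 2 powr (octave k * s)) * 2 powr (- (real k * ((B - A) / 2))))"
      using upper[of k] by simp
  qed
  have "spectral_norm b p q s lev2 \<mu>2 H = \<top>"
  proof (rule ennreal_top_unique_nat)
    fix n :: nat
    define \<epsilon> where "\<epsilon> = e * 2 powr (- (\<kappa> * \<bar>s\<bar>))"
    have \<epsilon>: "0 < \<epsilon>" using e by (simp add: \<epsilon>_def)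
    \<comment> \<open>A single late generation suffices to exceed \<open>n\<close>; the lower bound
      never has to combine several generations.\<close>
    obtain k :: nat where k: "real n / \<epsilon> \<le> 2 powr (real k * ((B - A) / 2))" using ex_nat_powr_ge[of "(B - A) / 2"] AB by auto
    have "real n \<le> \<epsilon> * 2 powr (real k * ((B - A) / 2))" using k \<epsilon> by (simp add: field_simps)
    also have "2 powr (real k * ((B - A) / 2)) = (a k * 2 powr (octave k * s) * \<tau> k) * 2 powr (real k * B)"
    proof -
      have "real k * ((B - A) / 2) = - (real k * ((A + B) / 2)) + real k * B" by (simp add: field_simps)
      then show ?thesis unfolding a_eq by (simp only: powr_add[symmetric])
    qed
    also have "\<epsilon> * \<dots> = (a k * 2 powr (octave k * s - \<kappa> * \<bar>s\<bar>)) * (e * \<tau> k * 2 powr (real k * B))"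
      by (simp add: \<epsilon>_def powr_diff powr_minus field_simps)
    finally have "of_nat n \<le> ennreal (a k * 2 powr (octave k * s - \<kappa> * \<bar>s\<bar>)) * ennreal (e * \<tau> k * 2 powr (real k * B))"
      using less_imp_le[OF a0[of k]] less_imp_le[OF \<tau>(1)[of k]] e
      by (subst ennreal_mult[symmetric]) (auto simp: ennreal_of_nat_eq_real_of_nat intro!: ennreal_leI)
    also have "\<dots> \<le> ennreal (a k * 2 powr (octave k * s - \<kappa> * \<bar>s\<bar>)) * flat_norm b p q \<mu>2 (G k)"
      by (intro mult_left_mono lower) simp
    also have "\<dots> \<le> spectral_norm b p q s lev2 \<mu>2 H"
      unfolding H_def by (rule glue_norm_lower[OF loc2 G a0 p q])
    finally show "of_nat n \<le> spectral_norm b p q s lev2 \<mu>2 H" .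
  qed
  then show ?thesis using growth fin by auto
qed

end

subsection \<open>Wave packets\<close>

lemma Lp_norm_translate:
  fixes f :: "'a::euclidean_space \<Rightarrow> ennreal"
  assumes [measurable]: "f \<in> borel_measurable borel" and p: "0 < p"
  shows "Lp_norm p (\<lambda>x. f (x - y)) = Lp_norm p f"
proof -
  have le: "Lp_norm p (\<lambda>x. f (z + x)) \<le> Lp_norm p f" if [measurable]: "f \<in> borel_measurable borel" for f z
  proof (cases "p = \<infinity>")
    case True
    have "AE x in distr lborel borel ((+) z). f x \<le> esssup lborel f"
      using esssup_AE[of f lborel] unfolding lborel_distr_plus .
    then have "AE x in lborel. f (z + x) \<le> esssup lborel f"
      by (subst (asm) AE_distr_iff) auto
    then show ?thesis using True unfolding Lp_norm_def by (auto intro!: esssup_I)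
  next
    case False
    have "(\<integral>\<^sup>+ x. ennreal_powr (f (z + x)) (enn2real p) \<partial>lborel) = (\<integral>\<^sup>+ x. ennreal_powr (f x) (enn2real p) \<partial>distr lborel borel ((+) z))"
      by (subst nn_integral_distr) auto
    then show ?thesis using False unfolding lborel_distr_plus by (simp add: Lp_norm_def)
  qed
  show ?thesis
  proof (rule antisym)
    show "Lp_norm p (\<lambda>x. f (x - y)) \<le> Lp_norm p f" using le[OF assms(1), of "- y"] by simp
    show "Lp_norm p f \<le> Lp_norm p (\<lambda>x. f (x - y))" using le[of "\<lambda>x. f (x - y)" y] by simp
  qed
qed

definition decay :: "nat \<Rightarrow> 'a::euclidean_space \<Rightarrow> real" where
  "decay K x = inverse ((1 + norm x) ^ K)"

lemma decay_nonneg [simp]: "0 \<le> decay K x"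
  by (simp add: decay_def)

lemma decay_measurable [measurable]: "decay K \<in> borel_measurable borel"
  unfolding decay_def[abs_def] by measurable

text \<open>The \<open>r\<close>-th power of the decay function must be dominated by the integrable
  weight of exponent \<open>2 * DIM('a)\<close>, hence the threshold \<open>2 * DIM('a) / r\<close>.
  For small \<open>p\<close> much decay is required.\<close>

lemma Lp_norm_decay:
  assumes p: "0 < p"
  obtains K0 where "\<And>K. K0 \<le> K \<Longrightarrow> Lp_norm p (\<lambda>x::'a::euclidean_space. ennreal (decay K x)) < \<infinity>"
proof (cases "p = \<infinity>")
  case True
  have "Lp_norm p (\<lambda>x::'a. ennreal (decay K x)) < \<infinity>" for K
  proof -
    have "decay K x \<le> 1" for x :: 'a
      unfolding decay_def using one_le_power[of "1 + norm x" K] by (intro inverse_le_1_iff[THEN iffD2]) simp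
    then have "esssup lborel (\<lambda>x::'a. ennreal (decay K x)) \<le> 1"
      by (intro esssup_I) (auto simp: ennreal_le_1)
    then show ?thesis using True by (auto simp: Lp_norm_def top_unique intro: le_less_trans[of _ 1])
  qed
  then show ?thesis using that by blast
next
  case False
  define r where "r = enn2real p"
  have r: "0 < r" using p False enn2real_pos by (simp add: r_def)
  show ?thesis
  proof (rule that[of "nat \<lceil>2 * real DIM('a) / r\<rceil>"])
    fix K assume "nat \<lceil>2 * real DIM('a) / r\<rceil> \<le> K"
    then have "2 * real DIM('a) / r \<le> real K" by linarith
    then have K: "real (2 * DIM('a)) \<le> real K * r" using r by (simp add: field_simps)
    have "(\<integral>\<^sup>+(x::'a). ennreal_powr (ennreal (decay K x)) r \<partial>lborel) \<le> (\<integral>\<^sup>+(x::'a). ennreal (inverse ((1 + norm x) ^ (2 * DIM('a)))) \<partial>lborel)"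
    proof (rule nn_integral_mono)
      fix x :: 'a
      have pos: "0 < 1 + norm x" by (simp add: add_pos_nonneg)
      have "decay K x powr r = (1 + norm x) powr (- (real K * r))"
        using pos by (simp add: decay_def powr_minus[symmetric] powr_powr flip: powr_realpow)
      also have "\<dots> \<le> (1 + norm x) powr (- real (2 * DIM('a)))"
        using K by (intro powr_mono) auto
      also have "\<dots> = inverse ((1 + norm x) ^ (2 * DIM('a)))"
        using pos by (simp only: powr_minus powr_realpow)
      finally show "ennreal_powr (ennreal (decay K x)) r \<le> ennreal (inverse ((1 + norm x) ^ (2 * DIM('a))))"
        by (simp add: ennreal_powr_ennreal ennreal_leI)
    qed
    also have "\<dots> < \<infinity>"
      using integrable_weight[where 'a = 'a] unfolding integrable_iff_bounded by simp
    finally show "Lp_norm p (\<lambda>x::'a. ennreal (decay K x)) < \<infinity>"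
      using False by (cases "\<integral>\<^sup>+(x::'a). ennreal_powr (ennreal (decay K x)) r \<partial>lborel")
        (auto simp: Lp_norm_def r_def ennreal_powr_ennreal)
  qed
qed

lemma partition_inverse_fourier:
  assumes \<mu>: "resolution \<mu>" and W: "finite W" "\<And>j \<xi>. \<mu> j \<xi> * H \<xi> \<noteq> 0 \<Longrightarrow> j \<in> W"
    and i: "\<And>j. integrable lborel (\<lambda>\<xi>. \<mu> j \<xi> * H \<xi>)"
  shows "inverse_fourier H x = (\<Sum>j\<in>W. inverse_fourier (\<lambda>\<xi>. \<mu> j \<xi> * H \<xi>) x)"
proof -
  have "H \<xi> = (\<Sum>j\<in>W. \<mu> j \<xi> * H \<xi>)" for \<xi>
  proof (cases "H \<xi> = 0")
    case False
    then have "(\<Sum>j\<in>W. \<mu> j \<xi>) = 1" using W by (intro resolution_sum[OF \<mu>]) auto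
    then show ?thesis by (simp flip: sum_distrib_right)
  qed simp
  then have "inverse_fourier H x = inverse_fourier (\<lambda>\<xi>. \<Sum>j\<in>W. \<mu> j \<xi> * H \<xi>) x" by simp
  also have "\<dots> = (\<Sum>j\<in>W. inverse_fourier (\<lambda>\<xi>. \<mu> j \<xi> * H \<xi>) x)" by (rule inverse_fourier_sum) (rule i)
  finally show ?thesis .
qed

text \<open>Shifting the spectrum produces a phase, and modulating it translates the function. Up to
  modulus, a packet at any frequency and any site is thus the same function at the origin, with the
  shift moved into the multiplier.\<close>

lemma inverse_fourier_modulated:
  fixes m b :: "'a::euclidean_space \<Rightarrow> complex"
  assumes [measurable]: "m \<in> borel_measurable borel" "b \<in> borel_measurable borel"
  shows "norm (inverse_fourier (\<lambda>\<xi>. m \<xi> * (exp (- (\<i> * complex_of_real (y \<bullet> \<xi>))) * b (\<xi> - \<eta>))) x) =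
    norm (inverse_fourier (\<lambda>\<zeta>. m (\<eta> + \<zeta>) * b \<zeta>) (x - y))"
proof -
  let ?F = "\<lambda>\<xi>. m \<xi> * (exp (- (\<i> * complex_of_real (y \<bullet> \<xi>))) * b (\<xi> - \<eta>)) * exp (\<i> * complex_of_real (x \<bullet> \<xi>))"
  have "(LINT \<xi>|lborel. ?F \<xi>) = (LINT \<zeta>|lborel. ?F (\<eta> + \<zeta>))"
    by (rule lborel_integral_translate[symmetric]) measurable
  also have "\<dots> = (LINT \<zeta>|lborel. exp (\<i> * complex_of_real ((x - y) \<bullet> \<eta>)) *
      (m (\<eta> + \<zeta>) * b \<zeta> * exp (\<i> * complex_of_real ((x - y) \<bullet> \<zeta>))))"
  proof (rule Bochner_Integration.integral_cong)
    fix \<zeta>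
    have "exp (- (\<i> * complex_of_real (y \<bullet> (\<eta> + \<zeta>)))) * exp (\<i> * complex_of_real (x \<bullet> (\<eta> + \<zeta>))) =
      exp (\<i> * complex_of_real ((x - y) \<bullet> \<eta>)) * exp (\<i> * complex_of_real ((x - y) \<bullet> \<zeta>))"
      unfolding exp_add[symmetric] by (simp add: inner_add_right inner_diff_left algebra_simps)
    then show "?F (\<eta> + \<zeta>) = exp (\<i> * complex_of_real ((x - y) \<bullet> \<eta>)) * (m (\<eta> + \<zeta>) * b \<zeta> * exp (\<i> * complex_of_real ((x - y) \<bullet> \<zeta>)))"
      by (simp add: mult_ac)
  qed simp
  also have "\<dots> = exp (\<i> * complex_of_real ((x - y) \<bullet> \<eta>)) * (LINT \<zeta>|lborel. m (\<eta> + \<zeta>) * b \<zeta> * exp (\<i> * complex_of_real ((x - y) \<bullet> \<zeta>)))"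
    by (rule integral_mult_right_zero)
  finally have "norm (LINT \<xi>|lborel. ?F \<xi>) = norm (LINT \<zeta>|lborel. m (\<eta> + \<zeta>) * b \<zeta> * exp (\<i> * complex_of_real ((x - y) \<bullet> \<zeta>)))"
    by (simp only: norm_mult norm_exp_i mult_1)
  then show ?thesis unfolding inverse_fourier_def norm_mult by (simp only:)
qed

lemma card_level_window: "finite {m::nat. \<bar>real m - t\<bar> \<le> \<kappa>}" "card {m::nat. \<bar>real m - t\<bar> \<le> \<kappa>} \<le> nat \<lceil>2 * \<kappa>\<rceil> + 1"
proof -
  define a where "a = nat \<lceil>t - \<kappa>\<rceil>"
  have "{m::nat. \<bar>real m - t\<bar> \<le> \<kappa>} \<subseteq> {a..a + nat \<lceil>2 * \<kappa>\<rceil>}"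
  proof
    fix m :: nat assume "m \<in> {m::nat. \<bar>real m - t\<bar> \<le> \<kappa>}"
    then have m: "t - \<kappa> \<le> real m" "real m \<le> (t - \<kappa>) + 2 * \<kappa>" by (auto simp: abs_le_iff)
    have "a \<le> m" unfolding a_def using m(1) by linarith
    moreover have "real m \<le> real a + real (nat \<lceil>2 * \<kappa>\<rceil>)" unfolding a_def using m(2) by linarith
    then have "m \<le> a + nat \<lceil>2 * \<kappa>\<rceil>" by linarith
    ultimately show "m \<in> {a..a + nat \<lceil>2 * \<kappa>\<rceil>}" by simp
  qed
  then show "finite {m::nat. \<bar>real m - t\<bar> \<le> \<kappa>}" "card {m::nat. \<bar>real m - t\<bar> \<le> \<kappa>} \<le> nat \<lceil>2 * \<kappa>\<rceil> + 1"
    using finite_subset card_mono[of "{a..a + nat \<lceil>2 * \<kappa>\<rceil>}"] by fastforce+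
qed

section \<open>Packets and their hyperbolic quasi-norms\<close>

context two_scales
begin

text \<open>The generator vanishes unless every coordinate is below
  \<open>2 powr (\<alpha> $ i)\<close>. Dividing by four times a common upper bound of these numbers
  places the support in the cube of half-width \<open>1/4\<close> used for the shell.\<close>

definition bmp :: "real ^ 'n \<Rightarrow> complex" where
  "bmp \<xi> = \<phi> (0 + (4 * 2 powr (\<Sum>i\<in>UNIV. \<alpha> $ i)) *\<^sub>R \<xi>)"

lemma bmp_nonzero: "bmp \<xi> \<noteq> 0 \<Longrightarrow> \<bar>\<xi> $ i\<bar> \<le> 1 / 4"
proof -
  assume "bmp \<xi> \<noteq> 0"
  then have "\<bar>(0 + (4 * 2 powr (\<Sum>i\<in>UNIV. \<alpha> $ i)) *\<^sub>R \<xi>) $ i\<bar> < 2 powr (\<alpha> $ i)"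
    unfolding bmp_def by (rule aniso_generator_zero[OF gen\<phi>])
  also have "\<dots> \<le> 2 powr (\<Sum>i\<in>UNIV. \<alpha> $ i)"
    using pos by (intro powr_mono member_le_sum) (auto intro: less_imp_le)
  finally show ?thesis by (simp add: abs_mult)
qed

lemma bmp_schwartz: "bmp \<in> schwartz"
proof (rule schwartz_cart_support[where \<rho> = "\<lambda>_. 1 / 4"])
  fix L
  have "\<phi> \<in> schwartz" using gen\<phi> by (simp add: anisotropic_generator_def)
  then obtain B where B: "deriv_bound L 0 B \<phi>" using deriv_bound_schwartz by blast
  have "(1::real) \<le> 4 * 2 powr (\<Sum>i\<in>UNIV. \<alpha> $ i)"
    using ge_one_powr_ge_zero[of 2 "\<Sum>i\<in>UNIV. \<alpha> $ i"] pos by (simp add: sum_nonneg less_imp_le)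
  from deriv_bound_scale[OF B this, of 0] show "\<exists>B. deriv_bound L 0 B bmp" unfolding bmp_def[abs_def] by blast
qed (rule bmp_nonzero)

lemma bmp_measurable [measurable]: "bmp \<in> borel_measurable borel"
  by (rule schwartz_measurable[OF bmp_schwartz])

lemma bmp_0: "bmp 0 = 1"
  unfolding bmp_def by (rule aniso_generator_one[OF gen\<phi>]) simp

definition profile :: "real ^ 'n \<Rightarrow> complex" where
  "profile = inverse_fourier bmp"

lemma profile_continuous: "continuous_on UNIV profile"
  unfolding profile_def by (intro continuous_inverse_fourier schwartz_integrable bmp_schwartz)

lemma profile_measurable [measurable]: "profile \<in> borel_measurable borel"
  by (rule borel_measurable_continuous_onI[OF profile_continuous])

text \<open>The value at the origin is a positive multiple of the integral of a continuous
  nonnegative function that equals one at the origin.\<close>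

lemma profile_0: "profile 0 \<noteq> 0"
proof
  assume "profile 0 = 0"
  then have "(LINT \<xi>|lborel. bmp \<xi>) = 0" by (simp add: profile_def inverse_fourier_def)
  then have z: "(LINT \<xi>|lborel. Re (bmp \<xi>)) = 0"
    using schwartz_integrable[OF bmp_schwartz] by (simp only: integral_Re zero_complex.sel)
  have nn: "0 \<le> Re (bmp \<xi>)" for \<xi>
    using gen\<phi> unfolding bmp_def anisotropic_generator_def by (simp add: complex_nonneg_Reals_iff)
  have "integrable lborel (\<lambda>\<xi>. Re (bmp \<xi>))" by (intro integrable_Re schwartz_integrable bmp_schwartz)
  then have "AE \<xi> in lborel. Re (bmp \<xi>) = 0" using z nn by (subst (asm) integral_nonneg_eq_0_iff_AE) auto
  then have "Re (bmp 0) = 0"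
    by (intro AE_zero_continuous[where F = "\<lambda>\<xi>. Re (bmp \<xi>)"]) (intro continuous_intros schwartz_continuous bmp_schwartz)
  then show False by (simp add: bmp_0)
qed

text \<open>Consecutive frequencies in the direction \<open>i2\<close> differ by a factor 16, that
  is four dyadic levels, so that the windows of levels they activate are disjoint.\<close>

definition freq :: "nat \<Rightarrow> nat \<Rightarrow> real ^ 'n" where
  "freq k l = axis i1 (radius k) + axis i2 (2 ^ (4 * l))"

lemma freq_nth: "freq k l $ i = (if i = i1 then radius k else if i = i2 then 2 ^ (4 * l) else 0)"
  using ne by (simp add: freq_def axis_def)

definition atom :: "nat \<Rightarrow> (nat \<Rightarrow> real ^ 'n) \<Rightarrow> nat \<Rightarrow> real ^ 'n \<Rightarrow> complex" where
  "atom k y l \<xi> = exp (- (\<i> * complex_of_real (y l \<bullet> \<xi>))) * bmp (\<xi> - freq k l)"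

lemma atom_measurable [measurable]: "atom k y l \<in> borel_measurable borel"
  unfolding atom_def[abs_def] by measurable

lemma atom_nonzero:
  assumes "atom k y l \<xi> \<noteq> 0"
  shows "\<bar>\<xi> $ i1 - radius k\<bar> \<le> 1 / 4" "\<bar>\<xi> $ i2 - 2 ^ (4 * l)\<bar> \<le> 1 / 4" "i \<noteq> i1 \<Longrightarrow> i \<noteq> i2 \<Longrightarrow> \<bar>\<xi> $ i\<bar> \<le> 1 / 4"
proof -
  have *: "\<bar>\<xi> $ i - freq k l $ i\<bar> \<le> 1 / 4" for i
    using assms bmp_nonzero[of "\<xi> - freq k l" i] by (simp add: atom_def)
  show "\<bar>\<xi> $ i1 - radius k\<bar> \<le> 1 / 4" "\<bar>\<xi> $ i2 - 2 ^ (4 * l)\<bar> \<le> 1 / 4" "i \<noteq> i1 \<Longrightarrow> i \<noteq> i2 \<Longrightarrow> \<bar>\<xi> $ i\<bar> \<le> 1 / 4"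
    using *[of i1] *[of i2] *[of i] ne by (auto simp: freq_nth)
qed

lemma atom_shell:
  assumes "atom k y l \<xi> \<noteq> 0" "l \<in> {1..2 ^ k}"
  shows "\<xi> \<in> shell k"
proof -
  have near: "\<bar>t\<bar> \<le> v * 2" if "\<bar>t - u\<bar> \<le> 1 / 4" "u \<le> v" "1 \<le> v" "0 \<le> u" for t u v :: real
    using that by linarith
  have "\<bar>\<xi> $ i2\<bar> \<le> 2 ^ (4 * 2 ^ k) * 2"
    by (rule near[OF atom_nonzero(2)[OF assms(1)]]) (use assms(2) in \<open>auto intro: power_increasing\<close>)
  also have "\<dots> = 2 powr (4 * 2 ^ k + 1)" by (simp add: powr_add powr_realpow[symmetric])
  also have "\<dots> \<le> 2 powr (\<alpha> $ i2 * octave k)"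
  proof (rule powr_mono)
    have "(1::real) \<le> 2 ^ k" by simp
    then show "4 * 2 ^ k + 1 \<le> \<alpha> $ i2 * octave k" using octave_i2[of k] by linarith
  qed simp
  finally show ?thesis using atom_nonzero(1,3)[OF assms(1)] by (simp add: shell_def)
qed

definition packet :: "nat \<Rightarrow> (nat \<Rightarrow> real ^ 'n) \<Rightarrow> nat set \<Rightarrow> real ^ 'n \<Rightarrow> complex" where
  "packet k y T \<xi> = signed_sum {1..2 ^ k} T (\<lambda>l. atom k y l \<xi>)"

lemma bmp_bounded: "\<exists>D. \<forall>\<xi>. norm (bmp \<xi>) \<le> D"
  using deriv_bound_schwartz[OF bmp_schwartz, of 0 0] deriv_bound_norm0 by blast

lemma good_family_packet: "good_family (\<lambda>k. packet k y (T k))"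
  unfolding good_family_def
proof (intro conjI allI impI)
  show "packet k y (T k) \<in> borel_measurable borel" for k
    unfolding packet_def[abs_def] by measurable
  show "\<xi> \<in> shell k" if "packet k y (T k) \<xi> \<noteq> 0" for k \<xi>
  proof -
    from that obtain l where "l \<in> {1..2 ^ k}" "atom k y l \<xi> \<noteq> 0"
      unfolding packet_def signed_sum_def by (metis (no_types, lifting) scaleR_zero_right sum.neutral)
    then show ?thesis by (intro atom_shell)
  qed
  obtain D where D: "\<And>\<xi>. norm (bmp \<xi>) \<le> D" using bmp_bounded by blast
  have D0: "0 \<le> D" using order_trans[OF norm_ge_zero D] .
  show "\<exists>D. \<forall>k \<xi>. norm (packet k y (T k) \<xi>) \<le> D * 2 powr octave k"
  proof (intro exI allI)
    fix k \<xi>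
    have "norm (packet k y (T k) \<xi>) \<le> (\<Sum>l\<in>{1..2 ^ k::nat}. D)"
      unfolding packet_def signed_sum_def by (rule sum_norm_le) (simp add: atom_def norm_mult D)
    also have "\<dots> = D * 2 powr real k" by (simp add: powr_realpow)
    also have "\<dots> \<le> D * 2 powr octave k" using octave_ge(2)[of k] D0 by (intro mult_left_mono powr_mono) auto
    finally show "norm (packet k y (T k) \<xi>) \<le> D * 2 powr octave k" .
  qed
qed

lemma atom_integrable:
  assumes "m \<in> schwartz"
  shows "integrable lborel (\<lambda>\<xi>. m \<xi> * atom k y l \<xi>)"
proof -
  obtain D where D: "\<And>\<xi>. norm (bmp \<xi>) \<le> D" using bmp_bounded by blast
  show ?thesis
    by (rule integrable_mult_bounded[OF schwartz_integrable[OF assms], of _ D]) (auto simp: atom_def norm_mult D)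
qed

lemma norm_inverse_fourier_atom: "norm (inverse_fourier (atom k y l) x) = norm (profile (x - y l))"
  using inverse_fourier_modulated[of "\<lambda>_. 1" bmp "y l" "freq k l" x] by (simp add: atom_def[abs_def] profile_def)

text \<open>After the shift to the origin the multiplier is merely bounded with its derivatives,
  uniformly in \<open>j\<close> and in the shift, and \<open>bmp\<close> carries all the weight. The
  constant is therefore the same for all levels, generations, sites and frequencies.\<close>

lemma atom_decay:
  assumes \<mu>: "resolution \<mu>"
  obtains C where "0 < C" "\<And>j k y l x. norm (inverse_fourier (\<lambda>\<xi>. \<mu> j \<xi> * atom k y l \<xi>) x) \<le> C * decay K (x - y l)"
proof -
  let ?n = "2 * DIM(real ^ 'n)"
  obtain B where B: "\<And>j. deriv_bound K 0 B (\<mu> j)" using resolution_deriv_bound[OF \<mu>] by blast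
  obtain B' where B': "deriv_bound K ?n B' bmp" using deriv_bound_schwartz[OF bmp_schwartz] by blast
  obtain C where C0: "0 \<le> C" and C: "\<And>(h::real ^ 'n \<Rightarrow> complex) B x. deriv_bound K ?n B h \<Longrightarrow>
     (1 + norm x) ^ K * norm (inverse_fourier h x) \<le> C * B"
    using inverse_fourier_decay[of K, where 'a = "real ^ 'n"] by blast
  have nn: "0 \<le> B" "0 \<le> B'" using deriv_bound_nonneg[OF B] deriv_bound_nonneg[OF B'] by auto
  let ?C = "C * (2 ^ K * B * B') + 1"
  show ?thesis
  proof (rule that[of ?C])
    have "0 \<le> C * (2 ^ K * B * B')" using C0 nn by simp
    then show "0 < ?C" by linarith
    fix j k y l x
    have d: "deriv_bound K 0 B (\<lambda>\<zeta>. \<mu> j (freq k l + \<zeta>))" using deriv_bound_scale[OF B, of 1] by simp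
    have "deriv_bound K (0 + ?n) (2 ^ K * B * B') (\<lambda>\<zeta>. \<mu> j (freq k l + \<zeta>) * bmp \<zeta>)"
      by (rule deriv_bound_mult[OF d B'])
    then have "(1 + norm (x - y l)) ^ K * norm (inverse_fourier (\<lambda>\<zeta>. \<mu> j (freq k l + \<zeta>) * bmp \<zeta>) (x - y l)) \<le> C * (2 ^ K * B * B')"
      by (intro C) simp
    then have "norm (inverse_fourier (\<lambda>\<zeta>. \<mu> j (freq k l + \<zeta>) * bmp \<zeta>) (x - y l)) \<le> C * (2 ^ K * B * B') * decay K (x - y l)"
      unfolding decay_def by (rule norm_le_weight)
    also have "\<dots> \<le> ?C * decay K (x - y l)" by (intro mult_right_mono) auto
    finally show "norm (inverse_fourier (\<lambda>\<xi>. \<mu> j \<xi> * atom k y l \<xi>) x) \<le> ?C * decay K (x - y l)"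
      unfolding atom_def using resolution_schwartz[OF \<mu>, of j] by (subst inverse_fourier_modulated) auto
  qed
qed

lemma inverse_fourier_packet:
  assumes "m \<in> schwartz"
  shows "inverse_fourier (\<lambda>\<xi>. m \<xi> * packet k y T \<xi>) x = signed_sum {1..2 ^ k} T (\<lambda>l. inverse_fourier (\<lambda>\<xi>. m \<xi> * atom k y l \<xi>) x)"
proof -
  have eq: "m \<xi> * packet k y T \<xi> = (\<Sum>l\<in>{1..2 ^ k}. complex_of_real (if l \<in> T then 1 else - 1) * (m \<xi> * atom k y l \<xi>))" for \<xi>
    by (simp add: packet_def signed_sum_def sum_distrib_left scaleR_conv_of_real mult.left_commute)
  have "inverse_fourier (\<lambda>\<xi>. m \<xi> * packet k y T \<xi>) x =
    (\<Sum>l\<in>{1..2 ^ k}. inverse_fourier (\<lambda>\<xi>. complex_of_real (if l \<in> T then 1 else - 1) * (m \<xi> * atom k y l \<xi>)) x)"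
    unfolding eq by (intro inverse_fourier_sum integrable_mult_right atom_integrable assms)
  also have "\<dots> = signed_sum {1..2 ^ k} T (\<lambda>l. inverse_fourier (\<lambda>\<xi>. m \<xi> * atom k y l \<xi>) x)"
    unfolding inverse_fourier_cmult by (simp add: signed_sum_def scaleR_conv_of_real)
  finally show ?thesis .
qed

text \<open>The strict inequality in the direction \<open>i2\<close> matters: intervals of radius 2
  around multiples of 4 are disjoint only without their endpoints.\<close>

definition hyp_window :: "nat \<Rightarrow> nat \<Rightarrow> (nat ^ 'n) set" where
  "hyp_window k l = {j. \<bar>real (j $ i1) - \<alpha> $ i1 * octave k\<bar> \<le> 2 \<and> \<bar>real (j $ i2) - 4 * real l\<bar> < 2 \<and>
     (\<forall>i. i \<noteq> i1 \<longrightarrow> i \<noteq> i2 \<longrightarrow> j $ i = 0)}"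

lemma hyp_window_disjoint: "l \<noteq> l' \<Longrightarrow> hyp_window k l \<inter> hyp_window k l' = {}"
proof (rule ccontr)
  assume l: "l \<noteq> l'" and "hyp_window k l \<inter> hyp_window k l' \<noteq> {}"
  then obtain j where "\<bar>real (j $ i2) - 4 * real l\<bar> < 2" "\<bar>real (j $ i2) - 4 * real l'\<bar> < 2"
    by (auto simp: hyp_window_def)
  then have "\<bar>real l - real l'\<bar> < 1" by linarith
  then show False using l by linarith
qed

lemma card_hyp_window: "finite (hyp_window k l)" "card (hyp_window k l) \<le> 25"
proof -
  let ?A = "{m::nat. \<bar>real m - \<alpha> $ i1 * octave k\<bar> \<le> 2} \<times> {m::nat. \<bar>real m - 4 * real l\<bar> \<le> 2}"
  let ?v = "\<lambda>(a, b). \<chi> i. if i = i1 then a else if i = i2 then b else (0::nat)"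
  have sub: "hyp_window k l \<subseteq> ?v ` ?A"
  proof
    fix j assume j: "j \<in> hyp_window k l"
    have "(j $ i1, j $ i2) \<in> ?A" using j by (auto simp: hyp_window_def)
    moreover have "j = ?v (j $ i1, j $ i2)" using j by (auto simp: hyp_window_def vec_eq_iff)
    ultimately show "j \<in> ?v ` ?A" by blast
  qed
  have fin: "finite ?A" by (intro finite_cartesian_product card_level_window)
  then show "finite (hyp_window k l)" using sub finite_surj by blast
  have "card (hyp_window k l) \<le> card ?A" by (rule surj_card_le[OF fin sub])
  also have "\<dots> \<le> (nat \<lceil>2 * (2::real)\<rceil> + 1) * (nat \<lceil>2 * (2::real)\<rceil> + 1)"
    unfolding card_cartesian_product by (intro mult_le_mono card_level_window)
  finally show "card (hyp_window k l) \<le> 25" by simp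
qed

lemma atom_hyp_window:
  assumes "\<Theta> j \<xi> * atom k y l \<xi> \<noteq> 0" "l \<in> {1..2 ^ k}"
  shows "j \<in> hyp_window k l"
proof -
  have nz: "\<Theta> j \<xi> \<noteq> 0" and a: "atom k y l \<xi> \<noteq> 0" using assms(1) by auto
  note h = hyperbolic_shell[OF atom_shell[OF a assms(2)] nz]
  have nz2: "dyadic_resolution \<theta> (j $ i2) (\<xi> $ i2) \<noteq> 0" using nz by (simp add: hyperbolic_resolution_nonzero)
  have e: "(2::real) ^ (4 * l) = 2 powr (4 * real l)" by (simp add: powr_realpow[symmetric])
  have ge: "(2::real) \<le> 2 ^ (4 * l)" using assms(2) self_le_power[of "2::real" "4 * l"] by simp
  have a2: "\<bar>\<xi> $ i2 - 2 ^ (4 * l)\<bar> \<le> 1 / 4" by (rule atom_nonzero(2)[OF a])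
  have near: "u / 2 < \<bar>t\<bar>" "\<bar>t\<bar> \<le> u * 2" if "\<bar>t - u\<bar> \<le> 1 / 4" "2 \<le> u" for t u :: real using that by linarith+
  have "2 powr (4 * real l - 1) < \<bar>\<xi> $ i2\<bar>" using near(1)[OF a2 ge] by (simp add: powr_diff e)
  also have "\<dots> \<le> 2 powr (real (j $ i2) + 1)" by (rule dyadic_resolution_nonzero(1)[OF gen\<theta> nz2])
  finally have 1: "4 * real l - 1 < real (j $ i2) + 1" by (rule powr_less_powr_2)
  have 2: "real (j $ i2) < 4 * real l + 2"
  proof (cases "j $ i2 = 0")
    case False
    then have "2 powr (real (j $ i2) - 1) < \<bar>\<xi> $ i2\<bar>" using dyadic_resolution_nonzero(2)[OF gen\<theta> nz2] by simp
    also have "\<dots> \<le> 2 powr (4 * real l + 1)" using near(2)[OF a2 ge] by (simp add: powr_add e)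
    finally have "real (j $ i2) - 1 < 4 * real l + 1" by (rule powr_less_powr_2)
    then show ?thesis by simp
  qed simp
  show ?thesis using h 1 2 by (auto simp: hyp_window_def abs_less_iff)
qed

lemma hyp_window_nonempty:
  assumes "l \<in> {1..2 ^ k}"
  shows "hyp_window k l \<noteq> {}"
proof -
  obtain j where "\<Theta> j (freq k l) \<noteq> 0"
    using resolution_nonzero[OF resolution_hyperbolic[OF gen\<theta>]] by blast
  then have "\<Theta> j (freq k l) * atom k (\<lambda>_. 0) l (freq k l) \<noteq> 0"
    by (simp add: atom_def bmp_0)
  then show ?thesis using atom_hyp_window[OF _ assms] by blast
qed

text \<open>By disjointness only the atom \<open>l\<close> survives in the block, and its sign
  disappears under the modulus. The hyperbolic quasi-norm does not see the choice of signs.\<close>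

lemma hyp_packet:
  assumes j: "j \<in> hyp_window k l" and l: "l \<in> {1..2 ^ k}"
  shows "norm (inverse_fourier (\<lambda>\<xi>. \<Theta> j \<xi> * packet k y T \<xi>) x) =
    norm (inverse_fourier (\<lambda>\<xi>. \<Theta> j \<xi> * atom k y l \<xi>) x)"
proof -
  have "inverse_fourier (\<lambda>\<xi>. \<Theta> j \<xi> * atom k y l' \<xi>) x = 0" if "l' \<in> {1..2 ^ k}" "l' \<noteq> l" for l'
  proof -
    have "\<Theta> j \<xi> * atom k y l' \<xi> = 0" for \<xi>
      using atom_hyp_window[of j \<xi> k y l', OF _ that(1)] j hyp_window_disjoint[OF that(2), of k] by blast
    then show ?thesis by (simp only: inverse_fourier_zero)
  qed
  then have "signed_sum {1..2 ^ k} T (\<lambda>l. inverse_fourier (\<lambda>\<xi>. \<Theta> j \<xi> * atom k y l \<xi>) x) =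
    (\<Sum>l'\<in>{l}. (if l' \<in> T then 1 else - 1) *\<^sub>R inverse_fourier (\<lambda>\<xi>. \<Theta> j \<xi> * atom k y l' \<xi>) x)"
    unfolding signed_sum_def using l by (intro sum.mono_neutral_right) auto
  then show ?thesis
    unfolding inverse_fourier_packet[OF resolution_schwartz[OF resolution_hyperbolic[OF gen\<theta>]]] by simp
qed

lemma hyp_packet_zero:
  assumes "j \<notin> (\<Union>l\<in>{1..2 ^ k}. hyp_window k l)"
  shows "inverse_fourier (\<lambda>\<xi>. \<Theta> j \<xi> * packet k y T \<xi>) x = 0"
proof -
  have "\<Theta> j \<xi> * atom k y l \<xi> = 0" if "l \<in> {1..2 ^ k}" for l \<xi>
    using atom_hyp_window[of j \<xi> k y l, OF _ that] assms that by blast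
  then show ?thesis
    unfolding inverse_fourier_packet[OF resolution_schwartz[OF resolution_hyperbolic[OF gen\<theta>]]]
    unfolding signed_sum_def by (intro sum.neutral ballI) (simp only: inverse_fourier_zero scaleR_zero_right)
qed

lemma profile_le_hyp:
  assumes l: "l \<in> {1..2 ^ k}"
  shows "norm (profile (x - y l)) \<le> (\<Sum>j\<in>hyp_window k l. norm (inverse_fourier (\<lambda>\<xi>. \<Theta> j \<xi> * packet k y T \<xi>) x))"
proof -
  have r: "resolution (\<Theta> :: nat ^ 'n \<Rightarrow> _)" by (rule resolution_hyperbolic[OF gen\<theta>])
  have "inverse_fourier (atom k y l) x = (\<Sum>j\<in>hyp_window k l. inverse_fourier (\<lambda>\<xi>. \<Theta> j \<xi> * atom k y l \<xi>) x)"
    using atom_hyp_window[OF _ l] by (intro partition_inverse_fourier[OF r] card_hyp_window atom_integrable resolution_schwartz[OF r])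
  then have "norm (inverse_fourier (atom k y l) x) \<le> (\<Sum>j\<in>hyp_window k l. norm (inverse_fourier (\<lambda>\<xi>. \<Theta> j \<xi> * atom k y l \<xi>) x))"
    by (simp only: norm_sum)
  then show ?thesis by (simp add: norm_inverse_fourier_atom hyp_packet[OF _ l] cong: sum.cong)
qed

text \<open>At most \<open>25 * 2 ^ k\<close> blocks are nonzero, each dominated by a translate of
  one decay function. Translation leaves \<open>L\<^sub>p\<close> norms unchanged, which allows
  arbitrary sites for the Besov type; for the other type the centre must be common.\<close>

lemma flat_hyp_upper:
  assumes p: "0 < p" and q: "0 < q" and y: "\<not> b \<Longrightarrow> y = (\<lambda>_. 0)"
  obtains C where "0 < C" "\<And>k T. flat_norm b p q \<Theta> (packet k y T) \<le> ennreal (C * qpow q (2 ^ k))"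
proof -
  have r: "resolution (\<Theta> :: nat ^ 'n \<Rightarrow> _)" by (rule resolution_hyperbolic[OF gen\<theta>])
  obtain K where K: "Lp_norm p (\<lambda>x::real ^ 'n. ennreal (decay K x)) < \<infinity>" using Lp_norm_decay[OF p] by blast
  obtain D where D: "Lp_norm p (\<lambda>x::real ^ 'n. ennreal (decay K x)) = ennreal D" "0 \<le> D"
    using K by (cases "Lp_norm p (\<lambda>x::real ^ 'n. ennreal (decay K x))") auto
  obtain C where C: "0 < C" "\<And>j k y l x. norm (inverse_fourier (\<lambda>\<xi>. \<Theta> j \<xi> * atom k y l \<xi>) x) \<le> C * decay K (x - y l)"
    using atom_decay[OF r] by blast
  have q25: "qpow q (25 * 2 ^ k) = qpow q 25 * qpow q (2 ^ k)" for k :: nat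
    by (simp add: qpow_def powr_mult)
  show ?thesis
  proof (rule that[of "qpow q 25 * (C * D) + 1"])
    show "0 < qpow q 25 * (C * D) + 1" using C(1) D(2) by (simp add: add_nonneg_pos)
    fix k T
    define W where "W = (\<Union>l\<in>{1..2 ^ k}. hyp_window k l)"
    have W: "finite W" unfolding W_def using card_hyp_window by blast
    have "card W \<le> (\<Sum>l\<in>{1..2 ^ k::nat}. card (hyp_window k l))" unfolding W_def by (rule card_UN_le) simp
    also have "\<dots> \<le> (\<Sum>l\<in>{1..2 ^ k::nat}. 25)" by (intro sum_mono card_hyp_window)
    finally have cW: "card W \<le> 25 * 2 ^ k" by simp
    then have "real (card W) \<le> real (25 * 2 ^ k)" by (simp only: of_nat_le_iff)
    then have cW: "real (card W) \<le> 25 * 2 ^ k" by simp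
    \<comment> \<open>Assigns to a block the packet that it sees, hence the site around which its
      decay is centred; disjointness of the windows makes this choice unambiguous on
      \<open>W\<close>.\<close>
    define sel where "sel j = (if j \<in> W then SOME l. l \<in> {1..2 ^ k} \<and> j \<in> hyp_window k l else 0)" for j
    have sel: "sel j \<in> {1..2 ^ k} \<and> j \<in> hyp_window k (sel j)" if "j \<in> W" for j
    proof -
      have "\<exists>l. l \<in> {1..2 ^ k} \<and> j \<in> hyp_window k l" using that unfolding W_def by blast
      from someI_ex[OF this] show ?thesis using that by (simp only: sel_def if_True)
    qed
    have "flat_norm b p q \<Theta> (packet k y T) \<le> ennreal (qpow q (25 * 2 ^ k)) * ennreal (C * D)"
      unfolding flat_norm_def
    proof (rule mixed_norm_le_card[OF p q W cW, where \<omega> = "\<lambda>j x. ennreal C * ennreal (decay K (x - y (sel j)))"])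
      show "(\<lambda>x. ennreal (norm (inverse_fourier (\<lambda>\<xi>. \<Theta> j \<xi> * packet k y T \<xi>) x))) \<in> borel_measurable borel" for j
        using inverse_fourier_measurable[OF good_family_integrable[OF good_family_packet r, of j k y "\<lambda>_. T"]] by measurable
      show "ennreal (norm (inverse_fourier (\<lambda>\<xi>. \<Theta> j \<xi> * packet k y T \<xi>) x)) = 0" if "j \<notin> W" for j x
        using hyp_packet_zero that by (simp add: W_def)
      show "ennreal (norm (inverse_fourier (\<lambda>\<xi>. \<Theta> j \<xi> * packet k y T \<xi>) x)) \<le> ennreal C * ennreal (decay K (x - y (sel j)))"
        if "j \<in> W" for j x
        using sel[OF that] C by (simp add: hyp_packet[of j k "sel j"] flip: ennreal_mult)
      show "Lp_norm p (\<lambda>x. ennreal C * ennreal (decay K (x - y (sel j)))) \<le> ennreal (C * D)" for j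
        using C(1) D p Lp_norm_translate[of "\<lambda>x::real ^ 'n. ennreal (decay K x)" p "y (sel j)"]
        by (subst Lp_norm_cmult) (auto simp: ennreal_mult)
      show "(\<lambda>x. ennreal C * ennreal (decay K (x - y (sel j)))) = (\<lambda>x. ennreal C * ennreal (decay K (x - y (sel j'))))" if "\<not> b" for j j'
        using y[OF that] by simp
    qed measurable
    also have "\<dots> = ennreal (qpow q 25 * (C * D) * qpow q (2 ^ k))"
      unfolding q25 using C(1) D(2) by (subst ennreal_mult[symmetric]) (auto simp: mult_ac)
    also have "\<dots> \<le> ennreal ((qpow q 25 * (C * D) + 1) * qpow q (2 ^ k))"
      by (intro ennreal_leI mult_right_mono) auto
    finally show "flat_norm b p q \<Theta> (packet k y T) \<le> ennreal ((qpow q 25 * (C * D) + 1) * qpow q (2 ^ k))" .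
  qed
qed

lemma Lp_norm_profile:
  assumes p: "0 < p"
  obtains d where "0 < d" "ennreal d \<le> Lp_norm p (\<lambda>x. ennreal (norm (profile x)))"
proof -
  have "Lp_norm p (\<lambda>x. ennreal (norm (profile x))) \<noteq> 0"
  proof
    assume z: "Lp_norm p (\<lambda>x. ennreal (norm (profile x))) = 0"
    have "AE x in lborel. profile x = 0"
    proof (cases "p = \<infinity>")
      case True
      then show ?thesis using z esssup_AE[of "\<lambda>x. ennreal (norm (profile x))" lborel] by (simp add: Lp_norm_def)
    next
      case False
      have "(\<integral>\<^sup>+ x. ennreal_powr (ennreal (norm (profile x))) (enn2real p) \<partial>lborel) = 0"
        using measure_norm_powr[OF p, of lborel "\<lambda>x. ennreal (norm (profile x))"] z False by (simp add: Lp_norm_eq)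
      then show ?thesis by (subst (asm) nn_integral_0_iff_AE) (auto simp: ennreal_powr_ennreal elim!: eventually_mono)
    qed
    then have "profile 0 = 0" by (rule AE_zero_continuous[OF profile_continuous])
    then show False using profile_0 by simp
  qed
  then show ?thesis
    using that[of 1] that[of "enn2real (Lp_norm p (\<lambda>x. ennreal (norm (profile x))))"]
    by (cases "Lp_norm p (\<lambda>x. ennreal (norm (profile x)))") auto
qed

text \<open>Each of the \<open>2 ^ k\<close> disjoint windows has to reproduce a full copy of the
  profile, since the resolution sums to one on the spectrum of its atom. The copies coincide
  pointwise when the packets are concentric.\<close>

lemma flat_hyp_lower:
  assumes p: "0 < p" and q: "0 < q" and y: "\<not> b \<Longrightarrow> y = (\<lambda>_. 0)"
  obtains e where "0 < e" "\<And>k T. ennreal (e * qpow q (2 ^ k)) \<le> flat_norm b p q \<Theta> (packet k y T)"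
proof -
  have r: "resolution (\<Theta> :: nat ^ 'n \<Rightarrow> _)" by (rule resolution_hyperbolic[OF gen\<theta>])
  obtain d where d: "0 < d" "ennreal d \<le> Lp_norm p (\<lambda>x. ennreal (norm (profile x)))" using Lp_norm_profile[OF p] by blast
  show ?thesis
  proof (rule mixed_norm_ge_card[OF p q, where w = 25 and b = b and 'l = nat and 'j = "nat ^ 'n" and 'a = "real ^ 'n"])
  fix e :: real assume e: "0 < e"
    "\<And>(F::nat ^ 'n \<Rightarrow> real ^ 'n \<Rightarrow> ennreal) (L::nat set) W N g S. finite L \<Longrightarrow> N \<le> real (card L) \<Longrightarrow> 1 \<le> N \<Longrightarrow>
      (\<And>j. F j \<in> borel_measurable borel) \<Longrightarrow> (\<And>l. g l \<in> borel_measurable borel) \<Longrightarrow>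
      (\<And>l. l \<in> L \<Longrightarrow> finite (W l) \<and> card (W l) \<le> 25 \<and> W l \<noteq> {}) \<Longrightarrow>
      (\<And>l l'. l \<in> L \<Longrightarrow> l' \<in> L \<Longrightarrow> l \<noteq> l' \<Longrightarrow> W l \<inter> W l' = {}) \<Longrightarrow>
      (\<And>l x. l \<in> L \<Longrightarrow> g l x \<le> (\<Sum>j\<in>W l. F j x)) \<Longrightarrow>
      (\<And>l. l \<in> L \<Longrightarrow> S \<le> Lp_norm p (g l)) \<Longrightarrow> (\<not> b \<Longrightarrow> (\<And>l l'. g l = g l')) \<Longrightarrow>
      ennreal (e * qpow q N) * S \<le> mixed_norm b p q F"
    show ?thesis
    proof (rule that[of "e * d"])
      show "0 < e * d" using e(1) d(1) by simp
      fix k T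
      have "ennreal (e * qpow q (2 ^ k)) * ennreal d \<le> flat_norm b p q \<Theta> (packet k y T)"
        unfolding flat_norm_def
      proof (rule e(2)[of "{1..2 ^ k}" "2 ^ k" _ "\<lambda>l x. ennreal (norm (profile (x - y l)))" "hyp_window k"])
        show "(\<lambda>x. ennreal (norm (inverse_fourier (\<lambda>\<xi>. \<Theta> j \<xi> * packet k y T \<xi>) x))) \<in> borel_measurable borel" for j
          using inverse_fourier_measurable[OF good_family_integrable[OF good_family_packet r, of j k y "\<lambda>_. T"]] by measurable
        show "finite (hyp_window k l) \<and> card (hyp_window k l) \<le> 25 \<and> hyp_window k l \<noteq> {}" if "l \<in> {1..2 ^ k}" for l
          using card_hyp_window hyp_window_nonempty[OF that] by blast
        show "hyp_window k l \<inter> hyp_window k l' = {}" if "l \<noteq> l'" for l l' by (rule hyp_window_disjoint[OF that])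
        show "ennreal (norm (profile (x - y l))) \<le> (\<Sum>j\<in>hyp_window k l. ennreal (norm (inverse_fourier (\<lambda>\<xi>. \<Theta> j \<xi> * packet k y T \<xi>) x)))"
          if "l \<in> {1..2 ^ k}" for l x
          using profile_le_hyp[OF that] by (subst sum_ennreal) (auto intro: ennreal_leI)
        show "ennreal d \<le> Lp_norm p (\<lambda>x. ennreal (norm (profile (x - y l))))" for l
          using d(2) Lp_norm_translate[of "\<lambda>x. ennreal (norm (profile x))" p "y l"] p by simp
        show "(\<lambda>x. ennreal (norm (profile (x - y l)))) = (\<lambda>x. ennreal (norm (profile (x - y l'))))" if "\<not> b" for l l'
          using y[OF that] by simp
      qed auto
      then show "ennreal (e * d * qpow q (2 ^ k)) \<le> flat_norm b p q \<Theta> (packet k y T)"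
        using e(1) d(1) by (simp add: ennreal_mult[symmetric] mult_ac)
    qed
  qed
qed

end

text \<open>Comparison with the integral of \<open>1 / (1 + v^2)\<close> over unit intervals centred
  at the points: the increments of \<open>arctan\<close> telescope and their total is at most
  \<open>pi\<close>, hence below 4.\<close>

lemma sum_decay_translates:
  fixes t :: real
  shows "(\<Sum>l\<in>{1..N::nat}. inverse ((1 + \<bar>t - real l\<bar>)\<^sup>2)) \<le> 9"
proof -
  \<comment> \<open>Inside a unit interval centred at \<open>u\<close> the point \<open>v\<close> of
    the mean value theorem satisfies \<open>\<bar>v\<bar> \<le> \<bar>u\<bar> + 1 / 2\<close>,
    whence \<open>1 + v^2\<close> is at most \<open>(3 / 2 * (1 + \<bar>u\<bar>))^2\<close>; this is
    the factor \<open>9 / 4\<close>.\<close>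
  have step: "inverse ((1 + \<bar>t - real l\<bar>)\<^sup>2) \<le> 9 / 4 * (arctan (real l - t + 1 / 2) - arctan (real l - t - 1 / 2))" for l
  proof -
    define u where "u = real l - t"
    obtain v where v: "u - 1 / 2 < v" "v < u + 1 / 2"
      and eq: "arctan (u + 1 / 2) - arctan (u - 1 / 2) = (u + 1 / 2 - (u - 1 / 2)) * inverse (1 + v\<^sup>2)"
      using MVT2[of "u - 1 / 2" "u + 1 / 2" arctan "\<lambda>v. inverse (1 + v\<^sup>2)"] DERIV_arctan by auto
    have av: "\<bar>v\<bar> \<le> \<bar>u\<bar> + 1 / 2" using v by linarith
    have "v\<^sup>2 \<le> (\<bar>u\<bar> + 1 / 2)\<^sup>2" using power_mono[OF av, of 2] by simp
    moreover have "(\<bar>u\<bar> + 1 / 2)\<^sup>2 = \<bar>u\<bar>\<^sup>2 + \<bar>u\<bar> + 1 / 4" "(1 + \<bar>u\<bar>)\<^sup>2 = 1 + 2 * \<bar>u\<bar> + \<bar>u\<bar>\<^sup>2"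
      by (simp_all only: power2_eq_square algebra_simps)
    ultimately have "1 + v\<^sup>2 \<le> 9 / 4 * (1 + \<bar>u\<bar>)\<^sup>2"
      using zero_le_power2[of "\<bar>u\<bar>"] abs_ge_zero[of u] by linarith
    then have "inverse (9 / 4 * (1 + \<bar>u\<bar>)\<^sup>2) \<le> inverse (1 + v\<^sup>2)"
      by (intro le_imp_inverse_le) (auto simp: add_pos_nonneg)
    moreover have "\<bar>t - real l\<bar> = \<bar>u\<bar>" by (simp add: u_def)
    moreover have "inverse (9 / 4 * (1 + \<bar>u\<bar>)\<^sup>2) = 4 / 9 * inverse ((1 + \<bar>u\<bar>)\<^sup>2)" by (simp add: inverse_eq_divide)
    ultimately show ?thesis using eq unfolding u_def[symmetric] by simp
  qed
  have tel: "(\<Sum>l\<in>{1..N}. arctan (real l - t + 1 / 2) - arctan (real l - t - 1 / 2)) = arctan (real N - t + 1 / 2) - arctan (- t + 1 / 2)"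
  proof (induction N)
    case (Suc N)
    have "real (Suc N) - t - 1 / 2 = real N - t + 1 / 2" by simp
    then show ?case unfolding sum.cl_ivl_Suc Suc by (simp add: add.commute)
  qed simp
  have "(\<Sum>l\<in>{1..N}. inverse ((1 + \<bar>t - real l\<bar>)\<^sup>2)) \<le>
    (\<Sum>l\<in>{1..N}. 9 / 4 * (arctan (real l - t + 1 / 2) - arctan (real l - t - 1 / 2)))"
    by (intro sum_mono step)
  also have "\<dots> = 9 / 4 * (arctan (real N - t + 1 / 2) - arctan (- t + 1 / 2))"
    unfolding tel[symmetric] by (simp add: sum_distrib_left)
  also have "\<dots> \<le> 9 / 4 * 4"
    using arctan_ubound[of "real N - t + 1 / 2"] arctan_lbound[of "- t + 1 / 2"] pi_less_4
    by (intro mult_left_mono) auto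
  finally show ?thesis by simp
qed

text \<open>The positive part of \<open>norm (g x) - M\<close> is continuous and vanishes almost
  everywhere, hence everywhere. This allows an \<open>L\<^sub>\<infinity>\<close> norm to be bounded
  below by a value at one point.\<close>

lemma esssup_continuous_ge:
  fixes g :: "'a::euclidean_space \<Rightarrow> complex"
  assumes g: "continuous_on UNIV g"
  shows "ennreal (norm (g x)) \<le> Lp_norm \<infinity> (\<lambda>x. ennreal (norm (g x)))"
proof (cases "Lp_norm \<infinity> (\<lambda>x. ennreal (norm (g x)))")
  case (real M)
  have "AE x in lborel. ennreal (norm (g x)) \<le> ennreal M"
    using esssup_AE[of "\<lambda>x. ennreal (norm (g x))" lborel] real by (simp add: Lp_norm_def)
  then have "AE x in lborel. max 0 (norm (g x) - M) = 0"
    by (rule eventually_mono) (use real in \<open>auto simp: ennreal_le_iff\<close>)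
  then have "max 0 (norm (g x) - M) = 0"
    by (intro AE_zero_continuous[where F = "\<lambda>x. max 0 (norm (g x) - M)"]) (intro continuous_intros g)
  then show ?thesis using real by (simp add: max_def ennreal_leI split: if_splits)
qed simp

section \<open>Packets in the anisotropic quasi-norm\<close>

context two_scales
begin

definition an_window :: "nat \<Rightarrow> nat set" where
  "an_window k = {m. \<bar>real m - octave k\<bar> \<le> \<kappa>}"

lemma card_an_window: "finite (an_window k)" "card (an_window k) \<le> nat \<lceil>2 * \<kappa>\<rceil> + 1"
  unfolding an_window_def by (rule card_level_window)+

lemma aniso_shell:
  assumes "G \<xi> \<noteq> 0 \<Longrightarrow> \<xi> \<in> shell k" "\<Phi> m \<xi> * G \<xi> \<noteq> 0"
  shows "m \<in> an_window k"
  using assms localized_anisotropic unfolding localized_def an_window_def by auto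

lemma resolution_an: "resolution \<Phi>"
  by (rule resolution_anisotropic[OF gen\<phi> pos])

text \<open>Only boundedly many levels meet a shell. The bound is kept in terms of the blocks
  because their decay is known uniformly, whereas bounding a block by the whole function would
  require a multiplier estimate in \<open>L\<^sub>p\<close>.\<close>

lemma flat_aniso_upper:
  assumes p: "0 < p" and q: "0 < q"
  obtains K where "0 < K" "\<And>G k S. good_family G \<Longrightarrow>
    (\<And>m. m \<in> an_window k \<Longrightarrow> Lp_norm p (\<lambda>x. ennreal (norm (inverse_fourier (\<lambda>\<xi>. \<Phi> m \<xi> * G k \<xi>) x))) \<le> S) \<Longrightarrow>
    flat_norm b p q \<Phi> (G k) \<le> ennreal K * S"
proof -
  show ?thesis
  proof (rule mixed_norm_window_upper[OF p q, where w = "nat \<lceil>2 * \<kappa>\<rceil> + 1" and b = b and 'j = nat and 'a = "real ^ 'n"])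
    fix K :: real assume K: "0 < K" "\<And>(F::nat \<Rightarrow> real ^ 'n \<Rightarrow> ennreal) W S. finite W \<Longrightarrow> card W \<le> nat \<lceil>2 * \<kappa>\<rceil> + 1 \<Longrightarrow> (\<And>j. F j \<in> borel_measurable borel) \<Longrightarrow>
      (\<And>j x. j \<notin> W \<Longrightarrow> F j x = 0) \<Longrightarrow> (\<And>j. j \<in> W \<Longrightarrow> Lp_norm p (F j) \<le> S) \<Longrightarrow> mixed_norm b p q F \<le> ennreal K * S"
    show ?thesis
    proof (rule that[OF K(1)])
      fix G k S
      assume G: "good_family G" and S: "\<And>m. m \<in> an_window k \<Longrightarrow> Lp_norm p (\<lambda>x. ennreal (norm (inverse_fourier (\<lambda>\<xi>. \<Phi> m \<xi> * G k \<xi>) x))) \<le> S"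
      show "flat_norm b p q \<Phi> (G k) \<le> ennreal K * S"
        unfolding flat_norm_def
      proof (rule K(2)[OF card_an_window[of k]])
        show "(\<lambda>x. ennreal (norm (inverse_fourier (\<lambda>\<xi>. \<Phi> m \<xi> * G k \<xi>) x))) \<in> borel_measurable borel" for m
          using inverse_fourier_measurable[OF good_family_integrable[OF G resolution_an]] by measurable
        show "ennreal (norm (inverse_fourier (\<lambda>\<xi>. \<Phi> m \<xi> * G k \<xi>) x)) = 0" if "m \<notin> an_window k" for m x
        proof -
          have "\<Phi> m \<xi> * G k \<xi> = 0" for \<xi>
            using aniso_shell[of "G k" \<xi> k m] G that unfolding good_family_def by blast
          then show ?thesis by (simp only: inverse_fourier_zero norm_zero ennreal_0)
        qed
      qed (rule S)
    qed
  qed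
qed

text \<open>In this direction no multiplier estimate is involved: the function is the sum of its
  blocks over the window.\<close>

lemma flat_aniso_lower:
  assumes p: "0 < p" and q: "0 < q"
  obtains K where "0 < K" "\<And>G k. good_family G \<Longrightarrow>
    ennreal K * Lp_norm p (\<lambda>x. ennreal (norm (inverse_fourier (G k) x))) \<le> flat_norm b p q \<Phi> (G k)"
proof -
  show ?thesis
  proof (rule mixed_norm_window_lower[OF p q, where w = "nat \<lceil>2 * \<kappa>\<rceil> + 1" and b = b and 'j = nat and 'a = "real ^ 'n"])
    fix K :: real assume K: "0 < K" "\<And>(F::nat \<Rightarrow> real ^ 'n \<Rightarrow> ennreal) W g. finite W \<Longrightarrow> card W \<le> nat \<lceil>2 * \<kappa>\<rceil> + 1 \<Longrightarrow> (\<And>j. F j \<in> borel_measurable borel) \<Longrightarrow>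
      g \<in> borel_measurable borel \<Longrightarrow> (\<And>x. g x \<le> (\<Sum>j\<in>W. F j x)) \<Longrightarrow> Lp_norm p g \<le> ennreal K * mixed_norm b p q F"
    show ?thesis
    proof (rule that[of "1 / K"])
      show "0 < 1 / K" using K(1) by simp
      fix G k assume G: "good_family G"
      have m: "inverse_fourier (\<lambda>\<xi>. \<Phi> m \<xi> * G k \<xi>) \<in> borel_measurable borel" for m
        by (rule inverse_fourier_measurable[OF good_family_integrable[OF G resolution_an]])
      have part: "inverse_fourier (G k) x = (\<Sum>m\<in>an_window k. inverse_fourier (\<lambda>\<xi>. \<Phi> m \<xi> * G k \<xi>) x)" for x
      proof (rule partition_inverse_fourier[OF resolution_an card_an_window(1)])
        show "m \<in> an_window k" if "\<Phi> m \<xi> * G k \<xi> \<noteq> 0" for m \<xi>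
          using aniso_shell[of "G k" \<xi> k m] G that unfolding good_family_def by blast
      qed (rule good_family_integrable[OF G resolution_an])
      have "Lp_norm p (\<lambda>x. ennreal (norm (inverse_fourier (G k) x))) \<le> ennreal K * flat_norm b p q \<Phi> (G k)"
        unfolding flat_norm_def
      proof (rule K(2)[OF card_an_window[of k]])
        show "(\<lambda>x. ennreal (norm (inverse_fourier (G k) x))) \<in> borel_measurable borel"
          unfolding part using m by measurable
        show "ennreal (norm (inverse_fourier (G k) x)) \<le> (\<Sum>m\<in>an_window k. ennreal (norm (inverse_fourier (\<lambda>\<xi>. \<Phi> m \<xi> * G k \<xi>) x)))" for x
          unfolding part by (subst sum_ennreal) (auto intro!: ennreal_leI norm_sum)
      qed (use m in measurable)
      then have "ennreal (1 / K) * Lp_norm p (\<lambda>x. ennreal (norm (inverse_fourier (G k) x))) \<le>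
          ennreal (1 / K) * (ennreal K * flat_norm b p q \<Phi> (G k))"
        by (rule mult_left_mono) simp
      also have "\<dots> = flat_norm b p q \<Phi> (G k)"
        using K(1) by (simp add: mult.assoc[symmetric] flip: ennreal_mult)
      finally show "ennreal (1 / K) * Lp_norm p (\<lambda>x. ennreal (norm (inverse_fourier (G k) x))) \<le> flat_norm b p q \<Phi> (G k)" .
    qed
  qed
qed

lemma sqrt_card: "sqrt (real (card {1..2 ^ k :: nat})) = 2 powr (real k * (1 / 2))"
  by (simp add: powr_half_sqrt[symmetric] powr_powr flip: powr_realpow)

lemma atom_inverse_fourier_measurable [measurable]:
  "inverse_fourier (\<lambda>\<xi>. \<Phi> m \<xi> * atom k y l \<xi>) \<in> borel_measurable borel"
  by (intro inverse_fourier_measurable atom_integrable resolution_schwartz resolution_an)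

text \<open>All atoms are concentric and share one decay majorant in every block, so the square
  function is at most \<open>2 powr (k / 2)\<close> times this majorant. One choice of signs is good
  for all levels of the window.\<close>

lemma flat_aniso_signs_upper:
  assumes p: "0 < p" "p \<noteq> \<infinity>" and q: "0 < q"
  obtains C where "0 < C"
    "\<And>k. \<exists>T. flat_norm b p q \<Phi> (packet k (\<lambda>_. 0) T) \<le> ennreal (C * 2 powr (real k * (1 / 2)))"
proof -
  obtain K where K: "Lp_norm p (\<lambda>x::real ^ 'n. ennreal (decay K x)) < \<infinity>" using Lp_norm_decay[OF p(1)] by blast
  obtain D where D: "Lp_norm p (\<lambda>x::real ^ 'n. ennreal (decay K x)) = ennreal D" "0 \<le> D"
    using K by (cases "Lp_norm p (\<lambda>x::real ^ 'n. ennreal (decay K x))") auto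
  obtain A where A: "0 < A" "\<And>j k y l x. norm (inverse_fourier (\<lambda>\<xi>. \<Phi> j \<xi> * atom k y l \<xi>) x) \<le> A * decay K (x - y l)"
    using atom_decay[OF resolution_an] by blast
  obtain B where B: "0 < B" "\<And>G k S. good_family G \<Longrightarrow>
    (\<And>m. m \<in> an_window k \<Longrightarrow> Lp_norm p (\<lambda>x. ennreal (norm (inverse_fourier (\<lambda>\<xi>. \<Phi> m \<xi> * G k \<xi>) x))) \<le> S) \<Longrightarrow>
    flat_norm b p q \<Phi> (G k) \<le> ennreal B * S"
    using flat_aniso_upper[OF p(1) q, of b] by blast
  have pt: "p \<noteq> \<top>" using p by simp
  show ?thesis
  proof (rule signs_upper[OF p(1) pt, where w = "nat \<lceil>2 * \<kappa>\<rceil> + 1" and 'l = nat and 'j = nat and 'a = "real ^ 'n"])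
    fix E :: real assume E: "0 < E"
      "\<And>(S::nat set) (W::nat set) (h::nat \<Rightarrow> nat \<Rightarrow> real ^ 'n \<Rightarrow> complex) \<omega>. finite S \<Longrightarrow> finite W \<Longrightarrow> card W \<le> nat \<lceil>2 * \<kappa>\<rceil> + 1 \<Longrightarrow>
      (\<And>j l. h j l \<in> borel_measurable borel) \<Longrightarrow> \<omega> \<in> borel_measurable borel \<Longrightarrow>
      (\<And>j l x. j \<in> W \<Longrightarrow> l \<in> S \<Longrightarrow> norm (h j l x) \<le> \<omega> x) \<Longrightarrow> (\<And>x. 0 \<le> \<omega> x) \<Longrightarrow>
      \<exists>T\<subseteq>S. \<forall>j\<in>W. Lp_norm p (\<lambda>x. ennreal (norm (signed_sum S T (\<lambda>l. h j l x)))) \<le>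
        ennreal (E * sqrt (real (card S))) * Lp_norm p (\<lambda>x. ennreal (\<omega> x))"
    show ?thesis
    proof (rule that[of "B * E * A * D + 1"])
      show "0 < B * E * A * D + 1" using A(1) B(1) E(1) D(2) by (simp add: add_nonneg_pos)
      fix k
      have "\<exists>T\<subseteq>{1..2 ^ k}. \<forall>m\<in>an_window k. Lp_norm p (\<lambda>x. ennreal (norm (signed_sum {1..2 ^ k} T
          (\<lambda>l. inverse_fourier (\<lambda>\<xi>. \<Phi> m \<xi> * atom k (\<lambda>_. 0) l \<xi>) x)))) \<le>
        ennreal (E * sqrt (real (card {1..2 ^ k::nat}))) * Lp_norm p (\<lambda>x::real ^ 'n. ennreal (A * decay K x))"
      proof (rule E(2)[of "{1..2 ^ k}" "an_window k" "\<lambda>m l. inverse_fourier (\<lambda>\<xi>. \<Phi> m \<xi> * atom k (\<lambda>_. 0) l \<xi>)" "\<lambda>x. A * decay K x"])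
        show "norm (inverse_fourier (\<lambda>\<xi>. \<Phi> m \<xi> * atom k (\<lambda>_. 0) l \<xi>) x) \<le> A * decay K x" for m l x
          using A(2)[of m k "\<lambda>_. 0" l x] by simp
        show "0 \<le> A * decay K x" for x using A(1) by (simp add: decay_def)
      qed (use card_an_window in auto)
      then obtain T where T: "\<And>m. m \<in> an_window k \<Longrightarrow> Lp_norm p (\<lambda>x. ennreal (norm (signed_sum {1..2 ^ k} T
          (\<lambda>l. inverse_fourier (\<lambda>\<xi>. \<Phi> m \<xi> * atom k (\<lambda>_. 0) l \<xi>) x)))) \<le>
        ennreal (E * sqrt (real (card {1..2 ^ k::nat}))) * Lp_norm p (\<lambda>x::real ^ 'n. ennreal (A * decay K x))" by blast
      have "Lp_norm p (\<lambda>x::real ^ 'n. ennreal (A * decay K x)) = ennreal (A * D)"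
        using A(1) D p by (simp add: ennreal_mult Lp_norm_cmult)
      then have "ennreal (E * sqrt (real (card {1..2 ^ k::nat}))) * Lp_norm p (\<lambda>x::real ^ 'n. ennreal (A * decay K x)) =
          ennreal (E * 2 powr (real k * (1 / 2)) * (A * D))"
        unfolding sqrt_card using A(1) D(2) E(1) by (simp add: ennreal_mult)
      then have "flat_norm b p q \<Phi> (packet k (\<lambda>_. 0) T) \<le> ennreal B * ennreal (E * 2 powr (real k * (1 / 2)) * (A * D))"
        using T by (intro B(2)[OF good_family_packet[of "\<lambda>_. 0" "\<lambda>_. T"], of k])
          (simp add: inverse_fourier_packet[OF resolution_schwartz[OF resolution_an]])
      also have "\<dots> = ennreal (B * E * A * D * 2 powr (real k * (1 / 2)))"
        using B(1) E(1) A(1) D(2) by (subst ennreal_mult[symmetric]) (auto simp: mult_ac)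
      also have "\<dots> \<le> ennreal ((B * E * A * D + 1) * 2 powr (real k * (1 / 2)))"
        by (intro ennreal_leI mult_right_mono) auto
      finally show "\<exists>T. flat_norm b p q \<Phi> (packet k (\<lambda>_. 0) T) \<le> ennreal ((B * E * A * D + 1) * 2 powr (real k * (1 / 2)))" ..
    qed
  qed
qed

lemma integrable_atom: "integrable lborel (atom k y l)"
proof -
  have "integrable lborel (\<lambda>\<xi>. bmp (- freq k l + \<xi>))"
    using schwartz_integrable[OF bmp_schwartz]
    by (intro integrable_distr[of "(+) (- freq k l)" lborel borel bmp]) (simp_all add: lborel_distr_plus)
  then have "integrable lborel (\<lambda>\<xi>. bmp (- freq k l + \<xi>) * exp (- (\<i> * complex_of_real (y l \<bullet> \<xi>))))"
    by (rule integrable_mult_bounded[where C = 1]) auto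
  then show ?thesis by (simp add: atom_def[abs_def] mult.commute)
qed

lemma inverse_fourier_packet_atoms:
  "inverse_fourier (packet k y T) x = signed_sum {1..2 ^ k} T (\<lambda>l. inverse_fourier (atom k y l) x)"
proof -
  have eq: "packet k y T = (\<lambda>\<xi>. \<Sum>l\<in>{1..2 ^ k}. complex_of_real (if l \<in> T then 1 else - 1) * atom k y l \<xi>)"
    by (auto simp: packet_def signed_sum_def scaleR_conv_of_real)
  have "inverse_fourier (packet k y T) x = (\<Sum>l\<in>{1..2 ^ k}. inverse_fourier (\<lambda>\<xi>. complex_of_real (if l \<in> T then 1 else - 1) * atom k y l \<xi>) x)"
    unfolding eq by (intro inverse_fourier_sum integrable_mult_right integrable_atom)
  also have "\<dots> = signed_sum {1..2 ^ k} T (\<lambda>l. inverse_fourier (atom k y l) x)"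
    unfolding inverse_fourier_cmult by (simp add: signed_sum_def scaleR_conv_of_real)
  finally show ?thesis .
qed

text \<open>Each atom has the modulus of the translated profile, so the Khinchine lower bound
  produces the square function of the profiles. The sites are arbitrary, for this bound is used with
  concentric as well as with distant packets.\<close>

lemma flat_aniso_signs_lower:
  assumes p: "0 < p" "p \<noteq> \<infinity>" and q: "0 < q"
  obtains e where "0 < e"
    "\<And>k y. \<exists>T. ennreal e * Lp_norm p (\<lambda>x. ennreal (sqrt (\<Sum>l\<in>{1..2 ^ k::nat}. (norm (profile (x - y l)))\<^sup>2))) \<le>
      flat_norm b p q \<Phi> (packet k y T)"
proof -
  obtain B where B: "0 < B" "\<And>G k. good_family G \<Longrightarrow>
    ennreal B * Lp_norm p (\<lambda>x. ennreal (norm (inverse_fourier (G k) x))) \<le> flat_norm b p q \<Phi> (G k)"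
    using flat_aniso_lower[OF p(1) q, of b] by blast
  have pt: "p \<noteq> \<top>" using p by simp
  show ?thesis
  proof (rule signs_lower[OF p(1) pt, where 'l = nat and 'a = "real ^ 'n"])
    fix d :: real assume d: "0 < d" "\<And>(S::nat set) (h::nat \<Rightarrow> real ^ 'n \<Rightarrow> complex). finite S \<Longrightarrow> (\<And>l. h l \<in> borel_measurable borel) \<Longrightarrow>
      \<exists>T\<subseteq>S. ennreal d * Lp_norm p (\<lambda>x. ennreal (sqrt (\<Sum>l\<in>S. (norm (h l x))\<^sup>2))) \<le>
        Lp_norm p (\<lambda>x. ennreal (norm (signed_sum S T (\<lambda>l. h l x))))"
    show ?thesis
    proof (rule that[of "B * d"])
      show "0 < B * d" using B(1) d(1) by simp
      fix k y
      have "inverse_fourier (atom k y l) \<in> borel_measurable borel" for l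
        by (rule inverse_fourier_measurable[OF integrable_atom])
      then obtain T where T: "ennreal d * Lp_norm p (\<lambda>x. ennreal (sqrt (\<Sum>l\<in>{1..2 ^ k::nat}. (norm (inverse_fourier (atom k y l) x))\<^sup>2))) \<le>
        Lp_norm p (\<lambda>x. ennreal (norm (signed_sum {1..2 ^ k} T (\<lambda>l. inverse_fourier (atom k y l) x))))"
        using d(2)[of "{1..2 ^ k}" "\<lambda>l. inverse_fourier (atom k y l)"] finite_atLeastAtMost by blast
      have "ennreal (B * d) * Lp_norm p (\<lambda>x. ennreal (sqrt (\<Sum>l\<in>{1..2 ^ k::nat}. (norm (profile (x - y l)))\<^sup>2))) =
          ennreal B * (ennreal d * Lp_norm p (\<lambda>x. ennreal (sqrt (\<Sum>l\<in>{1..2 ^ k::nat}. (norm (inverse_fourier (atom k y l) x))\<^sup>2))))"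
        using B(1) d(1) by (simp add: norm_inverse_fourier_atom ennreal_mult mult.assoc)
      also have "\<dots> \<le> ennreal B * Lp_norm p (\<lambda>x. ennreal (norm (inverse_fourier (packet k y T) x)))"
        unfolding inverse_fourier_packet_atoms by (intro mult_left_mono T) simp
      also have "\<dots> \<le> flat_norm b p q \<Phi> (packet k y T)"
        by (rule B(2)[OF good_family_packet[of y "\<lambda>_. T"], of k])
      finally show "\<exists>T. ennreal (B * d) * Lp_norm p (\<lambda>x. ennreal (sqrt (\<Sum>l\<in>{1..2 ^ k::nat}. (norm (profile (x - y l)))\<^sup>2))) \<le>
        flat_norm b p q \<Phi> (packet k y T)" ..
    qed
  qed
qed

lemma flat_aniso_centred_lower:
  assumes p: "0 < p" "p \<noteq> \<infinity>" and q: "0 < q"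
  obtains e where "0 < e"
    "\<And>k. \<exists>T. ennreal (e * 2 powr (real k * (1 / 2))) \<le> flat_norm b p q \<Phi> (packet k (\<lambda>_. 0) T)"
proof -
  obtain d where d: "0 < d" "ennreal d \<le> Lp_norm p (\<lambda>x. ennreal (norm (profile x)))" using Lp_norm_profile[OF p(1)] by blast
  obtain e where e: "0 < e"
    "\<And>k y. \<exists>T. ennreal e * Lp_norm p (\<lambda>x. ennreal (sqrt (\<Sum>l\<in>{1..2 ^ k::nat}. (norm (profile (x - y l)))\<^sup>2))) \<le>
      flat_norm b p q \<Phi> (packet k y T)"
    using flat_aniso_signs_lower[OF p q, of b] by blast
  show ?thesis
  proof (rule that[of "e * d"])
    show "0 < e * d" using e(1) d(1) by simp
    fix k
    obtain T where T: "ennreal e * Lp_norm p (\<lambda>x. ennreal (sqrt (\<Sum>l\<in>{1..2 ^ k::nat}. (norm (profile (x - 0)))\<^sup>2))) \<le>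
      flat_norm b p q \<Phi> (packet k (\<lambda>_. 0) T)" using e(2)[of "\<lambda>_. 0" k] by blast
    have "sqrt (\<Sum>l\<in>{1..2 ^ k::nat}. (norm (profile (x - 0)))\<^sup>2) = 2 powr (real k * (1 / 2)) * norm (profile x)" for x
      unfolding sqrt_card[symmetric] by (simp add: real_sqrt_mult)
    then have "Lp_norm p (\<lambda>x. ennreal (sqrt (\<Sum>l\<in>{1..2 ^ k::nat}. (norm (profile (x - 0)))\<^sup>2))) =
        ennreal (2 powr (real k * (1 / 2))) * Lp_norm p (\<lambda>x. ennreal (norm (profile x)))"
      using p by (simp add: ennreal_mult Lp_norm_cmult)
    note T = T[unfolded this]
    have "ennreal e * (ennreal (2 powr (real k * (1 / 2))) * ennreal d) \<le> ennreal e * (ennreal (2 powr (real k * (1 / 2))) * Lp_norm p (\<lambda>x. ennreal (norm (profile x))))"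
      by (intro mult_left_mono d(2)) auto
    also note T
    finally have "ennreal e * (ennreal (2 powr (real k * (1 / 2))) * ennreal d) \<le> flat_norm b p q \<Phi> (packet k (\<lambda>_. 0) T)" .
    then have "ennreal (e * d * 2 powr (real k * (1 / 2))) \<le> flat_norm b p q \<Phi> (packet k (\<lambda>_. 0) T)"
      using e(1) d(1) by (simp add: ennreal_mult[symmetric] mult_ac)
    then show "\<exists>T. ennreal (e * d * 2 powr (real k * (1 / 2))) \<le> flat_norm b p q \<Phi> (packet k (\<lambda>_. 0) T)" ..
  qed
qed

text \<open>With all signs plus, the atoms have the same value at the origin and add up to
  \<open>2 ^ k\<close> times that value; continuity transfers it to the essential supremum.\<close>

lemma flat_aniso_coherent_lower:
  assumes q: "0 < q"
  obtains e where "0 < e"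
    "\<And>k. ennreal (e * 2 powr real k) \<le> flat_norm b \<infinity> q \<Phi> (packet k (\<lambda>_. 0) UNIV)"
proof -
  obtain B where B: "0 < B" "\<And>G k. good_family G \<Longrightarrow>
    ennreal B * Lp_norm \<infinity> (\<lambda>x. ennreal (norm (inverse_fourier (G k) x))) \<le> flat_norm b \<infinity> q \<Phi> (G k)"
    using flat_aniso_lower[OF _ q, of \<infinity> b] by auto
  show ?thesis
  proof (rule that[of "B * norm (profile 0)"])
    show "0 < B * norm (profile 0)" using B(1) profile_0 by simp
    fix k
    have at: "inverse_fourier (atom k (\<lambda>_. 0) l) 0 = profile 0" for l
      using lborel_integral_translate[of "bmp" "- freq k l"]
      by (simp add: inverse_fourier_def profile_def atom_def)
    have P: "packet k (\<lambda>_. 0) UNIV = (\<lambda>\<xi>. \<Sum>l\<in>{1..2 ^ k}. atom k (\<lambda>_. 0) l \<xi>)"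
      by (auto simp: packet_def signed_sum_def)
    have "integrable lborel (packet k (\<lambda>_. 0) UNIV)"
      unfolding P by (intro Bochner_Integration.integrable_sum integrable_atom)
    then have c: "continuous_on UNIV (inverse_fourier (packet k (\<lambda>_. 0) UNIV))"
      by (rule continuous_inverse_fourier)
    have "norm (inverse_fourier (packet k (\<lambda>_. 0) UNIV) 0) = 2 powr real k * norm (profile 0)"
      unfolding inverse_fourier_packet_atoms at by (simp add: signed_sum_def norm_mult norm_power powr_realpow)
    then have "ennreal (2 powr real k * norm (profile 0)) \<le> Lp_norm \<infinity> (\<lambda>x. ennreal (norm (inverse_fourier (packet k (\<lambda>_. 0) UNIV) x)))"
      using esssup_continuous_ge[OF c, of 0] by simp
    then have "ennreal B * ennreal (2 powr real k * norm (profile 0)) \<le> ennreal B * Lp_norm \<infinity> (\<lambda>x. ennreal (norm (inverse_fourier (packet k (\<lambda>_. 0) UNIV) x)))"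
      by (intro mult_left_mono) auto
    also have "\<dots> \<le> flat_norm b \<infinity> q \<Phi> (packet k (\<lambda>_. 0) UNIV)"
      by (rule B(2)[OF good_family_packet[of "\<lambda>_. 0" "\<lambda>_. UNIV"], of k])
    finally have "ennreal B * ennreal (2 powr real k * norm (profile 0)) \<le> flat_norm b \<infinity> q \<Phi> (packet k (\<lambda>_. 0) UNIV)" .
    then show "ennreal (B * norm (profile 0) * 2 powr real k) \<le> flat_norm b \<infinity> q \<Phi> (packet k (\<lambda>_. 0) UNIV)"
      using B(1) by (simp add: ennreal_mult[symmetric] mult_ac)
  qed
qed

section \<open>Packets at distant sites\<close>

definition site :: "nat \<Rightarrow> real ^ 'n" where
  "site l = axis i1 (real l)"

lemma norm_site_diff: "\<bar>x $ i1 - real l\<bar> \<le> norm (x - site l)"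
  using component_le_norm_cart[of "x - site l" i1] by (simp add: site_def axis_def)

text \<open>Two powers of the decay are spent on summability along the axis \<open>i1\<close>, where
  the sites are the integer points; the remaining powers are bounded by their largest value
  \<open>d\<close>.\<close>

lemma sum_decay_site:
  "(\<Sum>l\<in>{1..N::nat}. decay (K + 2) (x - site l)) \<le> 9 * d" if d: "\<And>l. l \<in> {1..N} \<Longrightarrow> decay K (x - site l) \<le> d" "0 \<le> d" for d
proof -
  have "decay (K + 2) (x - site l) \<le> inverse ((1 + \<bar>x $ i1 - real l\<bar>)\<^sup>2) * d" if "l \<in> {1..N}" for l
  proof -
    have "(1 + \<bar>x $ i1 - real l\<bar>)\<^sup>2 \<le> (1 + norm (x - site l))\<^sup>2" using norm_site_diff[of x l] by (intro power_mono) auto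
    then have "inverse ((1 + norm (x - site l))\<^sup>2) \<le> inverse ((1 + \<bar>x $ i1 - real l\<bar>)\<^sup>2)"
      by (intro le_imp_inverse_le) (auto intro!: zero_less_power add_pos_nonneg)
    then have "inverse ((1 + norm (x - site l))\<^sup>2) * decay K (x - site l) \<le> inverse ((1 + \<bar>x $ i1 - real l\<bar>)\<^sup>2) * d"
      using d(1)[OF that] by (intro mult_mono) auto
    moreover have "decay (K + 2) (x - site l) = inverse ((1 + norm (x - site l))\<^sup>2) * decay K (x - site l)"
      by (simp only: decay_def power_add inverse_mult_distrib mult.commute)
    ultimately show ?thesis by simp
  qed
  then have "(\<Sum>l\<in>{1..N}. decay (K + 2) (x - site l)) \<le> (\<Sum>l\<in>{1..N}. inverse ((1 + \<bar>x $ i1 - real l\<bar>)\<^sup>2) * d)"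
    by (rule sum_mono)
  also have "\<dots> = (\<Sum>l\<in>{1..N}. inverse ((1 + \<bar>x $ i1 - real l\<bar>)\<^sup>2)) * d" by (simp add: sum_distrib_right)
  also have "\<dots> \<le> 9 * d" by (intro mult_right_mono sum_decay_translates d(2))
  finally show ?thesis .
qed

lemma Lp_norm_site_upper:
  assumes p: "0 < p"
  obtains K C where "0 < C" "\<And>k. Lp_norm p (\<lambda>x. ennreal (\<Sum>l\<in>{1..2 ^ k::nat}. decay K (x - site l))) \<le> ennreal (C * qpow p (2 ^ k))"
proof (cases "p = \<infinity>")
  case True
  show ?thesis
  proof (rule that[of 9 2])
    fix k
    have "(\<Sum>l\<in>{1..2 ^ k::nat}. decay 2 (x - site l)) \<le> 9" for x
      using sum_decay_site[of "2 ^ k" 0 x 1, unfolded add_0] by (simp add: decay_def del: One_nat_def)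
    then have "esssup lborel (\<lambda>x. ennreal (\<Sum>l\<in>{1..2 ^ k::nat}. decay 2 (x - site l))) \<le> ennreal 9"
      by (intro esssup_I AE_I2 ennreal_leI) auto
    then show "Lp_norm p (\<lambda>x. ennreal (\<Sum>l\<in>{1..2 ^ k::nat}. decay 2 (x - site l))) \<le> ennreal (9 * qpow p (2 ^ k))"
      using True by (simp add: Lp_norm_def qpow_def)
  qed simp
next
  case False
  define r where "r = enn2real p"
  have r: "0 < r" using p False enn2real_pos by (simp add: r_def)
  obtain K where K: "Lp_norm p (\<lambda>x::real ^ 'n. ennreal (decay K x)) < \<infinity>" using Lp_norm_decay[OF p] by blast
  obtain D where D: "Lp_norm p (\<lambda>x::real ^ 'n. ennreal (decay K x)) = ennreal D" "0 \<le> D"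
    using K by (cases "Lp_norm p (\<lambda>x::real ^ 'n. ennreal (decay K x))") auto
  show ?thesis
  proof (rule that[of "9 * D + 1" "K + 2"])
    show "0 < 9 * D + 1" using D(2) by simp
    fix k
    \<comment> \<open>The sum is at most 9 times its largest term with less decay, and the
      \<open>r\<close>-th power of that term is at most the sum of the \<open>r\<close>-th powers.
      This gives almost-orthogonality of the sites for every positive exponent.\<close>
    have pt: "(\<Sum>l\<in>{1..2 ^ k::nat}. decay (K + 2) (x - site l)) powr r \<le> 9 powr r * (\<Sum>l\<in>{1..2 ^ k::nat}. decay K (x - site l) powr r)" for x
    proof -
      define d where "d = Max ((\<lambda>l. decay K (x - site l)) ` {1..2 ^ k::nat})"
      have "d \<in> (\<lambda>l. decay K (x - site l)) ` {1..2 ^ k::nat}" unfolding d_def by (intro Max_in) auto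
      then obtain l where l: "l \<in> {1..2 ^ k::nat}" "d = decay K (x - site l)" by auto
      have "(\<Sum>l\<in>{1..2 ^ k::nat}. decay (K + 2) (x - site l)) \<le> 9 * d"
      proof (rule sum_decay_site)
        show "decay K (x - site l) \<le> d" if "l \<in> {1..2 ^ k}" for l unfolding d_def using that by (intro Max_ge) auto
        show "0 \<le> d" unfolding l(2) by (simp add: decay_def)
      qed
      then have "(\<Sum>l\<in>{1..2 ^ k::nat}. decay (K + 2) (x - site l)) powr r \<le> (9 * d) powr r"
        using r by (intro powr_mono2) (auto intro: sum_nonneg)
      also have "\<dots> = 9 powr r * decay K (x - site l) powr r" using l by (simp add: powr_mult)
      also have "\<dots> \<le> 9 powr r * (\<Sum>l\<in>{1..2 ^ k::nat}. decay K (x - site l) powr r)"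
        using l by (intro mult_left_mono member_le_sum) auto
      finally show ?thesis .
    qed
    have J: "(\<integral>\<^sup>+ x. ennreal (decay K (x - site l) powr r) \<partial>lborel) = ennreal (D powr r)" for l
    proof -
      have "Lp_norm p (\<lambda>x. ennreal (decay K (x - site l))) = ennreal D"
        using Lp_norm_translate[of "\<lambda>x::real ^ 'n. ennreal (decay K x)" p "site l"] D p by simp
      then have "ennreal_powr (ennreal D) r = (\<integral>\<^sup>+ x. ennreal_powr (ennreal (decay K (x - site l))) r \<partial>lborel)"
        using measure_norm_powr[OF p, of lborel "\<lambda>x. ennreal (decay K (x - site l))"] False by (simp add: Lp_norm_eq r_def)
      then show ?thesis using D(2) by (simp add: ennreal_powr_ennreal)
    qed
    have "(\<integral>\<^sup>+ x. ennreal_powr (ennreal (\<Sum>l\<in>{1..2 ^ k::nat}. decay (K + 2) (x - site l))) r \<partial>lborel) \<le>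
      (\<integral>\<^sup>+ x. ennreal (9 powr r) * (\<Sum>l\<in>{1..2 ^ k::nat}. ennreal (decay K (x - site l) powr r)) \<partial>lborel)"
    proof (rule nn_integral_mono)
      fix x
      have "ennreal_powr (ennreal (\<Sum>l\<in>{1..2 ^ k::nat}. decay (K + 2) (x - site l))) r =
          ennreal ((\<Sum>l\<in>{1..2 ^ k::nat}. decay (K + 2) (x - site l)) powr r)"
        by (intro ennreal_powr_ennreal sum_nonneg) simp
      also have "\<dots> \<le> ennreal (9 powr r * (\<Sum>l\<in>{1..2 ^ k::nat}. decay K (x - site l) powr r))" by (intro ennreal_leI pt)
      also have "\<dots> = ennreal (9 powr r) * (\<Sum>l\<in>{1..2 ^ k::nat}. ennreal (decay K (x - site l) powr r))"
        by (subst sum_ennreal) (auto simp: ennreal_mult sum_nonneg)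
      finally show "ennreal_powr (ennreal (\<Sum>l\<in>{1..2 ^ k::nat}. decay (K + 2) (x - site l))) r \<le>
          ennreal (9 powr r) * (\<Sum>l\<in>{1..2 ^ k::nat}. ennreal (decay K (x - site l) powr r))" .
    qed
    also have "\<dots> = ennreal (9 powr r) * (\<Sum>l\<in>{1..2 ^ k::nat}. \<integral>\<^sup>+ x. ennreal (decay K (x - site l) powr r) \<partial>lborel)"
      by (subst nn_integral_cmult) (auto simp: nn_integral_sum simp del: sum_ennreal)
    also have "\<dots> = ennreal (9 powr r) * (2 ^ k * ennreal (D powr r))" by (simp add: J)
    also have "\<dots> = ennreal (9 powr r * (2 ^ k * D powr r))"
      by (simp add: ennreal_mult flip: ennreal_power)
    also have "9 powr r * (2 ^ k * D powr r) = (9 * D * qpow p (2 ^ k)) powr r"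
      using False r D(2) by (simp add: qpow_def powr_mult powr_powr flip: r_def)
    also have "ennreal ((9 * D * qpow p (2 ^ k)) powr r) = ennreal_powr (ennreal (9 * D * qpow p (2 ^ k))) r"
      using D(2) by (simp add: ennreal_powr_ennreal)
    finally have "Lp_norm p (\<lambda>x. ennreal (\<Sum>l\<in>{1..2 ^ k::nat}. decay (K + 2) (x - site l))) \<le> ennreal (9 * D * qpow p (2 ^ k))"
      using False unfolding Lp_norm_eq r_def by (intro measure_norm_leI p) auto
    also have "\<dots> \<le> ennreal ((9 * D + 1) * qpow p (2 ^ k))" by (intro ennreal_leI mult_right_mono) auto
    finally show "Lp_norm p (\<lambda>x. ennreal (\<Sum>l\<in>{1..2 ^ k::nat}. decay (K + 2) (x - site l))) \<le> ennreal ((9 * D + 1) * qpow p (2 ^ k))" .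
  qed
qed

lemma flat_aniso_site_upper:
  assumes p: "0 < p" and q: "0 < q"
  obtains C where "0 < C"
    "\<And>k T. flat_norm b p q \<Phi> (packet k site T) \<le> ennreal (C * qpow p (2 ^ k))"
proof -
  obtain K D where D: "0 < D" "\<And>k. Lp_norm p (\<lambda>x. ennreal (\<Sum>l\<in>{1..2 ^ k::nat}. decay K (x - site l))) \<le> ennreal (D * qpow p (2 ^ k))"
    using Lp_norm_site_upper[OF p] by blast
  obtain A where A: "0 < A" "\<And>j k y l x. norm (inverse_fourier (\<lambda>\<xi>. \<Phi> j \<xi> * atom k y l \<xi>) x) \<le> A * decay K (x - y l)"
    using atom_decay[OF resolution_an] by blast
  obtain B where B: "0 < B" "\<And>G k S. good_family G \<Longrightarrow>
    (\<And>m. m \<in> an_window k \<Longrightarrow> Lp_norm p (\<lambda>x. ennreal (norm (inverse_fourier (\<lambda>\<xi>. \<Phi> m \<xi> * G k \<xi>) x))) \<le> S) \<Longrightarrow>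
    flat_norm b p q \<Phi> (G k) \<le> ennreal B * S"
    using flat_aniso_upper[OF p q, of b] by blast
  show ?thesis
  proof (rule that[of "B * (A * D)"])
    show "0 < B * (A * D)" using A(1) B(1) D(1) by simp
    fix k T
    have "flat_norm b p q \<Phi> (packet k site T) \<le> ennreal B * ennreal (A * D * qpow p (2 ^ k))"
    proof (rule B(2)[OF good_family_packet[of site "\<lambda>_. T"], of k])
      fix m
      have "Lp_norm p (\<lambda>x. ennreal (norm (inverse_fourier (\<lambda>\<xi>. \<Phi> m \<xi> * packet k site T \<xi>) x))) \<le>
        Lp_norm p (\<lambda>x. ennreal A * ennreal (\<Sum>l\<in>{1..2 ^ k::nat}. decay K (x - site l)))"
      proof (intro Lp_norm_mono p)
        fix x
        have "norm (inverse_fourier (\<lambda>\<xi>. \<Phi> m \<xi> * packet k site T \<xi>) x) \<le> (\<Sum>l\<in>{1..2 ^ k::nat}. A * decay K (x - site l))"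
          unfolding inverse_fourier_packet[OF resolution_schwartz[OF resolution_an]] signed_sum_def
          by (rule sum_norm_le) (simp add: A(2))
        then show "ennreal (norm (inverse_fourier (\<lambda>\<xi>. \<Phi> m \<xi> * packet k site T \<xi>) x)) \<le>
            ennreal A * ennreal (\<Sum>l\<in>{1..2 ^ k::nat}. decay K (x - site l))"
          using A(1) by (subst ennreal_mult[symmetric]) (auto simp: sum_distrib_left sum_nonneg intro: ennreal_leI)
      next
        show "(\<lambda>x. ennreal (norm (inverse_fourier (\<lambda>\<xi>. \<Phi> m \<xi> * packet k site T \<xi>) x))) \<in> borel_measurable borel"
          using inverse_fourier_measurable[OF good_family_integrable[OF good_family_packet[of site "\<lambda>_. T"] resolution_an, where j = m and k = k]] by measurable
      qed
      also have "\<dots> = ennreal A * Lp_norm p (\<lambda>x. ennreal (\<Sum>l\<in>{1..2 ^ k::nat}. decay K (x - site l)))"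
        by (rule Lp_norm_cmult[OF _ p]) auto
      also have "\<dots> \<le> ennreal A * ennreal (D * qpow p (2 ^ k))" by (intro mult_left_mono D(2)) simp
      also have "\<dots> = ennreal (A * D * qpow p (2 ^ k))" using A(1) D(1) by (simp add: ennreal_mult mult.assoc)
      finally show "Lp_norm p (\<lambda>x. ennreal (norm (inverse_fourier (\<lambda>\<xi>. \<Phi> m \<xi> * packet k site T \<xi>) x))) \<le> ennreal (A * D * qpow p (2 ^ k))" .
    qed
    then show "flat_norm b p q \<Phi> (packet k site T) \<le> ennreal (B * (A * D) * qpow p (2 ^ k))"
      using A(1) B(1) D(1) by (simp add: ennreal_mult mult.assoc)
  qed
qed

text \<open>On each of \<open>2 ^ k\<close> disjoint balls of equal volume one of the profiles is at
  least \<open>c0\<close>, and the square function is at least that profile. Integrating its power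
  over the balls gives the rate \<open>1/p\<close>.\<close>

lemma flat_aniso_site_lower:
  assumes p: "0 < p" "p \<noteq> \<infinity>" and q: "0 < q"
  obtains e where "0 < e"
    "\<And>k. \<exists>T. ennreal (e * qpow p (2 ^ k)) \<le> flat_norm b p q \<Phi> (packet k site T)"
proof -
  define r where "r = enn2real p"
  have r: "0 < r" using p enn2real_pos by (simp add: r_def)
  obtain e where e: "0 < e"
    "\<And>k y. \<exists>T. ennreal e * Lp_norm p (\<lambda>x. ennreal (sqrt (\<Sum>l\<in>{1..2 ^ k::nat}. (norm (profile (x - y l)))\<^sup>2))) \<le>
      flat_norm b p q \<Phi> (packet k y T)"
    using flat_aniso_signs_lower[OF p q, of b] by blast
  define c0 where "c0 = norm (profile 0) / 2"
  have c0: "0 < c0" using profile_0 by (simp add: c0_def)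
  have "open ((\<lambda>x. norm (profile x)) -` {c0<..})"
    by (intro open_vimage open_greaterThan continuous_intros profile_continuous)
  moreover have "0 \<in> (\<lambda>x. norm (profile x)) -` {c0<..}" using c0 by (simp add: c0_def)
  ultimately obtain \<rho> where \<rho>: "0 < \<rho>" "ball 0 \<rho> \<subseteq> (\<lambda>x. norm (profile x)) -` {c0<..}" by (rule openE)
  \<comment> \<open>Radius at most \<open>1/2\<close> keeps balls around distinct integer sites
    disjoint.\<close>
  define \<delta> where "\<delta> = min \<rho> (1 / 2)"
  have \<delta>: "0 < \<delta>" "\<delta> \<le> 1 / 2" and big: "\<And>x. norm x < \<delta> \<Longrightarrow> c0 < norm (profile x)"
    using \<rho> by (auto simp: \<delta>_def subset_iff)
  define V where "V = emeasure lborel (ball (0::real ^ 'n) \<delta>)"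
  have V: "emeasure lborel (ball (y::real ^ 'n) \<delta>) = V" for y
    using \<delta> by (simp add: V_def emeasure_ball)
  have "0 < V" using \<delta> by (simp add: V_def emeasure_ball)
  moreover have "V < \<top>" using \<delta> by (simp add: V_def emeasure_ball)
  ultimately obtain v where v: "V = ennreal v" "0 < v" by (cases V) auto
  define d where "d = c0 * v powr (1 / r)"
  have d: "0 < d" using c0 v by (simp add: d_def)
  show ?thesis
  proof (rule that[of "e * d"])
    show "0 < e * d" using e(1) d by simp
    fix k
    have disj: "x \<notin> ball (site l') \<delta>" if "x \<in> ball (site l) \<delta>" "l \<noteq> l'" for x l l'
    proof
      assume "x \<in> ball (site l') \<delta>"
      then have "\<bar>x $ i1 - real l'\<bar> < 1 / 2" using norm_site_diff[of x l'] \<delta>(2) by (simp add: dist_norm norm_minus_commute)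
      moreover have "\<bar>x $ i1 - real l\<bar> < 1 / 2" using norm_site_diff[of x l] \<delta>(2) that(1) by (simp add: dist_norm norm_minus_commute)
      ultimately have "\<bar>real l - real l'\<bar> < 1" by linarith
      then show False using that(2) by linarith
    qed
    have "ennreal (c0 powr r) * (\<Sum>l\<in>{1..2 ^ k::nat}. indicator (ball (site l) \<delta>) x) \<le>
      ennreal_powr (ennreal (sqrt (\<Sum>l\<in>{1..2 ^ k::nat}. (norm (profile (x - site l)))\<^sup>2))) r" for x
    proof (cases "\<exists>l\<in>{1..2 ^ k::nat}. x \<in> ball (site l) \<delta>")
      case True
      then obtain l where l: "l \<in> {1..2 ^ k}" "x \<in> ball (site l) \<delta>" by blast
      have "(\<Sum>l\<in>{1..2 ^ k::nat}. indicator (ball (site l) \<delta>) x :: ennreal) = (\<Sum>l\<in>{l}. indicator (ball (site l) \<delta>) x)"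
        using l disj[OF l(2)] by (intro sum.mono_neutral_right) (auto simp: indicator_def)
      then have 1: "(\<Sum>l\<in>{1..2 ^ k::nat}. indicator (ball (site l) \<delta>) x :: ennreal) = 1" using l by simp
      have "c0 \<le> norm (profile (x - site l))" using big[of "x - site l"] l(2) by (simp add: dist_norm norm_minus_commute)
      also have "\<dots> = sqrt ((norm (profile (x - site l)))\<^sup>2)" by simp
      also have "\<dots> \<le> sqrt (\<Sum>l\<in>{1..2 ^ k::nat}. (norm (profile (x - site l)))\<^sup>2)"
        using l(1) by (intro real_sqrt_le_mono member_le_sum) auto
      finally have "c0 powr r \<le> sqrt (\<Sum>l\<in>{1..2 ^ k::nat}. (norm (profile (x - site l)))\<^sup>2) powr r"
        using c0 r by (intro powr_mono2) auto
      then show ?thesis unfolding 1 by (subst ennreal_powr_ennreal) (auto simp: sum_nonneg intro: ennreal_leI)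
    next
      case False
      then have "(\<Sum>l\<in>{1..2 ^ k::nat}. indicator (ball (site l) \<delta>) x :: ennreal) = 0" by (intro sum.neutral) auto
      then show ?thesis by simp
    qed
    then have "(\<integral>\<^sup>+ x. ennreal (c0 powr r) * (\<Sum>l\<in>{1..2 ^ k::nat}. indicator (ball (site l) \<delta>) x) \<partial>lborel) \<le>
      (\<integral>\<^sup>+ x. ennreal_powr (ennreal (sqrt (\<Sum>l\<in>{1..2 ^ k::nat}. (norm (profile (x - site l)))\<^sup>2))) r \<partial>lborel)"
      by (intro nn_integral_mono)
    moreover have "(\<integral>\<^sup>+ x. ennreal (c0 powr r) * (\<Sum>l\<in>{1..2 ^ k::nat}. indicator (ball (site l) \<delta>) x) \<partial>lborel) =
      ennreal (c0 powr r) * (2 ^ k * ennreal v)"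
    proof -
      have "(\<integral>\<^sup>+ x. (\<Sum>l\<in>{1..2 ^ k::nat}. indicator (ball (site l) \<delta>) x) \<partial>lborel) =
          (\<Sum>l\<in>{1..2 ^ k::nat}. \<integral>\<^sup>+ x. indicator (ball (site l) \<delta>) x \<partial>lborel)"
        by (rule nn_integral_sum) (auto intro!: borel_measurable_indicator)
      also have "\<dots> = 2 ^ k * ennreal v"
        by (subst nn_integral_indicator) (auto simp: V v)
      finally show ?thesis
        by (subst nn_integral_cmult) (auto intro!: borel_measurable_sum borel_measurable_indicator)
    qed
    moreover have "ennreal (c0 powr r) * (2 ^ k * ennreal v) = ennreal_powr (ennreal (d * qpow p (2 ^ k))) r"
    proof -
      have "(d * qpow p (2 ^ k)) powr r = c0 powr r * (2 ^ k * v)"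
        using r c0 v p by (simp add: d_def qpow_def powr_mult powr_powr mult_ac flip: r_def)
      moreover have "ennreal (c0 powr r) * (2 ^ k * ennreal v) = ennreal (c0 powr r * (2 ^ k * v))"
        using v(2) by (simp add: ennreal_mult flip: ennreal_power)
      ultimately show ?thesis using d by (simp add: ennreal_powr_ennreal)
    qed
    ultimately have le: "ennreal (d * qpow p (2 ^ k)) \<le> Lp_norm p (\<lambda>x. ennreal (sqrt (\<Sum>l\<in>{1..2 ^ k::nat}. (norm (profile (x - site l)))\<^sup>2)))"
      using p unfolding Lp_norm_eq r_def by (intro measure_norm_geI) auto
    obtain T where T: "ennreal e * Lp_norm p (\<lambda>x. ennreal (sqrt (\<Sum>l\<in>{1..2 ^ k::nat}. (norm (profile (x - site l)))\<^sup>2))) \<le>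
      flat_norm b p q \<Phi> (packet k site T)" using e(2) by blast
    have "ennreal (e * d * qpow p (2 ^ k)) = ennreal e * ennreal (d * qpow p (2 ^ k))"
      using e(1) d by (simp add: ennreal_mult mult.assoc)
    also have "\<dots> \<le> ennreal e * Lp_norm p (\<lambda>x. ennreal (sqrt (\<Sum>l\<in>{1..2 ^ k::nat}. (norm (profile (x - site l)))\<^sup>2)))"
      by (intro mult_left_mono le) simp
    also note T
    finally show "\<exists>T. ennreal (e * d * qpow p (2 ^ k)) \<le> flat_norm b p q \<Phi> (packet k site T)" ..
  qed
qed

end

section \<open>Diagonal changes of variables\<close>

lemma diag_nth: "diag d (x :: real ^ 'n) $ i = d (axis i 1) * x $ i"
  using diag_inner[of "axis i 1" d x] by (simp add: inner_axis axis_in_Basis_iff)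

lemma diag_diag: "diag d (diag d' x) = diag (\<lambda>b. d b * d' b) x"
  by (rule euclidean_eqI) (simp add: diag_inner)

lemma diag_inner_diag: "x \<bullet> diag d \<zeta> = diag d x \<bullet> \<zeta>"
proof -
  have "x \<bullet> diag d \<zeta> = (\<Sum>b\<in>Basis. (x \<bullet> b) * (diag d \<zeta> \<bullet> b))" by (rule euclidean_inner)
  also have "\<dots> = (\<Sum>b\<in>Basis. (diag d x \<bullet> b) * (\<zeta> \<bullet> b))" by (intro sum.cong refl) (simp add: diag_inner)
  also have "\<dots> = diag d x \<bullet> \<zeta>" by (rule euclidean_inner[symmetric])
  finally show ?thesis .
qed

lemma diag_measurable [measurable]: "diag d \<in> borel_measurable borel"
  by (intro borel_measurable_continuous_onI linear_continuous_on bounded_linear_diag)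

lemma nn_integral_diag:
  fixes f :: "'a::euclidean_space \<Rightarrow> ennreal"
  assumes [measurable]: "f \<in> borel_measurable borel" and d: "\<And>b. b \<in> Basis \<Longrightarrow> d b \<noteq> 0"
  shows "(\<integral>\<^sup>+ x. f x \<partial>lborel) = ennreal (\<Prod>b\<in>Basis. \<bar>d b\<bar>) * (\<integral>\<^sup>+ x. f (diag d x) \<partial>lborel)"
  by (subst lborel_affine_euclidean[where c = d and t = 0, OF d])
    (simp_all add: nn_integral_density nn_integral_distr nn_integral_cmult flip: diag_def)

lemma integral_diag:
  fixes f :: "'a::euclidean_space \<Rightarrow> complex"
  assumes [measurable]: "f \<in> borel_measurable borel" and d: "\<And>b. b \<in> Basis \<Longrightarrow> d b \<noteq> 0"
  shows "(LINT x|lborel. f x) = (\<Prod>b\<in>Basis. \<bar>d b\<bar>) *\<^sub>R (LINT x|lborel. f (diag d x))"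
  by (subst lborel_affine_euclidean[where c = d and t = 0, OF d])
    (simp_all add: integral_density integral_distr prod_nonneg flip: diag_def)

context two_scales
begin

subsection \<open>Approximate delta functions\<close>

definition stretch :: "nat \<Rightarrow> real ^ 'n \<Rightarrow> real ^ 'n" where
  "stretch N = diag (\<lambda>b. if b = axis i2 1 then 2 ^ N else 1)"

definition contract :: "nat \<Rightarrow> real ^ 'n \<Rightarrow> real ^ 'n" where
  "contract N = diag (\<lambda>b. if b = axis i2 1 then 1 / 2 ^ N else 1)"

lemma stretch_nth: "stretch N x $ i = (if i = i2 then 2 ^ N * x $ i else x $ i)"
  by (simp add: stretch_def diag_nth axis_eq_axis)

lemma contract_nth: "contract N x $ i = (if i = i2 then x $ i / 2 ^ N else x $ i)"
  by (simp add: contract_def diag_nth axis_eq_axis)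

lemma contract_stretch: "contract N (stretch N x) = x"
  by (simp add: vec_eq_iff contract_nth stretch_nth)

lemma stretch_measurable [measurable]: "stretch N \<in> borel_measurable borel" "contract N \<in> borel_measurable borel"
  by (simp_all add: stretch_def contract_def)

lemma prod_stretch: "(\<Prod>b\<in>(Basis :: (real ^ 'n) set). \<bar>if b = axis i2 1 then 2 ^ N else 1\<bar>) = (2 ^ N :: real)"
proof -
  have "(\<Prod>b\<in>(Basis :: (real ^ 'n) set). \<bar>if b = axis i2 1 then 2 ^ N else 1\<bar>) = (\<Prod>b\<in>(Basis :: (real ^ 'n) set). if b = axis i2 1 then 2 ^ N else (1 :: real))"
    by (intro prod.cong) auto
  then show ?thesis by (simp add: prod.delta axis_in_Basis_iff)
qed

lemma nn_integral_stretch: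
  fixes f :: "real ^ 'n \<Rightarrow> ennreal"
  assumes "f \<in> borel_measurable borel"
  shows "(\<integral>\<^sup>+ x. f (stretch N x) \<partial>lborel) = ennreal (1 / 2 ^ N) * (\<integral>\<^sup>+ x. f x \<partial>lborel)"
proof -
  have "(\<integral>\<^sup>+ x. f x \<partial>lborel) = ennreal (2 ^ N) * (\<integral>\<^sup>+ x. f (stretch N x) \<partial>lborel)"
  proof -
    have "(\<integral>\<^sup>+ x. f x \<partial>lborel) = ennreal (\<Prod>b\<in>(Basis :: (real ^ 'n) set). \<bar>if b = axis i2 1 then 2 ^ N else 1\<bar>) *
        (\<integral>\<^sup>+ x. f (diag (\<lambda>b. if b = axis i2 1 then 2 ^ N else 1) x) \<partial>lborel)"
      by (rule nn_integral_diag[OF assms]) simp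
    then show ?thesis unfolding prod_stretch stretch_def .
  qed
  then have "ennreal (1 / 2 ^ N) * (\<integral>\<^sup>+ x. f x \<partial>lborel) = ennreal (1 / 2 ^ N) * ennreal (2 ^ N) * (\<integral>\<^sup>+ x. f (stretch N x) \<partial>lborel)"
    by (simp add: mult.assoc)
  moreover have "ennreal (1 / 2 ^ N) * ennreal (2 ^ N) = 1" by (subst ennreal_mult[symmetric]) simp_all
  ultimately show ?thesis by simp
qed

lemma Lp_norm_stretch:
  fixes f :: "real ^ 'n \<Rightarrow> ennreal"
  assumes [measurable]: "f \<in> borel_measurable borel" and p: "0 < p" "p \<noteq> \<infinity>"
  shows "Lp_norm p (\<lambda>x. f (stretch N x)) = ennreal (2 powr (- (real N / enn2real p))) * Lp_norm p f"
proof -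
  define r where "r = enn2real p"
  have r: "0 < r" using p enn2real_pos by (simp add: r_def)
  have "(1 / 2 ^ N :: real) = 2 powr (- real N)" by (simp add: powr_minus powr_realpow divide_inverse)
  then have "ennreal_powr (ennreal (1 / 2 ^ N)) (1 / r) = ennreal (2 powr (- (real N / r)))"
    by (simp add: ennreal_powr_ennreal powr_powr)
  then show ?thesis
    using p r unfolding Lp_norm_def
    by (subst nn_integral_stretch[where f = "\<lambda>x. ennreal_powr (f x) (enn2real p)"]) (simp_all add: ennreal_powr_mult flip: r_def)
qed

text \<open>Widening the spectrum by \<open>2 ^ N\<close> in the coordinate \<open>i2\<close>
  multiplies the amplitude by the Jacobian \<open>2 ^ N\<close> and compresses the function in
  space. The dilation is moved onto the multiplier, so that decay estimates can be made for a fixed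
  \<open>h\<close>.\<close>

lemma norm_inverse_fourier_contract:
  assumes [measurable]: "m \<in> borel_measurable borel" "h \<in> borel_measurable borel"
  shows "norm (inverse_fourier (\<lambda>\<xi>. m \<xi> * h (contract N (\<xi> - \<eta>))) x) =
    2 ^ N * norm (inverse_fourier (\<lambda>\<zeta>. m (\<eta> + stretch N \<zeta>) * h \<zeta>) (stretch N x))"
proof -
  have "norm (inverse_fourier (\<lambda>\<xi>. m \<xi> * h (contract N (\<xi> - \<eta>))) x) =
      norm (inverse_fourier (\<lambda>\<zeta>. m (\<eta> + \<zeta>) * h (contract N \<zeta>)) x)"
    using inverse_fourier_modulated[where m = m and b = "\<lambda>\<zeta>. h (contract N \<zeta>)" and y = 0 and \<eta> = \<eta> and x = x] by simp
  also have "norm (inverse_fourier (\<lambda>\<zeta>. m (\<eta> + \<zeta>) * h (contract N \<zeta>)) x) =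
      2 ^ N * norm (inverse_fourier (\<lambda>\<zeta>. m (\<eta> + stretch N \<zeta>) * h \<zeta>) (stretch N x))"
  proof -
    have "(LINT \<zeta>|lborel. (m (\<eta> + \<zeta>) * h (contract N \<zeta>)) * exp (\<i> * complex_of_real (x \<bullet> \<zeta>))) =
        2 ^ N *\<^sub>R (LINT \<zeta>|lborel. (m (\<eta> + stretch N \<zeta>) * h \<zeta>) * exp (\<i> * complex_of_real (stretch N x \<bullet> \<zeta>)))"
    proof -
      have "(LINT \<zeta>|lborel. (m (\<eta> + \<zeta>) * h (contract N \<zeta>)) * exp (\<i> * complex_of_real (x \<bullet> \<zeta>))) =
        2 ^ N *\<^sub>R (LINT \<zeta>|lborel. (m (\<eta> + stretch N \<zeta>) * h (contract N (stretch N \<zeta>))) * exp (\<i> * complex_of_real (x \<bullet> stretch N \<zeta>)))"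
      proof -
        have "(LINT \<zeta>|lborel. (m (\<eta> + \<zeta>) * h (contract N \<zeta>)) * exp (\<i> * complex_of_real (x \<bullet> \<zeta>))) =
          (\<Prod>b\<in>(Basis :: (real ^ 'n) set). \<bar>if b = axis i2 1 then 2 ^ N else 1\<bar>) *\<^sub>R (LINT \<zeta>|lborel.
            (m (\<eta> + diag (\<lambda>b. if b = axis i2 1 then 2 ^ N else 1) \<zeta>) * h (contract N (diag (\<lambda>b. if b = axis i2 1 then 2 ^ N else 1) \<zeta>))) *
            exp (\<i> * complex_of_real (x \<bullet> diag (\<lambda>b. if b = axis i2 1 then 2 ^ N else 1) \<zeta>)))"
          by (rule integral_diag) auto
        then show ?thesis unfolding prod_stretch stretch_def .
      qed
      then show ?thesis unfolding contract_stretch by (simp only: stretch_def diag_inner_diag)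
    qed
    then have "inverse_fourier (\<lambda>\<zeta>. m (\<eta> + \<zeta>) * h (contract N \<zeta>)) x = 2 ^ N *\<^sub>R inverse_fourier (\<lambda>\<zeta>. m (\<eta> + stretch N \<zeta>) * h \<zeta>) (stretch N x)"
      by (simp add: inverse_fourier_def)
    then show ?thesis by (simp add: norm_power)
  qed
  finally show ?thesis .
qed

text \<open>A tensor product whose only variable factor sits in the coordinate \<open>i2\<close>.
  Since \<open>\<theta>\<close> vanishes beyond 2, the factors \<open>\<theta> (8 * t)\<close>
  vanish beyond \<open>1/4\<close>, as the shell demands.\<close>

definition box :: "(real \<Rightarrow> complex) \<Rightarrow> real ^ 'n \<Rightarrow> complex" where
  "box g \<xi> = (\<Prod>i\<in>UNIV. (if i = i2 then g else (\<lambda>t. \<theta> (8 * t))) (\<xi> $ i))"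

lemma box_eq: "box g \<xi> = g (\<xi> $ i2) * (\<Prod>i\<in>UNIV - {i2}. \<theta> (8 * \<xi> $ i))"
  unfolding box_def by (subst prod.remove[of UNIV i2]) auto

lemma box_nonzero:
  assumes "box g \<xi> \<noteq> 0"
  shows "g (\<xi> $ i2) \<noteq> 0" "i \<noteq> i2 \<Longrightarrow> \<bar>\<xi> $ i\<bar> \<le> 1 / 4"
proof -
  show "g (\<xi> $ i2) \<noteq> 0" using assms by (auto simp: box_eq)
  assume i: "i \<noteq> i2"
  have "\<theta> (8 * \<xi> $ i) \<noteq> 0"
  proof
    assume "\<theta> (8 * \<xi> $ i) = 0"
    then have "(\<Prod>i\<in>UNIV - {i2}. \<theta> (8 * \<xi> $ i)) = 0" using i by (intro prod_zero) auto
    then show False using assms by (simp add: box_eq)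
  qed
  then show "\<bar>\<xi> $ i\<bar> \<le> 1 / 4" using hyperbolic_generator_zero[OF gen\<theta>, of "8 * \<xi> $ i"] by (simp add: abs_mult)
qed

lemma \<theta>_schwartz: "\<theta> \<in> schwartz"
  using gen\<theta> by (simp add: hyperbolic_generator_def)

lemma box_schwartz:
  assumes g: "\<And>L. \<exists>B. deriv_bound L 0 B g" "\<And>t. g t \<noteq> 0 \<Longrightarrow> \<bar>t\<bar> \<le> \<rho>"
  shows "box g \<in> schwartz"
proof (rule schwartz_cart_support[where \<rho> = "\<lambda>i. if i = i2 then \<rho> else 1 / 4"])
  fix L
  obtain B where B: "deriv_bound L 0 B g" using g(1) by blast
  obtain B' where B': "deriv_bound L 0 B' \<theta>" using deriv_bound_schwartz[OF \<theta>_schwartz] by blast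
  have 8: "deriv_bound L 0 (8 ^ L * B') (\<lambda>t. \<theta> (8 * t))" using deriv_bound_scale[OF B', of 8 0] by simp
  let ?B = "max B (8 ^ L * B')"
  have "deriv_bound L 0 ((2 ^ L * ?B) ^ CARD('n)) (\<lambda>\<xi>::real ^ 'n. \<Prod>i\<in>UNIV. (if i = i2 then g else (\<lambda>t. \<theta> (8 * t))) (\<xi> $ i))"
  proof (rule prod_coord_schwartz)
    show "deriv_bound L 0 ?B (if i = i2 then g else (\<lambda>t. \<theta> (8 * t)))" for i
      using deriv_bound_mono[OF B, of L 0 ?B] deriv_bound_mono[OF 8, of L 0 ?B] by (cases "i = i2") simp_all
  qed
  then show "\<exists>B. deriv_bound L 0 B (box g)" unfolding box_def[abs_def] by blast
next
  show "\<bar>\<xi> $ i\<bar> \<le> (if i = i2 then \<rho> else 1 / 4)" if "box g \<xi> \<noteq> 0" for \<xi> i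
    using box_nonzero[OF that] g(2) by simp
qed

lemma box_\<theta>_schwartz: "box \<theta> \<in> schwartz"
  using deriv_bound_schwartz[OF \<theta>_schwartz] hyperbolic_generator_zero[OF gen\<theta>] by (intro box_schwartz) blast+

lemma box_dyadic_schwartz: "box (dyadic_resolution \<theta> 1) \<in> schwartz"
proof (rule box_schwartz)
  show "\<exists>B. deriv_bound L 0 B (dyadic_resolution \<theta> 1)" for L
    using deriv_bound_schwartz[OF \<theta>_schwartz] dyadic_deriv_bound by blast
  show "\<bar>t\<bar> \<le> 2 powr (real 1 + 1)" if "dyadic_resolution \<theta> 1 t \<noteq> 0" for t
    by (rule dyadic_resolution_nonzero(1)[OF gen\<theta> that])
qed

text \<open>The approximate delta function on the Fourier side: the plateau of
  \<open>\<theta>\<close> is dilated to \<open>2 ^ (2 ^ k + 1)\<close> in the coordinate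
  \<open>i2\<close>, wide enough to contain the dyadic levels \<open>1\<close> to
  \<open>2 ^ k\<close> completely.\<close>

definition spike :: "nat \<Rightarrow> real ^ 'n \<Rightarrow> complex" where
  "spike k \<xi> = box \<theta> (contract (2 ^ k + 1) (\<xi> - axis i1 (radius k)))"

lemma spike_shell:
  assumes "spike k \<xi> \<noteq> 0"
  shows "\<xi> \<in> shell k"
proof -
  let ?\<zeta> = "contract (2 ^ k + 1) (\<xi> - axis i1 (radius k))"
  have nz: "box \<theta> ?\<zeta> \<noteq> 0" using assms by (simp add: spike_def)
  have z: "?\<zeta> $ i = (if i = i2 then \<xi> $ i2 / 2 ^ (2 ^ k + 1) else if i = i1 then \<xi> $ i - radius k else \<xi> $ i)" for i
    using ne by (simp add: contract_nth axis_def)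
  have "\<bar>\<xi> $ i2 / 2 ^ (2 ^ k + 1)\<bar> \<le> 2"
    using hyperbolic_generator_zero[OF gen\<theta> box_nonzero(1)[OF nz]] unfolding z by simp
  then have "\<bar>\<xi> $ i2\<bar> \<le> 2 * 2 ^ (2 ^ k + 1)" by (simp add: abs_divide divide_le_eq)
  also have "\<dots> = 2 powr (2 ^ k + 2)" by (simp add: powr_add powr_realpow[symmetric])
  also have "\<dots> \<le> 2 powr (\<alpha> $ i2 * octave k)"
  proof (rule powr_mono)
    have "(1::real) \<le> 2 ^ k" by simp
    then show "2 ^ k + 2 \<le> \<alpha> $ i2 * octave k" using octave_i2[of k] by linarith
  qed simp
  finally have "\<bar>\<xi> $ i2\<bar> \<le> 2 powr (\<alpha> $ i2 * octave k)" .
  moreover have i1: "\<bar>\<xi> $ i1 - radius k\<bar> \<le> 1 / 4" using box_nonzero(2)[OF nz ne] ne unfolding z by simp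
  moreover have rest: "\<bar>\<xi> $ i\<bar> \<le> 1 / 4" if "i \<noteq> i1" "i \<noteq> i2" for i using box_nonzero(2)[OF nz that(2)] that unfolding z by simp
  ultimately show ?thesis
    using i1 rest by (simp add: shell_def)
qed

lemma good_family_spike: "good_family spike"
  unfolding good_family_def
proof (intro conjI allI impI)
  have [measurable]: "box \<theta> \<in> borel_measurable borel" by (rule schwartz_measurable[OF box_\<theta>_schwartz])
  show "spike k \<in> borel_measurable borel" for k unfolding spike_def[abs_def] by measurable
  show "\<xi> \<in> shell k" if "spike k \<xi> \<noteq> 0" for k \<xi> by (rule spike_shell[OF that])
  obtain B where B: "deriv_bound 0 0 B (box \<theta>)" using deriv_bound_schwartz[OF box_\<theta>_schwartz] by blast
  have "norm (spike k \<xi>) \<le> B * 2 powr octave k" for k \<xi>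
  proof -
    have "norm (spike k \<xi>) \<le> B * 1" unfolding spike_def using deriv_bound_norm0[OF B] by simp
    also have "\<dots> \<le> B * 2 powr octave k"
      using deriv_bound_nonneg[OF B] octave_ge(3)[of k] by (intro mult_left_mono ge_one_powr_ge_zero) auto
    finally show ?thesis .
  qed
  then show "\<exists>D. \<forall>k \<xi>. norm (spike k \<xi>) \<le> D * 2 powr octave k" by blast
qed

text \<open>A multiplier of level near \<open>octave k\<close> varies in the coordinate
  \<open>i2\<close> only on a scale of at least \<open>2 ^ (2 ^ k + 1)\<close>, so stretching its
  argument by this factor creates no large derivatives.\<close>

lemma aniso_stretch_deriv_bound:
  assumes B: "deriv_bound L 0 B \<phi>" and m: "m \<in> an_window k"
  shows "deriv_bound L 0 (B + B) (\<lambda>\<zeta>. \<Phi> m (\<eta> + stretch (2 ^ k + 1) \<zeta>))"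
proof -
  have oc: "2 * \<kappa> < octave k" using c(3) mult_left_mono[of 1 "2 ^ k" "real c"] by (simp add: octave_def)
  have \<kappa>2: "2 < \<kappa>" using pos[of i1] pos[of i2] by (simp add: \<kappa> add_pos_pos add.assoc)
  have mk: "octave k - \<kappa> \<le> real m" using m by (auto simp: an_window_def abs_le_iff)
  have dil: "deriv_bound L 0 B (\<lambda>\<zeta>. \<phi> (anisotropic_dilation \<alpha> (- t) (\<eta> + stretch (2 ^ k + 1) \<zeta>)))" if t: "real m - 1 \<le> t" for t
  proof -
    \<comment> \<open>From \<open>t \<ge> octave k - \<kappa> - 1\<close>: the choice of
      \<open>c\<close> gives \<open>\<kappa> < octave k / 2\<close>, and \<open>2 < \<kappa>\<close>
      gives \<open>1 < octave k / 4\<close>.\<close>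
    have t4: "octave k / 4 \<le> t" using t mk oc \<kappa>2 by linarith
    have t0: "0 \<le> t" using t4 octave_ge(3)[of k] by linarith
    have "\<bar>2 powr (- t * (\<alpha> \<bullet> b)) * (if b = axis i2 1 then 2 ^ (2 ^ k + 1) else 1)\<bar> \<le> 1" if b: "b \<in> Basis" for b :: "real ^ 'n"
    proof -
      from b obtain i where i: "b = axis i 1" by (auto simp: Basis_vec_def)
      have \<alpha>: "\<alpha> \<bullet> b = \<alpha> $ i" by (simp add: i inner_axis)
      show ?thesis
      proof (cases "i = i2")
        case True
        have "2 ^ k + 1 \<le> t * \<alpha> $ i2"
        proof -
          have "(1::real) \<le> 2 ^ k" by simp
          moreover have "octave k / 4 * \<alpha> $ i2 \<le> t * \<alpha> $ i2" using t4 pos[of i2] by (intro mult_right_mono) auto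
          moreover have "\<alpha> $ i2 * octave k = 4 * (octave k / 4 * \<alpha> $ i2)" by simp
          ultimately show ?thesis using octave_i2[of k] by linarith
        qed
        then have "2 powr (- t * \<alpha> $ i2 + (2 ^ k + 1)) \<le> 2 powr 0" by (intro powr_mono) auto
        then have "2 powr (- t * \<alpha> $ i2) * 2 powr (2 ^ k + 1) \<le> 1" unfolding powr_add[symmetric] by simp
        moreover have "(2::real) powr (2 ^ k + 1) = 2 ^ (2 ^ k + 1)" using powr_realpow[of 2 "2 ^ k + 1"] by (simp add: add.commute)
        ultimately have "2 powr (- t * \<alpha> $ i2) * 2 ^ (2 ^ k + 1) \<le> 1" by simp
        then show ?thesis using True unfolding \<alpha> by (simp add: i abs_mult)
      next
        case False
        have "2 powr (- t * \<alpha> $ i) \<le> 2 powr 0" using t0 pos[of i] by (intro powr_mono) auto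
        then show ?thesis using False by (simp add: i inner_axis axis_eq_axis)
      qed
    qed
    then have "deriv_bound L 0 (1 ^ L * B) (\<lambda>\<zeta>. \<phi> (anisotropic_dilation \<alpha> (- t) \<eta> +
        diag (\<lambda>b. 2 powr (- t * (\<alpha> \<bullet> b)) * (if b = axis i2 1 then 2 ^ (2 ^ k + 1) else 1)) \<zeta>))"
      by (rule deriv_bound_affine[OF _ order_refl B])
    moreover have "anisotropic_dilation \<alpha> (- t) \<eta> + diag (\<lambda>b. 2 powr (- t * (\<alpha> \<bullet> b)) * (if b = axis i2 1 then 2 ^ (2 ^ k + 1) else 1)) \<zeta> =
        anisotropic_dilation \<alpha> (- t) (\<eta> + stretch (2 ^ k + 1) \<zeta>)" for \<zeta>
      unfolding anisotropic_dilation_diag stretch_def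
      by (simp only: linear_add[OF bounded_linear.linear[OF bounded_linear_diag]] diag_diag add_0)
    ultimately show ?thesis by simp
  qed
  have "m \<noteq> 0" using mk oc \<kappa>2 by (intro notI) simp
  then have "(\<lambda>\<zeta>. \<Phi> m (\<eta> + stretch (2 ^ k + 1) \<zeta>)) =
      (\<lambda>\<zeta>. \<phi> (anisotropic_dilation \<alpha> (- real m) (\<eta> + stretch (2 ^ k + 1) \<zeta>)) - \<phi> (anisotropic_dilation \<alpha> (- (real m - 1)) (\<eta> + stretch (2 ^ k + 1) \<zeta>)))"
    by (simp add: anisotropic_resolution_def)
  then show ?thesis by (simp only:) (intro deriv_bound_diff dil, simp_all)
qed

text \<open>With \<open>N = 2 ^ k + 1\<close>, the amplitude is \<open>2 ^ N\<close> and the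
  compression contributes \<open>2 powr (- N / p)\<close> to the \<open>L\<^sub>p\<close> norm;
  their product is the stated power.\<close>

lemma flat_aniso_spike_upper:
  assumes p: "0 < p" "p \<noteq> \<infinity>" and q: "0 < q"
  obtains C where "0 < C"
    "\<And>k. flat_norm b p q \<Phi> (spike k) \<le> ennreal (C * 2 powr ((2 ^ k + 1) * (1 - 1 / enn2real p)))"
proof -
  obtain K where K: "Lp_norm p (\<lambda>x::real ^ 'n. ennreal (decay K x)) < \<infinity>" using Lp_norm_decay[OF p(1)] by blast
  obtain D where D: "Lp_norm p (\<lambda>x::real ^ 'n. ennreal (decay K x)) = ennreal D" "0 \<le> D"
    using K by (cases "Lp_norm p (\<lambda>x::real ^ 'n. ennreal (decay K x))") auto
  let ?n = "2 * DIM(real ^ 'n)"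
  have \<phi>s: "\<phi> \<in> schwartz" using gen\<phi> by (simp add: anisotropic_generator_def)
  obtain B where B: "deriv_bound K 0 B \<phi>" using deriv_bound_schwartz[OF \<phi>s] by blast
  obtain B' where B': "deriv_bound K ?n B' (box \<theta>)" using deriv_bound_schwartz[OF box_\<theta>_schwartz] by blast
  obtain C where C0: "0 \<le> C" and C: "\<And>(h::real ^ 'n \<Rightarrow> complex) B x. deriv_bound K ?n B h \<Longrightarrow>
     (1 + norm x) ^ K * norm (inverse_fourier h x) \<le> C * B"
    using inverse_fourier_decay[of K, where 'a = "real ^ 'n"] by blast
  define A where "A = C * (2 ^ K * (B + B) * B')"
  have A0: "0 \<le> A" using C0 deriv_bound_nonneg[OF B] deriv_bound_nonneg[OF B'] by (simp add: A_def)
  obtain E where E: "0 < E" "\<And>G k S. good_family G \<Longrightarrow>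
    (\<And>m. m \<in> an_window k \<Longrightarrow> Lp_norm p (\<lambda>x. ennreal (norm (inverse_fourier (\<lambda>\<xi>. \<Phi> m \<xi> * G k \<xi>) x))) \<le> S) \<Longrightarrow>
    flat_norm b p q \<Phi> (G k) \<le> ennreal E * S"
    using flat_aniso_upper[OF p(1) q, of b] by blast
  define r where "r = enn2real p"
  have bm: "box \<theta> \<in> borel_measurable borel" by (rule schwartz_measurable[OF box_\<theta>_schwartz])
  show ?thesis
  proof (rule that[of "E * A * D + 1"])
    show "0 < E * A * D + 1" using E(1) A0 D(2) by (simp add: add_nonneg_pos)
    fix k
    let ?N = "2 ^ k + 1 :: nat"
    have "flat_norm b p q \<Phi> (spike k) \<le> ennreal E * ennreal (A * D * 2 powr ((2 ^ k + 1) * (1 - 1 / r)))"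
    proof (rule E(2)[OF good_family_spike])
      fix m assume m: "m \<in> an_window k"
      have am: "\<Phi> m \<in> borel_measurable borel"
        by (rule schwartz_measurable[OF resolution_schwartz[OF resolution_an]])
      have pt: "norm (inverse_fourier (\<lambda>\<xi>. \<Phi> m \<xi> * spike k \<xi>) x) \<le> 2 ^ ?N * A * decay K (stretch ?N x)" for x
      proof -
        have "deriv_bound K (0 + ?n) (2 ^ K * (B + B) * B') (\<lambda>\<zeta>. \<Phi> m (axis i1 (radius k) + stretch ?N \<zeta>) * box \<theta> \<zeta>)"
          by (rule deriv_bound_mult[OF aniso_stretch_deriv_bound[OF B m] B'])
        then have "(1 + norm (stretch ?N x)) ^ K * norm (inverse_fourier (\<lambda>\<zeta>. \<Phi> m (axis i1 (radius k) + stretch ?N \<zeta>) * box \<theta> \<zeta>) (stretch ?N x)) \<le> A"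
          unfolding A_def add_0 by (rule C)
        then have "norm (inverse_fourier (\<lambda>\<zeta>. \<Phi> m (axis i1 (radius k) + stretch ?N \<zeta>) * box \<theta> \<zeta>) (stretch ?N x)) \<le> A * decay K (stretch ?N x)"
          unfolding decay_def by (rule norm_le_weight)
        then show ?thesis
          unfolding spike_def norm_inverse_fourier_contract[OF am bm] by simp
      qed
      have "Lp_norm p (\<lambda>x. ennreal (norm (inverse_fourier (\<lambda>\<xi>. \<Phi> m \<xi> * spike k \<xi>) x))) \<le>
          Lp_norm p (\<lambda>x. ennreal (2 ^ ?N * A) * ennreal (decay K (stretch ?N x)))"
      proof (intro Lp_norm_mono p(1))
        show "ennreal (norm (inverse_fourier (\<lambda>\<xi>. \<Phi> m \<xi> * spike k \<xi>) x)) \<le> ennreal (2 ^ ?N * A) * ennreal (decay K (stretch ?N x))" for x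
          using ennreal_leI[OF pt[of x]] A0 by (simp add: ennreal_mult)
        show "(\<lambda>x. ennreal (norm (inverse_fourier (\<lambda>\<xi>. \<Phi> m \<xi> * spike k \<xi>) x))) \<in> borel_measurable borel"
          using inverse_fourier_measurable[OF good_family_integrable[OF good_family_spike resolution_an]] by measurable
      qed
      also have "\<dots> = ennreal (2 ^ ?N * A) * Lp_norm p (\<lambda>x. ennreal (decay K (stretch ?N x)))"
        by (rule Lp_norm_cmult[OF _ p(1)]) auto
      also have "Lp_norm p (\<lambda>x. ennreal (decay K (stretch ?N x))) = ennreal (2 powr (- (real ?N / r))) * ennreal D"
        unfolding D(1)[symmetric] r_def by (rule Lp_norm_stretch[OF _ p]) measurable
      also have "ennreal (2 ^ ?N * A) * (ennreal (2 powr (- (real ?N / r))) * ennreal D) = ennreal (2 ^ ?N * A * (2 powr (- (real ?N / r)) * D))"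
        using A0 D(2) by (simp add: ennreal_mult)
      also have "2 ^ ?N * A * (2 powr (- (real ?N / r)) * D) = A * D * 2 powr ((2 ^ k + 1) * (1 - 1 / r))"
      proof -
        have "(2::real) ^ ?N = 2 powr real ?N" by (simp only: powr_realpow[of 2])
        then have "2 ^ ?N * 2 powr (- (real ?N / r)) = 2 powr (real ?N * (1 - 1 / r))"
          by (simp only: powr_add[symmetric]) (simp add: algebra_simps add_divide_distrib)
        moreover have "real ?N = 2 ^ k + 1" by simp
        ultimately have "2 ^ ?N * 2 powr (- (real ?N / r)) = 2 powr ((2 ^ k + 1) * (1 - 1 / r))" by metis
        then show ?thesis by (metis mult.assoc mult.commute)
      qed
      finally show "Lp_norm p (\<lambda>x. ennreal (norm (inverse_fourier (\<lambda>\<xi>. \<Phi> m \<xi> * spike k \<xi>) x))) \<le>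
          ennreal (A * D * 2 powr ((2 ^ k + 1) * (1 - 1 / r)))" .
    qed
    also have "\<dots> = ennreal (E * A * D * 2 powr ((2 ^ k + 1) * (1 - 1 / r)))"
      using E(1) A0 D(2) by (subst ennreal_mult[symmetric]) (auto simp: mult.assoc)
    also have "\<dots> \<le> ennreal ((E * A * D + 1) * 2 powr ((2 ^ k + 1) * (1 - 1 / r)))"
      by (intro ennreal_leI mult_right_mono) auto
    finally show "flat_norm b p q \<Phi> (spike k) \<le> ennreal ((E * A * D + 1) * 2 powr ((2 ^ k + 1) * (1 - 1 / enn2real p)))"
      unfolding r_def .
  qed
qed

text \<open>The plateau of the spike contains the level \<open>Suc n\<close>, so cutting out this
  level leaves a dilate by \<open>2 ^ n\<close> of one fixed function. All slices have the same
  shape.\<close>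

lemma spike_slice:
  assumes n: "n < 2 ^ k"
  shows "dyadic_resolution \<theta> (Suc n) (\<xi> $ i2) * spike k \<xi> =
    box (dyadic_resolution \<theta> 1) (contract n (\<xi> - axis i1 (radius k)))"
proof -
  have d: "dyadic_resolution \<theta> (Suc n) t = dyadic_resolution \<theta> 1 (t / 2 ^ n)" for t
  proof -
    have n: "2 powr (- real n) = (1::real) / 2 ^ n" for n by (simp add: powr_minus powr_realpow inverse_eq_divide)
    have "real (Suc n) - 1 = real n" "real 1 - 1 = real 0" by simp_all
    then have "dyadic_resolution \<theta> (Suc n) t = \<theta> (1 / 2 ^ Suc n * t) - \<theta> (1 / 2 ^ n * t)"
      "dyadic_resolution \<theta> 1 (t / 2 ^ n) = \<theta> (1 / 2 ^ 1 * (t / 2 ^ n)) - \<theta> (1 / 2 ^ 0 * (t / 2 ^ n))"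
      unfolding dyadic_resolution_def by (simp_all only: n nat.distinct one_neq_zero if_False simp_thms)
    then show ?thesis by simp
  qed
  have one: "\<theta> (t / 2 ^ (2 ^ k + 1)) = 1" if "dyadic_resolution \<theta> (Suc n) t \<noteq> 0" for t
  proof -
    have "\<bar>t\<bar> \<le> 2 powr (real (Suc n) + 1)" by (rule dyadic_resolution_nonzero(1)[OF gen\<theta> that])
    also have "\<dots> = 2 ^ (n + 2)" using powr_realpow[of 2 "n + 2"] by (simp add: add.commute)
    \<comment> \<open>The level \<open>Suc n\<close> reaches up to \<open>2 ^ (n + 2)\<close>; for
      \<open>n < 2 ^ k\<close> this explains the extra one in the width of the spike.\<close>
    also have "\<dots> \<le> 2 ^ (2 ^ k + 1)" using n by (intro power_increasing) auto
    finally show ?thesis by (intro hyperbolic_generator_one[OF gen\<theta>]) (simp add: abs_divide divide_le_eq)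
  qed
  have i2: "contract M (\<xi> - axis i1 (radius k)) $ i2 = \<xi> $ i2 / 2 ^ M" for M
    using ne by (simp add: contract_nth axis_def)
  have rest: "(\<Prod>i\<in>UNIV - {i2}. \<theta> (8 * contract M (\<xi> - axis i1 (radius k)) $ i)) = (\<Prod>i\<in>UNIV - {i2}. \<theta> (8 * (\<xi> - axis i1 (radius k)) $ i))" for M
    by (intro prod.cong) (auto simp: contract_nth)
  have "dyadic_resolution \<theta> (Suc n) (\<xi> $ i2) * \<theta> (\<xi> $ i2 / 2 ^ (2 ^ k + 1)) = dyadic_resolution \<theta> (Suc n) (\<xi> $ i2)"
    using one[of "\<xi> $ i2"] by (cases "dyadic_resolution \<theta> (Suc n) (\<xi> $ i2) = 0") simp_all
  then show ?thesis
    unfolding spike_def box_eq i2 rest d[symmetric] by (simp only: mult.assoc[symmetric])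
qed

lemma dyadic_sum_shell:
  assumes \<xi>: "\<xi> \<in> shell k"
  shows "(\<Sum>a\<in>{a. \<bar>real a - \<alpha> $ i1 * octave k\<bar> \<le> 2}. dyadic_resolution \<theta> a (\<xi> $ i1)) = 1"
proof -
  let ?A = "{a. \<bar>real a - \<alpha> $ i1 * octave k\<bar> \<le> 2}" and ?K = "nat \<lceil>\<alpha> $ i1 * octave k + 2\<rceil>"
  have K: "\<alpha> $ i1 * octave k + 2 \<le> real ?K" by (rule real_nat_ceiling_ge)
  have "(\<Sum>a\<in>?A. dyadic_resolution \<theta> a (\<xi> $ i1)) = (\<Sum>a\<le>?K. dyadic_resolution \<theta> a (\<xi> $ i1))"
  proof (rule sum.mono_neutral_left)
    show "?A \<subseteq> {..?K}"
    proof
      fix a assume "a \<in> ?A"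
      then have "real a \<le> real ?K" using K by (simp add: abs_le_iff)
      then show "a \<in> {..?K}" by simp
    qed
    show "\<forall>a\<in>{..?K} - ?A. dyadic_resolution \<theta> a (\<xi> $ i1) = 0"
    proof (rule ballI, rule ccontr)
      fix a assume a: "a \<in> {..?K} - ?A" and nz: "dyadic_resolution \<theta> a (\<xi> $ i1) \<noteq> 0"
      have "2 powr (\<alpha> $ i1 * octave k - 1) \<le> 2 powr (real a + 1)"
        using shell_i1(1)[OF \<xi>] dyadic_resolution_nonzero(1)[OF gen\<theta> nz] by linarith
      then have lo: "\<alpha> $ i1 * octave k - 1 \<le> real a + 1" by (rule powr_le_powr_2)
      have "real a \<le> \<alpha> $ i1 * octave k + 2"
      proof (cases "a = 0")
        case True
        then show ?thesis using octave_i1[of k] by simp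
      next
        case False
        then have "2 powr (real a - 1) < 2 powr (\<alpha> $ i1 * octave k + 1)"
          using shell_i1(2)[OF \<xi>] dyadic_resolution_nonzero(2)[OF gen\<theta> nz] by linarith
        then have "real a - 1 < \<alpha> $ i1 * octave k + 1" by (rule powr_less_powr_2)
        then show ?thesis by simp
      qed
      then show False using lo a by (simp add: abs_le_iff)
    qed
  qed simp
  also have "\<dots> = \<theta> (2 powr (- real ?K) * \<xi> $ i1)" by (rule dyadic_resolution_sum)
  also have "\<dots> = 1"
  proof (rule hyperbolic_generator_dilation_one[OF gen\<theta>])
    have "2 powr (\<alpha> $ i1 * octave k + 1) \<le> 2 powr real ?K" using K by (intro powr_mono) auto
    then show "\<bar>\<xi> $ i1\<bar> \<le> 2 powr real ?K" using shell_i1(2)[OF \<xi>] by linarith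
  qed
  finally show ?thesis .
qed

definition slice_index :: "nat \<Rightarrow> nat \<Rightarrow> nat ^ 'n" where
  "slice_index n a = (\<chi> i. if i = i1 then a else if i = i2 then Suc n else 0)"

text \<open>Summing over the few active levels of the coordinate \<open>i1\<close> removes its
  resolution, and the remaining coordinates contribute the factor one, so that only the cut in the
  coordinate \<open>i2\<close> is left.\<close>

lemma hyperbolic_slice_sum:
  "(\<Sum>a\<in>{a. \<bar>real a - \<alpha> $ i1 * octave k\<bar> \<le> 2}. \<Theta> (slice_index n a) \<xi> * spike k \<xi>) =
    dyadic_resolution \<theta> (Suc n) (\<xi> $ i2) * spike k \<xi>"
proof (cases "spike k \<xi> = 0")
  case False
  then have \<xi>: "\<xi> \<in> shell k" by (rule spike_shell)
  have "\<Theta> (slice_index n a) \<xi> = dyadic_resolution \<theta> a (\<xi> $ i1) * dyadic_resolution \<theta> (Suc n) (\<xi> $ i2)" for a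
  proof -
    have i2: "i2 \<in> UNIV - {i1}" using ne by simp
    have "\<Theta> (slice_index n a) \<xi> = dyadic_resolution \<theta> a (\<xi> $ i1) *
        (dyadic_resolution \<theta> (Suc n) (\<xi> $ i2) * (\<Prod>i\<in>UNIV - {i1} - {i2}. dyadic_resolution \<theta> (slice_index n a $ i) (\<xi> $ i)))"
      unfolding hyperbolic_resolution_def
      using ne by (simp add: prod.remove[of UNIV i1] prod.remove[OF _ i2] slice_index_def)
    moreover have "(\<Prod>i\<in>UNIV - {i1} - {i2}. dyadic_resolution \<theta> (slice_index n a $ i) (\<xi> $ i)) = 1"
    proof (rule prod.neutral, rule ballI)
      fix i assume "i \<in> UNIV - {i1} - {i2}"
      then have i: "i \<noteq> i1" "i \<noteq> i2" by auto
      then have "\<bar>\<xi> $ i\<bar> \<le> 1 / 4" using \<xi> by (simp add: shell_def)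
      then show "dyadic_resolution \<theta> (slice_index n a $ i) (\<xi> $ i) = 1"
        using i hyperbolic_generator_one[OF gen\<theta>, of "\<xi> $ i"] by (simp add: slice_index_def dyadic_resolution_def)
    qed
    ultimately show ?thesis by simp
  qed
  then have "(\<Sum>a\<in>{a. \<bar>real a - \<alpha> $ i1 * octave k\<bar> \<le> 2}. \<Theta> (slice_index n a) \<xi> * spike k \<xi>) =
      (\<Sum>a\<in>{a. \<bar>real a - \<alpha> $ i1 * octave k\<bar> \<le> 2}. dyadic_resolution \<theta> a (\<xi> $ i1)) * (dyadic_resolution \<theta> (Suc n) (\<xi> $ i2) * spike k \<xi>)"
    by (simp only: sum_distrib_right mult.assoc)
  then show ?thesis using dyadic_sum_shell[OF \<xi>] by simp
qed simp

definition slice_profile :: "real ^ 'n \<Rightarrow> complex" where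
  "slice_profile = inverse_fourier (box (dyadic_resolution \<theta> 1))"

text \<open>By Fourier inversion the box itself would vanish, which forces
  \<open>\<theta> (t / 2) = \<theta> t\<close> for all \<open>t\<close>. This carries the value one
  at 1 over to 4, where \<open>\<theta>\<close> vanishes.\<close>

lemma slice_profile_nonzero: "\<exists>x. slice_profile x \<noteq> 0"
proof (rule ccontr)
  let ?h = "box (dyadic_resolution \<theta> 1)"
  assume z: "\<nexists>x. slice_profile x \<noteq> 0"
  have "fourier ?h x = 0" for x
  proof -
    have "fourier ?h x = slice_profile (- x)" by (simp add: slice_profile_def fourier_def inverse_fourier_def)
    then show ?thesis using z by simp
  qed
  then have "fourier ?h = (\<lambda>_. 0)" by auto
  then have h0: "?h \<xi> = 0" for \<xi>
    using inverse_fourier_fourier[OF box_dyadic_schwartz] inverse_fourier_zero by metis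
  have "dyadic_resolution \<theta> 1 t = 0" for t
  proof -
    have "?h (axis i2 t) = dyadic_resolution \<theta> 1 t * (\<Prod>i\<in>UNIV - {i2}. \<theta> (8 * axis i2 t $ i))" by (simp add: box_eq axis_def)
    moreover have "(\<Prod>i\<in>UNIV - {i2}. \<theta> (8 * axis i2 t $ i)) = 1"
      using hyperbolic_generator_one[OF gen\<theta>, of 0] by (intro prod.neutral) (auto simp: axis_def)
    ultimately show ?thesis using h0[of "axis i2 t"] by simp
  qed
  then have d: "\<theta> (t / 2) = \<theta> t" for t
    unfolding dyadic_resolution_def by (simp add: powr_minus)
  have "\<theta> 4 = \<theta> 1" using d[of 4] d[of 2] by simp
  then show False using hyperbolic_generator_one[OF gen\<theta>, of 1] hyperbolic_generator_zero[OF gen\<theta>, of 4] by auto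
qed

text \<open>The ball must keep away from the hyperplane where the coordinate \<open>i2\<close>
  vanishes, so that its preimages under different stretchings are disjoint; a point on the
  hyperplane is moved off it within the neighbourhood.\<close>

lemma slice_profile_large:
  "\<exists>c0 \<delta> x0. 0 < c0 \<and> 0 < \<delta> \<and> 3 * \<delta> \<le> \<bar>x0 $ i2\<bar> \<and> (\<forall>x\<in>ball x0 \<delta>. c0 \<le> norm (slice_profile x))"
proof -
  obtain y where y: "slice_profile y \<noteq> 0" using slice_profile_nonzero by blast
  define c0 where "c0 = norm (slice_profile y) / 2"
  have c0: "0 < c0" using y by (simp add: c0_def)
  have cont: "continuous_on UNIV slice_profile"
    unfolding slice_profile_def by (intro continuous_inverse_fourier schwartz_integrable box_dyadic_schwartz)
  have "open ((\<lambda>x. norm (slice_profile x)) -` {c0<..})"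
    by (intro open_vimage open_greaterThan continuous_intros cont)
  moreover have "y \<in> (\<lambda>x. norm (slice_profile x)) -` {c0<..}" using c0 by (simp add: c0_def)
  ultimately obtain \<rho> where \<rho>: "0 < \<rho>" "ball y \<rho> \<subseteq> (\<lambda>x. norm (slice_profile x)) -` {c0<..}" by (rule openE)
  define x0 where "x0 = (if y $ i2 = 0 then y + axis i2 (\<rho> / 2) else y)"
  have x0: "x0 $ i2 \<noteq> 0" using \<rho>(1) by (simp add: x0_def axis_def)
  have "norm (axis i2 (\<rho> / 2) :: real ^ 'n) = \<rho> / 2"
  proof -
    have "(axis i2 (\<rho> / 2) :: real ^ 'n) = (\<rho> / 2) *\<^sub>R axis i2 1" by (simp add: vec_eq_iff axis_def)
    then show ?thesis using \<rho>(1) by (simp add: norm_axis_1)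
  qed
  then have dist: "dist y x0 \<le> \<rho> / 2" using \<rho>(1) by (simp add: x0_def dist_norm)
  define \<delta> where "\<delta> = min (\<rho> / 2) (\<bar>x0 $ i2\<bar> / 3)"
  show ?thesis
  proof (intro exI conjI ballI)
    show "0 < c0" by (rule c0)
    show "0 < \<delta>" "3 * \<delta> \<le> \<bar>x0 $ i2\<bar>" using \<rho>(1) x0 by (auto simp: \<delta>_def)
    fix x assume "x \<in> ball x0 \<delta>"
    then have "dist y x < \<rho>" using dist dist_triangle[of y x x0] by (simp add: \<delta>_def)
    then have "x \<in> ball y \<rho>" by simp
    then show "c0 \<le> norm (slice_profile x)" using \<rho>(2) by force
  qed
qed

text \<open>The slice is the sum of at most five hyperbolic blocks, one for each active level of
  \<open>i1\<close>, and each of these is bounded by the \<open>\<ell>\<^sub>q\<close> quasi-norm at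
  the point \<open>x\<close>. This holds for every \<open>q\<close>.\<close>

lemma slice_lower:
  assumes q: "0 < q" and n: "n < 2 ^ k"
  shows "ennreal (2 ^ n * norm (slice_profile (stretch n x)) / 5) \<le>
    lq_norm q (\<lambda>j. ennreal (norm (inverse_fourier (\<lambda>\<xi>. \<Theta> j \<xi> * spike k \<xi>) x)))" (is "_ \<le> ?L")
proof (cases ?L)
  case (real l)
  let ?A = "{a. \<bar>real a - \<alpha> $ i1 * octave k\<bar> \<le> 2}"
  have i: "integrable lborel (\<lambda>\<xi>. \<Theta> j \<xi> * spike k \<xi>)" for j
    by (rule good_family_integrable[OF good_family_spike resolution_hyperbolic[OF gen\<theta>]])
  have bm: "box (dyadic_resolution \<theta> 1) \<in> borel_measurable borel" by (rule schwartz_measurable[OF box_dyadic_schwartz])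
  have "2 ^ n * norm (slice_profile (stretch n x)) =
      norm (inverse_fourier (\<lambda>\<xi>. 1 * box (dyadic_resolution \<theta> 1) (contract n (\<xi> - axis i1 (radius k)))) x)"
    unfolding slice_profile_def by (subst norm_inverse_fourier_contract[OF _ bm]) simp_all
  also have "\<dots> = norm (inverse_fourier (\<lambda>\<xi>. \<Sum>a\<in>?A. \<Theta> (slice_index n a) \<xi> * spike k \<xi>) x)"
    unfolding hyperbolic_slice_sum spike_slice[OF n] by simp
  also have "\<dots> = norm (\<Sum>a\<in>?A. inverse_fourier (\<lambda>\<xi>. \<Theta> (slice_index n a) \<xi> * spike k \<xi>) x)"
    by (subst inverse_fourier_sum) (auto intro: i)
  also have "\<dots> \<le> (\<Sum>a\<in>?A. l)"
  proof (rule sum_norm_le)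
    fix a
    have "ennreal (norm (inverse_fourier (\<lambda>\<xi>. \<Theta> (slice_index n a) \<xi> * spike k \<xi>) x)) \<le> ?L"
      by (rule lq_norm_ge[OF q, where j = "slice_index n a"])
    then show "norm (inverse_fourier (\<lambda>\<xi>. \<Theta> (slice_index n a) \<xi> * spike k \<xi>) x) \<le> l"
      unfolding real(2) using real(1) by (simp add: ennreal_le_iff)
  qed
  also have "\<dots> = real (card ?A) * l" by simp
  also have "\<dots> \<le> 5 * l"
    using card_level_window(2)[of "\<alpha> $ i1 * octave k" 2] real(1) by (intro mult_right_mono) auto
  finally show ?thesis unfolding real(2) by (intro ennreal_leI) simp
qed simp

text \<open>The slice \<open>n\<close> has amplitude \<open>2 ^ n\<close> on a set of volume
  proportional to \<open>2 powr (- n)\<close>, so it contributes \<open>2 powr (n * (p - 1))\<close>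
  to the integral of the \<open>p\<close>-th power. For \<open>p \<le> 1\<close> every slice
  contributes at least as much as the whole spike is worth in the anisotropic estimate. As the sets
  are disjoint, the \<open>2 ^ k\<close> contributions add up and yield the extra factor.\<close>

lemma flat_hyp_spike_lower:
  assumes p: "0 < p" "p \<le> 1" and q: "0 < q"
  obtains e where "0 < e"
    "\<And>k. ennreal (e * 2 powr ((2 ^ k + 1) * (1 - 1 / enn2real p)) * 2 powr (real k * (1 / enn2real p))) \<le>
      flat_norm False p q \<Theta> (spike k)"
proof -
  define r where "r = enn2real p"
  have pt: "p \<noteq> \<top>" using p(2) by (auto simp: top_unique)
  have r: "0 < r" using p pt enn2real_pos by (simp add: r_def)
  have r1: "r \<le> 1" using enn2real_mono[OF p(2)] by (simp add: r_def)
  obtain c0 \<delta> x0 where c0: "0 < c0" and \<delta>: "0 < \<delta>" "3 * \<delta> \<le> \<bar>x0 $ i2\<bar>"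
    and big: "\<And>x. x \<in> ball x0 \<delta> \<Longrightarrow> c0 \<le> norm (slice_profile x)" using slice_profile_large by blast
  have "0 < emeasure lborel (ball x0 \<delta>)" "emeasure lborel (ball x0 \<delta>) < \<top>"
    using \<delta> by (simp_all add: emeasure_ball)
  then obtain v where v: "emeasure lborel (ball x0 \<delta>) = ennreal v" "0 < v"
    by (cases "emeasure lborel (ball x0 \<delta>)") auto
  define e where "e = c0 / 5 * v powr (1 / r)"
  show ?thesis
  proof (rule that[of e])
    show e0: "0 < e" using c0 v by (simp add: e_def)
    fix k
    define \<tau> :: real where "\<tau> = 2 powr ((2 ^ k + 1) * (1 - 1 / r))"
    define F where "F x = lq_norm q (\<lambda>j. ennreal (norm (inverse_fourier (\<lambda>\<xi>. \<Theta> j \<xi> * spike k \<xi>) x)))" for x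
    let ?I = "\<lambda>n x. indicator (ball x0 \<delta>) (stretch n x) :: ennreal"
    have I_meas [measurable]: "?I n \<in> borel_measurable borel" for n
      by (rule measurable_compose[OF stretch_measurable(1)]) (simp add: borel_measurable_indicator)
    \<comment> \<open>Passing to a larger \<open>n\<close> at least doubles the coordinate
      \<open>i2\<close>. Two numbers within \<open>\<delta>\<close> of \<open>x0 $ i2\<close>, one
      at least twice the other in modulus, are impossible when this coordinate is at least
      \<open>3 * \<delta>\<close> in modulus.\<close>
    have disj: False if x: "stretch n x \<in> ball x0 \<delta>" "stretch n' x \<in> ball x0 \<delta>" and nn: "n < n'" for n n' x
    proof -
      have *: "\<bar>stretch n x $ i2 - x0 $ i2\<bar> < \<delta>" if "stretch n x \<in> ball x0 \<delta>" for n
        using component_le_norm_cart[of "stretch n x - x0" i2] that by (simp add: dist_norm norm_minus_commute)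
      define u where "u = stretch n x $ i2"
      have "stretch n' x $ i2 = 2 ^ (n' - n) * u"
        using nn by (simp add: u_def stretch_nth flip: power_add)
      then have 2: "\<bar>2 ^ (n' - n) * u - x0 $ i2\<bar> < \<delta>" using *[OF x(2)] by simp
      have 1: "\<bar>u - x0 $ i2\<bar> < \<delta>" using *[OF x(1)] by (simp add: u_def)
      have "2 * \<bar>u\<bar> \<le> 2 ^ (n' - n) * \<bar>u\<bar>"
        using nn self_le_power[of "2::real" "n' - n"] by (intro mult_right_mono) auto
      then have "2 * \<bar>u\<bar> \<le> \<bar>2 ^ (n' - n) * u\<bar>" by (simp add: abs_mult)
      then show False using 1 2 \<delta> by linarith
    qed
    have pt2: "(\<Sum>n<2 ^ k. ennreal ((c0 / 5 * 2 ^ n) powr r) * ?I n x) \<le> ennreal_powr (F x) r" for x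
    proof (cases "\<exists>n<2 ^ k. stretch n x \<in> ball x0 \<delta>")
      case True
      then obtain n where n: "n < 2 ^ k" "stretch n x \<in> ball x0 \<delta>" by blast
      have "?I n' x = 0" if "n' \<noteq> n" for n'
        using disj[of n x n'] disj[of n' x n] n(2) that by (cases "n < n'") (auto simp: indicator_def)
      then have "(\<Sum>n<2 ^ k. ennreal ((c0 / 5 * 2 ^ n) powr r) * ?I n x) = (\<Sum>n\<in>{n}. ennreal ((c0 / 5 * 2 ^ n) powr r) * ?I n x)"
        using n(1) by (intro sum.mono_neutral_right) auto
      also have "\<dots> = ennreal_powr (ennreal (c0 / 5 * 2 ^ n)) r"
        using n(2) c0 by (simp add: ennreal_powr_ennreal)
      also have "\<dots> \<le> ennreal_powr (F x) r"
      proof (rule ennreal_powr_mono)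
        have "c0 / 5 * 2 ^ n \<le> 2 ^ n * norm (slice_profile (stretch n x)) / 5" using big[OF n(2)] by simp
        then have "ennreal (c0 / 5 * 2 ^ n) \<le> ennreal (2 ^ n * norm (slice_profile (stretch n x)) / 5)" by (rule ennreal_leI)
        also have "\<dots> \<le> F x" unfolding F_def by (rule slice_lower[OF q n(1)])
        finally show "ennreal (c0 / 5 * 2 ^ n) \<le> F x" .
      qed (use r in simp)
      finally show ?thesis .
    next
      case False
      then have "(\<Sum>n<2 ^ k. ennreal ((c0 / 5 * 2 ^ n) powr r) * ?I n x) = 0" by (intro sum.neutral) auto
      then show ?thesis by simp
    qed
    have piece: "ennreal ((e * \<tau>) powr r) \<le> (\<integral>\<^sup>+ x. ennreal ((c0 / 5 * 2 ^ n) powr r) * ?I n x \<partial>lborel)" if n: "n < 2 ^ k" for n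
    proof -
      have "(\<integral>\<^sup>+ x. ?I n x \<partial>lborel) = ennreal (1 / 2 ^ n) * ennreal v"
        using nn_integral_stretch[of "indicator (ball x0 \<delta>)" n] v(1) by (simp add: borel_measurable_indicator)
      then have "(\<integral>\<^sup>+ x. ennreal ((c0 / 5 * 2 ^ n) powr r) * ?I n x \<partial>lborel) = ennreal ((c0 / 5 * 2 ^ n) powr r) * (ennreal (1 / 2 ^ n) * ennreal v)"
        using I_meas by (subst nn_integral_cmult) auto
      also have "\<dots> = ennreal ((c0 / 5 * 2 ^ n) powr r * (1 / 2 ^ n * v))"
        using v(2) by (simp only: ennreal_mult[symmetric] powr_ge_zero zero_le_mult_iff less_imp_le zero_le_divide_1_iff zero_le_power zero_le_numeral simp_thms)
      finally have eq: "(\<integral>\<^sup>+ x. ennreal ((c0 / 5 * 2 ^ n) powr r) * ?I n x \<partial>lborel) = ennreal ((c0 / 5 * 2 ^ n) powr r * (1 / 2 ^ n * v))" .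
      have "(e * \<tau>) powr r = (c0 / 5) powr r * v * 2 powr ((2 ^ k + 1) * (r - 1))"
      proof -
        have "(1 - 1 / r) * r = r - 1" using r by (simp add: left_diff_distrib)
        then have "\<tau> powr r = 2 powr ((2 ^ k + 1) * (r - 1))" by (simp only: \<tau>_def powr_powr mult.assoc)
        moreover have "e powr r = (c0 / 5) powr r * v" 
          unfolding e_def by (subst powr_mult) (use r c0 v(2) in \<open>auto simp: powr_powr\<close>)
        ultimately show ?thesis using e0 by (simp add: powr_mult \<tau>_def)
      qed
      \<comment> \<open>Here \<open>p \<le> 1\<close> enters: the exponent \<open>r - 1\<close> is
        not positive, so replacing \<open>2 ^ k + 1\<close> by the smaller \<open>n\<close> enlarges
        the power.\<close>
      also have "\<dots> \<le> (c0 / 5) powr r * v * 2 powr (real n * (r - 1))"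
      proof (intro mult_left_mono powr_mono)
        have "real n \<le> real (2 ^ k + 1)" by (subst of_nat_le_iff) (use n in simp)
        then have "real n * (1 - r) \<le> (2 ^ k + 1) * (1 - r)" using r1 by (intro mult_right_mono) auto
        then show "(2 ^ k + 1) * (r - 1) \<le> real n * (r - 1)" by (simp add: algebra_simps)
      qed (use v(2) in auto)
      also have "\<dots> = (c0 / 5 * 2 ^ n) powr r * (1 / 2 ^ n * v)"
      proof -
        have "(2 powr real n) powr r * (1 / 2 powr real n) = 2 powr (real n * (r - 1))"
          by (simp only: powr_powr) (simp add: right_diff_distrib powr_diff)
        then have P: "((2::real) ^ n) powr r * (1 / 2 ^ n) = 2 powr (real n * (r - 1))" by (simp add: powr_realpow)
        have "(c0 / 5 * 2 ^ n) powr r = (c0 / 5) powr r * (2 ^ n) powr r" by (subst powr_mult) (use c0 in auto)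
        then show ?thesis by (simp only: P[symmetric] mult.assoc mult.left_commute mult.commute)
      qed
      finally show ?thesis unfolding eq by (rule ennreal_leI)
    qed
    have "ennreal_powr (ennreal (e * \<tau> * 2 powr (real k * (1 / r)))) r = ennreal ((e * \<tau>) powr r * 2 ^ k)"
    proof -
      have \<tau>0: "0 < \<tau>" by (simp add: \<tau>_def)
      have "(e * \<tau> * 2 powr (real k * (1 / r))) powr r = (e * \<tau>) powr r * (2 powr (real k * (1 / r))) powr r"
        by (subst powr_mult) (use e0 \<tau>0 in auto)
      also have "(2 powr (real k * (1 / r))) powr r = 2 ^ k" using r by (simp add: powr_powr powr_realpow)
      finally show ?thesis using e0 \<tau>0 by (simp only: ennreal_powr_ennreal mult_nonneg_nonneg less_imp_le powr_ge_zero)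
    qed
    also have "\<dots> = (\<Sum>n<2 ^ k::nat. ennreal ((e * \<tau>) powr r))"
      by (simp add: ennreal_mult mult.commute flip: ennreal_power)
    also have "\<dots> \<le> (\<Sum>n<2 ^ k. \<integral>\<^sup>+ x. ennreal ((c0 / 5 * 2 ^ n) powr r) * ?I n x \<partial>lborel)"
      by (intro sum_mono piece) simp
    also have "\<dots> = (\<integral>\<^sup>+ x. (\<Sum>n<2 ^ k. ennreal ((c0 / 5 * 2 ^ n) powr r) * ?I n x) \<partial>lborel)"
      by (rule nn_integral_sum[symmetric]) auto
    also have "\<dots> \<le> (\<integral>\<^sup>+ x. ennreal_powr (F x) r \<partial>lborel)" by (intro nn_integral_mono pt2)
    finally have "ennreal (e * \<tau> * 2 powr (real k * (1 / r))) \<le> Lp_norm p F"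
      unfolding Lp_norm_eq r_def by (intro measure_norm_geI p(1) pt)
    then show "ennreal (e * 2 powr ((2 ^ k + 1) * (1 - 1 / enn2real p)) * 2 powr (real k * (1 / enn2real p))) \<le>
      flat_norm False p q \<Theta> (spike k)"
      unfolding flat_norm_def mixed_norm_def F_def[abs_def] \<tau>_def r_def by simp
  qed
qed


section \<open>Separation of the two scales\<close>

definition separated :: "bool \<Rightarrow> ennreal \<Rightarrow> ennreal \<Rightarrow> real \<Rightarrow> bool" where
  "separated b p q s \<longleftrightarrow> (\<exists>H. poly_growth H \<and>
     (spectral_norm b p q s real \<Phi> H < \<infinity>) \<noteq>
     (spectral_norm b p q s (hyperbolic_level \<alpha>) \<Theta> H < \<infinity>))"

lemma separated_aniso_finite:
  assumes p: "0 < p" and q: "0 < q" and G: "good_family G"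
    and \<tau>: "\<And>k. 0 < \<tau> k" "0 \<le> E" "\<And>k. 1 / \<tau> k \<le> 2 powr (E * octave k)" and AB: "A < B" and e: "0 < e"
    and "\<And>k. flat_norm b p q \<Phi> (G k) \<le> ennreal (C * \<tau> k * 2 powr (real k * A))"
    and "\<And>k. ennreal (e * \<tau> k * 2 powr (real k * B)) \<le> flat_norm b p q \<Theta> (G k)"
  shows "separated b p q s"
  unfolding separated_def
  using condensation[OF localized_anisotropic localized_hyperbolic p q G \<tau> AB e assms(9,10), of s] by fastforce

lemma separated_hyp_finite:
  assumes p: "0 < p" and q: "0 < q" and G: "good_family G" and AB: "A < B" and e: "0 < e"
    and upper: "\<And>k. flat_norm b p q \<Theta> (G k) \<le> ennreal (C * 2 powr (real k * A))"
    and lower: "\<And>k. ennreal (e * 2 powr (real k * B)) \<le> flat_norm b p q \<Phi> (G k)"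
  shows "separated b p q s"
proof -
  have "\<exists>H. poly_growth H \<and> spectral_norm b p q s (hyperbolic_level \<alpha>) \<Theta> H < \<infinity> \<and>
      spectral_norm b p q s real \<Phi> H = \<infinity>"
    using upper lower
    by (intro condensation[OF localized_hyperbolic localized_anisotropic p q G, where \<tau> = "\<lambda>_. 1" and E = 0 and A = A and B = B and e = e and C = C] AB e) simp_all
  then show ?thesis unfolding separated_def by fastforce
qed

lemma separated_aniso_finite_1:
  assumes "0 < p" "0 < q" "good_family G" "A < B" "0 < e"
    "\<And>k. flat_norm b p q \<Phi> (G k) \<le> ennreal (C * 2 powr (real k * A))"
    "\<And>k. ennreal (e * 2 powr (real k * B)) \<le> flat_norm b p q \<Theta> (G k)"
  shows "separated b p q s"
  using assms(6,7)
  by (intro separated_aniso_finite[OF assms(1-3), where \<tau> = "\<lambda>_. 1" and E = 0 and A = A and B = B and e = e and C = C] assms(4,5)) simp_all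

text \<open>The growth exponent of \<open>qpow q (2 ^ k)\<close> in \<open>k\<close>; comparing
  exponents \<open>p\<close> and \<open>q\<close> becomes comparing rates, with infinity
  included.\<close>

definition rate :: "ennreal \<Rightarrow> real" where
  "rate q = (if q = \<infinity> then 0 else 1 / enn2real q)"

lemma qpow_rate: "qpow q (2 ^ k) = 2 powr (real k * rate q)"
  by (simp add: qpow_def rate_def powr_powr flip: powr_realpow)

lemma rate_less:
  assumes "0 < p" "p < q"
  shows "rate q < rate p"
proof -
  have p: "p \<noteq> \<infinity>" using assms(2) by auto
  have r: "0 < enn2real p" using enn2real_pos[OF assms(1)] p by simp
  show ?thesis
  proof (cases "q = \<infinity>")
    case False
    then have "enn2real p < enn2real q" using assms p by (simp add: enn2real_less_iff less_top)
    then show ?thesis using r False p by (simp add: rate_def frac_less2)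
  qed (use r p in \<open>simp add: rate_def\<close>)
qed

lemma rate_2: "rate 2 = 1 / 2"
  by (simp add: rate_def)

text \<open>The packets grow at rate \<open>1/p\<close> in the anisotropic and \<open>1/q\<close> in
  the hyperbolic quasi-norm. Signs are needed only where the anisotropic quasi-norm is bounded
  below, and there \<open>p < q\<close> makes \<open>p\<close> finite; for \<open>q < p\<close> any
  signs will do.\<close>

lemma separated_sites:
  assumes p: "0 < p" and q: "0 < q" and pq: "p \<noteq> q"
  shows "separated True p q s"
proof (cases "p < q")
  case True
  then have "p \<noteq> \<infinity>" by auto
  then obtain e where e: "0 < e" "\<And>k. \<exists>T. ennreal (e * qpow p (2 ^ k)) \<le> flat_norm True p q \<Phi> (packet k site T)"
    by (rule flat_aniso_site_lower[OF p _ q]) (rule that)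
  obtain C where "0 < C" and C: "\<And>k T. flat_norm True p q \<Theta> (packet k site T) \<le> ennreal (C * qpow q (2 ^ k))"
    by (rule flat_hyp_upper[OF p q, of True site], simp, rule that)
  from e(2) obtain T where T: "\<And>k. ennreal (e * qpow p (2 ^ k)) \<le> flat_norm True p q \<Phi> (packet k site (T k))" by metis
  show ?thesis
    by (rule separated_hyp_finite[OF p q good_family_packet[of site T] rate_less[OF p True] e(1)])
      (rule C[unfolded qpow_rate] T[unfolded qpow_rate])+
next
  case False
  then have qp: "q < p" using pq by auto
  obtain C where "0 < C" and C: "\<And>k T. flat_norm True p q \<Phi> (packet k site T) \<le> ennreal (C * qpow p (2 ^ k))"
    by (rule flat_aniso_site_upper[OF p q, of True]) (rule that)
  obtain e where e: "0 < e" "\<And>k T. ennreal (e * qpow q (2 ^ k)) \<le> flat_norm True p q \<Theta> (packet k site T)"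
    by (rule flat_hyp_lower[OF p q, of True site], simp, rule that)
  show ?thesis
    by (rule separated_aniso_finite_1[OF p q good_family_packet[of site "\<lambda>_. UNIV"] rate_less[OF q qp] e(1)])
      (rule C[unfolded qpow_rate] e(2)[unfolded qpow_rate])+
qed

text \<open>The anisotropic rate can be held at most \<open>1/2\<close>, or at least
  \<open>1/2\<close>, by suitable signs depending on \<open>k\<close>, while the hyperbolic rate is
  \<open>1/q\<close> for all signs. The side of 2 on which \<open>q\<close> lies decides which
  quasi-norm stays finite.\<close>

lemma separated_centred:
  assumes p: "0 < p" "p \<noteq> \<infinity>" and q: "0 < q" "q \<noteq> 2"
  shows "separated b p q s"
proof (cases "q < 2")
  case True
  obtain C where "0 < C" and C: "\<And>k. \<exists>T. flat_norm b p q \<Phi> (packet k (\<lambda>_. 0) T) \<le> ennreal (C * 2 powr (real k * (1 / 2)))"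
    by (rule flat_aniso_signs_upper[OF p q(1), of b]) (rule that)
  obtain e where e: "0 < e" "\<And>k T. ennreal (e * qpow q (2 ^ k)) \<le> flat_norm b p q \<Theta> (packet k (\<lambda>_. 0) T)"
    by (rule flat_hyp_lower[OF p(1) q(1), of b "\<lambda>_. 0"], simp, rule that)
  from C obtain T where T: "\<And>k. flat_norm b p q \<Phi> (packet k (\<lambda>_. 0) (T k)) \<le> ennreal (C * 2 powr (real k * (1 / 2)))" by metis
  have "1 / 2 < rate q" using rate_less[OF q(1) True] by (simp add: rate_2)
  then show ?thesis
    by (rule separated_aniso_finite_1[OF p(1) q(1) good_family_packet[of "\<lambda>_. 0" T] _ e(1)]) (rule T e(2)[unfolded qpow_rate])+
next
  case False
  then have q2: "2 < q" using q(2) by auto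
  obtain C where "0 < C" and C: "\<And>k T. flat_norm b p q \<Theta> (packet k (\<lambda>_. 0) T) \<le> ennreal (C * qpow q (2 ^ k))"
    by (rule flat_hyp_upper[OF p(1) q(1), of b "\<lambda>_. 0"], simp, rule that)
  obtain e where e: "0 < e" "\<And>k. \<exists>T. ennreal (e * 2 powr (real k * (1 / 2))) \<le> flat_norm b p q \<Phi> (packet k (\<lambda>_. 0) T)"
    by (rule flat_aniso_centred_lower[OF p q(1), of b]) (rule that)
  from e(2) obtain T where T: "\<And>k. ennreal (e * 2 powr (real k * (1 / 2))) \<le> flat_norm b p q \<Phi> (packet k (\<lambda>_. 0) (T k))" by metis
  have "rate q < 1 / 2" using rate_less[OF _ q2] by (simp add: rate_2)
  then show ?thesis
    by (rule separated_hyp_finite[OF p(1) q(1) good_family_packet[of "\<lambda>_. 0" T] _ e(1)]) (rule T C[unfolded qpow_rate])+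
qed

text \<open>Coherent addition gives the anisotropic rate 1, against rate 0 for the hyperbolic
  supremum.\<close>

lemma separated_coherent: "separated b \<infinity> \<infinity> s"
proof -
  have z: "(0::ennreal) < \<infinity>" by simp
  obtain C where "0 < C" and C: "\<And>k T. flat_norm b \<infinity> \<infinity> \<Theta> (packet k (\<lambda>_. 0) T) \<le> ennreal (C * qpow \<infinity> (2 ^ k))"
    by (rule flat_hyp_upper[OF z z, of b "\<lambda>_. 0"], simp, rule that)
  obtain e where e: "0 < e" "\<And>k. ennreal (e * 2 powr real k) \<le> flat_norm b \<infinity> \<infinity> \<Phi> (packet k (\<lambda>_. 0) UNIV)"
    by (rule flat_aniso_coherent_lower[OF z, of b]) (rule that)
  show ?thesis
  proof (rule separated_hyp_finite[OF _ _ good_family_packet[of "\<lambda>_. 0" "\<lambda>_. UNIV"] _ e(1), where A = 0 and B = 1 and C = C])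
    show "flat_norm b \<infinity> \<infinity> \<Theta> (packet k (\<lambda>_. 0) UNIV) \<le> ennreal (C * 2 powr (real k * 0))" for k
      using C[of k UNIV] by (simp add: qpow_def)
    show "ennreal (e * 2 powr (real k * 1)) \<le> flat_norm b \<infinity> \<infinity> \<Phi> (packet k (\<lambda>_. 0) UNIV)" for k
      using e(2)[of k] by simp
  qed simp_all
qed

text \<open>Both quasi-norms share the common size \<open>\<tau> k\<close>, and the hyperbolic one
  exceeds it at rate \<open>1/p\<close>. The reciprocal of \<open>\<tau> k\<close> is large but
  still exponential in the octave, because \<open>2 ^ k + 1 \<le> 2 * octave k\<close>; this gives
  the value of \<open>E\<close>.\<close>

lemma separated_spike:
  assumes p: "0 < p" "p \<le> 1" and q: "0 < q"
  shows "separated False p q s"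
proof -
  have pt: "p \<noteq> \<infinity>" using p(2) by (auto simp: top_unique)
  define r where "r = enn2real p"
  have r: "0 < r" using enn2real_pos[OF p(1)] pt by (simp add: r_def)
  have r1: "r \<le> 1" using enn2real_mono[OF p(2)] by (simp add: r_def)
  obtain C where "0 < C" and C: "\<And>k. flat_norm False p q \<Phi> (spike k) \<le> ennreal (C * 2 powr ((2 ^ k + 1) * (1 - 1 / r)))"
    by (rule flat_aniso_spike_upper[OF p(1) pt q, of False]) (rule that, assumption, unfold r_def)
  obtain e where e: "0 < e" "\<And>k. ennreal (e * 2 powr ((2 ^ k + 1) * (1 - 1 / r)) * 2 powr (real k * (1 / r))) \<le>
      flat_norm False p q \<Theta> (spike k)"
    by (rule flat_hyp_spike_lower[OF p q]) (rule that, assumption, unfold r_def)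
  have i: "0 \<le> 1 / r - 1" using r r1 by simp
  show ?thesis
  proof (rule separated_aniso_finite[OF p(1) q good_family_spike, where \<tau> = "\<lambda>k. 2 powr ((2 ^ k + 1) * (1 - 1 / r))"
        and E = "2 * (1 / r - 1)" and A = 0 and B = "1 / r" and C = C and e = e])
    show "1 / 2 powr ((2 ^ k + 1) * (1 - 1 / r)) \<le> 2 powr (2 * (1 / r - 1) * octave k)" for k
    proof -
      have "(1::real) \<le> 2 ^ k" by simp
      then have "2 ^ k + 1 \<le> 2 * octave k" using octave_ge(1)[of k] by linarith
      then have "(2 ^ k + 1) * (1 / r - 1) \<le> 2 * octave k * (1 / r - 1)" using i by (intro mult_right_mono)
      then have "2 powr (- ((2 ^ k + 1) * (1 - 1 / r))) \<le> 2 powr (2 * (1 / r - 1) * octave k)"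
        by (intro powr_mono) (simp_all add: algebra_simps)
      then show ?thesis by (simp add: powr_minus inverse_eq_divide)
    qed
    show "flat_norm False p q \<Phi> (spike k) \<le> ennreal (C * 2 powr ((2 ^ k + 1) * (1 - 1 / r)) * 2 powr (real k * 0))" for k
      using C[of k] by simp
    show "0 \<le> 2 * (1 / r - 1)" using i by (rule mult_nonneg_nonneg[OF zero_le_numeral])
  qed (use r e in auto)
qed

text \<open>The passage back from explicit integrals to the quasi-norms of distributions; the
  generator \<open>\<phi>\<close> also supplies the bump on which uniqueness of the blocks
  rests.\<close>

lemma besov_norm_eq:
  assumes "poly_growth H" "0 < p"
  shows "besov_norm \<alpha> \<phi> s p q (spectral_dist H) = spectral_norm True p q s real \<Phi> H"
    and "triebel_lizorkin_norm \<alpha> \<phi> s p q (spectral_dist H) = spectral_norm False p q s real \<Phi> H"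
    and "hyperbolic_besov_norm \<alpha> \<theta> s p q (spectral_dist H) = spectral_norm True p q s (hyperbolic_level \<alpha>) \<Theta> H"
    and "hyperbolic_triebel_lizorkin_norm \<alpha> \<theta> s p q (spectral_dist H) = spectral_norm False p q s (hyperbolic_level \<alpha>) \<Theta> H"
  unfolding besov_norm_def triebel_lizorkin_norm_def hyperbolic_besov_norm_def hyperbolic_triebel_lizorkin_norm_def
  by (rule spectral_norm_besov[OF bump_aniso_generator[OF gen\<phi>] assms(1) resolution_an assms(2)]
      spectral_norm_besov[OF bump_aniso_generator[OF gen\<phi>] assms(1) resolution_hyperbolic[OF gen\<theta>] assms(2)])+

lemma separated_besov:
  assumes "separated True p q s" "0 < p"
  shows "besov_space \<alpha> \<phi> s p q \<noteq> hyperbolic_besov_space \<alpha> \<theta> s p q"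
proof
  assume eq: "besov_space \<alpha> \<phi> s p q = hyperbolic_besov_space \<alpha> \<theta> s p q"
  obtain H where H: "poly_growth H" and ne: "(spectral_norm True p q s real \<Phi> H < \<infinity>) \<noteq>
     (spectral_norm True p q s (hyperbolic_level \<alpha>) \<Theta> H < \<infinity>)"
    using assms(1) unfolding separated_def by blast
  have "spectral_dist H \<in> besov_space \<alpha> \<phi> s p q \<longleftrightarrow> spectral_dist H \<in> hyperbolic_besov_space \<alpha> \<theta> s p q" by (simp only: eq)
  then show False using ne tempered_spectral_dist[OF H]
    by (simp add: besov_space_def hyperbolic_besov_space_def besov_norm_eq[OF H assms(2)])
qed

lemma separated_triebel_lizorkin:
  assumes "separated False p q s" "0 < p"
  shows "triebel_lizorkin_space \<alpha> \<phi> s p q \<noteq> hyperbolic_triebel_lizorkin_space \<alpha> \<theta> s p q"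
proof
  assume eq: "triebel_lizorkin_space \<alpha> \<phi> s p q = hyperbolic_triebel_lizorkin_space \<alpha> \<theta> s p q"
  obtain H where H: "poly_growth H" and ne: "(spectral_norm False p q s real \<Phi> H < \<infinity>) \<noteq>
     (spectral_norm False p q s (hyperbolic_level \<alpha>) \<Theta> H < \<infinity>)"
    using assms(1) unfolding separated_def by blast
  have "spectral_dist H \<in> triebel_lizorkin_space \<alpha> \<phi> s p q \<longleftrightarrow> spectral_dist H \<in> hyperbolic_triebel_lizorkin_space \<alpha> \<theta> s p q" by (simp only: eq)
  then show False using ne tempered_spectral_dist[OF H]
    by (simp add: triebel_lizorkin_space_def hyperbolic_triebel_lizorkin_space_def besov_norm_eq[OF H assms(2)])
qed

end

theorem theorem7p1:
  fixes \<alpha> :: "real ^ 'n" and \<phi>\<^sub>0 :: "real ^ 'n \<Rightarrow> complex" and \<theta>\<^sub>0 :: "real \<Rightarrow> complex"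
    and s :: real and p q :: ennreal
  assumes "CARD('n) \<ge> 2"
    and "0 < p" and "0 < q"
    and "\<forall>i. 0 < \<alpha> $ i" and "(\<Sum>i\<in>UNIV. \<alpha> $ i) = real CARD('n)"
    and "anisotropic_generator \<alpha> \<phi>\<^sub>0" and "hyperbolic_generator \<theta>\<^sub>0"
  shows "(besov_space \<alpha> \<phi>\<^sub>0 s p q = hyperbolic_besov_space \<alpha> \<theta>\<^sub>0 s p q \<longrightarrow> p = 2 \<and> q = 2) \<and>
    (p < \<infinity> \<longrightarrow>
      triebel_lizorkin_space \<alpha> \<phi>\<^sub>0 s p q = hyperbolic_triebel_lizorkin_space \<alpha> \<theta>\<^sub>0 s p q \<longrightarrow>
      q = 2 \<and> 1 < p \<and> p < \<infinity>)"
proof -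
  have "\<not> (\<forall>i j :: 'n. i = j)"
  proof
    assume "\<forall>i j :: 'n. i = j"
    then have "CARD('n) \<le> 1" by (intro card_le_Suc0_iff_eq[THEN iffD2, unfolded One_nat_def[symmetric]]) auto
    then show False using assms(1) by simp
  qed
  then obtain i1 i2 :: 'n where ne: "i1 \<noteq> i2" by blast
  define \<kappa> where "\<kappa> = 2 + 2 / \<alpha> $ i1 + 1 / \<alpha> $ i2"
  \<comment> \<open>The constant only has to exceed three thresholds: separation of the octaves, and
    enough room in each of the coordinates \<open>i1\<close> and \<open>i2\<close>.\<close>
  obtain c :: nat where c: "max (2 * \<kappa>) (max (10 / \<alpha> $ i1) (10 / \<alpha> $ i2)) < real c" using reals_Archimedean2 by blast
  interpret two_scales \<alpha> \<phi>\<^sub>0 \<theta>\<^sub>0 i1 i2 c \<kappa>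
  proof
    show "10 \<le> real c * \<alpha> $ i1" "10 \<le> real c * \<alpha> $ i2" "2 * \<kappa> < real c"
      using c assms(4) by (auto simp: pos_divide_less_eq less_imp_le)
  qed (use assms ne \<kappa>_def in auto)
  have "p = 2 \<and> q = 2" if "besov_space \<alpha> \<phi>\<^sub>0 s p q = hyperbolic_besov_space \<alpha> \<theta>\<^sub>0 s p q"
  proof -
    have n: "\<not> separated True p q s" using separated_besov assms(2) that by blast
    then have pq: "p = q" using separated_sites assms(2,3) by blast
    \<comment> \<open>With \<open>p = q\<close> already known, an infinite \<open>p\<close> would be
      the doubly infinite case, which the coherent packets exclude; only now is \<open>p\<close>
      finite, as the sign argument requires.\<close>
    then have "p \<noteq> \<infinity>" using n separated_coherent by blast
    then have "q = 2" using n separated_centred assms(2,3) by blast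
    then show ?thesis using pq by blast
  qed
  moreover have "q = 2 \<and> 1 < p" if "p < \<infinity>" "triebel_lizorkin_space \<alpha> \<phi>\<^sub>0 s p q = hyperbolic_triebel_lizorkin_space \<alpha> \<theta>\<^sub>0 s p q"
  proof -
    have n: "\<not> separated False p q s" using separated_triebel_lizorkin assms(2) that(2) by blast
    have "p \<noteq> \<infinity>" using that(1) by auto
    then have "q = 2" using n separated_centred assms(2,3) by blast
    moreover have "\<not> p \<le> 1" using n separated_spike assms(2,3) by blast
    ultimately show ?thesis by auto
  qed
  ultimately show ?thesis by blast
qed

end
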